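(* There exist $T_{\max},\varepsilon_0\in(0,1)$ and $\bar C,c_\star>0$ such that, for all $\varepsilon\le\varepsilon_0$, $T\in[\varepsilon_0^{-4}\varepsilon,T_{\max}]$, $R\ge\bar C\sqrt{\varepsilon T}$ and $\theta_0^*\in\mathbb T$, setting $$Q_R=\{\gamma\in C^0([0,T],\mathbb R^d):\ \|\gamma(\cdot)-\bar\gamma(\cdot,\theta_0^* )\|_{C^0}\ge R\},$$ for any $\mu\in\mathcal P_\varepsilon(\theta_0^* )$, with $\mathbb P_\mu=(\gamma_\varepsilon)_*\mu$, one has $$\mathbb P_\mu(Q_R)\le\exp\!\big[-c_\star\,\varepsilon^{-1}T^{-1}R^2\big].$$
   Context: $\mathbb T=\mathbb R/\mathbb Z$. For $\varepsilon>0$ let $F_\varepsilon\in C^4(\mathbb T^2,\mathbb T^2)$, $F_\varepsilon(x,\theta)=(f(x,\theta),\theta+\varepsilon\omega(x,\theta))$, $\|\omega\|_{C^4}=1$; $f_\theta=f(\cdot,\theta)$, and $\inf\partial_xf\ge\lambda$ for some $\lambda>2$ (standing normalization). $\mu_\theta$ is the unique absolutely continuous $f_\theta$-invariant probability measure. Fix $d\in\mathbb N$ and $A\in C^3(\mathbb T^2,\mathbb R^d)$ with $A_1=\omega$; $\bar A(\theta)=\mu_\theta(A(\cdot,\theta))$, $\bar\omega=\bar A_1$. Standing assumption (A1'): for every $\theta\in\mathbb T$ and $\sigma\in\mathbb R^d\setminus\{0\}$ the function $\langle\sigma,A(\cdot,\theta)\rangle$ is not of the form $g\circ f_\theta-g+a$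 with $g$ measurable and $a\in\mathbb R$. $(x_k,\theta_k)=F_\varepsilon^k(x,\theta)$, $z_0=(\theta,0)$ ($\theta$ lifted to $\mathbb R$), $z_{k+1}=z_k+\varepsilon A(x_k,\theta_k)$, $z_\varepsilon(t)=z_{\lfloor t/\varepsilon\rfloor}+(t/\varepsilon-\lfloor t/\varepsilon\rfloor)[z_{\lfloor t/\varepsilon\rfloor+1}-z_{\lfloor t/\varepsilon\rfloor}]$, $\gamma_\varepsilon(t)=z_\varepsilon(t)-z_\varepsilon(0)$, a random element of $C^0([0,T],\mathbb R^d)$ when $(x,\theta)\sim\mu$. $\bar\theta(\cdot,\theta)$ solves $\bar\theta'=\bar\omega(\bar\theta)$, $\bar\theta(0,\theta)=\theta$, and $\bar\gamma(t,\theta)=\int_0^t\bar A(\bar\theta(s,\theta))ds$. Good measures. Constants $\delta>0$ small and $c_1,c_2,c_3,D_1,D_1',C_\star>0$ large are fixed once and for all, depending only on $f,\omega$ (so that the class of standard families is invariant under push-forward by $F_\varepsilon$ for small $\varepsilon$). A standard pair is $\ell=(\mathbb G,\rho)$ where $\mathbb G(x)=(x,G(x))$, $G\in C^3([a,b],\mathbb T)$, $b-a\in[\delta/2,\delta]$, $\|G'\|_\infty\le\varepsilon c_1$, $\|G''\|_\infty\le\varepsilon D_1c_1$, $\|G'''\|_\infty\le\varepsilon D_1'c_1$, and $\rho\in C^2([a,b],(0,\infty))$, $\int\rho=1$, $\|\rho'/\rho\|_\infty\le c_2$, $\|\rho''/\rho\|_\infty\le c_3$; it defines $\mu_\ell(g)=\int_a^bg(x,G(x))\rho(x)dx$.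 A standard (probability) family $\mathfrak L$ is a countable collection of standard pairs $\ell=(\mathbb G_\ell,\rho_\ell)$ with weights $\nu_\ell>0$, $\sum_\ell\nu_\ell=1$, and $\mu_{\mathfrak L}=\sum_\ell\nu_\ell\mu_\ell$. $\mathcal P_\varepsilon(\theta^*_0)$ is the set of all $\mu_{\mathfrak L}$ with $\sum_\ell\nu_\ell\int G_\ell\rho_\ell=\theta_0^*$ and $\sup_{\ell\in\mathfrak L}\sup|G_\ell-\theta_0^*|\le C_\star\varepsilon$. *)

theory Defs
  imports "HOL-Probability.Probability"
begin

text \<open>
  The circle \<open>\<real>/\<int>\<close> is handled through its universal cover. A function on the two-torus is a
  function on \<open>\<real> \<times> \<real>\<close> of period 1 in each variable, a map into the circle is given by a real
  lift, and a Borel measure on the torus is a Borel measure on \<open>\<real> \<times> \<real>\<close> carried by the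
  fundamental domain \<open>[0,1) \<times> [0,1)\<close>.
\<close>

definition periodic2 :: "(real \<times> real \<Rightarrow> 'a) \<Rightarrow> bool" where
  "periodic2 g \<longleftrightarrow> (\<forall>x \<theta>. g (x + 1, \<theta>) = g (x, \<theta>) \<and> g (x, \<theta> + 1) = g (x, \<theta>))"

definition circle_lift2 :: "(real \<times> real \<Rightarrow> real) \<Rightarrow> bool" where
  "circle_lift2 g \<longleftrightarrow>
     (\<forall>x \<theta>. g (x + 1, \<theta>) - g (x, \<theta>) \<in> \<int> \<and> g (x, \<theta> + 1) - g (x, \<theta>) \<in> \<int>)"

definition torus_proj :: "real \<times> real \<Rightarrow> real \<times> real" where
  "torus_proj p = (frac (fst p), frac (snd p))"

primrec Cr :: "nat \<Rightarrow> (real \<times> real \<Rightarrow> 'a::real_normed_vector) \<Rightarrow> bool" where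
  "Cr 0 g \<longleftrightarrow> continuous_on UNIV g"
| "Cr (Suc r) g \<longleftrightarrow>
     (\<exists>g1 g2. (\<forall>p. (g has_derivative (\<lambda>(u, v). u *\<^sub>R g1 p + v *\<^sub>R g2 p)) (at p)) \<and> Cr r g1 \<and> Cr r g2)"

definition pd_x :: "(real \<times> real \<Rightarrow> real) \<Rightarrow> real \<times> real \<Rightarrow> real" where
  "pd_x g = (\<lambda>(x, \<theta>). deriv (\<lambda>s. g (s, \<theta>)) x)"

definition pd_th :: "(real \<times> real \<Rightarrow> real) \<Rightarrow> real \<times> real \<Rightarrow> real" where
  "pd_th g = (\<lambda>(x, \<theta>). deriv (\<lambda>s. g (x, s)) \<theta>)"

text \<open>The norm is the maximum of the sup norms of the partial derivatives of order at most \<open>r\<close>.\<close>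

definition Cr_norm :: "nat \<Rightarrow> (real \<times> real \<Rightarrow> real) \<Rightarrow> real" where
  "Cr_norm r g =
     Max ((\<lambda>(i, j). SUP p. \<bar>((pd_x ^^ i) ((pd_th ^^ j) g)) p\<bar>) ` {(i, j). i + j \<le> r})"

definition fast_slow ::
  "(real \<times> real \<Rightarrow> real) \<Rightarrow> (real \<times> real \<Rightarrow> real) \<Rightarrow> real \<Rightarrow> real \<times> real \<Rightarrow> real \<times> real" where
  "fast_slow f \<omega> \<epsilon> = (\<lambda>(x, \<theta>). (f (x, \<theta>), \<theta> + \<epsilon> * \<omega> (x, \<theta>)))"

text \<open>\<open>h\<close> is a lift of the circle map; the measure lives on the fundamental domain \<open>[0,1)\<close>.\<close>

definition is_acim :: "(real \<Rightarrow> real) \<Rightarrow> real measure \<Rightarrow> bool" where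
  "is_acim h M \<longleftrightarrow> prob_space M \<and> sets M = sets borel \<and>
     absolutely_continuous (uniform_measure lborel {0..<1}) M \<and>
     distr M borel (\<lambda>x. frac (h x)) = M"

definition acim :: "(real \<Rightarrow> real) \<Rightarrow> real measure" where
  "acim h = (THE M. is_acim h M)"

definition avg ::
  "(real \<times> real \<Rightarrow> real) \<Rightarrow> (real \<times> real \<Rightarrow> real ^ 'd) \<Rightarrow> real \<Rightarrow> real ^ 'd" where
  "avg f A \<theta> = (LINT x | acim (\<lambda>x. f (x, \<theta>)). A (x, \<theta>))"

definition avg_flow :: "(real \<Rightarrow> real) \<Rightarrow> real \<Rightarrow> real \<Rightarrow> real" where
  "avg_flow w \<theta> = (THE u. u 0 = \<theta> \<and> (\<forall>t. (u has_real_derivative w (u t)) (at t)))"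

text \<open>The index \<open>i1\<close> is the one of the distinguished (first) coordinate, in which \<open>A\<close> is \<open>\<omega>\<close>.\<close>

definition avg_path ::
  "(real \<times> real \<Rightarrow> real) \<Rightarrow> (real \<times> real \<Rightarrow> real ^ 'd) \<Rightarrow> 'd \<Rightarrow> real \<Rightarrow> real \<Rightarrow> real ^ 'd" where
  "avg_path f A i1 \<theta> t = integral {0..t} (\<lambda>s. avg f A (avg_flow (\<lambda>\<theta>'. avg f A \<theta>' $ i1) \<theta> s))"

text \<open>The identity is required at every point; \<open>h\<close> is a lift of a circle map.\<close>

definition cohomologous_const :: "(real \<Rightarrow> real) \<Rightarrow> (real \<Rightarrow> real) \<Rightarrow> bool" where
  "cohomologous_const h \<phi> \<longleftrightarrow>
     (\<exists>g a. g \<in> borel_measurable borel \<and> (\<forall>x. g (x + 1) = g x) \<and> (\<forall>x. \<phi> x = g (h x) - g x + a))"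


primrec slow_sum ::
  "(real \<times> real \<Rightarrow> real) \<Rightarrow> (real \<times> real \<Rightarrow> real ^ 'd) \<Rightarrow> (real \<times> real \<Rightarrow> real) \<Rightarrow> 'd \<Rightarrow> real \<Rightarrow>
     real \<times> real \<Rightarrow> nat \<Rightarrow> real ^ 'd" where
  "slow_sum f A \<omega> i1 \<epsilon> p 0 = axis i1 (snd p)"
| "slow_sum f A \<omega> i1 \<epsilon> p (Suc k) =
     slow_sum f A \<omega> i1 \<epsilon> p k + \<epsilon> *\<^sub>R A ((fast_slow f \<omega> \<epsilon> ^^ k) p)"

definition slow_interp ::
  "(real \<times> real \<Rightarrow> real) \<Rightarrow> (real \<times> real \<Rightarrow> real ^ 'd) \<Rightarrow> (real \<times> real \<Rightarrow> real) \<Rightarrow> 'd \<Rightarrow> real \<Rightarrow>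
     real \<times> real \<Rightarrow> real \<Rightarrow> real ^ 'd" where
  "slow_interp f A \<omega> i1 \<epsilon> p t =
     (let k = nat \<lfloor>t / \<epsilon>\<rfloor> in
        slow_sum f A \<omega> i1 \<epsilon> p k +
        (t / \<epsilon> - real k) *\<^sub>R (slow_sum f A \<omega> i1 \<epsilon> p (Suc k) - slow_sum f A \<omega> i1 \<epsilon> p k))"

definition slow_path ::
  "(real \<times> real \<Rightarrow> real) \<Rightarrow> (real \<times> real \<Rightarrow> real ^ 'd) \<Rightarrow> (real \<times> real \<Rightarrow> real) \<Rightarrow> 'd \<Rightarrow> real \<Rightarrow>
     real \<times> real \<Rightarrow> real \<Rightarrow> real ^ 'd" where
  "slow_path f A \<omega> i1 \<epsilon> p t = slow_interp f A \<omega> i1 \<epsilon> p t - slow_interp f A \<omega> i1 \<epsilon> p 0"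

text \<open>The space \<open>C\<^sup>0([0,T], \<real>\<^sup>d)\<close> with the sup metric; its elements are undefined outside \<open>[0,T]\<close>.\<close>

abbreviation C0_space :: "real \<Rightarrow> (real \<Rightarrow> real ^ 'd) metric" where
  "C0_space T \<equiv> cfunspace (top_of_set {0..T}) euclidean_metric"

definition C0_borel :: "real \<Rightarrow> (real \<Rightarrow> real ^ 'd) measure" where
  "C0_borel T = sigma (mspace (C0_space T)) {U. openin (mtopology_of (C0_space T)) U}"

definition path_law ::
  "(real \<times> real \<Rightarrow> real) \<Rightarrow> (real \<times> real \<Rightarrow> real ^ 'd) \<Rightarrow> (real \<times> real \<Rightarrow> real) \<Rightarrow> 'd \<Rightarrow> real \<Rightarrow>
     real \<Rightarrow> (real \<times> real) measure \<Rightarrow> (real \<Rightarrow> real ^ 'd) measure" where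
  "path_law f A \<omega> i1 \<epsilon> T \<mu> = distr \<mu> (C0_borel T) (\<lambda>p. restrict (slow_path f A \<omega> i1 \<epsilon> p) {0..T})"

definition deviation_set ::
  "(real \<times> real \<Rightarrow> real) \<Rightarrow> (real \<times> real \<Rightarrow> real ^ 'd) \<Rightarrow> 'd \<Rightarrow> real \<Rightarrow> real \<Rightarrow> real \<Rightarrow>
     (real \<Rightarrow> real ^ 'd) set" where
  "deviation_set f A i1 T R \<theta> =
     {\<gamma> \<in> mspace (C0_space T). mdist (C0_space T) \<gamma> (restrict (avg_path f A i1 \<theta>) {0..T}) \<ge> R}"


record sp_params =
  sp_delta :: real
  sp_c1 :: real
  sp_c2 :: real
  sp_c3 :: real
  sp_D1 :: real
  sp_D1' :: real

text \<open>Only the values of \<open>sp_curve\<close> and \<open>sp_dens\<close> on \<open>[sp_lo, sp_hi]\<close> matter.\<close>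

record std_pair =
  sp_lo :: real
  sp_hi :: real
  sp_curve :: "real \<Rightarrow> real"
  sp_dens :: "real \<Rightarrow> real"

definition is_std_pair :: "sp_params \<Rightarrow> real \<Rightarrow> std_pair \<Rightarrow> bool" where
  "is_std_pair K \<epsilon> l \<longleftrightarrow>
     (let I = {sp_lo l..sp_hi l}; G = sp_curve l; \<rho> = sp_dens l in
        sp_lo l < sp_hi l \<and> sp_hi l - sp_lo l \<in> {sp_delta K / 2..sp_delta K} \<and>
        (\<exists>G1 G2 G3.
           (\<forall>x\<in>I. (G has_real_derivative G1 x) (at x within I) \<and>
                   (G1 has_real_derivative G2 x) (at x within I) \<and>
                   (G2 has_real_derivative G3 x) (at x within I)) \<and>
           continuous_on I G3 \<and>
           (\<forall>x\<in>I. \<bar>G1 x\<bar> \<le> \<epsilon> * sp_c1 K \<and>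
                   \<bar>G2 x\<bar> \<le> \<epsilon> * sp_D1 K * sp_c1 K \<and>
                   \<bar>G3 x\<bar> \<le> \<epsilon> * sp_D1' K * sp_c1 K)) \<and>
        (\<forall>x\<in>I. \<rho> x > 0) \<and> integral I \<rho> = 1 \<and>
        (\<exists>\<rho>1 \<rho>2.
           (\<forall>x\<in>I. (\<rho> has_real_derivative \<rho>1 x) (at x within I) \<and>
                   (\<rho>1 has_real_derivative \<rho>2 x) (at x within I)) \<and>
           continuous_on I \<rho>2 \<and>
           (\<forall>x\<in>I. \<bar>\<rho>1 x / \<rho> x\<bar> \<le> sp_c2 K \<and> \<bar>\<rho>2 x / \<rho> x\<bar> \<le> sp_c3 K)))"

definition pair_measure :: "std_pair \<Rightarrow> (real \<times> real) measure" where
  "pair_measure l =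
     distr (density (restrict_space lborel {sp_lo l..sp_hi l}) (\<lambda>x. ennreal (sp_dens l x))) borel
       (\<lambda>x. torus_proj (x, sp_curve l x))"

text \<open>
  A countable collection of standard pairs with positive weights of total mass 1 is a probability
  mass function on standard pairs: the support is the collection, the point masses are the weights.
\<close>

definition is_std_family :: "sp_params \<Rightarrow> real \<Rightarrow> std_pair pmf \<Rightarrow> bool" where
  "is_std_family K \<epsilon> L \<longleftrightarrow> (\<forall>l\<in>set_pmf L. is_std_pair K \<epsilon> l)"

definition family_measure :: "std_pair pmf \<Rightarrow> (real \<times> real) measure" where
  "family_measure L =
     measure_of UNIV (sets borel) (\<lambda>B. \<integral>\<^sup>+ l. emeasure (pair_measure l) B \<partial>measure_pmf L)"

lemma sets_family_measure [simp]: "sets (family_measure L) = sets borel"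
  by (simp add: family_measure_def sets.sigma_sets_eq[of borel, simplified])

lemma emeasure_family_measure:
  assumes "B \<in> sets borel"
  shows "emeasure (family_measure L) B = (\<integral>\<^sup>+ l. emeasure (pair_measure l) B \<partial>measure_pmf L)"
  unfolding family_measure_def
proof (rule emeasure_measure_of_sigma)
  show "sigma_algebra UNIV (sets (borel :: (real \<times> real) measure))"
    using sets.sigma_algebra_axioms[of "borel :: (real \<times> real) measure"] by simp
  show "positive (sets borel) (\<lambda>B. \<integral>\<^sup>+ l. emeasure (pair_measure l) B \<partial>measure_pmf L)"
    by (simp add: positive_def)
  show "countably_additive (sets borel) (\<lambda>B. \<integral>\<^sup>+ l. emeasure (pair_measure l) B \<partial>measure_pmf L)"
    by (auto simp: countably_additive_def nn_integral_suminf[symmetric] pair_measure_def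
        intro!: nn_integral_cong suminf_emeasure)
qed (rule assms)

text \<open>
  The constants: \<open>\<delta> < 1\<close> makes \<open>[a,b]\<close> an arc of the circle, and the constants are to be such that
  push-forward by the dynamics maps (measures given by) standard families to standard families as
  soon as \<open>\<epsilon>\<close> is small. This is all that the requirement ``\<open>\<delta>\<close> small and the others large'' is for.
\<close>

definition good_params ::
  "(real \<times> real \<Rightarrow> real) \<Rightarrow> (real \<times> real \<Rightarrow> real) \<Rightarrow> sp_params \<Rightarrow> bool" where
  "good_params f \<omega> K \<longleftrightarrow>
     0 < sp_delta K \<and> sp_delta K < 1 \<and>
     0 < sp_c1 K \<and> 0 < sp_c2 K \<and> 0 < sp_c3 K \<and> 0 < sp_D1 K \<and> 0 < sp_D1' K \<and>
     (\<exists>\<epsilon>1>0. \<forall>\<epsilon>. 0 < \<epsilon> \<and> \<epsilon> \<le> \<epsilon>1 \<longrightarrow>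
        (\<forall>L. is_std_family K \<epsilon> L \<longrightarrow>
           (\<exists>L'. is_std_family K \<epsilon> L' \<and>
              distr (family_measure L) borel (torus_proj \<circ> fast_slow f \<omega> \<epsilon>) = family_measure L')))"

text \<open>
  The base point is given by a real lift, and the curves by the lifts that are close to it; for
  small \<open>\<epsilon>\<close> these are determined by the curves in the circle, and the mean is taken with them.
\<close>

definition good_measures ::
  "sp_params \<Rightarrow> real \<Rightarrow> real \<Rightarrow> real \<Rightarrow> (real \<times> real) measure set" where
  "good_measures K Cst \<epsilon> \<theta>0 =
     {family_measure L | L. is_std_family K \<epsilon> L \<and>
        measure_pmf.expectation L
          (\<lambda>l. integral {sp_lo l..sp_hi l} (\<lambda>x. sp_curve l x * sp_dens l x)) = \<theta>0 \<and>
        (\<forall>l\<in>set_pmf L. \<forall>x\<in>{sp_lo l..sp_hi l}. \<bar>sp_curve l x - \<theta>0\<bar> \<le> Cst * \<epsilon>)}"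

end

(*
  For one expanding circle map, pushing forward a density whose logarithm has slope at most D yields
  slope at most 3D/4 (bounded distortion), so a fixed constant can be subtracted at each step without
  leaving the class. This Doeblin argument gives exponential decay of correlations and the
  absolutely continuous invariant measure. Composition with an expanding map turns test functions
  that are derivatives into derivatives, by integration by parts, which yields the Lipschitz
  dependence of the averages on the slow variable.

  For the slow-fast map, let S_k be the sum of the first k increments of a centred coordinate
  A_i - mean, or of its negative, along an orbit. A standard pair is split after one iteration into
  standard pairs with weights. The mean of S plus the potential, the sum of the first M correlations
  of the frozen dynamics, is a supermartingale up to an error that M of order eps^(-1/4) makes
  negligible, and its one-step range is bounded. Hence E exp(t S_k) gains a factor exp(O(t^2) + error)
  per step, as in the Azuma inequality; stopping a pair once its sum exceeds the level bounds the
  maximum over k. A Gronwall comparison of the orbit with the averaged flow transfers the bound to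
  the paths.
*)

theory Submission
  imports Defs
begin

section \<open>Integrals on the circle\<close>

text \<open>Two losses of regularity shape the argument. Summed over M correlations this gives
  \<epsilon> M^2, which forces M to stay small. The average of an observable, by contrast, is a
  limit of averages started from Lebesgue measure on the circle, which has no boundary: two
  integrations by parts are possible there, and the dependence on the parameter is Lipschitz without
  such growth.

  The exact image density of a pair contains the slope of its curve, so its derivative would involve
  the curvature. A slightly wrong density avoids this. Masses are then only within O(\<epsilon>) of
  1, which over N steps with N \<epsilon> \<le> 1 costs a bounded factor.

  With the chosen M the drift error is O(sqrt \<epsilon>) per step, hence O(sqrt N) in total. The
  lower bound imposed on the deviation, divided by \<epsilon>, has this size as well; it therefore
  absorbs the drift, the bounded factors and the number of coordinates.\<close>

definition periodic :: "(real \<Rightarrow> 'a) \<Rightarrow> bool" where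
  "periodic u \<longleftrightarrow> (\<forall>x. u (x + 1) = u x)"

lemma periodic_add_int:
  assumes "periodic u" shows "u (x + real_of_int k) = u x"
proof -
  have nat: "u (x + real n) = u x" for n :: nat and x
  proof (induction n arbitrary: x)
    case (Suc n)
    have "u (x + real (Suc n)) = u ((x + 1) + real n)" by (simp add: add_ac)
    then show ?case using Suc[of "x + 1"] assms by (simp add: periodic_def)
  qed simp
  show ?thesis
  proof (cases k rule: int_cases2)
    case (nonneg n) then show ?thesis using nat[of x n] by simp
  next
    case (nonpos n) then show ?thesis using nat[of "x - real n" n] by simp
  qed
qed

lemma periodic_Ints: "periodic u \<Longrightarrow> y - x \<in> \<int> \<Longrightarrow> u y = u x"
  using periodic_add_int[of u x] by (auto elim!: Ints_cases simp: algebra_simps)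

lemma periodic_frac: "periodic u \<Longrightarrow> u (frac x) = u x"
  by (rule periodic_Ints) (auto simp: frac_def)

text \<open>The substitution rule is available for Lebesgue integrals, whereas the calculus below
  uses gauge integrals. A continuous density times a bounded Borel function is integrable in both
  senses.\<close>

lemma set_integrable_cont_mult:
  fixes \<rho> u :: "real \<Rightarrow> real"
  assumes "continuous_on {a..b} \<rho>" "u \<in> borel_measurable borel" "\<And>x. \<bar>u x\<bar> \<le> S"
  shows "set_integrable lborel {a..b} (\<lambda>x. \<rho> x * u x)"
proof -
  have i: "integrable lborel (\<lambda>x. indicator {a..b} x *\<^sub>R \<rho> x)"
    using borel_integrable_atLeastAtMost'[OF assms(1)] by (simp add: set_integrable_def)
  have "integrable lborel (\<lambda>x. (indicator {a..b} x *\<^sub>R \<rho> x) * u x)"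
  proof (rule Bochner_Integration.integrable_bound[OF integrable_mult_right[OF i, of S]])
    show "(\<lambda>x. (indicator {a..b} x *\<^sub>R \<rho> x) * u x) \<in> borel_measurable lborel"
      using borel_measurable_integrable[OF i] assms(2) by measurable
    show "AE x in lborel. norm ((indicator {a..b} x *\<^sub>R \<rho> x) * u x) \<le> norm (S * (indicator {a..b} x *\<^sub>R \<rho> x))"
    proof (rule AE_I2)
      fix x
      have "\<bar>\<rho> x\<bar> * \<bar>u x\<bar> \<le> \<bar>\<rho> x\<bar> * \<bar>S\<bar>" using assms(3)[of x] by (intro mult_left_mono) auto
      then show "norm ((indicator {a..b} x *\<^sub>R \<rho> x) * u x) \<le> norm (S * (indicator {a..b} x *\<^sub>R \<rho> x))"
        by (auto simp: indicator_def abs_mult mult_ac)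
    qed
  qed
  then show ?thesis by (simp add: set_integrable_def mult.assoc)
qed

lemma integrable_cont_mult:
  fixes \<rho> u :: "real \<Rightarrow> real"
  assumes "continuous_on {a..b} \<rho>" "u \<in> borel_measurable borel" "\<And>x. \<bar>u x\<bar> \<le> S"
  shows "(\<lambda>x. \<rho> x * u x) integrable_on {a..b}"
  using set_integrable_cont_mult[OF assms] by (rule set_borel_integral_eq_integral)

lemma integrable_meas:
  fixes u :: "real \<Rightarrow> real"
  assumes "u \<in> borel_measurable borel" "\<And>x. \<bar>u x\<bar> \<le> S"
  shows "u integrable_on {a..b}"
  using integrable_cont_mult[of a b "\<lambda>_. 1" u S] assms by simp

lemma abs_integral_weighted_le:
  fixes \<rho> u :: "real \<Rightarrow> real"
  assumes "continuous_on {a..b} \<rho>" "u \<in> borel_measurable borel" "\<And>x. \<bar>u x\<bar> \<le> S"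
    and "\<And>x. x \<in> {a..b} \<Longrightarrow> 0 \<le> \<rho> x"
  shows "\<bar>integral {a..b} (\<lambda>x. \<rho> x * u x)\<bar> \<le> S * integral {a..b} \<rho>"
proof -
  have "norm (integral {a..b} (\<lambda>x. \<rho> x * u x)) \<le> integral {a..b} (\<lambda>x. S * \<rho> x)"
  proof (rule integral_norm_bound_integral)
    show "(\<lambda>x. \<rho> x * u x) integrable_on {a..b}" using assms by (intro integrable_cont_mult)
    show "(\<lambda>x. S * \<rho> x) integrable_on {a..b}"
      using assms(1) by (intro integrable_continuous_real continuous_intros)
    show "norm (\<rho> x * u x) \<le> S * \<rho> x" if "x \<in> {a..b}" for x
      using mult_right_mono[OF assms(3)[of x] assms(4)[OF that]] assms(4)[OF that]
      by (simp add: abs_mult mult.commute)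
  qed
  then show ?thesis by simp
qed

lemma integral_pieces:
  fixes v :: "real \<Rightarrow> real"
  assumes "v integrable_on {A..A + real n * s}" "0 \<le> s"
  shows "integral {A..A + real n * s} v = (\<Sum>j<n. integral {A + real j * s..A + real (Suc j) * s} v)"
  using assms(1)
proof (induction n)
  case (Suc n)
  have le: "A \<le> A + real n * s" "A + real n * s \<le> A + real (Suc n) * s"
    using assms(2) by (auto simp: mult_right_mono)
  have "v integrable_on {A..A + real n * s}"
    using Suc.prems by (rule integrable_on_subinterval) (use le in auto)
  moreover have "integral {A..A + real (Suc n) * s} v =
     integral {A..A + real n * s} v + integral {A + real n * s..A + real (Suc n) * s} v"
    using Henstock_Kurzweil_Integration.integral_combine[OF le Suc.prems] by simp
  ultimately show ?case using Suc.IH by simp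
qed simp

lemma integral_shift_int:
  fixes u :: "real \<Rightarrow> real"
  assumes "periodic u"
  shows "integral {a + real_of_int k..b + real_of_int k} u = integral {a..b} u"
  using integral_shift_real_ivl[of "a + real_of_int k" "real_of_int k" "b + real_of_int k" u]
    periodic_add_int[OF assms] by simp

text \<open>The interval is cut at the integer \<open>\<lceil>c\<rceil>\<close>; integer translates
  of the two pieces fill [0,1].\<close>

lemma integral_unit_periodic:
  fixes u :: "real \<Rightarrow> real"
  assumes "periodic u" "u \<in> borel_measurable borel" "\<And>x. \<bar>u x\<bar> \<le> S"
  shows "integral {c..c + 1} u = integral {0..1} u"
proof -
  define k where "k = \<lceil>c\<rceil>"
  have k: "c \<le> real_of_int k" "real_of_int k \<le> c + 1" unfolding k_def by linarith+
  have "integral {c..c + 1} u = integral {c..real_of_int k} u + integral {real_of_int k..c + 1} u"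
    using Henstock_Kurzweil_Integration.integral_combine[OF k integrable_meas[OF assms(2,3)]] by simp
  also have "integral {c..real_of_int k} u = integral {c + 1 - real_of_int k..1} u"
    using integral_shift_int[OF assms(1), of "c + 1 - real_of_int k" "k - 1" 1] by simp
  also have "integral {real_of_int k..c + 1} u = integral {0..c + 1 - real_of_int k} u"
    using integral_shift_int[OF assms(1), of 0 k "c + 1 - real_of_int k"] by simp
  also have "integral {c + 1 - real_of_int k..1} u + integral {0..c + 1 - real_of_int k} u = integral {0..1} u"
    using Henstock_Kurzweil_Integration.integral_combine[of 0 "c + 1 - real_of_int k" 1 u] k
      integrable_meas[OF assms(2,3)] by simp
  finally show ?thesis .
qed

lemma integral_pos_cont:
  fixes w :: "real \<Rightarrow> real"
  assumes "continuous_on {a..b} w" "a < b" "\<And>x. x \<in> {a..b} \<Longrightarrow> 0 < w x"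
  shows "0 < integral {a..b} w"
proof -
  obtain m where m: "m \<in> {a..b}" "\<And>x. x \<in> {a..b} \<Longrightarrow> w m \<le> w x"
    using continuous_attains_inf[OF compact_Icc _ assms(1)] assms(2) by auto
  have "integral {a..b} (\<lambda>_. w m) \<le> integral {a..b} w"
    using m(2) by (intro integral_le integrable_continuous_real assms(1) continuous_intros)
  moreover have "0 < integral {a..b} (\<lambda>_. w m)" using assms m by simp
  ultimately show ?thesis by linarith
qed

text \<open>The map lives on the line, where it has a single inverse branch. Periodicity is kept out
  of this locale because the locale is also applied to the map that a standard pair induces on its
  horizontal coordinate, which is no lift of a circle map.\<close>

locale expanding_diffeo =
  fixes h h1 :: "real \<Rightarrow> real"
  assumes deriv: "\<And>x. (h has_real_derivative h1 x) (at x)"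
    and cont1: "continuous_on UNIV h1"
    and ge2: "\<And>x. 2 \<le> h1 x"
begin

definition hinv :: "real \<Rightarrow> real" where "hinv = inv h"

lemma continuous_h: "continuous_on S h"
  using deriv DERIV_continuous_on has_field_derivative_at_within by blast

lemma growth:
  assumes "x \<le> y" shows "2 * (y - x) \<le> h y - h x"
proof (cases "x = y")
  case False
  then obtain z where "h y - h x = (y - x) * h1 z"
    using MVT2[of x y h h1] deriv assms by auto
  then show ?thesis using mult_left_mono[OF ge2[of z], of "y - x"] assms by (simp add: mult.commute)
qed simp

lemma abs_growth: "2 * \<bar>y - x\<bar> \<le> \<bar>h y - h x\<bar>"
  using growth[of x y] growth[of y x] by (cases "x \<le> y") auto

lemma strict_mono: "strict_mono h"
  using growth by (intro strict_monoI) (smt (verit))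

lemma bij: "bij h"
proof -
  have "\<exists>x. h x = y" for y
  proof -
    \<comment> \<open>Expansion puts \<open>h t\<close> at least 2t above \<open>h 0\<close> and
      \<open>h (- t)\<close> at least 2t below it, so \<open>y\<close> lies between these
      values.\<close>
    define t where "t = \<bar>y - h 0\<bar>"
    have "0 \<le> t" "y - h 0 \<le> t" "h 0 - y \<le> t" by (auto simp: t_def)
    then have "h (- t) \<le> y" "y \<le> h t" using growth[of 0 t] growth[of "- t" 0] by auto
    then show ?thesis using IVT'[of h "- t" y t] continuous_h by (auto simp: t_def)
  qed
  then show ?thesis using strict_mono strict_mono_imp_inj_on[of h] by (metis bijI surjI)
qed

lemma h_hinv [simp]: "h (hinv y) = y"
  unfolding hinv_def using bij by (simp add: bij_is_surj surj_f_inv_f)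

lemma hinv_h [simp]: "hinv (h x) = x"
  unfolding hinv_def using bij by (simp add: bij_is_inj inv_f_f)

lemma hinv_lipschitz: "2 * \<bar>hinv y - hinv z\<bar> \<le> \<bar>y - z\<bar>"
  using abs_growth[of "hinv y" "hinv z"] by simp

lemma hinv_le_iff: "hinv y \<le> x \<longleftrightarrow> y \<le> h x" "x \<le> hinv y \<longleftrightarrow> h x \<le> y"
  using strict_mono_less_eq[OF strict_mono, of "hinv y" x] strict_mono_less_eq[OF strict_mono, of x "hinv y"]
  by simp_all

lemma h_le_iff: "h x \<le> h y \<longleftrightarrow> x \<le> y"
  using strict_mono_less_eq[OF strict_mono] .

lemma continuous_hinv: "continuous_on S hinv"
proof (rule continuous_on_subset[OF _ subset_UNIV])
  show "continuous_on UNIV hinv"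
    unfolding continuous_on_iff
  proof (intro ballI allI impI)
    fix x e :: real assume "0 < e"
    then show "\<exists>d>0. \<forall>x'\<in>UNIV. dist x' x < d \<longrightarrow> dist (hinv x') (hinv x) < e"
      using hinv_lipschitz by (intro exI[of _ e]) (auto simp: dist_real_def, smt (verit))
  qed
qed

lemma deriv_hinv: "(hinv has_real_derivative 1 / h1 (hinv y)) (at y)"
proof -
  have "(hinv has_real_derivative inverse (h1 (hinv y))) (at y)"
  proof (rule DERIV_inverse_function[where a = "y - 1" and b = "y + 1"])
    show "(h has_real_derivative h1 (hinv y)) (at (hinv y))" by (rule deriv)
    show "h1 (hinv y) \<noteq> 0" using ge2[of "hinv y"] by auto
    show "isCont hinv y" using continuous_hinv[of UNIV] by (simp add: continuous_on_eq_continuous_at)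
  qed auto
  then show ?thesis by (simp add: inverse_eq_divide)
qed

lemma hinv_image: "y \<in> {h a..h b} \<Longrightarrow> hinv y \<in> {a..b}"
  by (simp add: hinv_le_iff)

lemma continuous_push:
  assumes "continuous_on {a..b} \<rho>"
  shows "continuous_on {h a..h b} (\<lambda>y. \<rho> (hinv y) / h1 (hinv y))"
proof (intro continuous_intros)
  show "continuous_on {h a..h b} (\<lambda>y. \<rho> (hinv y))"
    by (rule continuous_on_compose2[OF assms continuous_hinv]) (auto simp: hinv_le_iff)
  show "continuous_on {h a..h b} (\<lambda>y. h1 (hinv y))"
    by (rule continuous_on_compose2[OF cont1 continuous_hinv]) auto
  show "\<forall>x\<in>{h a..h b}. h1 (hinv x) \<noteq> 0" using ge2 by (metis not_numeral_le_zero)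
qed

text \<open>This is the transfer operator with one branch. The several branches of a circle map
  reappear only when the image interval is cut into unit intervals.\<close>

lemma integral_push:
  fixes \<rho> u :: "real \<Rightarrow> real"
  assumes "a \<le> b" "continuous_on {a..b} \<rho>" "u \<in> borel_measurable borel" "\<And>x. \<bar>u x\<bar> \<le> S"
  shows "integral {a..b} (\<lambda>x. \<rho> x * u (h x)) =
         integral {h a..h b} (\<lambda>y. \<rho> (hinv y) / h1 (hinv y) * u y)"
proof -
  define v where "v = (\<lambda>y. \<rho> (hinv y) / h1 (hinv y) * u y)"
  have si: "set_integrable lborel {h a..h b} v"
    unfolding v_def using assms by (intro set_integrable_cont_mult[OF continuous_push])
  have *: "(LBINT x. v x * indicat_real {h a..h b} x) = (LBINT x. v (h x) * h1 x * indicat_real {a..b} x)"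
    by (rule integral_substitution(2)[OF si deriv])
      (use assms(1) ge2 in \<open>auto intro!: continuous_on_subset[OF cont1] intro: order.trans[of 0 2]\<close>)
  have vh: "v (h x) * h1 x = \<rho> x * u (h x)" for x
    using ge2[of x] by (simp add: v_def)
  have hm: "h \<in> borel_measurable borel"
    by (intro borel_measurable_continuous_onI continuous_h)
  have uh: "(\<lambda>x. u (h x)) \<in> borel_measurable borel"
    using measurable_compose[OF hm assms(3)] .
  have si2: "set_integrable lborel {a..b} (\<lambda>x. \<rho> x * u (h x))"
    using assms(2,4) uh by (intro set_integrable_cont_mult) auto
  have "integral {h a..h b} v = (LBINT x. v x * indicat_real {h a..h b} x)"
    using set_borel_integral_eq_integral(2)[OF si] by (simp add: set_lebesgue_integral_def mult.commute)
  also have "\<dots> = (LBINT x. \<rho> x * u (h x) * indicat_real {a..b} x)"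
    unfolding * vh ..
  also have "\<dots> = integral {a..b} (\<lambda>x. \<rho> x * u (h x))"
    using set_borel_integral_eq_integral(2)[OF si2] by (simp add: set_lebesgue_integral_def mult.commute)
  finally show ?thesis by (simp add: v_def)
qed

lemma borel_measurable_h: "h \<in> borel_measurable borel"
  by (intro borel_measurable_continuous_onI continuous_h)

lemma continuous_funpow: "continuous_on S (h ^^ n)"
proof (induction n)
  case (Suc n)
  then show ?case
    using continuous_on_compose[OF Suc continuous_h] by simp
qed (simp add: id_def)

lemma borel_measurable_funpow: "h ^^ n \<in> borel_measurable borel"
  by (intro borel_measurable_continuous_onI continuous_funpow)

end

lemma integral_lincomb:
  fixes f g :: "real \<Rightarrow> real"
  assumes "f integrable_on S" "g integrable_on S"
  shows "integral S (\<lambda>x. a * f x + b * g x) = a * integral S f + b * integral S g"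
  using assms by (simp add: Henstock_Kurzweil_Integration.integral_add integrable_on_mult_right)

text \<open>With \<open>e n\<close> the tail of the geometric series, \<open>c - e\<close> increases
  and \<open>c + e\<close> decreases. The nested intervals give the limit and the rate
  together.\<close>

lemma geometric_increments_converge:
  fixes c :: "nat \<Rightarrow> real"
  assumes "\<And>n. \<bar>c (Suc n) - c n\<bar> \<le> K * \<kappa> ^ n" "0 \<le> \<kappa>" "\<kappa> < 1" "0 \<le> K"
  shows "\<exists>l. c \<longlonglongrightarrow> l \<and> (\<forall>n. \<bar>c n - l\<bar> \<le> K / (1 - \<kappa>) * \<kappa> ^ n)"
proof -
  define e where "e n = K / (1 - \<kappa>) * \<kappa> ^ n" for n
  have e: "K * \<kappa> ^ n = e n - e (Suc n)" for n
  proof -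
    have "e n - e (Suc n) = (K / (1 - \<kappa>) * (1 - \<kappa>)) * \<kappa> ^ n" unfolding e_def power_Suc
      by (simp only: right_diff_distrib left_diff_distrib mult_1_right mult.assoc)
    then show ?thesis using assms(3) by simp
  qed
  have e0: "0 \<le> e n" for n using assms by (simp add: e_def)
  have elim: "e \<longlonglongrightarrow> 0"
    unfolding e_def using tendsto_mult_left[OF LIMSEQ_realpow_zero[OF assms(2,3)], of "K / (1 - \<kappa>)"] by simp
  have inc: "c n - e n \<le> c (Suc n) - e (Suc n)" and dec: "c (Suc n) + e (Suc n) \<le> c n + e n" for n
    using assms(1)[of n] e[of n] by linarith+
  have lim: "(\<lambda>n. (c n - e n) - (c n + e n)) \<longlonglongrightarrow> 0"
    using tendsto_mult_left[OF elim, of "-2"] by simp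
  have "\<exists>l. ((\<forall>n. c n - e n \<le> l) \<and> (\<lambda>n. c n - e n) \<longlonglongrightarrow> l) \<and>
            ((\<forall>n. l \<le> c n + e n) \<and> (\<lambda>n. c n + e n) \<longlonglongrightarrow> l)"
    by (rule nested_sequence_unique) (use inc dec e0 lim in \<open>auto intro: order.trans[of _ "c _"]\<close>)
  then obtain l where l: "\<And>n. c n - e n \<le> l" "\<And>n. l \<le> c n + e n" "(\<lambda>n. c n - e n) \<longlonglongrightarrow> l" by blast
  have "c \<longlonglongrightarrow> l" using tendsto_add[OF l(3) elim] by simp
  moreover have "\<bar>c n - l\<bar> \<le> e n" for n using l(1,2)[of n] by linarith
  ultimately show ?thesis by (auto simp: e_def)
qed

section \<open>Contraction of densities by an expanding map\<close>

text \<open>Probability densities on a unit interval whose logarithm is Lipschitz with constant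
  \<open>a\<close>. The two end values may differ, so on the circle a jump is allowed; this is why
  the interval \<open>c\<close> is part of the data.\<close>

definition cone :: "real \<Rightarrow> real \<Rightarrow> (real \<Rightarrow> real) \<Rightarrow> bool" where
  "cone a c \<rho> \<longleftrightarrow> continuous_on {c..c + 1} \<rho> \<and> (\<forall>x\<in>{c..c + 1}. 0 < \<rho> x) \<and>
     (\<forall>x\<in>{c..c + 1}. \<forall>y\<in>{c..c + 1}. \<rho> x \<le> exp (a * \<bar>x - y\<bar>) * \<rho> y) \<and> integral {c..c + 1} \<rho> = 1"

text \<open>On a unit interval the density is at most \<open>exp a\<close> times its value at
  \<open>y\<close>, and its integral is 1.\<close>

lemma cone_ge:
  assumes "cone a c \<rho>" "0 \<le> a" "y \<in> {c..c + 1}"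
  shows "exp (- a) \<le> \<rho> y"
proof -
  have "integral {c..c + 1} \<rho> \<le> integral {c..c + 1} (\<lambda>_. exp a * \<rho> y)"
  proof (rule integral_le)
    show "\<rho> integrable_on {c..c + 1}" using assms(1) by (auto simp: cone_def intro: integrable_continuous_real)
    fix x assume x: "x \<in> {c..c + 1}"
    have "\<rho> x \<le> exp (a * \<bar>x - y\<bar>) * \<rho> y" using assms x by (auto simp: cone_def)
    also have "\<dots> \<le> exp a * \<rho> y"
    proof (rule mult_right_mono)
      have "a * \<bar>x - y\<bar> \<le> a * 1" using assms x by (intro mult_left_mono) auto
      then show "exp (a * \<bar>x - y\<bar>) \<le> exp a" by simp
      show "0 \<le> \<rho> y" using assms by (auto simp: cone_def intro: less_imp_le)
    qed
    finally show "\<rho> x \<le> exp a * \<rho> y" .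
  qed (rule integrable_const_ivl)
  then have "1 \<le> exp a * \<rho> y" using assms(1) by (simp add: cone_def)
  then show ?thesis by (simp add: exp_minus field_simps)
qed

lemma cone_one: "0 \<le> a \<Longrightarrow> cone a c (\<lambda>_. 1)"
  by (simp add: cone_def)

lemma exp_chord:
  fixes s t :: real
  assumes "0 \<le> s" "s \<le> 1" shows "exp (s * t) \<le> s * exp t + (1 - s)"
  using convex_onD[OF exp_convex, of s 0 t] assms by simp

text \<open>By convexity \<open>exp (s * t)\<close> lies below its chord, so log-slope
  \<open>s * a\<close> gives \<open>\<rho> x \<le> (s * E + (1 - s)) * \<rho> y\<close> with
  \<open>E\<close> the factor for log-slope \<open>a\<close>. The room left,
  \<open>(1 - s) * (E - 1) * \<rho> y\<close>, is what subtracting \<open>q\<close> needs, since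
  \<open>q\<close> is \<open>1 - s\<close> times the lower bound of the density.\<close>

lemma cone_subtract:
  assumes "cone (s * a) c \<rho>" "0 \<le> a" "0 < s" "s < 1"
  defines "q \<equiv> exp (- (s * a)) * (1 - s)"
  shows "q < 1" "cone a c (\<lambda>x. (\<rho> x - q) / (1 - q))"
proof -
  have sa: "0 \<le> s * a" using assms by simp
  have ge: "exp (- (s * a)) \<le> \<rho> x" if "x \<in> {c..c + 1}" for x using cone_ge[OF assms(1) sa that] .
  have q_lt: "q < exp (- (s * a))" using assms(3) by (simp add: q_def)
  also have "\<dots> \<le> 1" using sa by simp
  finally show q1: "q < 1" .
  have ineq: "\<rho> x - q \<le> exp (a * \<bar>x - y\<bar>) * (\<rho> y - q)" if "x \<in> {c..c + 1}" "y \<in> {c..c + 1}" for x y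
  proof -
    define E where "E = exp (a * \<bar>x - y\<bar>)"
    have E1: "1 \<le> E" using assms(2) by (simp add: E_def)
    have ry: "exp (- (s * a)) \<le> \<rho> y" using ge that by simp
    have "\<rho> x \<le> exp (s * (a * \<bar>x - y\<bar>)) * \<rho> y"
      using assms(1) that by (auto simp: cone_def mult.assoc)
    also have "\<dots> \<le> (s * E + (1 - s)) * \<rho> y"
      unfolding E_def using assms(3,4) order.trans[OF exp_ge_zero ry]
      by (intro mult_right_mono exp_chord) auto
    finally have 1: "\<rho> x \<le> (s * E + (1 - s)) * \<rho> y" .
    have "q * (E - 1) \<le> \<rho> y * (1 - s) * (E - 1)"
      unfolding q_def using ry E1 assms by (intro mult_right_mono) auto
    then show ?thesis using 1 unfolding E_def[symmetric] by (simp add: algebra_simps)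
  qed
  have ig: "\<rho> integrable_on {c..c + 1}"
    using assms(1) by (auto simp: cone_def intro: integrable_continuous_real)
  show "cone a c (\<lambda>x. (\<rho> x - q) / (1 - q))"
    unfolding cone_def
  proof (intro conjI ballI)
    show "continuous_on {c..c + 1} (\<lambda>x. (\<rho> x - q) / (1 - q))"
      using assms(1) q1 by (auto simp: cone_def intro!: continuous_intros)
    show "integral {c..c + 1} (\<lambda>x. (\<rho> x - q) / (1 - q)) = 1"
      using assms(1) q1 Henstock_Kurzweil_Integration.integral_diff[OF ig integrable_const_ivl[of q]]
      by (simp add: cone_def)
    fix x assume x: "x \<in> {c..c + 1}"
    show "0 < (\<rho> x - q) / (1 - q)" using ge[OF x] q_lt q1 by simp
    fix y assume y: "y \<in> {c..c + 1}"
    show "(\<rho> x - q) / (1 - q) \<le> exp (a * \<bar>x - y\<bar>) * ((\<rho> y - q) / (1 - q))"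
      using ineq[OF x y] q1 by (simp add: divide_right_mono)
  qed
qed

text \<open>The constant \<open>D\<close> plays two roles: it bounds the Lipschitz constant of the
  derivative and is the log-slope allowed in the cone.\<close>

locale expanding_map = expanding_diffeo +
  fixes D :: real
  assumes h1_lipschitz: "\<And>x y. \<bar>h1 x - h1 y\<bar> \<le> D * \<bar>x - y\<bar>"
    and D_ge_1: "1 \<le> D"
    and degree: "\<And>x. h (x + 1) - h x \<in> \<int>"
begin

lemma periodic_comp: "periodic u \<Longrightarrow> periodic (\<lambda>x. u (h x))"
  unfolding periodic_def[of "\<lambda>x. u (h x)"] using periodic_Ints[OF _ degree] by blast

lemma periodic_comp_funpow: "periodic u \<Longrightarrow> periodic (\<lambda>x. u ((h ^^ n) x))"
proof (induction n)
  case (Suc n)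
  from periodic_comp[OF Suc.IH[OF Suc.prems]] show ?case by (simp add: funpow_swap1)
qed simp

text \<open>The inverse contracts by 1/2, which turns the slope D of the logarithm into D/2. The
  distortion adds D/4: as the derivative is at least 2, its relative variation between preimages is
  at most \<open>D / 2\<close> times their distance.\<close>

lemma push_regular:
  assumes "cone D c \<rho>" "x \<in> {h c..h (c + 1)}" "y \<in> {h c..h (c + 1)}"
  shows "\<rho> (hinv x) / h1 (hinv x) \<le> exp (3 / 4 * D * \<bar>x - y\<bar>) * (\<rho> (hinv y) / h1 (hinv y))"
proof -
  define X Y where "X = hinv x" and "Y = hinv y"
  have XY: "X \<in> {c..c + 1}" "Y \<in> {c..c + 1}" unfolding X_def Y_def using assms hinv_image by auto
  have pos: "0 < h1 X" "0 < h1 Y" "2 \<le> h1 X" using ge2[of X] ge2[of Y] by auto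
  have rho: "\<rho> X \<le> exp (D * \<bar>X - Y\<bar>) * \<rho> Y" "0 < \<rho> X" "0 < \<rho> Y"
    using assms(1) XY by (auto simp: cone_def)
  have "h1 Y \<le> h1 X + D * \<bar>X - Y\<bar>" using h1_lipschitz[of X Y] by linarith
  also have "\<dots> \<le> h1 X + D / 2 * \<bar>X - Y\<bar> * h1 X"
    using mult_left_mono[OF pos(3), of "D / 2 * \<bar>X - Y\<bar>"] D_ge_1 by simp
  also have "\<dots> = h1 X * (1 + D / 2 * \<bar>X - Y\<bar>)" by (simp add: algebra_simps)
  also have "\<dots> \<le> h1 X * exp (D / 2 * \<bar>X - Y\<bar>)"
    using pos by (intro mult_left_mono exp_ge_add_one_self) auto
  finally have h1Y: "h1 Y \<le> h1 X * exp (D / 2 * \<bar>X - Y\<bar>)" .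
  have "\<rho> X / h1 X \<le> (exp (D * \<bar>X - Y\<bar>) * \<rho> Y) / (h1 Y / exp (D / 2 * \<bar>X - Y\<bar>))"
    using rho pos h1Y by (intro frac_le) (auto simp: field_simps)
  also have "\<dots> = exp (3 / 2 * D * \<bar>X - Y\<bar>) * (\<rho> Y / h1 Y)"
  proof -
    have "exp (D * \<bar>X - Y\<bar>) * exp (D / 2 * \<bar>X - Y\<bar>) = exp (3 / 2 * D * \<bar>X - Y\<bar>)"
      by (simp flip: exp_add)
    then show ?thesis by (simp add: field_simps)
  qed
  also have "\<dots> \<le> exp (3 / 4 * D * \<bar>x - y\<bar>) * (\<rho> Y / h1 Y)"
  proof (rule mult_right_mono)
    have "3 / 4 * D * (2 * \<bar>X - Y\<bar>) \<le> 3 / 4 * D * \<bar>x - y\<bar>"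
      unfolding X_def Y_def using hinv_lipschitz D_ge_1 by (intro mult_left_mono) auto
    then show "exp (3 / 2 * D * \<bar>X - Y\<bar>) \<le> exp (3 / 4 * D * \<bar>x - y\<bar>)" by simp
  qed (use rho pos in auto)
  finally show ?thesis by (simp add: X_def Y_def)
qed

text \<open>The image of a unit interval has integer length, because the map is a lift, and is cut
  into unit intervals. The weights are the masses of the pieces; normalising a piece does not affect
  its log-slope.\<close>

lemma push_cone:
  assumes "cone D c \<rho>"
  obtains k :: nat and wt r where "\<And>j. j < k \<Longrightarrow> 0 < wt j" "(\<Sum>j<k. wt j) = (1::real)"
    "\<And>j. j < k \<Longrightarrow> cone (3 / 4 * D) (h c + real j) (r j)"
    "\<And>u S. u \<in> borel_measurable borel \<Longrightarrow> (\<And>x. \<bar>u x\<bar> \<le> S) \<Longrightarrow>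
       integral {c..c + 1} (\<lambda>x. \<rho> x * u (h x)) =
       (\<Sum>j<k. wt j * integral {h c + real j..h c + real j + 1} (\<lambda>y. r j y * u y))"
proof -
  define w where "w = (\<lambda>y. \<rho> (hinv y) / h1 (hinv y))"
  obtain k :: nat where k: "h (c + 1) = h c + real k"
  proof -
    obtain m where m: "h (c + 1) - h c = of_int m" using degree[of c] by (auto elim: Ints_cases)
    moreover have "2 \<le> h (c + 1) - h c" using growth[of c "c + 1"] by simp
    ultimately have "h (c + 1) = h c + real (nat m)" by simp
    then show ?thesis using that by blast
  qed
  have cw: "continuous_on {h c..h (c + 1)} w"
    unfolding w_def using assms by (intro continuous_push) (auto simp: cone_def)
  have wpos: "0 < w y" if "y \<in> {h c..h (c + 1)}" for y
    unfolding w_def using assms hinv_image[OF that] ge2[of "hinv y"] by (auto simp: cone_def intro!: divide_pos_pos)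
  have sub: "{h c + real j..h c + real j + 1} \<subseteq> {h c..h (c + 1)}" if "j < k" for j
    using that unfolding k by auto
  define wt where "wt j = integral {h c + real j..h c + real j + 1} w" for j
  define r where "r j y = w y / wt j" for j y
  have wtpos: "0 < wt j" if "j < k" for j
    unfolding wt_def using sub[OF that] wpos
    by (intro integral_pos_cont continuous_on_subset[OF cw]) auto
  have push: "integral {c..c + 1} (\<lambda>x. \<rho> x * u (h x)) =
       (\<Sum>j<k. integral {h c + real j..h c + real j + 1} (\<lambda>y. w y * u y))"
    if "u \<in> borel_measurable borel" "\<And>x. \<bar>u x\<bar> \<le> S" for u :: "real \<Rightarrow> real" and S
  proof -
    have "integral {c..c + 1} (\<lambda>x. \<rho> x * u (h x)) = integral {h c..h (c + 1)} (\<lambda>y. w y * u y)"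
      unfolding w_def using assms that by (intro integral_push) (auto simp: cone_def)
    also have "\<dots> = (\<Sum>j<k. integral {h c + real j * 1..h c + real (Suc j) * 1} (\<lambda>y. w y * u y))"
      using integral_pieces[of "\<lambda>y. w y * u y" "h c" k 1] integrable_cont_mult[OF cw that] k by simp
    finally show ?thesis by (simp add: add_ac)
  qed
  show ?thesis
  proof (rule that)
    show "0 < wt j" if "j < k" for j by (rule wtpos[OF that])
    show "(\<Sum>j<k. wt j) = 1"
      using push[of "\<lambda>_. 1" 1] assms by (simp add: wt_def cone_def)
    show "cone (3 / 4 * D) (h c + real j) (r j)" if j: "j < k" for j
      unfolding cone_def
    proof (intro conjI ballI)
      show "continuous_on {h c + real j..h c + real j + 1} (r j)"
        unfolding r_def using wtpos[OF j] by (intro continuous_intros continuous_on_subset[OF cw sub[OF j]]) auto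
      show "integral {h c + real j..h c + real j + 1} (r j) = 1"
        unfolding r_def using wtpos[OF j] by (simp add: wt_def)
      fix x assume x: "x \<in> {h c + real j..h c + real j + 1}"
      show "0 < r j x" unfolding r_def using wpos[of x] x sub[OF j] wtpos[OF j] by auto
      fix y assume y: "y \<in> {h c + real j..h c + real j + 1}"
      have "w x \<le> exp (3 / 4 * D * \<bar>x - y\<bar>) * w y"
        unfolding w_def using push_regular[OF assms, of x y] x y sub[OF j] by blast
      then show "r j x \<le> exp (3 / 4 * D * \<bar>x - y\<bar>) * r j y"
        unfolding r_def using wtpos[OF j] by (simp add: divide_right_mono)
    qed
    show "integral {c..c + 1} (\<lambda>x. \<rho> x * u (h x)) =
       (\<Sum>j<k. wt j * integral {h c + real j..h c + real j + 1} (\<lambda>y. r j y * u y))"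
      if "u \<in> borel_measurable borel" "\<And>x. \<bar>u x\<bar> \<le> S" for u S
    proof -
      have "wt j * integral {h c + real j..h c + real j + 1} (\<lambda>y. r j y * u y) =
        integral {h c + real j..h c + real j + 1} (\<lambda>y. w y * u y)" if "j < k" for j
      proof -
        have "(\<lambda>y. w y * u y) = (\<lambda>y. wt j * (r j y * u y))"
          unfolding r_def using wtpos[OF that] by (auto simp: fun_eq_iff)
        then show ?thesis by simp
      qed
      then show ?thesis using push[OF that] by simp
    qed
  qed
qed

text \<open>A density with log-slope at most \<open>3D/4\<close> on a unit interval is at least \<open>exp (-3D/4)\<close>; subtracting a
  quarter of that bound raises the log-slope to at most \<open>D\<close>.\<close>

definition gap :: real where "gap = exp (- (3 / 4 * D)) / 4"

lemma gap: "0 < gap" "gap < 1"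
proof -
  have "exp (- (3 / 4 * D)) \<le> 1" using D_ge_1 by simp
  then have "gap \<le> 1 / 4" by (simp add: gap_def)
  then show "gap < 1" by linarith
qed (simp add: gap_def)

lemma push_average:
  assumes u: "u \<in> borel_measurable borel" "\<And>x. \<bar>u x\<bar> \<le> S"
    and \<beta>: "\<And>c \<rho>. cone (3 / 4 * D) c \<rho> \<Longrightarrow> \<bar>integral {c..c + 1} (\<lambda>x. \<rho> x * u x) - \<beta>\<bar> \<le> e"
    and cone: "cone D c \<rho>"
  shows "\<bar>integral {c..c + 1} (\<lambda>x. \<rho> x * u (h x)) - \<beta>\<bar> \<le> e"
proof -
  obtain k wt r where p: "\<And>j. j < k \<Longrightarrow> 0 < wt j" "(\<Sum>j<k. wt j) = 1"
    "\<And>j. j < k \<Longrightarrow> cone (3 / 4 * D) (h c + real j) (r j)"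
    "\<And>u S. u \<in> borel_measurable borel \<Longrightarrow> (\<And>x. \<bar>u x\<bar> \<le> S) \<Longrightarrow>
     integral {c..c + 1} (\<lambda>x. \<rho> x * u (h x)) =
     (\<Sum>j<k. wt j * integral {h c + real j..h c + real j + 1} (\<lambda>y. r j y * u y))"
    using push_cone[OF cone] by blast
  define E where "E j = integral {h c + real j..h c + real j + 1} (\<lambda>y. r j y * u y)" for j
  have "integral {c..c + 1} (\<lambda>x. \<rho> x * u (h x)) - \<beta> = (\<Sum>j<k. wt j * E j) - (\<Sum>j<k. wt j) * \<beta>"
    using p(4)[OF u] p(2) by (simp add: E_def)
  also have "\<dots> = (\<Sum>j<k. wt j * (E j - \<beta>))"
    by (simp add: sum_distrib_right sum_subtractf right_diff_distrib)
  also have "\<bar>\<dots>\<bar> \<le> (\<Sum>j<k. wt j * e)"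
  proof (rule order.trans[OF sum_abs], rule sum_mono)
    fix j assume j: "j \<in> {..<k}"
    have "\<bar>E j - \<beta>\<bar> \<le> e" using \<beta>[OF p(3)[of j]] j by (simp add: E_def)
    then show "\<bar>wt j * (E j - \<beta>)\<bar> \<le> wt j * e"
      using p(1)[of j] j by (simp add: abs_mult)
  qed
  also have "\<dots> = e" using p(2) by (simp flip: sum_distrib_right)
  finally show ?thesis .
qed

text \<open>Each density splits into the constant \<open>gap\<close> and a multiple
  \<open>1 - gap\<close> of a density in the larger cone, which the map sends to convex combinations
  of densities in the smaller one. The constant part contributes the same number for every density,
  so only the rest contributes to the error.\<close>

lemma contraction:
  assumes u: "u \<in> borel_measurable borel" "\<And>x. \<bar>u x\<bar> \<le> S" "periodic u"
  shows "\<exists>\<beta>. \<forall>c \<rho>. cone (3 / 4 * D) c \<rho> \<longrightarrow>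
    \<bar>integral {c..c + 1} (\<lambda>x. \<rho> x * u ((h ^^ n) x)) - \<beta>\<bar> \<le> S * (1 - gap) ^ n"
proof (induction n)
  case 0
  have "\<bar>integral {c..c + 1} (\<lambda>x. \<rho> x * u x)\<bar> \<le> S" if "cone (3 / 4 * D) c \<rho>" for c \<rho>
    using abs_integral_weighted_le[of c "c + 1" \<rho> u S] that u by (auto simp: cone_def less_imp_le)
  then show ?case by (intro exI[of _ 0]) simp
next
  case (Suc n)
  then obtain \<beta> where \<beta>: "\<bar>integral {c..c + 1} (\<lambda>x. \<rho> x * u ((h ^^ n) x)) - \<beta>\<bar> \<le> S * (1 - gap) ^ n"
    if "cone (3 / 4 * D) c \<rho>" for c \<rho> by blast
  define v where "v = (\<lambda>x. u ((h ^^ n) x))"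
  have v: "v \<in> borel_measurable borel" "\<And>x. \<bar>v x\<bar> \<le> S"
    unfolding v_def using u(2) measurable_compose[OF borel_measurable_funpow u(1)] by auto
  have vh: "(\<lambda>x. v (h x)) \<in> borel_measurable borel" "periodic (\<lambda>x. v (h x))"
    using measurable_compose[OF borel_measurable_h v(1)]
      periodic_comp[OF periodic_comp_funpow[OF u(3)]] by (auto simp: v_def)
  have v_Suc: "u ((h ^^ Suc n) x) = v (h x)" for x by (simp add: v_def funpow_swap1)
  show ?case
  proof (intro exI allI impI)
    fix c \<rho> assume rho: "cone (3 / 4 * D) c \<rho>"
    define \<rho>' where "\<rho>' = (\<lambda>x. (\<rho> x - gap) / (1 - gap))"
    have cone': "cone D c \<rho>'"
      using cone_subtract(2)[of "3 / 4" D c \<rho>] rho D_ge_1 by (simp add: \<rho>'_def gap_def)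
    have 1: "\<bar>integral {c..c + 1} (\<lambda>x. \<rho>' x * v (h x)) - \<beta>\<bar> \<le> S * (1 - gap) ^ n"
      using \<beta> by (intro push_average[OF v _ cone']) (simp add: v_def)
    have cr: "continuous_on {c..c + 1} \<rho>'" using cone' by (simp add: cone_def)
    have "(\<lambda>x. \<rho> x * v (h x)) = (\<lambda>x. gap * v (h x) + (1 - gap) * (\<rho>' x * v (h x)))"
      using gap by (auto simp: \<rho>'_def fun_eq_iff field_simps)
    then have "integral {c..c + 1} (\<lambda>x. \<rho> x * v (h x)) =
       gap * integral {c..c + 1} (\<lambda>x. v (h x)) + (1 - gap) * integral {c..c + 1} (\<lambda>x. \<rho>' x * v (h x))"
      by (simp only: integral_lincomb[OF integrable_meas[OF vh(1) v(2)] integrable_cont_mult[OF cr vh(1) v(2)]])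
    \<comment> \<open>Periodicity makes this term independent of \<open>c\<close>, so that the new
      centre depends neither on the interval nor on the density.\<close>
    also have "integral {c..c + 1} (\<lambda>x. v (h x)) = integral {0..1} (\<lambda>x. v (h x))"
      by (rule integral_unit_periodic[OF vh(2,1) v(2)])
    finally have "integral {c..c + 1} (\<lambda>x. \<rho> x * v (h x)) -
        (gap * integral {0..1} (\<lambda>x. v (h x)) + (1 - gap) * \<beta>) =
        (1 - gap) * (integral {c..c + 1} (\<lambda>x. \<rho>' x * v (h x)) - \<beta>)" by (simp add: algebra_simps)
    then have "\<bar>integral {c..c + 1} (\<lambda>x. \<rho> x * v (h x)) -
        (gap * integral {0..1} (\<lambda>x. v (h x)) + (1 - gap) * \<beta>)\<bar> \<le> (1 - gap) * (S * (1 - gap) ^ n)"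
      using 1 gap by (simp add: abs_mult)
    then show "\<bar>integral {c..c + 1} (\<lambda>x. \<rho> x * u ((h ^^ Suc n) x)) -
        (gap * integral {0..1} (\<lambda>x. v (h x)) + (1 - gap) * \<beta>)\<bar> \<le> S * (1 - gap) ^ Suc n"
      unfolding v_Suc by (simp add: mult_ac)
  qed
qed

text \<open>The square root comes from smoothing indicators of intervals at scale
  \<open>rate ^ n\<close>: the smoothing error is of this order, and the steepness
  \<open>1 / rate ^ n\<close> multiplied by \<open>(1 - gap) ^ n\<close> is of this order
  too.\<close>

definition rate :: real where "rate = sqrt (1 - gap)"

lemma rate: "0 < rate" "rate < 1" "rate ^ n * rate ^ n = (1 - gap) ^ n"
  using gap by (auto simp: rate_def simp flip: power_mult_distrib)

lemma rate_le: "(1 - gap) ^ n \<le> rate ^ n"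
proof -
  have "rate ^ n \<le> 1" using rate by (intro power_le_one) auto
  then have "rate ^ n * rate ^ n \<le> rate ^ n * 1" using rate(1) by (intro mult_left_mono) auto
  then show ?thesis using rate(3) by simp
qed

text \<open>Defined without reference to an invariant measure; the measure is built from this
  functional later.\<close>

definition mean :: "(real \<Rightarrow> real) \<Rightarrow> real" where
  "mean u = lim (\<lambda>n. integral {0..1} (\<lambda>x. u ((h ^^ n) x)))"

text \<open>The Lebesgue averages at times n and n+1 lie within \<open>S * (1 - gap) ^ n\<close> of
  the same centre: the one at time n+1 is an average of densities in the cone at time n. Hence the
  increments are geometric.\<close>

lemma mean_limit:
  assumes u: "u \<in> borel_measurable borel" "\<And>x. \<bar>u x\<bar> \<le> S" "periodic u"
  shows "(\<lambda>n. integral {0..1} (\<lambda>x. u ((h ^^ n) x))) \<longlonglongrightarrow> mean u"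
    and "\<And>c \<rho>. cone (3 / 4 * D) c \<rho> \<Longrightarrow>
      \<bar>integral {c..c + 1} (\<lambda>x. \<rho> x * u ((h ^^ n) x)) - mean u\<bar> \<le> 4 / gap * S * (1 - gap) ^ n"
proof -
  define c where "c n = integral {0..1} (\<lambda>x. u ((h ^^ n) x))" for n
  have S0: "0 \<le> S" using u(2)[of 0] by linarith
  have one: "cone (3 / 4 * D) 0 (\<lambda>_. 1)" "cone D 0 (\<lambda>_. 1)" using D_ge_1 by (auto intro: cone_one)
  have "\<bar>c (Suc n) - c n\<bar> \<le> (2 * S) * (1 - gap) ^ n \<and>
    (\<forall>b \<rho>. cone (3 / 4 * D) b \<rho> \<longrightarrow> \<bar>integral {b..b + 1} (\<lambda>x. \<rho> x * u ((h ^^ n) x)) - c n\<bar> \<le> 2 * S * (1 - gap) ^ n)" for n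
  proof -
    obtain \<beta> where \<beta>: "\<And>c \<rho>. cone (3 / 4 * D) c \<rho> \<Longrightarrow>
      \<bar>integral {c..c + 1} (\<lambda>x. \<rho> x * u ((h ^^ n) x)) - \<beta>\<bar> \<le> S * (1 - gap) ^ n"
      using contraction[OF u, where n = n] by blast
    have m: "(\<lambda>x. u ((h ^^ n) x)) \<in> borel_measurable borel"
      using measurable_compose[OF borel_measurable_funpow u(1)] .
    have "\<bar>c (Suc n) - \<beta>\<bar> \<le> S * (1 - gap) ^ n"
      using push_average[OF m u(2) \<beta> one(2)] by (simp add: c_def funpow_swap1)
    moreover have c: "\<bar>c n - \<beta>\<bar> \<le> S * (1 - gap) ^ n" using \<beta>[OF one(1)] by (simp add: c_def)
    ultimately have "\<bar>c (Suc n) - c n\<bar> \<le> 2 * S * (1 - gap) ^ n" by linarith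
    moreover have "\<bar>integral {b..b + 1} (\<lambda>x. \<rho> x * u ((h ^^ n) x)) - c n\<bar> \<le> 2 * S * (1 - gap) ^ n"
      if "cone (3 / 4 * D) b \<rho>" for b \<rho> using \<beta>[OF that] c by linarith
    ultimately show ?thesis by blast
  qed
  then have inc: "\<bar>c (Suc n) - c n\<bar> \<le> (2 * S) * (1 - gap) ^ n"
    and cn: "cone (3 / 4 * D) b \<rho> \<Longrightarrow> \<bar>integral {b..b + 1} (\<lambda>x. \<rho> x * u ((h ^^ n) x)) - c n\<bar> \<le> 2 * S * (1 - gap) ^ n"
    for n b \<rho> by blast+
  obtain l where l: "c \<longlonglongrightarrow> l" "\<And>n. \<bar>c n - l\<bar> \<le> 2 * S / (1 - (1 - gap)) * (1 - gap) ^ n"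
    using geometric_increments_converge[OF inc] gap S0 by auto
  have "mean u = l" unfolding mean_def using l(1) by (simp add: c_def[abs_def] limI)
  with l show "(\<lambda>n. integral {0..1} (\<lambda>x. u ((h ^^ n) x))) \<longlonglongrightarrow> mean u" by (simp add: c_def[abs_def])
  fix b \<rho> assume b: "cone (3 / 4 * D) b \<rho>"
  have "\<bar>integral {b..b + 1} (\<lambda>x. \<rho> x * u ((h ^^ n) x)) - mean u\<bar> \<le> (2 * S) * (1 - gap) ^ n + 2 * S / gap * (1 - gap) ^ n"
    using cn[OF b, of n] l(2)[of n] \<open>mean u = l\<close> by simp
  also have "\<dots> \<le> 2 * S / gap * (1 - gap) ^ n + 2 * S / gap * (1 - gap) ^ n"
  proof -
    have "2 * S * gap \<le> 2 * S * 1" using S0 gap by (intro mult_left_mono) auto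
    then have "2 * S \<le> 2 * S / gap" using gap by (simp add: field_simps)
    then show ?thesis using gap by (intro add_right_mono mult_right_mono) auto
  qed
  finally show "\<bar>integral {b..b + 1} (\<lambda>x. \<rho> x * u ((h ^^ n) x)) - mean u\<bar> \<le> 4 / gap * S * (1 - gap) ^ n" by simp
qed

lemma abs_mean_le:
  assumes u: "u \<in> borel_measurable borel" "\<And>x. \<bar>u x\<bar> \<le> S" "periodic u"
  shows "\<bar>mean u\<bar> \<le> S"
proof (rule LIMSEQ_le_const2[OF tendsto_rabs[OF mean_limit(1)[OF u]]])
  have "\<bar>integral {0..1} (\<lambda>x. u ((h ^^ n) x))\<bar> \<le> S" for n
    using abs_integral_weighted_le[of 0 1 "\<lambda>_. 1" "\<lambda>x. u ((h ^^ n) x)" S] u(2)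
      measurable_compose[OF borel_measurable_funpow u(1)] by simp
  then show "\<exists>N. \<forall>n\<ge>N. \<bar>integral {0..1} (\<lambda>x. u ((h ^^ n) x))\<bar> \<le> S" by blast
qed

text \<open>The weight is 1 up to \<open>y\<close> and descends linearly to 0 over a length
  \<open>\<eta>\<close>, cut off at \<open>x + 1\<close>; beyond \<open>y\<close> its mass is at
  most \<open>\<eta>\<close>.\<close>

lemma ramp_integral:
  fixes v :: "real \<Rightarrow> real"
  assumes v: "v \<in> borel_measurable borel" "\<And>t. \<bar>v t\<bar> \<le> S" and xy: "x \<le> y" "y \<le> x + 1" and eta: "0 < \<eta>"
  shows "\<bar>integral {x..x + 1} (\<lambda>t. max 0 (min 1 (1 - (t - y) / \<eta>)) * v t) - integral {x..y} v\<bar> \<le> S * \<eta>"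
proof -
  define r where "r t = max 0 (min 1 (1 - (t - y) / \<eta>))" for t
  have cr: "continuous_on T r" for T unfolding r_def[abs_def] using eta by (auto intro!: continuous_intros)
  have r01: "0 \<le> r t" "r t \<le> 1" for t by (auto simp: r_def)
  have S0: "0 \<le> S" using v(2)[of 0] by linarith
  have "integral {x..x + 1} (\<lambda>t. r t * v t) = integral {x..y} (\<lambda>t. r t * v t) + integral {y..x + 1} (\<lambda>t. r t * v t)"
    using Henstock_Kurzweil_Integration.integral_combine[OF xy integrable_cont_mult[OF cr v]] by simp
  also have "integral {x..y} (\<lambda>t. r t * v t) = integral {x..y} v"
  proof (rule integral_cong)
    fix t assume "t \<in> {x..y}"
    then have "(t - y) / \<eta> \<le> 0" using eta by (simp add: divide_le_0_iff)
    then show "r t * v t = v t" by (simp add: r_def)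
  qed
  finally have eq: "integral {x..x + 1} (\<lambda>t. r t * v t) - integral {x..y} v = integral {y..x + 1} (\<lambda>t. r t * v t)" by simp
  have le: "integral {y..b} r \<le> \<eta>" if "y \<le> b" for b
  proof (cases "b \<le> y + \<eta>")
    case True
    have "integral {y..b} r \<le> integral {y..b} (\<lambda>_. 1)"
      using r01 by (intro integral_le integrable_continuous_real cr continuous_intros)
    then show ?thesis using True that by simp
  next
    case False
    have "integral {y..b} r = integral {y..y + \<eta>} r + integral {y + \<eta>..b} r"
      using False eta by (intro Henstock_Kurzweil_Integration.integral_combine[symmetric] integrable_continuous_real cr) auto
    also have "integral {y + \<eta>..b} r = integral {y + \<eta>..b} (\<lambda>_. 0)"
      using eta by (intro integral_cong) (auto simp: r_def field_simps)
    also have "integral {y..y + \<eta>} r \<le> integral {y..y + \<eta>} (\<lambda>_. 1)"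
      using r01 by (intro integral_le integrable_continuous_real cr continuous_intros)
    finally show ?thesis using eta by simp
  qed
  have "\<bar>integral {y..x + 1} (\<lambda>t. r t * v t)\<bar> \<le> S * integral {y..x + 1} r"
    using r01 by (intro abs_integral_weighted_le cr v)
  also have "\<dots> \<le> S * \<eta>" using le[OF xy(2)] S0 by (intro mult_left_mono)
  finally show ?thesis using eq by (simp add: r_def)
qed

lemma interval_mean:
  assumes u: "u \<in> borel_measurable borel" "\<And>x. \<bar>u x\<bar> \<le> S" "periodic u" and xy: "x \<le> y" "y \<le> x + 1"
  shows "\<bar>integral {x..y} (\<lambda>t. u ((h ^^ n) t)) - (y - x) * mean u\<bar> \<le> 18 / gap * S * rate ^ n"
proof -
  define v where "v = (\<lambda>t. u ((h ^^ n) t))"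
  have v: "v \<in> borel_measurable borel" "\<And>t. \<bar>v t\<bar> \<le> S"
    unfolding v_def using u(2) measurable_compose[OF borel_measurable_funpow u(1)] by auto
  have S0: "0 \<le> S" using u(2)[of 0] by linarith
  define \<eta> where "\<eta> = rate ^ n"
  have eta: "0 < \<eta>" unfolding \<eta>_def using rate by auto
  \<comment> \<open>A ramp of slope \<open>1 / \<eta>\<close> vanishes somewhere and is in no cone.
    Adding \<open>K\<close> makes its logarithm Lipschitz with constant \<open>3 / 4 * D\<close>;
    the contribution of \<open>K\<close> is subtracted again by comparing with the constant
    density.\<close>
  define K where "K = 1 / (3 / 4 * D * \<eta>)"
  have K: "0 < K" using eta D_ge_1 by (simp add: K_def)
  define r where "r t = max 0 (min 1 (1 - (t - y) / \<eta>))" for t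
  have cr: "continuous_on T r" for T unfolding r_def[abs_def] using eta by (auto intro!: continuous_intros)
  have r01: "0 \<le> r t" "r t \<le> 1" for t by (auto simp: r_def)
  have rlip: "r s \<le> r t + \<bar>s - t\<bar> / \<eta>" for s t
  proof -
    have "(t - y) / \<eta> \<le> (s - y) / \<eta> + \<bar>s - t\<bar> / \<eta>"
      using eta by (simp add: divide_right_mono flip: add_divide_distrib)
    moreover have "0 \<le> \<bar>s - t\<bar> / \<eta>" using eta by simp
    ultimately show ?thesis unfolding r_def by linarith
  qed
  define Z where "Z = integral {x..x + 1} (\<lambda>t. r t + K)"
  define I where "I = integral {x..x + 1} r"
  have I01: "0 \<le> I" "I \<le> 1"
    using integral_nonneg[OF integrable_continuous_real[OF cr]] r01
      integral_le[OF integrable_continuous_real[OF cr] integrable_const_ivl, of x "x + 1" 1] by (auto simp: I_def)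
  have Z: "Z = I + K" unfolding Z_def I_def
    by (subst Henstock_Kurzweil_Integration.integral_add) (auto intro: integrable_continuous_real cr)
  have Zpos: "0 < Z" using Z K I01 by simp
  have cone: "cone (3 / 4 * D) x (\<lambda>t. (r t + K) / Z)"
    unfolding cone_def
  proof (intro conjI ballI)
    show "continuous_on {x..x + 1} (\<lambda>t. (r t + K) / Z)" using Zpos by (intro continuous_intros cr) auto
    show "integral {x..x + 1} (\<lambda>t. (r t + K) / Z) = 1" using Zpos by (simp add: Z_def)
    fix s t
    show "0 < (r s + K) / Z" using r01[of s] K Zpos by (simp add: add_nonneg_pos)
    have "r s + K \<le> (r t + K) + 3 / 4 * D * \<bar>s - t\<bar> * K"
      using rlip[of s t] eta D_ge_1 by (simp add: K_def)
    also have "\<dots> \<le> (r t + K) + 3 / 4 * D * \<bar>s - t\<bar> * (r t + K)"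
      using r01 D_ge_1 by (intro add_left_mono mult_left_mono) auto
    also have "\<dots> = (1 + 3 / 4 * D * \<bar>s - t\<bar>) * (r t + K)" by (simp add: algebra_simps)
    also have "\<dots> \<le> exp (3 / 4 * D * \<bar>s - t\<bar>) * (r t + K)"
      using r01[of t] K by (intro mult_right_mono exp_ge_add_one_self) auto
    finally show "(r s + K) / Z \<le> exp (3 / 4 * D * \<bar>s - t\<bar>) * ((r t + K) / Z)"
      using Zpos by (simp add: divide_right_mono)
  qed
  define e where "e = 4 / gap * S * (1 - gap) ^ n"
  define E where "E = integral {x..x + 1} (\<lambda>t. (r t + K) / Z * v t)"
  have E: "\<bar>E - mean u\<bar> \<le> e" using mean_limit(2)[OF u cone] by (simp add: E_def e_def v_def)
  have V: "\<bar>integral {x..x + 1} v - mean u\<bar> \<le> e"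
    using mean_limit(2)[OF u cone_one[of "3 / 4 * D" x]] D_ge_1 by (simp add: e_def v_def)
  have "(\<lambda>t. Z * ((r t + K) / Z * v t)) = (\<lambda>t. 1 * (r t * v t) + K * v t)"
    using Zpos by (simp add: fun_eq_iff distrib_right)
  then have "Z * E = integral {x..x + 1} (\<lambda>t. 1 * (r t * v t) + K * v t)"
    by (simp only: E_def flip: integral_mult_right)
  also have "\<dots> = 1 * integral {x..x + 1} (\<lambda>t. r t * v t) + K * integral {x..x + 1} v"
    by (rule integral_lincomb) (intro integrable_cont_mult[OF cr v] integrable_meas[OF v])+
  finally have "integral {x..x + 1} (\<lambda>t. r t * v t) - I * mean u = Z * (E - mean u) - K * (integral {x..x + 1} v - mean u)"
    by (simp add: Z algebra_simps)
  also have "\<bar>\<dots>\<bar> \<le> Z * e + K * e"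
  proof -
    have "\<bar>Z * (E - mean u)\<bar> \<le> Z * e" using E Zpos by (simp add: abs_mult)
    moreover have "\<bar>K * (integral {x..x + 1} v - mean u)\<bar> \<le> K * e" using V K by (simp add: abs_mult)
    ultimately show ?thesis by linarith
  qed
  also have "\<dots> \<le> (1 + 2 * K) * e"
  proof -
    have "0 \<le> e" using S0 gap by (simp add: e_def)
    then have "I * e \<le> 1 * e" using I01 by (intro mult_right_mono) auto
    then show ?thesis by (simp add: Z algebra_simps)
  qed
  finally have A: "\<bar>integral {x..x + 1} (\<lambda>t. r t * v t) - I * mean u\<bar> \<le> (1 + 2 * K) * e" .
  have B: "\<bar>integral {x..x + 1} (\<lambda>t. r t * v t) - integral {x..y} v\<bar> \<le> S * \<eta>"
    using ramp_integral[OF v xy eta] by (simp add: r_def)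
  have C: "\<bar>I - (y - x)\<bar> \<le> \<eta>"
    using ramp_integral[of "\<lambda>_. 1" 1, OF _ _ xy eta] xy by (simp add: I_def r_def[abs_def])
  have C': "\<bar>I * mean u - (y - x) * mean u\<bar> \<le> S * \<eta>"
  proof -
    have "\<bar>I * mean u - (y - x) * mean u\<bar> = \<bar>I - (y - x)\<bar> * \<bar>mean u\<bar>"
      by (simp add: left_diff_distrib flip: abs_mult)
    also have "\<dots> \<le> \<eta> * S" using C abs_mean_le[OF u] eta by (intro mult_mono) auto
    finally show ?thesis by (simp add: mult.commute)
  qed
  have "\<bar>integral {x..y} v - (y - x) * mean u\<bar> \<le> 2 * (S * \<eta>) + (1 + 2 * K) * e"
    using A B C' by linarith
  also have "\<dots> \<le> 18 / gap * S * \<eta>"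
  proof -
    have sq: "(1 - gap) ^ n = \<eta> * \<eta>" using rate(3)[of n] by (simp add: \<eta>_def)
    have "S * \<eta> * gap \<le> S * \<eta> * 1" using S0 eta gap by (intro mult_left_mono) auto
    then have 1: "S * \<eta> \<le> S * \<eta> / gap" using gap by (simp add: field_simps)
    have 2: "e \<le> 4 / gap * S * \<eta>"
      unfolding e_def using rate_le[of n] S0 gap by (intro mult_left_mono) (auto simp: \<eta>_def)
    have 3: "K * e \<le> 6 / gap * S * \<eta>"
    proof -
      have "K * e = (16 / 3) / D * (S * \<eta> / gap)" using eta by (simp add: K_def e_def sq field_simps)
      also have "\<dots> \<le> 6 * (S * \<eta> / gap)"
        using D_ge_1 S0 eta gap by (intro mult_right_mono) (auto simp: field_simps)
      finally show ?thesis by simp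
    qed
    have "2 * (S * \<eta>) + (1 + 2 * K) * e = 2 * (S * \<eta>) + e + 2 * (K * e)" by (simp add: algebra_simps)
    also have "\<dots> \<le> 2 * (S * \<eta> / gap) + 4 * (S * \<eta> / gap) + 2 * (6 * (S * \<eta> / gap))"
      using 1 2 3 by simp
    also have "\<dots> = 18 / gap * S * \<eta>" by simp
    finally show ?thesis .
  qed
  finally show ?thesis by (simp add: v_def \<eta>_def)
qed

text \<open>Mixing in weak form: an integral of \<open>u \<circ> h ^^ n - b\<close> over part of a
  period is small by \<open>interval_mean\<close>, so the primitive is uniformly small although the
  function itself is not. The constant \<open>b\<close> is the exact average over a period, and not
  the limit, because this makes the primitive periodic. The factor 22 is 18 from the interval plus 4
  from replacing \<open>mean u\<close> by \<open>b\<close>.\<close>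

lemma decay_primitive:
  assumes u: "continuous_on UNIV u" "\<And>x. \<bar>u x\<bar> \<le> S" "periodic u"
  obtains \<Phi> b where "\<And>x. (\<Phi> has_real_derivative u ((h ^^ n) x) - b) (at x)" "periodic \<Phi>"
    "\<And>x. \<bar>\<Phi> x\<bar> \<le> 22 / gap * S * rate ^ n" "\<bar>b - mean u\<bar> \<le> 4 / gap * S * rate ^ n"
proof -
  have m: "u \<in> borel_measurable borel" using u(1) by (rule borel_measurable_continuous_onI)
  have S0: "0 \<le> S" using u(2)[of 0] by linarith
  define v where "v = (\<lambda>x. u ((h ^^ n) x))"
  have vc: "continuous_on T v" for T
    unfolding v_def by (rule continuous_on_compose2[OF u(1) continuous_funpow]) auto
  have vp: "periodic v" unfolding v_def by (rule periodic_comp_funpow[OF u(3)])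
  have vm: "v \<in> borel_measurable borel" "\<And>x. \<bar>v x\<bar> \<le> S"
    using vc[of UNIV] u(2) by (auto simp: v_def intro: borel_measurable_continuous_onI)
  define b where "b = integral {0..1} v"
  have b: "\<bar>b - mean u\<bar> \<le> 4 / gap * S * rate ^ n"
  proof -
    have "\<bar>b - mean u\<bar> \<le> 4 / gap * S * (1 - gap) ^ n"
      using mean_limit(2)[OF m u(2,3) cone_one[of "3 / 4 * D" 0]] D_ge_1 by (simp add: b_def v_def)
    also have "\<dots> \<le> 4 / gap * S * rate ^ n" using rate_le S0 gap by (intro mult_left_mono) auto
    finally show ?thesis .
  qed
  have "isCont (\<lambda>x. v x - b) x" for x
    using vc[of UNIV] by (intro continuous_intros) (simp add: continuous_on_eq_continuous_at)
  then obtain F where F: "\<And>x. (F has_real_derivative v x - b) (at x)"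
    using einterval_antiderivative[of "-\<infinity>" \<infinity> "\<lambda>x. v x - b"]
    by (auto simp: has_real_derivative_iff_has_vector_derivative)
  define \<Phi> where "\<Phi> x = F x - F 0" for x
  have d: "(\<Phi> has_real_derivative v x - b) (at x)" for x
    unfolding \<Phi>_def[abs_def] using F[of x] by (auto intro!: derivative_eq_intros)
  have ftc: "\<Phi> y - \<Phi> x = integral {x..y} v - (y - x) * b" if "x \<le> y" for x y
  proof -
    have "((\<lambda>x. v x - b) has_integral (\<Phi> y - \<Phi> x)) {x..y}"
      using that d by (intro fundamental_theorem_of_calculus)
        (auto simp: has_real_derivative_iff_has_vector_derivative[symmetric] intro: has_field_derivative_at_within)
    then have "integral {x..y} (\<lambda>x. v x - b) = \<Phi> y - \<Phi> x" by (rule integral_unique)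
    then show ?thesis
      using Henstock_Kurzweil_Integration.integral_diff[OF integrable_continuous_real[OF vc] integrable_const_ivl[of b], of x y] that
      by simp
  qed
  have per: "periodic \<Phi>"
    unfolding periodic_def
  proof
    fix x
    have "integral {x..x + 1} v = b" unfolding b_def by (rule integral_unit_periodic[OF vp vm])
    then show "\<Phi> (x + 1) = \<Phi> x" using ftc[of x "x + 1"] by simp
  qed
  have bound: "\<bar>\<Phi> x\<bar> \<le> 22 / gap * S * rate ^ n" for x
  proof -
    define t where "t = frac x"
    have t: "0 \<le> t" "t \<le> 1" by (auto simp: t_def frac_lt_1 less_imp_le)
    have "\<Phi> x = \<Phi> t" using periodic_frac[OF per, of x] by (simp add: t_def)
    also have "\<dots> = integral {0..t} v - t * b" using ftc[OF t(1)] by (simp add: \<Phi>_def)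
    also have "\<dots> = (integral {0..t} v - (t - 0) * mean u) + t * (mean u - b)" by (simp add: algebra_simps)
    also have "\<bar>\<dots>\<bar> \<le> 18 / gap * S * rate ^ n + 1 * (4 / gap * S * rate ^ n)"
    proof (rule order.trans[OF abs_triangle_ineq add_mono])
      show "\<bar>integral {0..t} v - (t - 0) * mean u\<bar> \<le> 18 / gap * S * rate ^ n"
        using interval_mean[OF m u(2,3), of 0 t n] t by (simp add: v_def)
      show "\<bar>t * (mean u - b)\<bar> \<le> 1 * (4 / gap * S * rate ^ n)"
        unfolding abs_mult using t b by (intro mult_mono) auto
    qed
    finally show ?thesis by (simp add: field_simps)
  qed
  show ?thesis by (rule that[OF _ per bound b]) (use d in \<open>simp add: v_def\<close>)
qed

end

section \<open>The absolutely continuous invariant measure\<close>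

definition unit_lebesgue :: "real measure" where
  "unit_lebesgue = uniform_measure lborel {0..<1}"

lemma sets_unit_lebesgue [simp, measurable_cong]: "sets unit_lebesgue = sets borel"
  and space_unit_lebesgue [simp]: "space unit_lebesgue = UNIV"
  by (simp_all add: unit_lebesgue_def)

lemma prob_space_unit_lebesgue: "prob_space unit_lebesgue"
  unfolding unit_lebesgue_def by (intro prob_space_uniform_measure) auto

lemma unit_lebesgue_density: "unit_lebesgue = density lborel (indicator {0..<1})"
  unfolding unit_lebesgue_def uniform_measure_def by (intro density_cong) (auto simp: divide_ennreal_def)

lemma integral_unit_lebesgue:
  fixes u :: "real \<Rightarrow> real"
  assumes "u \<in> borel_measurable borel"
  shows "integral\<^sup>L unit_lebesgue u = (LBINT x:{0..<1}. u x)"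
proof -
  have "integral\<^sup>L (density lborel (\<lambda>x. ennreal (indicator {0..<1} x))) u = (LBINT x. indicator {0..<1} x *\<^sub>R u x)"
    using assms by (intro integral_density) auto
  then show ?thesis unfolding unit_lebesgue_density by (simp add: set_lebesgue_integral_def ennreal_indicator)
qed

lemma integral_unit_lebesgue_atMost:
  fixes v :: "real \<Rightarrow> real"
  assumes v: "v \<in> borel_measurable borel" "\<And>x. \<bar>v x\<bar> \<le> S"
  shows "integral\<^sup>L unit_lebesgue (\<lambda>x. indicator {..a} x * v x) = integral {0..max 0 (min 1 a)} v"
proof -
  define y where "y = max 0 (min 1 a)"
  have "integral\<^sup>L unit_lebesgue (\<lambda>x. indicator {..a} x * v x) =
      (LBINT x. indicator {0..<1} x *\<^sub>R (indicator {..a} x * v x))"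
    using v(1) by (subst integral_unit_lebesgue) (auto simp: set_lebesgue_integral_def)
  also have "\<dots> = (LBINT x. indicator {0..y} x *\<^sub>R v x)"
  proof (rule integral_cong_AE)
    show "AE x in lborel. indicator {0..<1} x *\<^sub>R (indicator {..a} x * v x) = indicator {0..y} x *\<^sub>R v x"
      using AE_lborel_singleton[of 0] AE_lborel_singleton[of 1]
      by eventually_elim (auto simp: indicator_def y_def)
  qed (use v(1) in measurable)
  also have "\<dots> = integral {0..y} v"
    using set_borel_integral_eq_integral(2)[OF set_integrable_cont_mult[of 0 y "\<lambda>_. 1", OF _ v]]
    by (simp add: set_lebesgue_integral_def)
  finally show ?thesis by (simp add: y_def)
qed

context expanding_map begin

text \<open>The densities for which the limit holds form a linear class closed under L1 limits. It
  contains the indicators of half-lines, for which the claim is \<open>interval_mean\<close>, hence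
  those of Borel sets by a Dynkin argument, hence all integrable functions.\<close>

lemma mixing:
  fixes r :: "real \<Rightarrow> real"
  assumes u: "u \<in> borel_measurable borel" "\<And>x. \<bar>u x\<bar> \<le> S" "periodic u"
    and r: "integrable unit_lebesgue r"
  shows "(\<lambda>n. integral\<^sup>L unit_lebesgue (\<lambda>x. r x * u ((h ^^ n) x))) \<longlonglongrightarrow>
    integral\<^sup>L unit_lebesgue r * mean u"
proof -
  interpret N: prob_space unit_lebesgue by (rule prob_space_unit_lebesgue)
  define v where "v n = (\<lambda>x. u ((h ^^ n) x))" for n
  have v: "v n \<in> borel_measurable borel" "\<bar>v n x\<bar> \<le> S" for n x
    unfolding v_def using u(2) measurable_compose[OF borel_measurable_funpow u(1)] by auto
  have S0: "0 \<le> S" using u(2)[of 0] by linarith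
  define Q where "Q r \<longleftrightarrow> (\<lambda>n. integral\<^sup>L unit_lebesgue (\<lambda>x. r x * v n x)) \<longlonglongrightarrow>
    integral\<^sup>L unit_lebesgue r * mean u" for r :: "real \<Rightarrow> real"
  have ri: "integrable unit_lebesgue (\<lambda>x. r x * v n x)" if "integrable unit_lebesgue r" for r n
  proof (rule Bochner_Integration.integrable_bound[OF integrable_mult_right[OF that, of S]])
    show "(\<lambda>x. r x * v n x) \<in> borel_measurable unit_lebesgue"
      using borel_measurable_integrable[OF that] v(1) by measurable
    show "AE x in unit_lebesgue. norm (r x * v n x) \<le> norm (S * r x)"
    proof (rule AE_I2)
      fix x
      show "norm (r x * v n x) \<le> norm (S * r x)"
        using mult_right_mono[OF v(2)[of n x], of "\<bar>r x\<bar>"] S0 by (simp add: abs_mult mult.commute)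
    qed
  qed
  have rS: "\<bar>integral\<^sup>L unit_lebesgue (\<lambda>x. r x * v n x)\<bar> \<le> S * integral\<^sup>L unit_lebesgue (\<lambda>x. \<bar>r x\<bar>)"
    if "integrable unit_lebesgue r" for r n
  proof -
    have "norm (r x * v n x) \<le> S * \<bar>r x\<bar>" for x
      using mult_right_mono[OF v(2)[of n x], of "\<bar>r x\<bar>"] by (simp add: abs_mult mult.commute)
    then have "norm (integral\<^sup>L unit_lebesgue (\<lambda>x. r x * v n x)) \<le> integral\<^sup>L unit_lebesgue (\<lambda>x. S * \<bar>r x\<bar>)"
      by (intro Bochner_Integration.integral_norm_bound_integral[OF ri[OF that] integrable_mult_right[OF integrable_abs[OF that]]])
    then show ?thesis by simp
  qed
  have closure: "Q r" if r: "integrable unit_lebesgue r"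
    and approx: "\<And>e. 0 < e \<Longrightarrow> \<exists>r'. integrable unit_lebesgue r' \<and> Q r' \<and> integral\<^sup>L unit_lebesgue (\<lambda>x. \<bar>r x - r' x\<bar>) \<le> e"
    for r
    unfolding Q_def
  proof (rule LIMSEQ_I)
    fix e :: real assume e: "0 < e"
    define e' where "e' = e / (2 * S + 2)"
    have "e = (2 * S + 2) * e'" using S0 by (simp add: e'_def)
    moreover have "0 < e'" using e S0 by (simp add: e'_def)
    ultimately have e': "0 < e'" "2 * S * e' + e' < e" by (simp_all add: algebra_simps)
    obtain r' where r': "integrable unit_lebesgue r'" "Q r'" "integral\<^sup>L unit_lebesgue (\<lambda>x. \<bar>r x - r' x\<bar>) \<le> e'"
      using approx[OF e'(1)] by blast
    obtain n0 where n0: "\<And>n. n \<ge> n0 \<Longrightarrow>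
        \<bar>integral\<^sup>L unit_lebesgue (\<lambda>x. r' x * v n x) - integral\<^sup>L unit_lebesgue r' * mean u\<bar> < e'"
      using LIMSEQ_D[OF r'(2)[unfolded Q_def] e'(1)] by auto
    have d: "integrable unit_lebesgue (\<lambda>x. r x - r' x)" using r r' by auto
    have "norm (integral\<^sup>L unit_lebesgue (\<lambda>x. r x * v n x) - integral\<^sup>L unit_lebesgue r * mean u) < e" if "n0 \<le> n" for n
    proof -
      have 1: "integral\<^sup>L unit_lebesgue (\<lambda>x. (r x - r' x) * v n x) =
         integral\<^sup>L unit_lebesgue (\<lambda>x. r x * v n x) - integral\<^sup>L unit_lebesgue (\<lambda>x. r' x * v n x)"
        using ri[OF r] ri[OF r'(1)] by (simp add: left_diff_distrib)
      have 2: "\<bar>integral\<^sup>L unit_lebesgue (\<lambda>x. (r x - r' x) * v n x)\<bar> \<le> S * e'"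
        using rS[OF d, of n] mult_left_mono[OF r'(3) S0] by linarith
      have "\<bar>integral\<^sup>L unit_lebesgue r' - integral\<^sup>L unit_lebesgue r\<bar> \<le> e'"
      proof -
        have "\<bar>integral\<^sup>L unit_lebesgue (\<lambda>x. r x - r' x)\<bar> \<le> e'"
          using integral_abs_bound[of unit_lebesgue "\<lambda>x. r x - r' x"] r'(3) by linarith
        then show ?thesis using r r' by (simp add: abs_minus_commute)
      qed
      then have 3: "\<bar>(integral\<^sup>L unit_lebesgue r' - integral\<^sup>L unit_lebesgue r) * mean u\<bar> \<le> e' * S"
        unfolding abs_mult using abs_mean_le[OF u] e' by (intro mult_mono) auto
      have "integral\<^sup>L unit_lebesgue (\<lambda>x. r x * v n x) - integral\<^sup>L unit_lebesgue r * mean u =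
         integral\<^sup>L unit_lebesgue (\<lambda>x. (r x - r' x) * v n x) +
         (integral\<^sup>L unit_lebesgue (\<lambda>x. r' x * v n x) - integral\<^sup>L unit_lebesgue r' * mean u) +
         (integral\<^sup>L unit_lebesgue r' - integral\<^sup>L unit_lebesgue r) * mean u"
        unfolding 1 by (simp add: algebra_simps)
      moreover have "\<bar>a + b + c\<bar> < e" if "\<bar>a\<bar> \<le> S * e'" "\<bar>b\<bar> < e'" "\<bar>c\<bar> \<le> e' * S" for a b c
        using that e'(2) by (simp add: algebra_simps)
      ultimately show ?thesis using 2 3 n0[OF that] by simp
    qed
    then show "\<exists>n0. \<forall>n\<ge>n0. norm (integral\<^sup>L unit_lebesgue (\<lambda>x. r x * v n x) - integral\<^sup>L unit_lebesgue r * mean u) < e"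
      by blast
  qed
  have scale: "Q (\<lambda>x. c * r x)" if "Q r" for c r
    using tendsto_mult_left[OF that[unfolded Q_def], of c] by (simp add: Q_def mult.assoc)
  have Qadd: "Q (\<lambda>x. r x + s x)" if "Q r" "Q s" "integrable unit_lebesgue r" "integrable unit_lebesgue s" for r s
    using tendsto_add[OF that(1,2)[unfolded Q_def]] that(3,4) ri[OF that(3)] ri[OF that(4)]
    by (simp add: Q_def distrib_right)
  have Ai: "integrable unit_lebesgue (indicator B :: real \<Rightarrow> real)" if "B \<in> sets borel" for B
    using that by (intro N.integrable_const_bound[of _ 1]) auto
  have at: "Q (indicator {..a})" for a :: real
  proof -
    define y where "y = max 0 (min 1 a)"
    have y: "0 \<le> y" "y \<le> 1" by (auto simp: y_def)
    have m: "integral\<^sup>L unit_lebesgue (indicator {..a}) = y"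
    proof -
      have "integral\<^sup>L unit_lebesgue (indicator {..a}) = integral\<^sup>L unit_lebesgue (\<lambda>x. indicator {..a} x * (1 :: real))"
        by simp
      also have "\<dots> = integral {0..y} (\<lambda>_. 1)"
        unfolding y_def by (rule integral_unit_lebesgue_atMost[where S = 1]) auto
      finally show ?thesis using y by simp
    qed
    have "(\<lambda>n. integral {0..y} (v n) - y * mean u) \<longlonglongrightarrow> 0"
    proof (rule Lim_null_comparison)
      show "\<forall>\<^sub>F n in sequentially. norm (integral {0..y} (v n) - y * mean u) \<le> 18 / gap * S * rate ^ n"
        using interval_mean[OF u, of 0 y] y by (simp add: v_def)
      show "(\<lambda>n. 18 / gap * S * rate ^ n) \<longlonglongrightarrow> 0"
        using tendsto_mult_left[OF LIMSEQ_realpow_zero, of rate "18 / gap * S"] rate by simp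
    qed
    then have "(\<lambda>n. integral {0..y} (v n)) \<longlonglongrightarrow> y * mean u" by (simp add: LIM_zero_iff)
    then show ?thesis unfolding Q_def m using integral_unit_lebesgue_atMost[OF v] by (simp add: y_def)
  qed
  have one: "Q (\<lambda>_. 1)"
  proof (rule closure)
    fix e :: real assume "0 < e"
    have "integral\<^sup>L unit_lebesgue (\<lambda>x. \<bar>1 - indicator {..1} x\<bar>) = integral\<^sup>L unit_lebesgue (\<lambda>_. 0 :: real)"
    proof (rule integral_cong_AE)
      show "AE x in unit_lebesgue. \<bar>1 - indicator {..1} x :: real\<bar> = 0"
        unfolding unit_lebesgue_def by (rule AE_uniform_measureI) (auto simp: indicator_def)
    qed auto
    then show "\<exists>r'. integrable unit_lebesgue r' \<and> Q r' \<and> integral\<^sup>L unit_lebesgue (\<lambda>x. \<bar>1 - r' x\<bar>) \<le> e"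
      using at[of 1] Ai[of "{..1}"] \<open>0 < e\<close> by (intro exI[of _ "indicator {..1}"]) auto
  qed auto
  have ind: "Q (indicator A)" if "A \<in> sets borel" for A
  proof -
    have st: "Int_stable (range (atMost :: real \<Rightarrow> real set))"
      by (auto simp: Int_stable_def)
    have pw: "range (atMost :: real \<Rightarrow> real set) \<subseteq> Pow UNIV" by simp
    have A_gen: "A \<in> sigma_sets UNIV (range atMost)"
      using that by (simp add: borel_eq_atMost[where 'a = real])
    show ?thesis
      using st pw A_gen
    proof (induction rule: sigma_sets_induct_disjoint)
      case (basic A) then show ?case using at by auto
    next
      case empty show ?case by (simp add: Q_def)
    next
      case (compl A)
      then have A: "A \<in> sets borel" by (simp add: borel_eq_atMost[where 'a = real])
      have "Q (\<lambda>x. 1 + (- 1) * indicator A x)"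
        using scale[OF compl(2), of "- 1"] one Ai[OF A] by (intro Qadd) auto
      moreover have "(\<lambda>x. 1 + (- 1) * indicator A x) = (indicator (UNIV - A) :: real \<Rightarrow> real)"
        by (auto simp: indicator_def)
      ultimately show ?case by simp
    next
      case (union A)
      then have A: "A i \<in> sets borel" for i by (auto simp: borel_eq_atMost[where 'a = real])
      define B where "B m = (\<Union>i<m. A i)" for m
      have B: "B m \<in> sets borel" for m using A by (auto simp: B_def)
      have QB: "Q (indicator (B m))" for m
      proof (induction m)
        case 0 then show ?case by (simp add: Q_def B_def)
      next
        case (Suc m)
        have "disjnt (B m) (A m)"
        proof -
          have "A i \<inter> A m = {}" if "i < m" for i
            using disjoint_family_onD[OF union(1), of i m] that by simp
          then show ?thesis by (auto simp: B_def disjnt_def)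
        qed
        then have "(\<lambda>x. indicator (B m) x + indicator (A m) x) = (indicator (B (Suc m)) :: real \<Rightarrow> real)"
          by (auto simp: B_def indicator_def fun_eq_iff disjnt_def lessThan_Suc)
        then show ?case using Qadd[OF Suc union(3)[of m] Ai[OF B] Ai[OF A]] by simp
      qed
      show ?case
      proof (rule closure)
        show "integrable unit_lebesgue (indicator (\<Union>i. A i) :: real \<Rightarrow> real)" using A by (intro Ai) auto
        fix e :: real assume e: "0 < e"
        have "(\<lambda>m. measure unit_lebesgue (B m)) \<longlonglongrightarrow> measure unit_lebesgue (\<Union>m. B m)"
          using B by (intro N.finite_Lim_measure_incseq) (auto simp: B_def incseq_def intro: less_le_trans)
        moreover have "(\<Union>m. B m) = (\<Union>i. A i)" by (auto simp: B_def)
        ultimately obtain m where m: "\<bar>measure unit_lebesgue (B m) - measure unit_lebesgue (\<Union>i. A i)\<bar> < e"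
          using LIMSEQ_D[OF _ e, of "\<lambda>m. measure unit_lebesgue (B m)"] by fastforce
        have "integral\<^sup>L unit_lebesgue (\<lambda>x. \<bar>indicator (\<Union>i. A i) x - indicator (B m) x\<bar>) =
          integral\<^sup>L unit_lebesgue (\<lambda>x. indicator (\<Union>i. A i) x - indicator (B m) x :: real)"
          by (intro Bochner_Integration.integral_cong) (auto simp: indicator_def B_def)
        also have "\<dots> = measure unit_lebesgue (\<Union>i. A i) - measure unit_lebesgue (B m)"
          using A B by (subst Bochner_Integration.integral_diff) (auto intro!: Ai)
        finally show "\<exists>r'. integrable unit_lebesgue r' \<and> Q r' \<and>
            integral\<^sup>L unit_lebesgue (\<lambda>x. \<bar>indicator (\<Union>i. A i) x - r' x\<bar>) \<le> e"
          using QB[of m] Ai[OF B] m by (intro exI[of _ "indicator (B m)"]) auto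
      qed
    qed
  qed
  have "Q r" using r
  proof (induction rule: integrable_induct)
    case (base A c)
    then show ?case using scale[OF ind[of A], of c] by (simp add: mult.commute)
  next
    case (add f g)
    then show ?case by (intro Qadd)
  next
    case (lim f s)
    show ?case
    proof (rule closure)
      show "integrable unit_lebesgue f" using lim by simp
      fix e :: real assume e: "0 < e"
      have "(\<lambda>i. integral\<^sup>L unit_lebesgue (\<lambda>x. \<bar>f x - s i x\<bar>)) \<longlonglongrightarrow> integral\<^sup>L unit_lebesgue (\<lambda>x. 0 :: real)"
      \<comment> \<open>The approximating functions satisfy
        \<open>\<bar>s i x\<bar> \<le> 2 * \<bar>f x\<bar>\<close>, whence the factor 3.\<close>
      proof (rule integral_dominated_convergence[where w = "\<lambda>x. 3 * \<bar>f x\<bar>"])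
        show "AE x in unit_lebesgue. (\<lambda>i. \<bar>f x - s i x\<bar>) \<longlonglongrightarrow> 0"
        proof (rule AE_I2)
          fix x assume "x \<in> space unit_lebesgue"
          then have "(\<lambda>i. \<bar>f x - s i x\<bar>) \<longlonglongrightarrow> \<bar>f x - f x\<bar>" by (intro tendsto_intros lim(2))
          then show "(\<lambda>i. \<bar>f x - s i x\<bar>) \<longlonglongrightarrow> 0" by simp
        qed
        show "AE x in unit_lebesgue. norm \<bar>f x - s i x\<bar> \<le> 3 * \<bar>f x\<bar>" for i
          using lim(3)[of _ i] by (intro AE_I2) (smt (verit) real_norm_def)
      qed (use lim(1,4) in \<open>auto simp: borel_measurable_integrable\<close>)
      then obtain i where "\<bar>integral\<^sup>L unit_lebesgue (\<lambda>x. \<bar>f x - s i x\<bar>)\<bar> < e"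
        using LIMSEQ_D[OF _ e] by fastforce
      then show "\<exists>r'. integrable unit_lebesgue r' \<and> Q r' \<and> integral\<^sup>L unit_lebesgue (\<lambda>x. \<bar>f x - r' x\<bar>) \<le> e"
        using lim(1,5)[of i] by (intro exI[of _ "s i"]) auto
    qed
  qed
  then show ?thesis by (simp add: Q_def v_def)
qed

end

section \<open>Algebraic and order properties of the limiting average\<close>

context expanding_map begin

lemma mean_add:
  assumes u: "u \<in> borel_measurable borel" "\<And>x. \<bar>u x\<bar> \<le> S" "periodic u"
    and v: "v \<in> borel_measurable borel" "\<And>x. \<bar>v x\<bar> \<le> S" "periodic v"
  shows "mean (\<lambda>x. a * u x + b * v x) = a * mean u + b * mean v"
proof -
  have m: "(\<lambda>x. w ((h ^^ n) x)) \<in> borel_measurable borel" if "w \<in> borel_measurable borel" for w :: "real \<Rightarrow> real" and n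
    using measurable_compose[OF borel_measurable_funpow that] .
  have "(\<lambda>n. integral {0..1} (\<lambda>x. a * u ((h ^^ n) x) + b * v ((h ^^ n) x))) \<longlonglongrightarrow> a * mean u + b * mean v"
    unfolding integral_lincomb[OF integrable_meas[OF m[OF u(1)] u(2)] integrable_meas[OF m[OF v(1)] v(2)]]
    by (intro tendsto_intros mean_limit(1)[OF u] mean_limit(1)[OF v])
  then show ?thesis unfolding mean_def by (rule limI)
qed

lemma mean_const: "mean (\<lambda>_. c) = c"
  unfolding mean_def by simp

lemma mean_nonneg:
  assumes u: "u \<in> borel_measurable borel" "\<And>x. \<bar>u x\<bar> \<le> S" "periodic u" and "\<And>x. 0 \<le> u x"
  shows "0 \<le> mean u"
proof (rule LIMSEQ_le_const[OF mean_limit(1)[OF u]])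
  have "0 \<le> integral {0..1} (\<lambda>x. u ((h ^^ n) x))" for n
    using measurable_compose[OF borel_measurable_funpow u(1)] u(2) assms(4)
    by (intro integral_nonneg integrable_meas) auto
  then show "\<exists>N. \<forall>n\<ge>N. 0 \<le> integral {0..1} (\<lambda>x. u ((h ^^ n) x))" by blast
qed

lemma mean_comp:
  assumes u: "u \<in> borel_measurable borel" "\<And>x. \<bar>u x\<bar> \<le> S" "periodic u"
  shows "mean (\<lambda>x. u (h x)) = mean u"
  using LIMSEQ_Suc[OF mean_limit(1)[OF u]] unfolding mean_def by (intro limI) simp

text \<open>The induction runs over all densities of the cone at once. Each of them is bounded and
  so does not charge a null function; one more iterate gives a convex combination of such zero
  integrals, expressed by \<open>push_average\<close> with centre and error 0.\<close>

lemma mean_null: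
  assumes u: "u \<in> borel_measurable borel" "\<And>x. \<bar>u x\<bar> \<le> S" "periodic u"
    and nonneg: "\<And>x. 0 \<le> u x" and null: "integral {0..1} u = 0"
  shows "mean u = 0"
proof -
  have cone34: "cone D c \<rho>" if "cone (3 / 4 * D) c \<rho>" for c \<rho>
    unfolding cone_def
  proof (intro conjI ballI)
    fix x y assume xy: "x \<in> {c..c + 1}" "y \<in> {c..c + 1}"
    have "\<rho> x \<le> exp (3 / 4 * D * \<bar>x - y\<bar>) * \<rho> y" using that xy by (auto simp: cone_def)
    also have "\<dots> \<le> exp (D * \<bar>x - y\<bar>) * \<rho> y"
      using that xy D_ge_1 by (intro mult_right_mono) (auto simp: cone_def less_imp_le mult_right_mono)
    finally show "\<rho> x \<le> exp (D * \<bar>x - y\<bar>) * \<rho> y" .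
  qed (use that in \<open>auto simp: cone_def\<close>)
  have "integral {c..c + 1} (\<lambda>x. \<rho> x * u ((h ^^ n) x)) = 0" if "cone (3 / 4 * D) c \<rho>" for n c \<rho>
    using that
  proof (induction n arbitrary: c \<rho>)
    case 0
    have cr: "continuous_on {c..c + 1} \<rho>" and pos: "\<And>x. x \<in> {c..c + 1} \<Longrightarrow> 0 < \<rho> x"
      using 0 by (auto simp: cone_def)
    obtain z where "\<forall>y\<in>{c..c + 1}. \<rho> y \<le> \<rho> z"
      using continuous_attains_sup[OF compact_Icc _ cr] by auto
    then obtain m where m: "\<And>x. x \<in> {c..c + 1} \<Longrightarrow> \<rho> x \<le> m" by blast
    have "integral {c..c + 1} (\<lambda>x. \<rho> x * u x) \<le> integral {c..c + 1} (\<lambda>x. m * u x)"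
      using m nonneg by (intro integral_le integrable_cont_mult[OF cr u(1,2)] integrable_on_mult_right
          integrable_meas[OF u(1,2)] mult_right_mono) auto
    also have "\<dots> = 0" using integral_unit_periodic[OF u(3,1,2), of c] null by simp
    finally have "integral {c..c + 1} (\<lambda>x. \<rho> x * u x) \<le> 0" .
    moreover have "0 \<le> integral {c..c + 1} (\<lambda>x. \<rho> x * u x)"
      using pos nonneg by (intro integral_nonneg integrable_cont_mult[OF cr u(1,2)]) (simp add: less_imp_le)
    ultimately have "integral {c..c + 1} (\<lambda>x. \<rho> x * u x) = 0" by (rule antisym)
    then show ?case by simp
  next
    case (Suc n)
    have m: "(\<lambda>x. u ((h ^^ n) x)) \<in> borel_measurable borel"
      using measurable_compose[OF borel_measurable_funpow u(1)] .
    have "\<bar>integral {c..c + 1} (\<lambda>x. \<rho> x * u ((h ^^ n) (h x))) - 0\<bar> \<le> 0"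
      by (rule push_average[OF m u(2) _ cone34[OF Suc.prems]]) (simp add: Suc.IH)
    then show ?case by (simp add: funpow_swap1)
  qed
  from this[OF cone_one[of "3 / 4 * D" 0]] have "integral {0..1} (\<lambda>x. u ((h ^^ n) x)) = 0" for n
    using D_ge_1 by simp
  then have "(\<lambda>n::nat. 0) \<longlonglongrightarrow> mean u" using mean_limit(1)[OF u] by simp
  then show ?thesis by (simp add: LIMSEQ_const_iff)
qed

section \<open>Construction and uniqueness of the invariant measure\<close>

definition srb :: "real measure" where
  "srb = measure_of UNIV (sets borel) (\<lambda>B. ennreal (mean (\<lambda>x. indicator B (frac x))))"

lemma indicator_frac:
  assumes "B \<in> sets borel"
  shows "(\<lambda>x. indicator B (frac x) :: real) \<in> borel_measurable borel"
    "\<bar>indicator B (frac x) :: real\<bar> \<le> 1" "periodic (\<lambda>x. indicator B (frac x) :: real)"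
proof -
  have fr: "frac \<in> borel_measurable (borel :: real measure)" unfolding frac_def[abs_def] by measurable
  show "(\<lambda>x. indicator B (frac x) :: real) \<in> borel_measurable borel"
    using measurable_compose[OF fr borel_measurable_indicator[OF assms]] .
  show "\<bar>indicator B (frac x) :: real\<bar> \<le> 1" by (simp add: indicator_def)
  show "periodic (\<lambda>x. indicator B (frac x) :: real)" by (simp add: periodic_def frac_1_eq)
qed

lemma sets_srb [simp, measurable_cong]: "sets srb = sets borel"
  by (simp add: srb_def sets.sigma_sets_eq[of borel, simplified])

lemma space_srb [simp]: "space srb = UNIV"
  by (simp add: srb_def space_measure_of_conv)

text \<open>Countable additivity is not obvious for a limit of averages. It is reduced to continuity
  at the empty set, where the uniformity of \<open>mean_limit\<close> helps: for a large fixed n the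
  limit is within e/2 of the average at time n for every Borel set simultaneously, and at fixed n
  dominated convergence applies.\<close>

lemma emeasure_srb:
  assumes "B \<in> sets borel"
  shows "emeasure srb B = ennreal (mean (\<lambda>x. indicator B (frac x)))"
  unfolding srb_def
proof (rule emeasure_measure_of_sigma)
  interpret sigma_algebra UNIV "sets (borel :: real measure)"
    using sets.sigma_algebra_axioms[of "borel :: real measure"] by simp
  show "sigma_algebra UNIV (sets (borel :: real measure))" ..
  let ?m = "\<lambda>B. mean (\<lambda>x. indicator B (frac x))"
  have nonneg: "0 \<le> ?m B" if "B \<in> sets borel" for B
    using indicator_frac[OF that] by (intro mean_nonneg[where S = 1]) auto
  show pos: "positive (sets borel) (\<lambda>B. ennreal (?m B))"
    using mean_const[of 0] by (simp add: positive_def)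
  show "countably_additive (sets borel) (\<lambda>B. ennreal (?m B))"
  proof (rule empty_continuous_imp_countably_additive[OF pos])
    show "additive (sets borel) (\<lambda>B. ennreal (?m B))"
      unfolding additive_def
    proof (intro ballI impI)
      fix A B :: "real set" assume AB: "A \<in> sets borel" "B \<in> sets borel" "A \<inter> B = {}"
      have "?m (A \<union> B) = mean (\<lambda>x. 1 * indicator A (frac x) + 1 * indicator B (frac x))"
        using AB(3) by (intro arg_cong[where f = mean]) (auto simp: indicator_def fun_eq_iff)
      also have "\<dots> = 1 * ?m A + 1 * ?m B"
        by (rule mean_add[where S = 1]) (use AB indicator_frac in auto)
      finally show "ennreal (?m (A \<union> B)) = ennreal (?m A) + ennreal (?m B)"
        using nonneg AB by (simp add: ennreal_plus)
    qed
    show "\<forall>A\<in>sets borel. ennreal (?m A) \<noteq> \<infinity>" by simp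
    fix A :: "nat \<Rightarrow> real set"
    assume A: "range A \<subseteq> sets borel" "decseq A" "\<Inter> (range A) = {}"
    then have Ab: "A i \<in> sets borel" for i by auto
    have "(\<lambda>i. ?m (A i)) \<longlonglongrightarrow> 0"
    proof (rule LIMSEQ_I)
      fix e :: real assume e: "0 < e"
      have "(\<lambda>n. 4 / gap * 1 * (1 - gap) ^ n) \<longlonglongrightarrow> 4 / gap * 1 * 0"
        using gap by (intro tendsto_mult_left LIMSEQ_realpow_zero) auto
      then have "\<forall>\<^sub>F n in sequentially. 4 / gap * 1 * (1 - gap) ^ n < e / 2"
        by (rule order_tendstoD(2)) (use e in simp)
      then obtain n where n: "4 / gap * 1 * (1 - gap) ^ n < e / 2"
        using eventually_happens'[OF sequentially_bot] by blast
      define c where "c i = integral {0..1} (\<lambda>x. indicator (A i) (frac ((h ^^ n) x)) :: real)" for i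
      have close: "\<bar>c i - ?m (A i)\<bar> < e / 2" for i
        using mean_limit(2)[OF indicator_frac[OF Ab[of i]] cone_one[of "3 / 4 * D" 0], of n] n D_ge_1
        by (simp add: c_def)
      have "c \<longlonglongrightarrow> integral {0..1} (\<lambda>_ :: real. 0)"
        unfolding c_def[abs_def]
      proof (rule dominated_convergence(2)[where h = "\<lambda>_. 1" and g = "\<lambda>_. 0"])
        show "(\<lambda>x. indicator (A i) (frac ((h ^^ n) x)) :: real) integrable_on {0..1}" for i
          using measurable_compose[OF borel_measurable_funpow indicator_frac(1)[OF Ab[of i]]]
          by (intro integrable_meas[where S = 1]) auto
        fix x
        obtain i where i: "frac ((h ^^ n) x) \<notin> A i" using A(3) by blast
        have "indicator (A j) (frac ((h ^^ n) x)) = (0 :: real)" if "i \<le> j" for j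
          using decseqD[OF A(2) that] i by (auto simp: indicator_def)
        then show "(\<lambda>i. indicator (A i) (frac ((h ^^ n) x)) :: real) \<longlonglongrightarrow> 0"
          by (intro tendsto_eventually eventually_sequentiallyI[of i])
      qed auto
      then have "c \<longlonglongrightarrow> 0" by simp
      from LIMSEQ_D[OF this, of "e / 2"] e
      obtain i0 where i0: "\<And>i. i0 \<le> i \<Longrightarrow> \<bar>c i\<bar> < e / 2" by auto
      have "\<bar>?m (A i)\<bar> < e" if "i0 \<le> i" for i using close[of i] i0[OF that] by linarith
      then have "norm (?m (A i) - 0) < e" if "i0 \<le> i" for i using that by simp
      then show "\<exists>i0. \<forall>i\<ge>i0. norm (?m (A i) - 0) < e" by blast
    qed
    from tendsto_ennrealI[OF this] show "(\<lambda>i. ennreal (?m (A i))) \<longlonglongrightarrow> 0" by simp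
  qed
qed (rule assms)

lemma is_acim_srb: "is_acim h srb"
  unfolding is_acim_def
proof (intro conjI)
  show "prob_space srb"
    by (rule prob_spaceI) (simp add: emeasure_srb mean_const)
  show "absolutely_continuous (uniform_measure lborel {0..<1}) srb"
    unfolding absolutely_continuous_def
  proof
    fix B :: "real set" assume "B \<in> null_sets (uniform_measure lborel {0..<1})"
    then have B: "B \<in> sets borel" "emeasure unit_lebesgue B = 0"
      by (auto simp: null_sets_def unit_lebesgue_def)
    have "integral\<^sup>L unit_lebesgue (indicator B) = (0 :: real)"
      using B by (simp add: measure_def)
    moreover have "integral\<^sup>L unit_lebesgue (\<lambda>x. indicator {..1} x * indicator B (frac x)) = integral\<^sup>L unit_lebesgue (indicator B :: real \<Rightarrow> real)"
    proof (rule integral_cong_AE)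
      show "AE x in unit_lebesgue. indicator {..1} x * indicator B (frac x) = (indicator B x :: real)"
        unfolding unit_lebesgue_def by (rule AE_uniform_measureI) (auto simp: indicator_def frac_eq)
    qed (use B indicator_frac(1)[OF B(1)] in measurable)
    ultimately have "integral {0..1} (\<lambda>x. indicator B (frac x) :: real) = 0"
      using integral_unit_lebesgue_atMost[OF indicator_frac(1,2)[OF B(1)], of 1] by simp
    then have "mean (\<lambda>x. indicator B (frac x)) = 0"
      by (intro mean_null[OF indicator_frac[OF B(1)]]) auto
    then show "B \<in> null_sets srb" using B by (simp add: null_sets_def emeasure_srb)
  qed
  show "distr srb borel (\<lambda>x. frac (h x)) = srb"
  proof (rule measure_eqI)
    have fm: "(\<lambda>x. frac (h x)) \<in> measurable srb borel"
      using measurable_compose[OF borel_measurable_h, of frac borel] unfolding frac_def[abs_def] by measurable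
    fix B assume "B \<in> sets (distr srb borel (\<lambda>x. frac (h x)))"
    then have B: "B \<in> sets borel" by simp
    have pre: "(\<lambda>x. frac (h x)) -` B \<in> sets borel"
      using measurable_sets[OF fm B] by simp
    have "emeasure (distr srb borel (\<lambda>x. frac (h x))) B = emeasure srb ((\<lambda>x. frac (h x)) -` B)"
      using emeasure_distr[OF fm B] by simp
    also have "\<dots> = ennreal (mean (\<lambda>x. indicator B (frac (h x))))"
    proof -
      have "indicator ((\<lambda>x. frac (h x)) -` B) (frac x) = (indicator B (frac (h x)) :: real)" for x
      proof -
        have "periodic (\<lambda>x. frac (h x))" by (rule periodic_comp) (simp add: periodic_def frac_1_eq)
        then show ?thesis using periodic_frac[of "\<lambda>x. frac (h x)" x] by (simp add: indicator_def)
      qed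
      then show ?thesis using emeasure_srb[OF pre] by simp
    qed
    also have "\<dots> = emeasure srb B"
      using mean_comp[OF indicator_frac[OF B]] emeasure_srb[OF B] by simp
    finally show "emeasure (distr srb borel (\<lambda>x. frac (h x))) B = emeasure srb B" .
  qed simp
qed simp

text \<open>By invariance the integral of \<open>u\<close> along the n-th iterate does not depend on
  n. Writing the measure as a Lebesgue density, \<open>mixing\<close> shows that it converges to
  \<open>mean u\<close>.\<close>

lemma integral_acim:
  assumes M: "is_acim h M" and u: "u \<in> borel_measurable borel" "\<And>x. \<bar>u x\<bar> \<le> S" "periodic u"
  shows "integral\<^sup>L M u = mean u"
proof -
  have sets: "sets M = sets borel" and ac: "absolutely_continuous unit_lebesgue M"
    and inv: "distr M borel (\<lambda>x. frac (h x)) = M" and p: "prob_space M"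
    using M by (auto simp: is_acim_def unit_lebesgue_def)
  interpret M: prob_space M by (rule p)
  interpret N: prob_space unit_lebesgue by (rule prob_space_unit_lebesgue)
  obtain g where g: "g \<in> borel_measurable unit_lebesgue" "\<And>x. 0 \<le> g x" "density unit_lebesgue (\<lambda>x. ennreal (g x)) = M"
  proof -
    obtain D where D: "D \<in> borel_measurable unit_lebesgue" "AE x in unit_lebesgue. RN_deriv unit_lebesgue M x = ennreal (D x)"
      "\<And>x. 0 \<le> D x"
      by (rule N.real_RN_deriv[OF M.finite_measure_axioms ac]) (use sets in auto)
    have "density unit_lebesgue (\<lambda>x. ennreal (D x)) = density unit_lebesgue (RN_deriv unit_lebesgue M)"
      using D(1,2) by (intro density_cong) auto
    also have "\<dots> = M" using ac sets by (intro N.density_RN_deriv) auto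
    finally show ?thesis using that D by blast
  qed
  have um: "(\<lambda>x. u ((h ^^ n) x)) \<in> borel_measurable borel" for n
    using measurable_compose[OF borel_measurable_funpow u(1)] .
  have inv_u: "integral\<^sup>L M (\<lambda>x. u ((h ^^ n) x)) = integral\<^sup>L M u" for n
  proof (induction n)
    case (Suc n)
    have "(\<lambda>x. frac (h x)) \<in> borel_measurable borel"
      using measurable_compose[OF borel_measurable_h, of frac borel] unfolding frac_def[abs_def] by measurable
    then have fm: "(\<lambda>x. frac (h x)) \<in> measurable M borel"
      unfolding measurable_cong_sets[OF sets refl] .
    have "integral\<^sup>L M (\<lambda>x. u ((h ^^ n) x)) = integral\<^sup>L (distr M borel (\<lambda>x. frac (h x))) (\<lambda>x. u ((h ^^ n) x))"
      using inv by simp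
    also have "\<dots> = integral\<^sup>L M (\<lambda>x. u ((h ^^ n) (frac (h x))))"
      by (rule integral_distr[OF fm um])
    also have "(\<lambda>x. u ((h ^^ n) (frac (h x)))) = (\<lambda>x. u ((h ^^ Suc n) x))"
      using periodic_frac[OF periodic_comp_funpow[OF u(3)]] by (simp add: fun_eq_iff funpow_swap1)
    finally show ?case using Suc by simp
  qed simp
  have dens: "integral\<^sup>L M w = integral\<^sup>L unit_lebesgue (\<lambda>x. g x * w x)" if "w \<in> borel_measurable borel" for w :: "real \<Rightarrow> real"
  proof -
    have "integral\<^sup>L (density unit_lebesgue (\<lambda>x. ennreal (g x))) w = integral\<^sup>L unit_lebesgue (\<lambda>x. g x *\<^sub>R w x)"
      using that g(1,2) by (intro integral_density) auto
    then show ?thesis unfolding g(3) by simp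
  qed
  have gi: "integrable unit_lebesgue g"
  proof -
    have "integrable (density unit_lebesgue (\<lambda>x. ennreal (g x))) (\<lambda>_. 1 :: real)"
      unfolding g(3) by simp
    then show ?thesis using g(1,2) by (subst (asm) integrable_density) auto
  qed
  have "integral\<^sup>L unit_lebesgue g = 1"
    using dens[of "\<lambda>_. 1"] M.prob_space by simp
  then have "(\<lambda>n. integral\<^sup>L M (\<lambda>x. u ((h ^^ n) x))) \<longlonglongrightarrow> mean u"
    using mixing[OF u gi] dens[OF um] by simp
  then show ?thesis unfolding inv_u by (simp add: LIMSEQ_const_iff)
qed

lemma acim_unique:
  assumes "is_acim h M" shows "M = srb"
proof (rule measure_eqI)
  show sets: "sets M = sets srb" using assms by (simp add: is_acim_def)
  have conc: "emeasure M' B = ennreal (mean (\<lambda>x. indicator B (frac x)))" if M': "is_acim h M'" and B: "B \<in> sets borel" for M' B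
  proof -
    interpret prob_space M' using M' by (simp add: is_acim_def)
    have s: "sets M' = sets borel" using M' by (simp add: is_acim_def)
    \<comment> \<open>The integral formula concerns periodic functions only. As the measure is
      carried by the fundamental domain, \<open>frac\<close> is the identity almost everywhere
      there, which brings in arbitrary Borel sets.\<close>
    have "- {0..<1::real} \<in> null_sets unit_lebesgue"
      by (auto simp: null_sets_def unit_lebesgue_def)
    then have "- {0..<1::real} \<in> null_sets M'"
      using M' by (auto simp: is_acim_def absolutely_continuous_def unit_lebesgue_def)
    then have AE: "AE x in M'. x \<in> {0..<1}"
      by (rule AE_I') auto
    have "measure M' B = integral\<^sup>L M' (indicator B)" using B s by simp
    also have "\<dots> = integral\<^sup>L M' (\<lambda>x. indicator B (frac x))"
    proof (rule integral_cong_AE)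
      show "AE x in M'. indicator B x = (indicator B (frac x) :: real)"
        using AE by eventually_elim (simp add: frac_eq)
    qed (unfold measurable_cong_sets[OF s refl], use B indicator_frac(1)[OF B] in auto)
    also have "\<dots> = mean (\<lambda>x. indicator B (frac x))"
      by (rule integral_acim[OF M' indicator_frac[OF B]])
    finally show ?thesis by (simp add: emeasure_eq_measure)
  qed
  fix B assume "B \<in> sets M"
  then show "emeasure M B = emeasure srb B"
    using conc[OF assms] emeasure_srb sets by simp
qed

lemma acim_eq: "acim h = srb"
  unfolding acim_def by (intro the_equality is_acim_srb acim_unique)

lemma integral_acim_eq_mean:
  assumes "u \<in> borel_measurable borel" "\<And>x. \<bar>u x\<bar> \<le> S" "periodic u"
  shows "integral\<^sup>L (acim h) u = mean u"
  unfolding acim_eq by (rule integral_acim[OF is_acim_srb assms])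

lemma integrable_acim:
  assumes "u \<in> borel_measurable borel" "\<And>x. norm (u x) \<le> S"
  shows "integrable (acim h) (u :: real \<Rightarrow> 'b::{banach, second_countable_topology})"
proof -
  interpret prob_space srb using is_acim_srb by (simp add: is_acim_def)
  show ?thesis unfolding acim_eq using assms
    by (intro integrable_const_bound[of _ S]) (auto simp: measurable_cong_sets[OF sets_srb refl])
qed

end

section \<open>Averages tested against derivatives\<close>

text \<open>Integration against the image of a density under a continuous map \<open>w\<close>. The
  map makes the class stable under composition with the dynamics, and the explicit form permits
  differentiation under the integral sign.\<close>

definition averaging :: "((real \<Rightarrow> real) \<Rightarrow> real) \<Rightarrow> bool" where
  "averaging l \<longleftrightarrow> (\<exists>(a :: real) b \<rho> w. a \<le> b \<and> continuous_on {a..b} \<rho> \<and> (\<forall>x\<in>{a..b}. 0 \<le> \<rho> x) \<and>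
     integral {a..b} \<rho> = 1 \<and> continuous_on UNIV w \<and> l = (\<lambda>\<phi>. integral {a..b} (\<lambda>x. \<rho> x * \<phi> (w x))))"

text \<open>In terms of a density, \<open>var1\<close> bounds the total variation on the circle (a jump is allowed), and
  \<open>var2\<close> bounds that of the derivative. Testing against derivatives turns composition with an
  expanding map into an integration by parts, so that no transfer operator is needed.\<close>

definition var1 :: "real \<Rightarrow> ((real \<Rightarrow> real) \<Rightarrow> real) \<Rightarrow> bool" where
  "var1 V l \<longleftrightarrow> (\<forall>\<psi> \<psi>1 S. (\<forall>x. (\<psi> has_real_derivative \<psi>1 x) (at x)) \<longrightarrow> continuous_on UNIV \<psi>1 \<longrightarrow>
     periodic \<psi> \<longrightarrow> (\<forall>x. \<bar>\<psi> x\<bar> \<le> S) \<longrightarrow> \<bar>l \<psi>1\<bar> \<le> V * S)"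

definition var2 :: "real \<Rightarrow> ((real \<Rightarrow> real) \<Rightarrow> real) \<Rightarrow> bool" where
  "var2 W l \<longleftrightarrow> (\<forall>\<psi> \<psi>1 \<psi>2 S. (\<forall>x. (\<psi> has_real_derivative \<psi>1 x) (at x)) \<longrightarrow>
     (\<forall>x. (\<psi>1 has_real_derivative \<psi>2 x) (at x)) \<longrightarrow> continuous_on UNIV \<psi>2 \<longrightarrow>
     periodic \<psi> \<longrightarrow> (\<forall>x. \<bar>\<psi> x\<bar> \<le> S) \<longrightarrow> \<bar>l \<psi>2\<bar> \<le> W * S)"

lemma var1D:
  assumes "var1 V l" "\<And>x. (\<psi> has_real_derivative \<psi>1 x) (at x)" "continuous_on UNIV \<psi>1"
    "periodic \<psi>" "\<And>x. \<bar>\<psi> x\<bar> \<le> S"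
  shows "\<bar>l \<psi>1\<bar> \<le> V * S"
  using assms unfolding var1_def by blast

lemma var2D:
  assumes "var2 W l" "\<And>x. (\<psi> has_real_derivative \<psi>1 x) (at x)" "\<And>x. (\<psi>1 has_real_derivative \<psi>2 x) (at x)"
    "continuous_on UNIV \<psi>2" "periodic \<psi>" "\<And>x. \<bar>\<psi> x\<bar> \<le> S"
  shows "\<bar>l \<psi>2\<bar> \<le> W * S"
  using assms unfolding var2_def by blast

lemma var1_mono: "var1 V l \<Longrightarrow> V \<le> V' \<Longrightarrow> var1 V' l"
  unfolding var1_def by (meson abs_ge_zero mult_right_mono order.trans)

lemma continuous_on_UNIV_deriv:
  assumes "\<And>x. (u has_real_derivative u1 x) (at x)" shows "continuous_on S u"
  using assms DERIV_continuous_on has_field_derivative_at_within by blast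

section \<open>Integration by parts for averaging functionals\<close>

context
  fixes l :: "(real \<Rightarrow> real) \<Rightarrow> real"
  assumes l: "averaging l"
begin

lemma averaging_linear:
  assumes "continuous_on UNIV u" "continuous_on UNIV v"
  shows "l (\<lambda>x. c * u x + d * v x) = c * l u + d * l v"
proof -
  obtain a b :: real and \<rho> w where lw: "continuous_on {a..b} \<rho>" "continuous_on UNIV w"
    "l = (\<lambda>\<phi>. integral {a..b} (\<lambda>x. \<rho> x * \<phi> (w x)))" using l unfolding averaging_def by blast
  have i: "(\<lambda>x. \<rho> x * u (w x)) integrable_on {a..b}" if "continuous_on UNIV u" for u
    by (intro integrable_continuous_real continuous_intros lw(1) continuous_on_compose2[OF that] continuous_on_subset[OF lw(2)]) auto
  have "(\<lambda>x. \<rho> x * (c * u (w x) + d * v (w x))) = (\<lambda>x. c * (\<rho> x * u (w x)) + d * (\<rho> x * v (w x)))"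
    by (simp add: fun_eq_iff algebra_simps)
  then show ?thesis unfolding lw(3) using integral_lincomb[OF i[OF assms(1)] i[OF assms(2)]] by simp
qed

lemma averaging_bound:
  assumes "continuous_on UNIV u" "\<And>x. \<bar>u x\<bar> \<le> S"
  shows "\<bar>l u\<bar> \<le> S"
proof -
  obtain a b :: real and \<rho> w where lw: "continuous_on {a..b} \<rho>" "continuous_on UNIV w" "\<forall>x\<in>{a..b}. 0 \<le> \<rho> x"
    "integral {a..b} \<rho> = 1" "l = (\<lambda>\<phi>. integral {a..b} (\<lambda>x. \<rho> x * \<phi> (w x)))"
    using l unfolding averaging_def by blast
  have "(\<lambda>x. u (w x)) \<in> borel_measurable borel"
    by (intro borel_measurable_continuous_onI continuous_on_compose2[OF assms(1) lw(2)]) auto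
  then show ?thesis
    using abs_integral_weighted_le[OF lw(1), of "\<lambda>x. u (w x)" S] assms(2) lw(3,4,5) by auto
qed

lemma averaging_const: "l (\<lambda>_. c) = c"
proof -
  obtain a b :: real and \<rho> w where "integral {a..b} \<rho> = 1" "l = (\<lambda>\<phi>. integral {a..b} (\<lambda>x. \<rho> x * \<phi> (w x)))"
    using l unfolding averaging_def by blast
  then show ?thesis by simp
qed

lemma averaging_comp:
  assumes "continuous_on UNIV h" shows "averaging (\<lambda>\<phi>. l (\<lambda>x. \<phi> (h x)))"
proof -
  obtain a b :: real and \<rho> w where lw: "a \<le> b" "continuous_on {a..b} \<rho>" "\<forall>x\<in>{a..b}. 0 \<le> \<rho> x"
    "integral {a..b} \<rho> = 1" "continuous_on UNIV w" "l = (\<lambda>\<phi>. integral {a..b} (\<lambda>x. \<rho> x * \<phi> (w x)))"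
    using l unfolding averaging_def by blast
  have "continuous_on UNIV (\<lambda>x. h (w x))"
    by (rule continuous_on_compose2[OF assms lw(5)]) auto
  then show ?thesis unfolding averaging_def using lw
    by (intro exI[of _ a] exI[of _ b] exI[of _ \<rho>] exI[of _ "\<lambda>x. h (w x)"]) auto
qed

text \<open>By the product rule, \<open>p * h1 * (\<Phi>1 \<circ> h)\<close> is the derivative of
  the periodic function \<open>p * (\<Phi> \<circ> h)\<close> minus
  \<open>p1 * (\<Phi> \<circ> h)\<close>. The former is handled by \<open>var1\<close>, the latter
  by the sup norm.\<close>

lemma var1_push_weight:
  assumes V: "var1 V l"
    and h: "\<And>x. (h has_real_derivative h1 x) (at x)" "continuous_on UNIV h1" "\<And>x. h (x + 1) - h x \<in> \<int>"
    and p: "\<And>x. (p has_real_derivative p1 x) (at x)" "continuous_on UNIV p1" "periodic p"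
      "\<And>x. \<bar>p x\<bar> \<le> P0" "\<And>x. \<bar>p1 x\<bar> \<le> P1"
    and \<Phi>: "\<And>x. (\<Phi> has_real_derivative \<Phi>1 x) (at x)" "continuous_on UNIV \<Phi>1" "periodic \<Phi>" "\<And>x. \<bar>\<Phi> x\<bar> \<le> S"
  shows "\<bar>l (\<lambda>x. p x * h1 x * \<Phi>1 (h x))\<bar> \<le> (V * P0 + P1) * S"
proof -
  have ch: "continuous_on UNIV h" using h(1) by (rule continuous_on_UNIV_deriv)
  have c\<Phi>: "continuous_on UNIV (\<lambda>x. \<Phi> (h x))" "continuous_on UNIV (\<lambda>x. \<Phi>1 (h x))"
    by (rule continuous_on_compose2[OF continuous_on_UNIV_deriv[OF \<Phi>(1), of UNIV] ch] continuous_on_compose2[OF \<Phi>(2) ch]; simp)+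
  define \<psi> where "\<psi> x = p x * \<Phi> (h x)" for x
  define \<psi>1 where "\<psi>1 x = p1 x * \<Phi> (h x) + p x * (\<Phi>1 (h x) * h1 x)" for x
  have S0: "0 \<le> S" using \<Phi>(4)[of 0] by linarith
  have d: "(\<psi> has_real_derivative \<psi>1 x) (at x)" for x
    unfolding \<psi>_def[abs_def] \<psi>1_def
    using DERIV_mult[OF p(1) DERIV_chain2[OF \<Phi>(1) h(1)], of x] by (simp add: algebra_simps)
  have c1: "continuous_on UNIV \<psi>1" unfolding \<psi>1_def[abs_def]
    by (intro continuous_intros p(2) c\<Phi> h(2) continuous_on_UNIV_deriv[OF p(1)])
  have per: "periodic \<psi>"
    unfolding \<psi>_def periodic_def using p(3) periodic_Ints[OF \<Phi>(3) h(3)] by (simp add: periodic_def)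
  have bd: "\<bar>\<psi> x\<bar> \<le> P0 * S" for x
    unfolding \<psi>_def abs_mult using p(4)[of x] \<Phi>(4)[of "h x"] by (intro mult_mono) auto
  have b1: "\<bar>l \<psi>1\<bar> \<le> V * (P0 * S)" by (rule var1D[OF V d c1 per bd])
  have b2: "\<bar>l (\<lambda>x. p1 x * \<Phi> (h x))\<bar> \<le> P1 * S"
  proof (rule averaging_bound)
    show "continuous_on UNIV (\<lambda>x. p1 x * \<Phi> (h x))" by (intro continuous_intros p(2) c\<Phi>)
    show "\<bar>p1 x * \<Phi> (h x)\<bar> \<le> P1 * S" for x
      unfolding abs_mult using p(5)[of x] \<Phi>(4)[of "h x"] by (intro mult_mono) auto
  qed
  have "(\<lambda>x. p x * h1 x * \<Phi>1 (h x)) = (\<lambda>x. 1 * \<psi>1 x + (- 1) * (p1 x * \<Phi> (h x)))"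
    by (simp add: \<psi>1_def fun_eq_iff algebra_simps)
  then have "l (\<lambda>x. p x * h1 x * \<Phi>1 (h x)) = 1 * l \<psi>1 + (- 1) * l (\<lambda>x. p1 x * \<Phi> (h x))"
    using averaging_linear[OF c1, of "\<lambda>x. p1 x * \<Phi> (h x)" 1 "- 1"] c\<Phi> p(2) by (simp add: continuous_on_mult)
  then show ?thesis using b1 b2 by (simp add: algebra_simps)
qed

text \<open>Two derivatives of \<open>\<Phi> \<circ> h\<close> produce the square of
  \<open>h1\<close>, but only one factor is wanted, so the test function is
  \<open>p * q * (\<Phi> \<circ> h)\<close> with \<open>q = 1 / h1\<close>. Its second derivative is
  the wanted term plus one term with \<open>\<Phi>\<close>, bounded by the sup norm (4), and one
  with \<open>\<Phi>1\<close>, bounded by \<open>var1_push_weight\<close>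
  (\<open>3 * V + 6\<close>).\<close>

lemma var2_push_weight:
  assumes V: "var1 V l" and W: "var2 W l"
    and h: "\<And>x. (h has_real_derivative h1 x) (at x)" "continuous_on UNIV h1" "\<And>x. h (x + 1) - h x \<in> \<int>"
    and q: "\<And>x. h1 x * q x = 1" "\<And>x. (q has_real_derivative q1 x) (at x)" "\<And>x. (q1 has_real_derivative q2 x) (at x)"
      "continuous_on UNIV q2" "periodic q" "periodic q1"
      "\<And>x. \<bar>q x\<bar> \<le> Q0" "\<And>x. \<bar>q1 x\<bar> \<le> P" "\<And>x. \<bar>q2 x\<bar> \<le> P"
    and p: "\<And>x. (p has_real_derivative p1 x) (at x)" "\<And>x. (p1 has_real_derivative p2 x) (at x)" "continuous_on UNIV p2"
      "periodic p" "periodic p1" "\<And>x. \<bar>p x\<bar> \<le> P0" "\<And>x. \<bar>p1 x\<bar> \<le> P" "\<And>x. \<bar>p2 x\<bar> \<le> P" 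
    and \<Phi>: "\<And>x. (\<Phi> has_real_derivative \<Phi>1 x) (at x)" "\<And>x. (\<Phi>1 has_real_derivative \<Phi>2 x) (at x)" "continuous_on UNIV \<Phi>2"
      "periodic \<Phi>" "\<And>x. \<bar>\<Phi> x\<bar> \<le> S"
    and le: "Q0 \<le> P" "P0 \<le> P" "0 \<le> V"
  shows "\<bar>l (\<lambda>x. p x * h1 x * \<Phi>2 (h x))\<bar> \<le> (W * (P0 * Q0) + (10 + 3 * V) * P\<^sup>2) * S"
proof -
  have S0: "0 \<le> S" using \<Phi>(5)[of 0] by linarith
  have Q0: "0 \<le> Q0" "0 \<le> P0" "0 \<le> P" using q(7)[of 0] p(6)[of 0] p(7)[of 0] by linarith+
  have ch: "continuous_on UNIV h" using h(1) by (rule continuous_on_UNIV_deriv)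
  have c\<Phi>: "continuous_on UNIV (\<lambda>x. \<Phi> (h x))" "continuous_on UNIV (\<lambda>x. \<Phi>1 (h x))" "continuous_on UNIV (\<lambda>x. \<Phi>2 (h x))"
    by (rule continuous_on_compose2[OF continuous_on_UNIV_deriv[OF \<Phi>(1), of UNIV] ch]
        continuous_on_compose2[OF continuous_on_UNIV_deriv[OF \<Phi>(2), of UNIV] ch]
        continuous_on_compose2[OF \<Phi>(3) ch]; simp)+
  note cont = c\<Phi> h(2) continuous_on_UNIV_deriv[OF p(1)] continuous_on_UNIV_deriv[OF p(2)] p(3)
    continuous_on_UNIV_deriv[OF q(2)] continuous_on_UNIV_deriv[OF q(3)] q(4)
  define \<psi> where "\<psi> x = p x * q x * \<Phi> (h x)" for x
  define \<psi>1 where "\<psi>1 x = (p1 x * q x + p x * q1 x) * \<Phi> (h x) + p x * \<Phi>1 (h x)" for x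
  define R where "R x = p2 x * q x + 2 * (p1 x * q1 x) + p x * q2 x" for x
  define s where "s x = 2 * (p1 x * q x) + p x * q1 x" for x
  define s1 where "s1 x = 2 * (p2 x * q x) + 3 * (p1 x * q1 x) + p x * q2 x" for x
  define \<psi>2 where "\<psi>2 x = R x * \<Phi> (h x) + s x * h1 x * \<Phi>1 (h x) + p x * h1 x * \<Phi>2 (h x)" for x
  have qh: "q x * h1 x = 1" "q x * (h1 x * z) = z" for x z
    using q(1)[of x] by (simp_all add: mult.commute)
  have d1: "(\<psi> has_real_derivative \<psi>1 x) (at x)" for x
  proof -
    have "(\<psi> has_real_derivative (p1 x * q x + q1 x * p x) * \<Phi> (h x) + \<Phi>1 (h x) * h1 x * (p x * q x)) (at x)"
      unfolding \<psi>_def[abs_def] by (intro DERIV_mult DERIV_chain2[OF \<Phi>(1) h(1)] p(1) q(2))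
    moreover have "(p1 x * q x + q1 x * p x) * \<Phi> (h x) + \<Phi>1 (h x) * h1 x * (p x * q x) = \<psi>1 x"
      using qh[of x] unfolding \<psi>1_def by (simp add: algebra_simps)
    ultimately show ?thesis by simp
  qed
  have d2: "(\<psi>1 has_real_derivative \<psi>2 x) (at x)" for x
  proof -
    have "(\<psi>1 has_real_derivative
       ((p2 x * q x + q1 x * p1 x) + (p1 x * q1 x + q2 x * p x)) * \<Phi> (h x) + \<Phi>1 (h x) * h1 x * (p1 x * q x + p x * q1 x)
       + (p1 x * \<Phi>1 (h x) + \<Phi>2 (h x) * h1 x * p x)) (at x)"
      unfolding \<psi>1_def[abs_def]
      by (intro DERIV_add DERIV_mult DERIV_chain2[OF \<Phi>(1) h(1)] DERIV_chain2[OF \<Phi>(2) h(1)] p(1,2) q(2,3))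
    moreover have "((p2 x * q x + q1 x * p1 x) + (p1 x * q1 x + q2 x * p x)) * \<Phi> (h x) + \<Phi>1 (h x) * h1 x * (p1 x * q x + p x * q1 x)
       + (p1 x * \<Phi>1 (h x) + \<Phi>2 (h x) * h1 x * p x) = \<psi>2 x"
    proof -
      have "p1 x * \<Phi>1 (h x) = p1 x * (q x * h1 x) * \<Phi>1 (h x)" using qh(1)[of x] by simp
      then show ?thesis unfolding \<psi>2_def R_def s_def by (simp add: algebra_simps)
    qed
    ultimately show ?thesis by simp
  qed
  have cR: "continuous_on UNIV R" "continuous_on UNIV s1" "continuous_on UNIV s"
    unfolding R_def[abs_def] s_def[abs_def] s1_def[abs_def] by (intro continuous_intros cont)+
  have c2: "continuous_on UNIV \<psi>2"
    unfolding \<psi>2_def[abs_def] by (intro continuous_intros cont cR)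
  have per: "periodic \<psi>"
    unfolding \<psi>_def periodic_def using p(4) q(5) periodic_Ints[OF \<Phi>(4) h(3)] by (simp add: periodic_def)
  have bd: "\<bar>\<psi> x\<bar> \<le> P0 * Q0 * S" for x
    unfolding \<psi>_def abs_mult using p(6)[of x] q(7)[of x] \<Phi>(5)[of "h x"] Q0 by (intro mult_mono) auto
  have b1: "\<bar>l \<psi>2\<bar> \<le> W * (P0 * Q0 * S)" by (rule var2D[OF W d1 d2 c2 per bd])
  have mm: "\<bar>u * v\<bar> \<le> P\<^sup>2" if "\<bar>u\<bar> \<le> P" "\<bar>v\<bar> \<le> P" for u v
    unfolding abs_mult power2_eq_square using that Q0 by (intro mult_mono) auto
  have bds: "\<bar>p x\<bar> \<le> P" "\<bar>q x\<bar> \<le> P" for x using p(6)[of x] q(7)[of x] le by linarith+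
  have bR: "\<bar>R x\<bar> \<le> 4 * P\<^sup>2" for x
    unfolding R_def using mm[OF p(8)[of x] bds(2)[of x]] mm[OF p(7)[of x] q(8)[of x]] mm[OF bds(1)[of x] q(9)[of x]]
    by linarith
  have bs: "\<bar>s x\<bar> \<le> 3 * P\<^sup>2" for x
    unfolding s_def using mm[OF p(7)[of x] bds(2)[of x]] mm[OF bds(1)[of x] q(8)[of x]] by linarith
  have bs1: "\<bar>s1 x\<bar> \<le> 6 * P\<^sup>2" for x
    unfolding s1_def using mm[OF p(8)[of x] bds(2)[of x]] mm[OF p(7)[of x] q(8)[of x]] mm[OF bds(1)[of x] q(9)[of x]]
    by linarith
  have ds: "(s has_real_derivative s1 x) (at x)" for x
  proof -
    have "(s has_real_derivative 2 * (p2 x * q x + q1 x * p1 x) + (p1 x * q1 x + q2 x * p x)) (at x)"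
      unfolding s_def[abs_def] by (intro DERIV_add DERIV_mult DERIV_cmult p(1,2) q(2,3))
    then show ?thesis by (simp add: s1_def algebra_simps)
  qed
  have pers: "periodic s" unfolding s_def periodic_def using p(4,5) q(5,6) by (simp add: periodic_def)
  have b2: "\<bar>l (\<lambda>x. s x * h1 x * \<Phi>1 (h x))\<bar> \<le> (V * (3 * P\<^sup>2) + 6 * P\<^sup>2) * S"
    by (rule var1_push_weight[OF V h ds cR(2) pers bs bs1 \<Phi>(1) continuous_on_UNIV_deriv[OF \<Phi>(2)] \<Phi>(4,5)])
  have b3: "\<bar>l (\<lambda>x. R x * \<Phi> (h x))\<bar> \<le> 4 * P\<^sup>2 * S"
  proof (rule averaging_bound)
    show "continuous_on UNIV (\<lambda>x. R x * \<Phi> (h x))" by (intro continuous_intros cont cR)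
    show "\<bar>R x * \<Phi> (h x)\<bar> \<le> 4 * P\<^sup>2 * S" for x
      unfolding abs_mult using bR[of x] \<Phi>(5)[of "h x"] by (intro mult_mono) auto
  qed
  have c3: "continuous_on UNIV (\<lambda>x. R x * \<Phi> (h x))" "continuous_on UNIV (\<lambda>x. s x * h1 x * \<Phi>1 (h x))"
    by (intro continuous_intros cont cR)+
  have "(\<lambda>x. p x * h1 x * \<Phi>2 (h x)) =
      (\<lambda>x. 1 * \<psi>2 x + (- 1) * (1 * (R x * \<Phi> (h x)) + 1 * (s x * h1 x * \<Phi>1 (h x))))"
    by (simp add: \<psi>2_def fun_eq_iff)
  then have "l (\<lambda>x. p x * h1 x * \<Phi>2 (h x)) =
      1 * l \<psi>2 + (- 1) * (1 * l (\<lambda>x. R x * \<Phi> (h x)) + 1 * l (\<lambda>x. s x * h1 x * \<Phi>1 (h x)))"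
    using averaging_linear[OF c2 continuous_on_add[OF c3], of 1 "- 1"] averaging_linear[OF c3, of 1 1] by simp
  moreover have "\<bar>z\<bar> \<le> z1 + z2 + z3" if "z = 1 * y1 + (- 1) * (1 * y2 + 1 * y3)" "\<bar>y1\<bar> \<le> z1" "\<bar>y2\<bar> \<le> z2" "\<bar>y3\<bar> \<le> z3"
    for z y1 y2 y3 z1 z2 z3 :: real using that unfolding abs_le_iff by auto
  ultimately have "\<bar>l (\<lambda>x. p x * h1 x * \<Phi>2 (h x))\<bar> \<le> W * (P0 * Q0 * S) + 4 * P\<^sup>2 * S + (V * (3 * P\<^sup>2) + 6 * P\<^sup>2) * S"
    using b1 b2 b3 by blast
  then show ?thesis by (simp add: algebra_simps)
qed

end

section \<open>Dependence of the averages on the slow variable\<close>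

definition partials :: "(real \<times> real \<Rightarrow> real) \<Rightarrow> (real \<times> real \<Rightarrow> real) \<Rightarrow> (real \<times> real \<Rightarrow> real) \<Rightarrow> bool" where
  "partials g g1 g2 \<longleftrightarrow> (\<forall>p. (g has_derivative (\<lambda>(u, v). u * g1 p + v * g2 p)) (at p))"

lemma partials_chain:
  assumes "partials g g1 g2" "(a has_real_derivative a') (at s)" "(b has_real_derivative b') (at s)"
  shows "((\<lambda>s. g (a s, b s)) has_real_derivative a' * g1 (a s, b s) + b' * g2 (a s, b s)) (at s)"
proof -
  have "((\<lambda>s. (a s, b s)) has_derivative (\<lambda>t. (t * a', t * b'))) (at s)"
    using assms(2,3) unfolding has_field_derivative_def
    by (intro has_derivative_Pair) (simp_all add: mult.commute[of _ a'] mult.commute[of _ b'])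
  from has_derivative_compose[OF this, of g "\<lambda>(u, v). u * g1 (a s, b s) + v * g2 (a s, b s)"]
  have "((\<lambda>s. g (a s, b s)) has_derivative (\<lambda>t. t * a' * g1 (a s, b s) + t * b' * g2 (a s, b s))) (at s)"
    using assms(1) by (simp add: partials_def)
  moreover have "(\<lambda>t. t * a' * g1 (a s, b s) + t * b' * g2 (a s, b s)) = (*) (a' * g1 (a s, b s) + b' * g2 (a s, b s))"
    by (simp add: fun_eq_iff algebra_simps)
  ultimately show ?thesis unfolding has_field_derivative_def by simp
qed

lemma partials_x: "partials g g1 g2 \<Longrightarrow> ((\<lambda>x. g (x, \<theta>)) has_real_derivative g1 (x, \<theta>)) (at x)"
  using partials_chain[where a = "\<lambda>x. x" and b = "\<lambda>_. \<theta>" and s = x, OF _ DERIV_ident DERIV_const] by simp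

lemma partials_theta: "partials g g1 g2 \<Longrightarrow> ((\<lambda>s. g (x, s)) has_real_derivative g2 (x, \<theta>)) (at \<theta>)"
  using partials_chain[where a = "\<lambda>_. x" and b = "\<lambda>s. s" and s = \<theta>, OF _ DERIV_const DERIV_ident] by simp

lemma partials_continuous: "partials g g1 g2 \<Longrightarrow> continuous_on S g"
  by (intro continuous_at_imp_continuous_on ballI) (auto simp: partials_def dest!: spec intro: has_derivative_continuous)

lemma lipschitz_of_deriv_bound:
  fixes u :: "real \<Rightarrow> real"
  assumes "\<And>x. (u has_real_derivative u1 x) (at x)" "\<And>x. \<bar>u1 x\<bar> \<le> L"
  shows "\<bar>u x - u y\<bar> \<le> L * \<bar>x - y\<bar>"
  using field_differentiable_bound[of UNIV u u1 L x y] assms by simp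

text \<open>Names of derivatives: \<open>f1\<close>, \<open>f2\<close>, \<open>f3\<close> are
  successive x-derivatives of \<open>f\<close>; \<open>t0\<close> is its \<theta>-derivative, with
  x-derivatives \<open>t1\<close> and \<open>t2\<close>; \<open>e1\<close>, \<open>e2\<close>,
  \<open>t01\<close>, \<open>t11\<close> are the \<theta>-derivatives of \<open>f1\<close>,
  \<open>f2\<close>, \<open>t0\<close>, \<open>t1\<close>. Only derivatives bounded by
  \<open>B\<close> enter the estimates.\<close>

locale expanding_family =
  fixes f f1 f2 f3 t0 t1 t2 e1 e2 t01 t11 :: "real \<times> real \<Rightarrow> real" and B :: real
  assumes f: "partials f f1 t0" and f1: "partials f1 f2 e1" and t0: "partials t0 t1 t01"
    and f2: "partials f2 f3 e2" and t1: "partials t1 t2 t11"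
    and cont: "continuous_on UNIV f3" "continuous_on UNIV t2"
    and bounds: "\<And>p. \<bar>f1 p\<bar> \<le> B" "\<And>p. \<bar>f2 p\<bar> \<le> B" "\<And>p. \<bar>f3 p\<bar> \<le> B" "\<And>p. \<bar>t0 p\<bar> \<le> B" "\<And>p. \<bar>t1 p\<bar> \<le> B"
      "\<And>p. \<bar>t2 p\<bar> \<le> B" "\<And>p. \<bar>e1 p\<bar> \<le> B"
    and B1: "1 \<le> B" and f1_ge: "\<And>p. 2 \<le> f1 p"
    and degree: "\<And>x \<theta>. f (x + 1, \<theta>) - f (x, \<theta>) \<in> \<int>"
    and per: "\<And>\<theta>. periodic (\<lambda>x. f1 (x, \<theta>))" "\<And>\<theta>. periodic (\<lambda>x. f2 (x, \<theta>))"
      "\<And>\<theta>. periodic (\<lambda>x. t0 (x, \<theta>))" "\<And>\<theta>. periodic (\<lambda>x. t1 (x, \<theta>))"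
begin

lemma continuous_partial:
  assumes "continuous_on UNIV g" "continuous_on S a" "continuous_on S b"
  shows "continuous_on S (\<lambda>s. g (a s, b s))"
  by (rule continuous_on_compose2[OF assms(1)]) (auto intro!: continuous_intros assms(2,3))

lemma expanding_map: "expanding_map (\<lambda>x. f (x, \<theta>)) (\<lambda>x. f1 (x, \<theta>)) B"
proof
  show "((\<lambda>x. f (x, \<theta>)) has_real_derivative f1 (x, \<theta>)) (at x)" for x by (rule partials_x[OF f])
  show "continuous_on UNIV (\<lambda>x. f1 (x, \<theta>))"
    by (intro continuous_partial[OF partials_continuous[OF f1]] continuous_intros)
  show "\<bar>f1 (x, \<theta>) - f1 (y, \<theta>)\<bar> \<le> B * \<bar>x - y\<bar>" for x y
    by (rule lipschitz_of_deriv_bound[OF partials_x[OF f1] bounds(2)])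
  show "2 \<le> f1 (x, \<theta>)" for x by (rule f1_ge)
  show "1 \<le> B" by (rule B1)
  show "f (x + 1, \<theta>) - f (x, \<theta>) \<in> \<int>" for x by (rule degree)
qed

definition P :: real where "P = 2 * B ^ 3"

definition q where "q \<theta> x = 1 / f1 (x, \<theta>)"
definition q1 where "q1 \<theta> x = - f2 (x, \<theta>) / (f1 (x, \<theta>))\<^sup>2"
definition q2 where "q2 \<theta> x = - f3 (x, \<theta>) / (f1 (x, \<theta>))\<^sup>2 + 2 * (f2 (x, \<theta>))\<^sup>2 / (f1 (x, \<theta>)) ^ 3"

lemma f1_nz: "f1 p \<noteq> 0" using f1_ge[of p] by auto

lemma B_powers: "B \<le> B\<^sup>2" "B\<^sup>2 \<le> B ^ 3" "1 \<le> B ^ 3" "B \<le> B ^ 3"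
  using power_increasing[OF _ B1, of 1 2] power_increasing[OF _ B1, of 2 3] power_increasing[OF _ B1, of 1 3] one_le_power[OF B1, of 3]
  by simp_all

lemma q: "f1 (x, \<theta>) * q \<theta> x = 1" "(q \<theta> has_real_derivative q1 \<theta> x) (at x)" "(q1 \<theta> has_real_derivative q2 \<theta> x) (at x)"
  "continuous_on UNIV (q2 \<theta>)" "periodic (q \<theta>)" "periodic (q1 \<theta>)"
  "\<bar>q \<theta> x\<bar> \<le> 1 / 2" "\<bar>q1 \<theta> x\<bar> \<le> B / 4" "\<bar>q2 \<theta> x\<bar> \<le> B\<^sup>2 / 2"
proof -
  note d = partials_x[OF f1, of \<theta> x] partials_x[OF f2, of \<theta> x]
  show "f1 (x, \<theta>) * q \<theta> x = 1" by (simp add: q_def f1_nz)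
  show "(q \<theta> has_real_derivative q1 \<theta> x) (at x)"
    unfolding q_def[abs_def] q1_def using f1_nz[of "(x, \<theta>)"]
    by (auto intro!: derivative_eq_intros d simp: power2_eq_square)
  show "(q1 \<theta> has_real_derivative q2 \<theta> x) (at x)"
    unfolding q2_def q1_def[abs_def] using f1_nz[of "(x, \<theta>)"]
    by (auto intro!: derivative_eq_intros d simp: field_simps eval_nat_numeral)
  show "continuous_on UNIV (q2 \<theta>)"
    unfolding q2_def[abs_def] using f1_nz
    by (intro continuous_intros continuous_partial[OF partials_continuous[OF f1]] continuous_partial[OF partials_continuous[OF f2]]
        continuous_partial[OF cont(1)]) auto
  show "periodic (q \<theta>)" "periodic (q1 \<theta>)"
    using per[of \<theta>] by (auto simp: q_def q1_def periodic_def)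
  have ge: "2 \<le> f1 (x, \<theta>)" by (rule f1_ge)
  show "\<bar>q \<theta> x\<bar> \<le> 1 / 2" unfolding q_def using ge by (simp add: field_simps)
  have sq: "4 \<le> (f1 (x, \<theta>))\<^sup>2" using power_mono[OF ge, of 2] by simp
  have cu: "8 \<le> (f1 (x, \<theta>)) ^ 3" using power_mono[OF ge, of 3] by simp
  show "\<bar>q1 \<theta> x\<bar> \<le> B / 4"
    unfolding q1_def abs_divide using bounds(2)[of "(x, \<theta>)"] sq by (intro frac_le) auto
  have "\<bar>- f3 (x, \<theta>) / (f1 (x, \<theta>))\<^sup>2\<bar> \<le> B / 4"
    unfolding abs_divide using bounds(3)[of "(x, \<theta>)"] sq by (intro frac_le) auto
  moreover have "\<bar>2 * (f2 (x, \<theta>))\<^sup>2 / (f1 (x, \<theta>)) ^ 3\<bar> \<le> 2 * B\<^sup>2 / 8"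
    unfolding abs_divide using power_mono[OF bounds(2)[of "(x, \<theta>)"], of 2] cu by (intro frac_le) auto
  ultimately show "\<bar>q2 \<theta> x\<bar> \<le> B\<^sup>2 / 2" unfolding q2_def using B_powers(1) by linarith
qed

lemma P_ge: "1 / 2 \<le> P" "B / 4 \<le> P" "B\<^sup>2 / 2 \<le> P" "0 < P" "B\<^sup>2 \<le> P" "B / 2 \<le> P"
  unfolding P_def using B_powers B1 by linarith+

text \<open>The quotient of the \<theta>-derivative of \<open>f\<close> by its x-derivative. A
  variation of \<theta> acts on a test function composed with \<open>f\<close> like a displacement
  of x by this amount, which is how it becomes accessible to integration by parts.\<close>

definition p where "p \<theta> x = t0 (x, \<theta>) * q \<theta> x"
definition p1 where "p1 \<theta> x = t1 (x, \<theta>) * q \<theta> x + t0 (x, \<theta>) * q1 \<theta> x"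
definition p2 where "p2 \<theta> x = t2 (x, \<theta>) * q \<theta> x + 2 * (t1 (x, \<theta>) * q1 \<theta> x) + t0 (x, \<theta>) * q2 \<theta> x"

lemma p: "(p \<theta> has_real_derivative p1 \<theta> x) (at x)" "(p1 \<theta> has_real_derivative p2 \<theta> x) (at x)"
  "continuous_on UNIV (p2 \<theta>)" "periodic (p \<theta>)" "periodic (p1 \<theta>)"
  "\<bar>p \<theta> x\<bar> \<le> P" "\<bar>p1 \<theta> x\<bar> \<le> P" "\<bar>p2 \<theta> x\<bar> \<le> P"
proof -
  note d = partials_x[OF t0, of \<theta> x] partials_x[OF t1, of \<theta> x] q(2,3)[of \<theta> x]
  show "(p \<theta> has_real_derivative p1 \<theta> x) (at x)"
    unfolding p_def[abs_def] p1_def by (auto intro!: derivative_eq_intros d)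
  show "(p1 \<theta> has_real_derivative p2 \<theta> x) (at x)"
    unfolding p1_def[abs_def] p2_def by (auto intro!: derivative_eq_intros d simp: algebra_simps)
  show "continuous_on UNIV (p2 \<theta>)"
    unfolding p2_def[abs_def]
    by (intro continuous_intros continuous_partial[OF partials_continuous[OF t0]] continuous_partial[OF partials_continuous[OF t1]]
        continuous_partial[OF cont(2)] continuous_on_UNIV_deriv[OF q(2)] continuous_on_UNIV_deriv[OF q(3)] q(4))
  show "periodic (p \<theta>)" "periodic (p1 \<theta>)"
    using per[of \<theta>] q(5,6)[of \<theta>] by (auto simp: p_def p1_def periodic_def)
  have mm: "\<bar>u * v\<bar> \<le> B * w" if "\<bar>u\<bar> \<le> B" "\<bar>v\<bar> \<le> w" for u v w
    unfolding abs_mult using that B1 by (intro mult_mono) auto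
  have B3: "B * B\<^sup>2 = B ^ 3" by (simp add: eval_nat_numeral)
  have B2: "B * B = B\<^sup>2" by (simp add: power2_eq_square)
  show "\<bar>p \<theta> x\<bar> \<le> P"
    unfolding p_def using mm[OF bounds(4)[of "(x, \<theta>)"] q(7)[of \<theta> x]] P_ge by linarith
  show "\<bar>p1 \<theta> x\<bar> \<le> P"
    unfolding p1_def P_def
    using mm[OF bounds(5)[of "(x, \<theta>)"] q(7)[of \<theta> x]] mm[OF bounds(4)[of "(x, \<theta>)"] q(8)[of \<theta> x]] B_powers B1 B2
    by linarith
  show "\<bar>p2 \<theta> x\<bar> \<le> P"
    unfolding p2_def P_def
    using mm[OF bounds(6)[of "(x, \<theta>)"] q(7)[of \<theta> x]] mm[OF bounds(5)[of "(x, \<theta>)"] q(8)[of \<theta> x]]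
      mm[OF bounds(4)[of "(x, \<theta>)"] q(9)[of \<theta> x]] B_powers B1 B2 B3
    by linarith
qed

lemma h: "((\<lambda>x. f (x, \<theta>)) has_real_derivative f1 (x, \<theta>)) (at x)" "continuous_on UNIV (\<lambda>x. f1 (x, \<theta>))"
  "continuous_on S (\<lambda>x. f (x, \<theta>))"
  using partials_x[OF f] continuous_on_UNIV_deriv[OF partials_x[OF f1]] continuous_on_UNIV_deriv[OF partials_x[OF f]]
  by auto

text \<open>A Lasota-Yorke inequality: the weight \<open>q = 1 / f1\<close> is at most 1/2, so the
  variation becomes at most \<open>V / 2 + P\<close>, and every \<open>V \<ge> 2 * P\<close> is
  preserved.\<close>

lemma var1_comp:
  assumes l: "averaging l" and V: "var1 V l" "2 * P \<le> V"
  shows "var1 V (\<lambda>\<phi>. l (\<lambda>x. \<phi> (f (x, \<theta>))))"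
  unfolding var1_def
proof (intro allI impI)
  fix \<psi> \<psi>1 S
  assume psi: "\<forall>x. (\<psi> has_real_derivative \<psi>1 x) (at x)" "continuous_on UNIV \<psi>1" "periodic \<psi>" "\<forall>x. \<bar>\<psi> x\<bar> \<le> S"
  have S0: "0 \<le> S" using psi(4) abs_ge_zero order.trans by blast
  have "\<bar>l (\<lambda>x. q \<theta> x * f1 (x, \<theta>) * \<psi>1 (f (x, \<theta>)))\<bar> \<le> (V * (1 / 2) + P) * S"
    by (rule var1_push_weight[OF l V(1) h(1,2) degree q(2) continuous_on_UNIV_deriv[OF q(3)] q(5,7) order.trans[OF q(8) P_ge(2)]])
      (use psi in auto)
  also have "\<dots> \<le> V * S" using V(2) S0 by (intro mult_right_mono) auto
  finally show "\<bar>l (\<lambda>x. \<psi>1 (f (x, \<theta>)))\<bar> \<le> V * S" using q(1) by (simp add: mult.commute)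
qed

text \<open>The second-order Lasota-Yorke inequality. The weight \<open>q\<close> occurs twice and
  gives the factor 1/4; the lower-order terms are governed by \<open>V\<close>.\<close>

lemma var2_comp:
  assumes l: "averaging l" and V: "var1 V l" "0 \<le> V" and W: "var2 W l" "2 * ((10 + 3 * V) * P\<^sup>2) \<le> W"
  shows "var2 W (\<lambda>\<phi>. l (\<lambda>x. \<phi> (f (x, \<theta>))))"
  unfolding var2_def
proof (intro allI impI)
  fix \<psi> \<psi>1 \<psi>2 S
  assume psi: "\<forall>x. (\<psi> has_real_derivative \<psi>1 x) (at x)" "\<forall>x. (\<psi>1 has_real_derivative \<psi>2 x) (at x)"
    "continuous_on UNIV \<psi>2" "periodic \<psi>" "\<forall>x. \<bar>\<psi> x\<bar> \<le> S"
  have S0: "0 \<le> S" using psi(5) abs_ge_zero order.trans by blast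
  have W0: "0 \<le> W" using W(2) V(2) P_ge by (smt (verit) mult_nonneg_nonneg zero_le_power2)
  have "\<bar>l (\<lambda>x. q \<theta> x * f1 (x, \<theta>) * \<psi>2 (f (x, \<theta>)))\<bar> \<le> (W * (1 / 2 * (1 / 2)) + (10 + 3 * V) * P\<^sup>2) * S"
    by (rule var2_push_weight[OF l V(1) W(1) h(1,2) degree q(1,2,3,4,5,6,7) order.trans[OF q(8) P_ge(2)] order.trans[OF q(9) P_ge(3)]
          q(2,3,4,5,6,7) order.trans[OF q(8) P_ge(2)] order.trans[OF q(9) P_ge(3)]])
      (use psi P_ge V in auto)
  also have "\<dots> \<le> W * S" using W(2) W0 S0 by (intro mult_right_mono) auto
  finally show "\<bar>l (\<lambda>x. \<psi>2 (f (x, \<theta>)))\<bar> \<le> W * S" using q(1) by (simp add: mult.commute)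
qed

lemma deriv_averaging:
  assumes l: "averaging l" and \<xi>: "\<And>x. (\<xi> has_real_derivative \<xi>1 x) (at x)" "continuous_on UNIV \<xi>1"
  shows "((\<lambda>s. l (\<lambda>x. \<xi> (f (x, s)))) has_real_derivative l (\<lambda>x. p \<theta> x * f1 (x, \<theta>) * \<xi>1 (f (x, \<theta>)))) (at \<theta>)"
proof -
  obtain a b :: real and \<rho> w where lw: "a \<le> b" "continuous_on {a..b} \<rho>" "continuous_on UNIV w"
    "l = (\<lambda>\<phi>. integral {a..b} (\<lambda>x. \<rho> x * \<phi> (w x)))" using l unfolding averaging_def by blast
  have c\<xi>: "continuous_on UNIV \<xi>" using \<xi>(1) by (rule continuous_on_UNIV_deriv)
  have "((\<lambda>s. integral (cbox a b) (\<lambda>y. \<rho> y * \<xi> (f (w y, s)))) has_field_derivative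
      integral (cbox a b) (\<lambda>y. \<rho> y * (t0 (w y, \<theta>) * \<xi>1 (f (w y, \<theta>))))) (at \<theta> within UNIV)"
  proof (rule leibniz_rule_field_derivative)
    fix s y :: real
    show "((\<lambda>s. \<rho> y * \<xi> (f (w y, s))) has_field_derivative \<rho> y * (t0 (w y, s) * \<xi>1 (f (w y, s)))) (at s within UNIV)"
      using DERIV_cmult[OF DERIV_chain2[OF \<xi>(1) partials_theta[OF f, of "w y" s]], of "\<rho> y"] by (simp add: mult_ac)
    show "(\<lambda>y. \<rho> y * \<xi> (f (w y, s))) integrable_on cbox a b"
      unfolding cbox_interval
      by (intro integrable_continuous_real continuous_intros lw(2) continuous_on_compose2[OF c\<xi>]
          continuous_partial[OF partials_continuous[OF f]] continuous_on_subset[OF lw(3)]) auto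
  next
    have w2: "continuous_on (UNIV \<times> cbox a b) (\<lambda>x. w (snd x))"
      by (rule continuous_on_compose2[OF lw(3) continuous_on_snd[OF continuous_on_id]]) auto
    have r2: "continuous_on (UNIV \<times> cbox a b) (\<lambda>x. \<rho> (snd x))"
      by (rule continuous_on_compose2[OF lw(2) continuous_on_snd[OF continuous_on_id]]) (auto simp: cbox_interval)
    show "continuous_on (UNIV \<times> cbox a b) (\<lambda>(s, y). \<rho> y * (t0 (w y, s) * \<xi>1 (f (w y, s))))"
      unfolding case_prod_beta
      by (intro continuous_intros r2 continuous_partial[OF partials_continuous[OF t0]] w2 continuous_on_compose2[OF \<xi>(2)]
          continuous_partial[OF partials_continuous[OF f]]) auto
  qed auto
  moreover have "t0 (x, \<theta>) * z = p \<theta> x * f1 (x, \<theta>) * z" for x z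
    unfolding p_def using q(1)[of x \<theta>] by (simp add: mult.assoc mult.left_commute[of _ "f1 _"] mult.commute)
  ultimately show ?thesis unfolding lw(4) by (simp add: cbox_interval)
qed

lemma perturb1:
  assumes l: "averaging l" and V: "var1 V l" 
    and \<xi>: "\<And>x. (\<xi> has_real_derivative \<xi>1 x) (at x)" "continuous_on UNIV \<xi>1" "periodic \<xi>" "\<And>x. \<bar>\<xi> x\<bar> \<le> S"
  shows "\<bar>l (\<lambda>x. \<xi> (f (x, \<theta>))) - l (\<lambda>x. \<xi> (f (x, \<theta>')))\<bar> \<le> (V * P + P) * S * \<bar>\<theta> - \<theta>'\<bar>"
  by (rule lipschitz_of_deriv_bound[OF deriv_averaging[OF l \<xi>(1,2)]])
    (rule var1_push_weight[OF l V h(1,2) degree p(1) continuous_on_UNIV_deriv[OF p(2)] p(4,6,7) \<xi>])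

text \<open>The observable is the derivative \<open>\<Phi>1\<close>, yet the bound involves only the
  size of \<open>\<Phi>\<close>. For observables composed with many iterates this primitive is
  exponentially small, while the observable is not.\<close>

lemma perturb2:
  assumes l: "averaging l" and V: "var1 V l" "0 \<le> V" and W: "var2 W l"
    and \<Phi>: "\<And>x. (\<Phi> has_real_derivative \<Phi>1 x) (at x)" "\<And>x. (\<Phi>1 has_real_derivative \<Phi>2 x) (at x)" "continuous_on UNIV \<Phi>2"
      "periodic \<Phi>" "\<And>x. \<bar>\<Phi> x\<bar> \<le> S"
  shows "\<bar>l (\<lambda>x. \<Phi>1 (f (x, \<theta>))) - l (\<lambda>x. \<Phi>1 (f (x, \<theta>')))\<bar> \<le> (W * (P * (1 / 2)) + (10 + 3 * V) * P\<^sup>2) * S * \<bar>\<theta> - \<theta>'\<bar>"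
  by (rule lipschitz_of_deriv_bound[OF deriv_averaging[OF l \<Phi>(2,3)]])
    (rule var2_push_weight[OF l V(1) W h(1,2) degree q(1,2,3,4,5,6,7) order.trans[OF q(8) P_ge(2)] order.trans[OF q(9) P_ge(3)]
          p \<Phi> P_ge(1) order.refl V(2)])

abbreviation fz where "fz \<theta> \<equiv> (\<lambda>x. f (x, \<theta>))"

lemma continuous_iter: "continuous_on S (fz \<theta> ^^ n)"
proof -
  interpret E: expanding_map "fz \<theta>" "\<lambda>x. f1 (x, \<theta>)" B by (rule expanding_map)
  show ?thesis by (rule E.continuous_funpow)
qed

lemma averaging_iter: "averaging l \<Longrightarrow> averaging (\<lambda>\<phi>. l (\<lambda>x. \<phi> ((fz \<theta> ^^ n) x)))"
  by (rule averaging_comp[OF _ continuous_iter])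

lemma var1_iter:
  assumes l: "averaging l" and V: "var1 V l" "2 * P \<le> V"
  shows "var1 V (\<lambda>\<phi>. l (\<lambda>x. \<phi> ((fz \<theta> ^^ n) x)))"
proof (induction n)
  case (Suc n)
  from var1_comp[OF averaging_iter[OF l] Suc V(2)] show ?case by simp
qed (use V in simp)

lemma var2_iter:
  assumes l: "averaging l" and V: "var1 V l" "2 * P \<le> V" and W: "var2 W l" "2 * ((10 + 3 * V) * P\<^sup>2) \<le> W"
  shows "var2 W (\<lambda>\<phi>. l (\<lambda>x. \<phi> ((fz \<theta> ^^ n) x)))"
proof (induction n)
  case (Suc n)
  have "0 \<le> V" using V(2) P_ge(4) by linarith
  from var2_comp[OF averaging_iter[OF l] var1_iter[OF l V] this Suc W(2)] show ?case by simp
qed (use W in simp)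

lemma deriv_iter:
  assumes "\<And>x. (u has_real_derivative u1 x) (at x)" "continuous_on UNIV u1"
  shows "\<exists>v. (\<forall>x. ((\<lambda>x. u ((fz \<theta> ^^ n) x)) has_real_derivative v x) (at x)) \<and> continuous_on UNIV v"
proof (induction n)
  case (Suc n)
  then obtain v where v: "\<And>x. ((\<lambda>x. u ((fz \<theta> ^^ n) x)) has_real_derivative v x) (at x)" "continuous_on UNIV v" by blast
  have "((\<lambda>x. u ((fz \<theta> ^^ n) (f (x, \<theta>)))) has_real_derivative v (f (x, \<theta>)) * f1 (x, \<theta>)) (at x)" for x
    by (rule DERIV_chain2[OF v(1) h(1)])
  moreover have "continuous_on UNIV (\<lambda>x. v (f (x, \<theta>)) * f1 (x, \<theta>))"
    by (intro continuous_intros continuous_on_compose2[OF v(2)] h) auto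
  moreover have "(\<lambda>x. u ((fz \<theta> ^^ Suc n) x)) = (\<lambda>x. u ((fz \<theta> ^^ n) (f (x, \<theta>))))"
    by (simp only: funpow_Suc_right o_apply)
  ultimately show ?case by (intro exI[of _ "\<lambda>x. v (f (x, \<theta>)) * f1 (x, \<theta>)"]) simp
qed (use assms in auto)

text \<open>The parameter is exchanged in one iterate at a time: the i-th intermediate composition
  applies the map for \<open>\<theta>'\<close> i times and then that for \<open>\<theta>\<close> the
  remaining times.\<close>

lemma telescope:
  fixes l :: "(real \<Rightarrow> real) \<Rightarrow> real" and u :: "real \<Rightarrow> real"
  assumes d: "\<And>i. i < n \<Longrightarrow>
    \<bar>l (\<lambda>x. u ((fz \<theta> ^^ (n - Suc i)) (f ((fz \<theta>' ^^ i) x, \<theta>)))) - l (\<lambda>x. u ((fz \<theta> ^^ (n - Suc i)) (f ((fz \<theta>' ^^ i) x, \<theta>'))))\<bar> \<le> d i"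
  shows "\<bar>l (\<lambda>x. u ((fz \<theta> ^^ n) x)) - l (\<lambda>x. u ((fz \<theta>' ^^ n) x))\<bar> \<le> (\<Sum>i<n. d i)"
proof -
  define T where "T i = l (\<lambda>x. u ((fz \<theta> ^^ (n - i)) ((fz \<theta>' ^^ i) x)))" for i
  have step: "\<bar>T i - T (Suc i)\<bar> \<le> d i" if "i < n" for i
  proof -
    have "fz \<theta> ^^ (n - i) = (fz \<theta> ^^ (n - Suc i)) \<circ> fz \<theta>"
      using that by (metis Suc_diff_Suc funpow_Suc_right)
    then show ?thesis using d[OF that] by (simp add: T_def)
  qed
  have "\<bar>\<Sum>i<n. T i - T (Suc i)\<bar> \<le> (\<Sum>i<n. d i)"
    by (intro order.trans[OF sum_abs] sum_mono) (use step in auto)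
  moreover have "(\<Sum>i<n. T i - T (Suc i)) = T 0 - T n"
    by (induction n) simp_all
  ultimately show ?thesis by (simp add: T_def)
qed

abbreviation gap where "gap \<equiv> expanding_map.gap B"
abbreviation rate where "rate \<equiv> expanding_map.rate B"
abbreviation mean where "mean \<theta> \<equiv> expanding_map.mean (fz \<theta>)"

lemma gap: "0 < gap" "gap < 1" and rate: "0 < rate" "rate < 1"
  using expanding_map.gap[OF expanding_map[of 0]] expanding_map.rate(1,2)[OF expanding_map[of 0]] by auto

lemma decay:
  assumes l: "averaging l" and V: "var1 V l" "0 \<le> V"
    and u: "continuous_on UNIV u" "\<And>x. \<bar>u x\<bar> \<le> S" "periodic u"
  shows "\<bar>l (\<lambda>x. u ((fz \<theta> ^^ n) x)) - mean \<theta> u\<bar> \<le> (22 * V + 4) / gap * S * rate ^ n"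
proof -
  interpret E: expanding_map "fz \<theta>" "\<lambda>x. f1 (x, \<theta>)" B by (rule expanding_map)
  obtain \<Phi> b where \<Phi>: "\<And>x. (\<Phi> has_real_derivative u ((fz \<theta> ^^ n) x) - b) (at x)" "periodic \<Phi>"
    "\<And>x. \<bar>\<Phi> x\<bar> \<le> 22 / gap * S * rate ^ n" "\<bar>b - mean \<theta> u\<bar> \<le> 4 / gap * S * rate ^ n"
    using E.decay_primitive[OF u] by blast
  have c: "continuous_on UNIV (\<lambda>x. u ((fz \<theta> ^^ n) x))"
    by (rule continuous_on_compose2[OF u(1) continuous_iter]) auto
  have "\<bar>l (\<lambda>x. u ((fz \<theta> ^^ n) x) - b)\<bar> \<le> V * (22 / gap * S * rate ^ n)"
    by (rule var1D[OF V(1) \<Phi>(1) _ \<Phi>(2,3)]) (intro continuous_intros c)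
  moreover have "l (\<lambda>x. u ((fz \<theta> ^^ n) x) - b) = l (\<lambda>x. u ((fz \<theta> ^^ n) x)) - b"
    using averaging_linear[OF l c continuous_on_const[of UNIV b], of 1 "- 1"] averaging_const[OF l] by simp
  ultimately have "\<bar>l (\<lambda>x. u ((fz \<theta> ^^ n) x)) - mean \<theta> u\<bar> \<le> V * (22 / gap * S * rate ^ n) + 4 / gap * S * rate ^ n"
    using \<Phi>(4) by linarith
  then show ?thesis by (simp add: algebra_simps add_divide_distrib)
qed

definition lebesgue :: "(real \<Rightarrow> real) \<Rightarrow> real" where "lebesgue \<phi> = integral {0..1} \<phi>"

text \<open>Over a period the derivative of a periodic function integrates to 0. There are no
  boundary terms, so both variations vanish.\<close>

lemma lebesgue: "averaging lebesgue" "var1 0 lebesgue" "var2 0 lebesgue"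
proof -
  show "averaging lebesgue"
    unfolding averaging_def lebesgue_def[abs_def]
    by (intro exI[of _ 0] exI[of _ 1] exI[of _ "\<lambda>_. 1"] exI[of _ "\<lambda>x. x"]) (auto simp: continuous_on_id)
  have zero: "integral {0..1} \<psi>1 = 0"
    if "\<And>x. (\<psi> has_real_derivative \<psi>1 x) (at x)" "periodic \<psi>" for \<psi> \<psi>1 :: "real \<Rightarrow> real"
  proof -
    have "(\<psi>1 has_integral (\<psi> 1 - \<psi> 0)) {0..1}"
      using that(1) by (intro fundamental_theorem_of_calculus)
        (auto simp: has_real_derivative_iff_has_vector_derivative[symmetric] intro: has_field_derivative_at_within)
    moreover have "\<psi> 1 = \<psi> 0" using that(2) by (auto simp: periodic_def dest: spec[of _ 0])
    ultimately show ?thesis by (simp add: integral_unique)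
  qed
  then show "var1 0 lebesgue" unfolding var1_def lebesgue_def by auto
  show "var2 0 lebesgue"
    unfolding var2_def lebesgue_def
  proof (intro allI impI)
    fix \<psi> \<psi>1 \<psi>2 :: "real \<Rightarrow> real" and S
    assume d: "\<forall>x. (\<psi> has_real_derivative \<psi>1 x) (at x)" "\<forall>x. (\<psi>1 has_real_derivative \<psi>2 x) (at x)" "periodic \<psi>"
    have "((\<lambda>x. \<psi> (x + 1)) has_real_derivative \<psi>1 (x + 1)) (at x)" for x
      using d(1) DERIV_shift[of \<psi> "\<psi>1 (x + 1)" x 1] by simp
    moreover have "(\<lambda>x. \<psi> (x + 1)) = \<psi>" using d(3) by (auto simp: periodic_def)
    ultimately have "periodic \<psi>1" using d(1) DERIV_unique unfolding periodic_def by metis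
    then show "\<bar>integral {0..1} \<psi>2\<bar> \<le> 0 * S" using zero[of \<psi>1 \<psi>2] d by simp
  qed
qed

text \<open>This version serves functionals with a bound on the first variation only, such as
  densities of standard pairs. Each exchanged iterate then costs a fixed amount, and the growth in
  \<open>n\<close> is the price.\<close>

lemma iterate_lipschitz_linear:
  assumes l: "averaging l" and V: "var1 V l" "2 * P \<le> V"
    and u: "\<And>x. (u has_real_derivative u1 x) (at x)" "continuous_on UNIV u1" "periodic u" "\<And>x. \<bar>u x\<bar> \<le> S"
  shows "\<bar>l (\<lambda>x. u ((fz \<theta> ^^ n) x)) - l (\<lambda>x. u ((fz \<theta>' ^^ n) x))\<bar> \<le> real n * ((V * P + P) * S * \<bar>\<theta> - \<theta>'\<bar>)"
proof -
  have "\<bar>l (\<lambda>x. u ((fz \<theta> ^^ n) x)) - l (\<lambda>x. u ((fz \<theta>' ^^ n) x))\<bar> \<le> (\<Sum>i<n. (V * P + P) * S * \<bar>\<theta> - \<theta>'\<bar>)"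
  proof (rule telescope)
    fix i assume "i < n"
    obtain v where v: "\<And>x. ((\<lambda>x. u ((fz \<theta> ^^ (n - Suc i)) x)) has_real_derivative v x) (at x)" "continuous_on UNIV v"
      using deriv_iter[OF u(1,2)] by blast
    show "\<bar>l (\<lambda>x. u ((fz \<theta> ^^ (n - Suc i)) (f ((fz \<theta>' ^^ i) x, \<theta>)))) - l (\<lambda>x. u ((fz \<theta> ^^ (n - Suc i)) (f ((fz \<theta>' ^^ i) x, \<theta>'))))\<bar>
       \<le> (V * P + P) * S * \<bar>\<theta> - \<theta>'\<bar>"
      by (rule perturb1[OF averaging_iter[OF l] var1_iter[OF l V] v
            expanding_map.periodic_comp_funpow[OF expanding_map u(3)]]) (rule u(4))
  qed
  then show ?thesis by simp
qed

definition V0 :: real where "V0 = 2 * P"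
definition W0 :: real where "W0 = 2 * ((10 + 3 * V0) * P\<^sup>2)"
definition response :: real where
  "response = (W0 * (P * (1 / 2)) + (10 + 3 * V0) * P\<^sup>2) * (22 / gap) / (1 - rate)"

lemma V0_W0: "0 \<le> V0" "0 \<le> W0" "0 \<le> response"
proof -
  show 1: "0 \<le> V0" using P_ge(4) by (simp add: V0_def)
  then show 2: "0 \<le> W0" unfolding W0_def by simp
  show "0 \<le> response" unfolding response_def using 1 2 P_ge(4) gap rate by simp
qed

text \<open>Primitives of \<open>u \<circ> f\<^sup>m\<close> decay like \<open>rate\<^sup>m\<close>, which makes the telescoping sum of the
  perturbations converge: this is linear response.\<close>

lemma mean_lipschitz:
  assumes u: "\<And>x. (u has_real_derivative u1 x) (at x)" "continuous_on UNIV u1" "periodic u" "\<And>x. \<bar>u x\<bar> \<le> S"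
  shows "\<bar>mean \<theta> u - mean \<theta>' u\<bar> \<le> response * S * \<bar>\<theta> - \<theta>'\<bar>"
proof -
  interpret E: expanding_map "fz \<theta>" "\<lambda>x. f1 (x, \<theta>)" B by (rule expanding_map)
  interpret E': expanding_map "fz \<theta>'" "\<lambda>x. f1 (x, \<theta>')" B by (rule expanding_map)
  define K where "K = (W0 * (P * (1 / 2)) + (10 + 3 * V0) * P\<^sup>2) * (22 / gap) * S * \<bar>\<theta> - \<theta>'\<bar>"
  have S0: "0 \<le> S" using u(4)[of 0] by linarith
  have K0: "0 \<le> K" using V0_W0 P_ge(4) gap S0 by (simp add: K_def)
  have cu: "continuous_on UNIV u" using u(1) by (rule continuous_on_UNIV_deriv)
  have V: "var1 V0 lebesgue" using var1_mono[OF lebesgue(2) V0_W0(1)] .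
  have W: "var2 W0 lebesgue"
    unfolding var2_def
  proof (intro allI impI)
    fix \<psi> \<psi>1 \<psi>2 :: "real \<Rightarrow> real" and S
    assume d: "\<forall>x. (\<psi> has_real_derivative \<psi>1 x) (at x)" "\<forall>x. (\<psi>1 has_real_derivative \<psi>2 x) (at x)"
      "continuous_on UNIV \<psi>2" "periodic \<psi>" "\<forall>x. \<bar>\<psi> x\<bar> \<le> S"
    have "\<bar>lebesgue \<psi>2\<bar> \<le> 0 * S" using d by (intro var2D[OF lebesgue(3)]) auto
    moreover have "0 \<le> W0 * S"
    proof (rule mult_nonneg_nonneg[OF V0_W0(2)])
      show "0 \<le> S" using spec[OF d(5), of 0] by linarith
    qed
    ultimately show "\<bar>lebesgue \<psi>2\<bar> \<le> W0 * S" by simp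
  qed
  have le: "2 * P \<le> V0" "2 * ((10 + 3 * V0) * P\<^sup>2) \<le> W0" by (simp_all add: V0_def W0_def)
  have "\<bar>lebesgue (\<lambda>x. u ((fz \<theta> ^^ n) x)) - lebesgue (\<lambda>x. u ((fz \<theta>' ^^ n) x))\<bar> \<le> K / (1 - rate)" for n
  proof -
    have "\<bar>lebesgue (\<lambda>x. u ((fz \<theta> ^^ n) x)) - lebesgue (\<lambda>x. u ((fz \<theta>' ^^ n) x))\<bar> \<le> (\<Sum>i<n. K * rate ^ (n - Suc i))"
    proof (rule telescope)
      fix i assume "i < n"
      define m where "m = n - Suc i"
      define l where "l = (\<lambda>\<phi>. lebesgue (\<lambda>x. \<phi> ((fz \<theta>' ^^ i) x)))"
      have l: "averaging l" "var1 V0 l" "var2 W0 l"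
        unfolding l_def by (rule averaging_iter[OF lebesgue(1)] var1_iter[OF lebesgue(1) V le(1)]
          var2_iter[OF lebesgue(1) V le(1) W le(2)])+
      \<comment> \<open>A periodic primitive exists only after subtracting the average
        \<open>b\<close>, which cancels in the difference of the two parameters.\<close>
      obtain \<Phi> b where \<Phi>: "\<And>x. (\<Phi> has_real_derivative u ((fz \<theta> ^^ m) x) - b) (at x)" "periodic \<Phi>"
        "\<And>x. \<bar>\<Phi> x\<bar> \<le> 22 / gap * S * rate ^ m" "\<bar>b - mean \<theta> u\<bar> \<le> 4 / gap * S * rate ^ m"
        using E.decay_primitive[where n = m, OF cu u(4,3)] by blast
      obtain v where v: "\<And>x. ((\<lambda>x. u ((fz \<theta> ^^ m) x)) has_real_derivative v x) (at x)" "continuous_on UNIV v"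
        using deriv_iter[OF u(1,2)] by blast
      have d2: "((\<lambda>x. u ((fz \<theta> ^^ m) x) - b) has_real_derivative v x) (at x)" for x
        using DERIV_diff[OF v(1) DERIV_const[of b]] by simp
      have pert: "\<bar>l (\<lambda>x. u ((fz \<theta> ^^ m) (f (x, \<theta>))) - b) - l (\<lambda>x. u ((fz \<theta> ^^ m) (f (x, \<theta>'))) - b)\<bar>
         \<le> (W0 * (P * (1 / 2)) + (10 + 3 * V0) * P\<^sup>2) * (22 / gap * S * rate ^ m) * \<bar>\<theta> - \<theta>'\<bar>"
        by (rule perturb2[OF l(1,2) V0_W0(1) l(3) \<Phi>(1) d2 v(2) \<Phi>(2,3)])
      have shift: "l (\<lambda>x. u ((fz \<theta> ^^ m) (f (x, s))) - b) = l (\<lambda>x. u ((fz \<theta> ^^ m) (f (x, s)))) - b" for s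
      proof -
        have "continuous_on UNIV (\<lambda>x. u ((fz \<theta> ^^ m) (f (x, s))))"
          by (rule continuous_on_compose2[OF continuous_on_UNIV_deriv[OF v(1), of UNIV] h(3)]) auto
        from averaging_linear[OF l(1) this continuous_on_const[of UNIV b], of 1 "- 1"]
        show ?thesis unfolding averaging_const[OF l(1)] by simp
      qed
      have "(W0 * (P * (1 / 2)) + (10 + 3 * V0) * P\<^sup>2) * (22 / gap * S * rate ^ m) * \<bar>\<theta> - \<theta>'\<bar> = K * rate ^ m"
        unfolding K_def by (simp only: mult.assoc mult.commute[of "rate ^ m"])
      moreover have "(l (\<lambda>x. u ((fz \<theta> ^^ m) (f (x, \<theta>)))) - b) - (l (\<lambda>x. u ((fz \<theta> ^^ m) (f (x, \<theta>')))) - b) =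
         l (\<lambda>x. u ((fz \<theta> ^^ m) (f (x, \<theta>)))) - l (\<lambda>x. u ((fz \<theta> ^^ m) (f (x, \<theta>'))))" by (rule diff_diff_eq2[THEN trans]) linarith
      ultimately have "\<bar>l (\<lambda>x. u ((fz \<theta> ^^ m) (f (x, \<theta>)))) - l (\<lambda>x. u ((fz \<theta> ^^ m) (f (x, \<theta>'))))\<bar> \<le> K * rate ^ m"
        using pert unfolding shift by argo
      then show "\<bar>lebesgue (\<lambda>x. u ((fz \<theta> ^^ (n - Suc i)) (f ((fz \<theta>' ^^ i) x, \<theta>)))) -
          lebesgue (\<lambda>x. u ((fz \<theta> ^^ (n - Suc i)) (f ((fz \<theta>' ^^ i) x, \<theta>'))))\<bar> \<le> K * rate ^ (n - Suc i)"
        by (simp add: l_def m_def)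
    qed
    also have "\<dots> = K * (\<Sum>i<n. rate ^ i)"
      unfolding sum_distrib_left[symmetric] by (simp add: sum.nat_diff_reindex)
    also have "\<dots> = K * ((1 - rate ^ n) / (1 - rate))" using rate by (simp add: sum_gp_strict)
    also have "\<dots> \<le> K * (1 / (1 - rate))"
      using K0 rate by (intro mult_left_mono divide_right_mono) auto
    finally show ?thesis by simp
  qed
  then have le_n: "\<bar>integral {0..1} (\<lambda>x. u ((fz \<theta> ^^ n) x)) - integral {0..1} (\<lambda>x. u ((fz \<theta>' ^^ n) x))\<bar> \<le> K / (1 - rate)" for n
    by (simp add: lebesgue_def)
  have "(\<lambda>n. \<bar>integral {0..1} (\<lambda>x. u ((fz \<theta> ^^ n) x)) - integral {0..1} (\<lambda>x. u ((fz \<theta>' ^^ n) x))\<bar>)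
      \<longlonglongrightarrow> \<bar>mean \<theta> u - mean \<theta>' u\<bar>"
    by (intro tendsto_rabs tendsto_diff E.mean_limit(1)[OF borel_measurable_continuous_onI[OF cu] u(4,3)]
        E'.mean_limit(1)[OF borel_measurable_continuous_onI[OF cu] u(4,3)])
  then have "\<bar>mean \<theta> u - mean \<theta>' u\<bar> \<le> K / (1 - rate)"
    by (rule LIMSEQ_le_const2) (use le_n in blast)
  then show ?thesis by (simp add: K_def response_def mult_ac)
qed

end

section \<open>Standard pairs and the correlation potential\<close>

lemma exp_le_quadratic:
  fixes t :: real assumes "\<bar>t\<bar> \<le> 1" shows "exp t \<le> 1 + t + t\<^sup>2"
proof (cases "0 \<le> t")
  case True then show ?thesis using exp_bound[of t] assms by simp
next
  case False
  define s where "s = - t"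
  have s: "0 \<le> s" "s \<le> 1" using False assms by (auto simp: s_def)
  have e: "1 + s + s\<^sup>2 / 2 \<le> exp s" using exp_lower_Taylor_quadratic[OF s(1)] .
  have nn: "0 \<le> 1 - s + s\<^sup>2" using s by (simp add: add_nonneg_nonneg)
  \<comment> \<open>For negative argument the claim is \<open>1 \<le> (1 - s + s^2) * exp s\<close>;
    inserting the quadratic Taylor bound of \<open>exp s\<close> reduces it to this
    polynomial.\<close>
  have "1 \<le> 1 + s\<^sup>2 / 2 + s ^ 3 / 2 + s ^ 4 / 2" using s by simp
  also have "\<dots> = (1 - s + s\<^sup>2) * (1 + s + s\<^sup>2 / 2)" by (simp add: algebra_simps eval_nat_numeral) (simp add: field_simps)
  also have "\<dots> \<le> (1 - s + s\<^sup>2) * exp s" using e nn by (intro mult_left_mono)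
  finally have "exp (- s) \<le> 1 - s + s\<^sup>2" by (simp add: exp_minus field_simps)
  then show ?thesis by (simp add: s_def)
qed

text \<open>Valid for every real t, and the remainder is already a Gaussian factor: for a centred
  variable the linear term averages out, without any restriction on the size of the exponential
  parameter.\<close>

lemma exp_le_gaussian:
  fixes t :: real shows "exp t \<le> t + exp (t\<^sup>2)"
proof -
  consider "\<bar>t\<bar> \<le> 1" | "1 < t" | "t < - 1" by linarith
  then show ?thesis
  proof cases
    case 1 then show ?thesis using exp_le_quadratic[OF 1] exp_ge_add_one_self[of "t\<^sup>2"] by linarith
  next
    case 2
    then have "t \<le> t\<^sup>2" by (simp add: power2_eq_square)
    then have "exp t \<le> exp (t\<^sup>2)" by simp
    then show ?thesis using 2 by linarith
  next
    case 3
    then have "0 \<le> (- t) * (- t - 1)" by (intro mult_nonneg_nonneg) auto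
    then have "- t \<le> t\<^sup>2" by (simp add: power2_eq_square algebra_simps)
    moreover have "exp t \<le> 1" using 3 by simp
    ultimately show ?thesis using exp_ge_add_one_self[of "t\<^sup>2"] by linarith
  qed
qed

text \<open>All values lie within \<open>R\<close> of their mean, being pairwise within
  \<open>R\<close>. After factoring out the exponential of the mean, \<open>exp_le_gaussian\<close>
  is averaged and its linear term vanishes.\<close>

lemma exp_average_le:
  fixes pr m :: "nat \<Rightarrow> real"
  assumes pr: "\<And>i. i < n \<Longrightarrow> 0 \<le> pr i" "(\<Sum>i<n. pr i) = 1"
    and range: "\<And>i j. i < n \<Longrightarrow> j < n \<Longrightarrow> \<bar>m i - m j\<bar> \<le> R"
  shows "(\<Sum>i<n. pr i * exp (\<sigma> * m i)) \<le> exp (\<sigma> * (\<Sum>i<n. pr i * m i) + \<sigma>\<^sup>2 * R\<^sup>2)"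
proof -
  define c where "c = (\<Sum>i<n. pr i * m i)"
  have dev: "\<bar>m i - c\<bar> \<le> R" if i: "i < n" for i
  proof -
    have "m i - c = (\<Sum>j<n. pr j * (m i - m j))"
      using pr(2) by (simp add: c_def right_diff_distrib sum_subtractf flip: sum_distrib_right)
    also have "\<bar>\<dots>\<bar> \<le> (\<Sum>j<n. pr j * R)"
      by (intro order.trans[OF sum_abs] sum_mono) (use pr(1) range[OF i] in \<open>auto simp: abs_mult intro!: mult_left_mono\<close>)
    also have "\<dots> = R" using pr(2) by (simp flip: sum_distrib_right)
    finally show ?thesis .
  qed
  have "pr i * exp (\<sigma> * m i) \<le> exp (\<sigma> * c) * (pr i * (\<sigma> * (m i - c)) + pr i * exp (\<sigma>\<^sup>2 * R\<^sup>2))" if i: "i < n" for i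
  proof -
    have sq: "(\<sigma> * (m i - c))\<^sup>2 \<le> \<sigma>\<^sup>2 * R\<^sup>2"
      unfolding power_mult_distrib using power_mono[OF dev[OF i], of 2] by (intro mult_left_mono) auto
    have "exp (\<sigma> * m i) = exp (\<sigma> * c) * exp (\<sigma> * (m i - c))" by (simp add: algebra_simps flip: exp_add)
    also have "\<dots> \<le> exp (\<sigma> * c) * (\<sigma> * (m i - c) + exp (\<sigma>\<^sup>2 * R\<^sup>2))"
      using exp_le_gaussian[of "\<sigma> * (m i - c)"] sq by (intro mult_left_mono) (auto intro: order.trans)
    finally have "pr i * exp (\<sigma> * m i) \<le> pr i * (exp (\<sigma> * c) * (\<sigma> * (m i - c) + exp (\<sigma>\<^sup>2 * R\<^sup>2)))"
      using pr(1)[OF i] by (rule mult_left_mono)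
    then show ?thesis by (simp add: algebra_simps)
  qed
  then have "(\<Sum>i<n. pr i * exp (\<sigma> * m i)) \<le> (\<Sum>i<n. exp (\<sigma> * c) * (pr i * (\<sigma> * (m i - c)) + pr i * exp (\<sigma>\<^sup>2 * R\<^sup>2)))"
    by (intro sum_mono) auto
  also have "\<dots> = exp (\<sigma> * c) * ((\<Sum>i<n. pr i * (\<sigma> * (m i - c))) + (\<Sum>i<n. pr i) * exp (\<sigma>\<^sup>2 * R\<^sup>2))"
    by (simp only: sum_distrib_left[symmetric] sum.distrib sum_distrib_right[symmetric])
  also have "(\<Sum>i<n. pr i * (\<sigma> * (m i - c))) = (\<Sum>i<n. \<sigma> * (pr i * m i) - \<sigma> * (pr i * c))"
    by (simp add: algebra_simps)
  also have "\<dots> = \<sigma> * c - \<sigma> * ((\<Sum>i<n. pr i) * c)"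
    unfolding sum_subtractf sum_distrib_left[symmetric] sum_distrib_right[symmetric] c_def[symmetric] ..
  finally show ?thesis using pr(2) by (simp add: c_def exp_add)
qed

lemma log_lipschitz:
  fixes \<rho> :: "real \<Rightarrow> real"
  assumes "\<And>x. (\<rho> has_real_derivative \<rho>1 x) (at x)" "\<And>x. 0 < \<rho> x" "\<And>x. \<bar>\<rho>1 x\<bar> \<le> c * \<rho> x"
  shows "\<rho> x \<le> exp (c * \<bar>x - y\<bar>) * \<rho> y"
proof -
  have "((\<lambda>x. ln (\<rho> x)) has_real_derivative \<rho>1 x / \<rho> x) (at x)" for x
    using DERIV_ln_divide[OF assms(2)] DERIV_chain2[OF DERIV_ln_divide[OF assms(2)] assms(1)] by auto
  moreover have "\<bar>\<rho>1 x / \<rho> x\<bar> \<le> c" for x using assms(2,3)[of x] by (simp add: abs_divide divide_le_eq)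
  ultimately have "\<bar>ln (\<rho> x) - ln (\<rho> y)\<bar> \<le> c * \<bar>x - y\<bar>" by (rule lipschitz_of_deriv_bound)
  then have "ln (\<rho> x) \<le> c * \<bar>x - y\<bar> + ln (\<rho> y)" by linarith
  then have "exp (ln (\<rho> x)) \<le> exp (c * \<bar>x - y\<bar> + ln (\<rho> y))" by simp
  then show ?thesis using assms(2) by (simp add: exp_add)
qed

text \<open>Two densities supported on intervals with a common left end: the overlap contributes the
  distance of the densities, the excess of the longer interval its length times the sup
  bound.\<close>

lemma integral_diff_le:
  fixes u v :: "real \<Rightarrow> real"
  assumes u: "continuous_on {A..b1} u" and v: "continuous_on {A..b2} v" and phi: "\<phi> \<in> borel_measurable borel" "\<And>x. \<bar>\<phi> x\<bar> \<le> S"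
    and le: "A \<le> b1" "A \<le> b2" "min b1 b2 - A \<le> L" "0 \<le> \<eta>"
    and close: "\<And>x. A \<le> x \<Longrightarrow> x \<le> b1 \<Longrightarrow> x \<le> b2 \<Longrightarrow> \<bar>u x - v x\<bar> \<le> \<eta>"
    and bd: "\<And>x. x \<in> {A..b1} \<Longrightarrow> \<bar>u x\<bar> \<le> R" "\<And>x. x \<in> {A..b2} \<Longrightarrow> \<bar>v x\<bar> \<le> R"
  shows "\<bar>integral {A..b1} (\<lambda>x. u x * \<phi> x) - integral {A..b2} (\<lambda>x. v x * \<phi> x)\<bar> \<le> (\<eta> * L + R * \<bar>b1 - b2\<bar>) * S"
proof -
  define c where "c = min b1 b2"
  have S0: "0 \<le> S" using phi(2)[of 0] by linarith
  have ui: "(\<lambda>x. u x * \<phi> x) integrable_on {A..b1}" and vi: "(\<lambda>x. v x * \<phi> x) integrable_on {A..b2}"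
    using integrable_cont_mult[OF u phi] integrable_cont_mult[OF v phi] by auto
  have tail: "\<bar>integral {A..b} (\<lambda>x. g x * \<phi> x) - integral {A..c} (\<lambda>x. g x * \<phi> x)\<bar> \<le> R * (b - c) * S"
    if g: "(\<lambda>x. g x * \<phi> x) integrable_on {A..b}" "c \<le> b" "\<And>x. x \<in> {A..b} \<Longrightarrow> \<bar>g x\<bar> \<le> R" for g :: "real \<Rightarrow> real" and b
  proof -
    have Ac: "A \<le> c" using le by (simp add: c_def)
    have "integral {A..b} (\<lambda>x. g x * \<phi> x) = integral {A..c} (\<lambda>x. g x * \<phi> x) + integral {c..b} (\<lambda>x. g x * \<phi> x)"
      using Henstock_Kurzweil_Integration.integral_combine[OF Ac g(2,1)] by simp
    moreover have "norm (integral {c..b} (\<lambda>x. g x * \<phi> x)) \<le> integral {c..b} (\<lambda>_. R * S)"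
    proof (rule Henstock_Kurzweil_Integration.integral_norm_bound_integral)
      show "(\<lambda>x. g x * \<phi> x) integrable_on {c..b}"
        using g(1) by (rule integrable_on_subinterval) (use Ac in auto)
      fix x assume "x \<in> {c..b}"
      then show "norm (g x * \<phi> x) \<le> R * S"
        using g(3)[of x] phi(2)[of x] Ac by (auto simp: abs_mult intro!: mult_mono intro: order.trans[OF abs_ge_zero])
    qed (rule integrable_const_ivl)
    ultimately show ?thesis using g(2) by (simp add: mult_ac)
  qed
  have c: "c \<le> b1" "c \<le> b2" "A \<le> c" "c - A \<le> L" using le by (auto simp: c_def)
  have uc: "(\<lambda>x. u x * \<phi> x) integrable_on {A..c}" "(\<lambda>x. v x * \<phi> x) integrable_on {A..c}"
    using integrable_on_subinterval[OF ui, of A c] integrable_on_subinterval[OF vi, of A c] c by auto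
  have "norm (integral {A..c} (\<lambda>x. u x * \<phi> x - v x * \<phi> x)) \<le> integral {A..c} (\<lambda>_. \<eta> * S)"
  proof (rule Henstock_Kurzweil_Integration.integral_norm_bound_integral)
    show "(\<lambda>x. u x * \<phi> x - v x * \<phi> x) integrable_on {A..c}" using uc by (rule Henstock_Kurzweil_Integration.integrable_diff)
    fix x assume "x \<in> {A..c}"
    then have "\<bar>u x - v x\<bar> * \<bar>\<phi> x\<bar> \<le> \<eta> * S" using close[of x] phi(2)[of x] c le(4) by (intro mult_mono) auto
    then show "norm (u x * \<phi> x - v x * \<phi> x) \<le> \<eta> * S" by (simp flip: abs_mult left_diff_distrib)
  qed (rule integrable_const_ivl)
  also have "\<dots> \<le> \<eta> * L * S"
    using c S0 le(4) mult_right_mono[OF c(4), of "\<eta> * S"] by (simp add: mult_ac)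
  finally have m: "\<bar>integral {A..c} (\<lambda>x. u x * \<phi> x) - integral {A..c} (\<lambda>x. v x * \<phi> x)\<bar> \<le> \<eta> * L * S"
    using uc by (simp add: Henstock_Kurzweil_Integration.integral_diff)
  have R0: "0 \<le> R" using bd(1)[of A] le(1) by force
  have "R * (b1 - c) * S + R * (b2 - c) * S = R * \<bar>b1 - b2\<bar> * S"
    by (cases "b1 \<le> b2") (auto simp: c_def algebra_simps)
  then have "\<bar>integral {A..b1} (\<lambda>x. u x * \<phi> x) - integral {A..b2} (\<lambda>x. v x * \<phi> x)\<bar> \<le> \<eta> * L * S + R * \<bar>b1 - b2\<bar> * S"
    using tail[OF ui c(1) bd(1)] tail[OF vi c(2) bd(2)] m by linarith
  then show ?thesis by (simp add: algebra_simps)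
qed

lemma lipschitz_continuous_on:
  fixes u :: "real \<Rightarrow> real"
  assumes u: "\<And>x x'. \<bar>u x - u x'\<bar> \<le> L * \<bar>x - x'\<bar>" and "0 \<le> L"
  shows "continuous_on T u"
proof (rule continuous_on_subset[OF _ subset_UNIV], unfold continuous_on_iff, intro ballI allI impI)
  fix x e :: real assume e: "0 < e"
  show "\<exists>d>0. \<forall>x'\<in>UNIV. dist x' x < d \<longrightarrow> dist (u x') (u x) < e"
  proof (intro exI[of _ "e / (L + 1)"] conjI ballI impI)
    show "0 < e / (L + 1)" using e assms by simp
    fix x' assume "dist x' x < e / (L + 1)"
    then have lt: "(L + 1) * \<bar>x' - x\<bar> < e" using assms(2) by (simp add: dist_real_def field_simps)
    have "L * \<bar>x' - x\<bar> \<le> (L + 1) * \<bar>x' - x\<bar>" by (intro mult_right_mono) auto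
    then show "dist (u x') (u x) < e" using u[of x' x] lt unfolding dist_real_def by linarith
  qed
qed

text \<open>The sizes of \<open>c1\<close> and \<open>c2\<close> make the class of pairs reproduce
  itself: one iteration yields slopes at most
  \<open>(\<epsilon> * c1 + 2 * \<epsilon> * B) / 2\<close> and log-slopes at most
  \<open>(c2 + B) / 2\<close>. The margin \<open>lam - 2\<close> compensates the tilt of the curve.
  The observable \<open>\<alpha>\<close> is real; in the vector case it is a coordinate or the
  negative of one.\<close>

locale slow_fast = expanding_family +
  fixes \<alpha> \<alpha>1 \<alpha>2 \<omega> \<omega>1 \<omega>2 :: "real \<times> real \<Rightarrow> real" and c1 c2 \<delta> lam :: real
  assumes \<alpha>: "partials \<alpha> \<alpha>1 \<alpha>2" "continuous_on UNIV \<alpha>1" "\<And>p. \<bar>\<alpha> p\<bar> \<le> B" "\<And>p. \<bar>\<alpha>1 p\<bar> \<le> B" "\<And>p. \<bar>\<alpha>2 p\<bar> \<le> B"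
      "\<And>\<theta>. periodic (\<lambda>x. \<alpha> (x, \<theta>))"
    and \<omega>: "partials \<omega> \<omega>1 \<omega>2" "continuous_on UNIV \<omega>1" "continuous_on UNIV \<omega>2"
      "\<And>p. \<bar>\<omega> p\<bar> \<le> B" "\<And>p. \<bar>\<omega>1 p\<bar> \<le> B" "\<And>p. \<bar>\<omega>2 p\<bar> \<le> B"
    and c: "2 * B \<le> c1" "2 * B \<le> c2" and \<delta>: "0 < \<delta>" "\<delta> \<le> 1 / 2"
    and lam: "2 < lam" "\<And>p. lam \<le> f1 p" and cont_e1: "continuous_on UNIV e1"
begin

definition \<alpha>bar where "\<alpha>bar \<theta> = mean \<theta> (\<lambda>x. \<alpha> (x, \<theta>))"
definition La where "La = response * B + B"
definition \<alpha>h where "\<alpha>h z = \<alpha> z - \<alpha>bar (snd z)"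

lemma c_pos: "0 < c1" "0 < c2" "2 \<le> c1" using c B1 by linarith+

lemma B0: "0 \<le> B" using B1 by linarith

lemma \<alpha>_deriv: "((\<lambda>x. \<alpha> (x, \<theta>)) has_real_derivative \<alpha>1 (x, \<theta>)) (at x)" "continuous_on UNIV (\<lambda>x. \<alpha>1 (x, \<theta>))"
  "continuous_on UNIV (\<lambda>x. \<alpha> (x, \<theta>))"
  by (rule partials_x[OF \<alpha>(1)])
    (rule continuous_partial[OF \<alpha>(2)] continuous_on_UNIV_deriv[OF partials_x[OF \<alpha>(1)]]; intro continuous_intros)+

lemma \<alpha>_meas: "(\<lambda>x. \<alpha> (x, \<theta>)) \<in> borel_measurable borel"
  by (rule borel_measurable_continuous_onI[OF \<alpha>_deriv(3)])

lemma La: "0 \<le> La" "B \<le> La" using V0_W0(3) B0 by (auto simp: La_def)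

lemma \<alpha>bar_lipschitz: "\<bar>\<alpha>bar \<theta> - \<alpha>bar \<theta>'\<bar> \<le> La * \<bar>\<theta> - \<theta>'\<bar>"
proof -
  have 1: "\<bar>mean \<theta> (\<lambda>x. \<alpha> (x, \<theta>)) - mean \<theta>' (\<lambda>x. \<alpha> (x, \<theta>))\<bar> \<le> response * B * \<bar>\<theta> - \<theta>'\<bar>"
    by (rule mean_lipschitz[OF \<alpha>_deriv(1,2) \<alpha>(6) \<alpha>(3)])
  have "mean \<theta>' (\<lambda>x. 1 * \<alpha> (x, \<theta>) + (- 1) * \<alpha> (x, \<theta>')) = 1 * mean \<theta>' (\<lambda>x. \<alpha> (x, \<theta>)) + (- 1) * mean \<theta>' (\<lambda>x. \<alpha> (x, \<theta>'))"
    by (rule expanding_map.mean_add[OF expanding_map \<alpha>_meas \<alpha>(3) \<alpha>(6) \<alpha>_meas \<alpha>(3) \<alpha>(6)])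
  moreover have "\<bar>mean \<theta>' (\<lambda>x. 1 * \<alpha> (x, \<theta>) + (- 1) * \<alpha> (x, \<theta>'))\<bar> \<le> B * \<bar>\<theta> - \<theta>'\<bar>"
  proof (rule expanding_map.abs_mean_le[OF expanding_map])
    show "(\<lambda>x. 1 * \<alpha> (x, \<theta>) + (- 1) * \<alpha> (x, \<theta>')) \<in> borel_measurable borel"
      using \<alpha>_meas[of \<theta>] \<alpha>_meas[of \<theta>'] by measurable
    show "\<bar>1 * \<alpha> (x, \<theta>) + (- 1) * \<alpha> (x, \<theta>')\<bar> \<le> B * \<bar>\<theta> - \<theta>'\<bar>" for x
      using lipschitz_of_deriv_bound[OF partials_theta[OF \<alpha>(1)] \<alpha>(5), of x \<theta> \<theta>'] by simp
    show "periodic (\<lambda>x. 1 * \<alpha> (x, \<theta>) + (- 1) * \<alpha> (x, \<theta>'))"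
      using \<alpha>(6) by (simp add: periodic_def)
  qed
  ultimately have "\<bar>mean \<theta>' (\<lambda>x. \<alpha> (x, \<theta>)) - mean \<theta>' (\<lambda>x. \<alpha> (x, \<theta>'))\<bar> \<le> B * \<bar>\<theta> - \<theta>'\<bar>" by simp
  with 1 have "\<bar>\<alpha>bar \<theta> - \<alpha>bar \<theta>'\<bar> \<le> response * B * \<bar>\<theta> - \<theta>'\<bar> + B * \<bar>\<theta> - \<theta>'\<bar>"
    unfolding \<alpha>bar_def by linarith
  then show ?thesis by (simp add: La_def algebra_simps)
qed

lemma \<alpha>bar_bound: "\<bar>\<alpha>bar \<theta>\<bar> \<le> B"
  unfolding \<alpha>bar_def by (rule expanding_map.abs_mean_le[OF expanding_map \<alpha>_meas \<alpha>(3) \<alpha>(6)])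

lemma \<alpha>h_bound: "\<bar>\<alpha>h z\<bar> \<le> 2 * B"
  unfolding \<alpha>h_def using \<alpha>(3)[of z] \<alpha>bar_bound[of "snd z"] by linarith

lemma continuous_\<alpha>bar: "continuous_on S \<alpha>bar"
proof (rule continuous_on_subset[OF _ subset_UNIV], unfold continuous_on_iff, intro ballI allI impI)
  fix x e :: real assume e: "0 < e"
  show "\<exists>d>0. \<forall>x'\<in>UNIV. dist x' x < d \<longrightarrow> dist (\<alpha>bar x') (\<alpha>bar x) < e"
  proof (intro exI[of _ "e / (La + 1)"] conjI ballI impI)
    show "0 < e / (La + 1)" using e La by simp
    fix x' assume "dist x' x < e / (La + 1)"
    then have lt: "(La + 1) * \<bar>x' - x\<bar> < e" using La by (simp add: dist_real_def field_simps)
    have "La * \<bar>x' - x\<bar> \<le> (La + 1) * \<bar>x' - x\<bar>" by (intro mult_right_mono) auto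
    then show "dist (\<alpha>bar x') (\<alpha>bar x) < e"
      using \<alpha>bar_lipschitz[of x' x] lt unfolding dist_real_def by linarith
  qed
qed

lemma continuous_\<alpha>h: "continuous_on S \<alpha>h"
  unfolding \<alpha>h_def[abs_def]
  by (intro continuous_intros partials_continuous[OF \<alpha>(1)] continuous_on_compose2[OF continuous_\<alpha>bar[of UNIV]]) auto

lemma \<alpha>h_lipschitz_x: "\<bar>\<alpha>h (x, \<theta>) - \<alpha>h (y, \<theta>)\<bar> \<le> B * \<bar>x - y\<bar>"
  using lipschitz_of_deriv_bound[OF partials_x[OF \<alpha>(1)] \<alpha>(4), of x \<theta> y] by (simp add: \<alpha>h_def)

lemma \<alpha>h_lipschitz_theta: "\<bar>\<alpha>h (x, \<theta>) - \<alpha>h (x, \<theta>')\<bar> \<le> (B + La) * \<bar>\<theta> - \<theta>'\<bar>"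
proof -
  have "\<bar>\<alpha> (x, \<theta>) - \<alpha> (x, \<theta>')\<bar> \<le> B * \<bar>\<theta> - \<theta>'\<bar>"
    by (rule lipschitz_of_deriv_bound[OF partials_theta[OF \<alpha>(1)] \<alpha>(5)])
  then have "\<bar>\<alpha>h (x, \<theta>) - \<alpha>h (x, \<theta>')\<bar> \<le> B * \<bar>\<theta> - \<theta>'\<bar> + La * \<bar>\<theta> - \<theta>'\<bar>"
    using \<alpha>bar_lipschitz[of \<theta> \<theta>'] unfolding \<alpha>h_def by (simp add: abs_le_iff)
  then show ?thesis by (simp add: algebra_simps)
qed

text \<open>Curve and density are defined on the whole line, so that the same formula serves the pair and
  its images; only a first derivative of each is controlled.\<close>

definition good_pair :: "real \<Rightarrow> real \<Rightarrow> real \<Rightarrow> (real \<Rightarrow> real) \<Rightarrow> (real \<Rightarrow> real) \<Rightarrow> bool" where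
  "good_pair \<epsilon> a b G \<rho> \<longleftrightarrow> \<delta> \<le> b - a \<and> b - a \<le> 1 \<and>
     (\<exists>G1. (\<forall>x. (G has_real_derivative G1 x) (at x)) \<and> continuous_on UNIV G1 \<and> (\<forall>x. \<bar>G1 x\<bar> \<le> \<epsilon> * c1)) \<and>
     (\<exists>\<rho>1. (\<forall>x. (\<rho> has_real_derivative \<rho>1 x) (at x)) \<and> continuous_on UNIV \<rho>1 \<and> (\<forall>x. 0 < \<rho> x) \<and>
        (\<forall>x. \<bar>\<rho>1 x\<bar> \<le> c2 * \<rho> x)) \<and> integral {a..b} \<rho> = 1"

text \<open>Upper bound for the density of a pair on [a-2, b+2]: every point there is within 3 of
  every point of the pair, whose length is at least \<open>\<delta>\<close>. In \<open>Vp\<close>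
  the term \<open>2 * Rs\<close> comes from the two ends and \<open>c2\<close> from the interior;
  \<open>2 * P\<close> meets the condition of \<open>var1_comp\<close>.\<close>

definition Rs where "Rs = exp (3 * c2) / \<delta>"
definition Vp where "Vp = 2 * Rs + c2 + 2 * P"
definition \<psi> where "\<psi> \<theta> k x = \<alpha>h ((fz \<theta> ^^ k) x, \<theta>)"
definition Cd where "Cd = (22 * Vp + 4) / gap * B"
definition CH where "CH = Cd / (1 - rate)"
definition Hp where "Hp M \<theta> a b \<rho> = (\<Sum>k<M. integral {a..b} (\<lambda>x. \<rho> x * \<psi> \<theta> k x))"

lemma Rs0: "0 < Rs" using \<delta> by (simp add: Rs_def)
lemma Vp: "0 \<le> Vp" "2 * P \<le> Vp" using Rs0 c_pos P_ge(4) by (auto simp: Vp_def)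
lemma Cd0: "0 \<le> Cd" "0 \<le> CH" using Vp gap rate B0 by (auto simp: Cd_def CH_def)

lemma \<psi>_bound: "\<bar>\<psi> \<theta> k x\<bar> \<le> 2 * B" unfolding \<psi>_def by (rule \<alpha>h_bound)

lemma continuous_\<psi>: "continuous_on S (\<psi> \<theta> k)"
  unfolding \<psi>_def[abs_def]
  by (intro continuous_on_compose2[OF continuous_\<alpha>h[of UNIV]] continuous_intros continuous_iter) auto

lemma \<psi>_meas: "\<psi> \<theta> k \<in> borel_measurable borel"
  by (rule borel_measurable_continuous_onI[OF continuous_\<psi>])

lemma \<psi>_Suc: "\<psi> \<theta> k (f (x, \<theta>)) = \<psi> \<theta> (Suc k) x"
  by (simp only: \<psi>_def funpow_Suc_right o_apply)

lemma good_pairD: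
  assumes "good_pair \<epsilon> a b G \<rho>"
  shows "a < b" "continuous_on S \<rho>" "\<And>x. 0 < \<rho> x" "\<And>x y. \<rho> x \<le> exp (c2 * \<bar>x - y\<bar>) * \<rho> y"
    "\<And>x. a - 2 \<le> x \<Longrightarrow> x \<le> b + 2 \<Longrightarrow> \<rho> x \<le> Rs"
    "averaging (\<lambda>\<phi>. integral {a..b} (\<lambda>x. \<rho> x * \<phi> x))" "var1 Vp (\<lambda>\<phi>. integral {a..b} (\<lambda>x. \<rho> x * \<phi> x))"
proof -
  obtain \<rho>1 where r: "\<And>x. (\<rho> has_real_derivative \<rho>1 x) (at x)" "continuous_on UNIV \<rho>1" "\<And>x. 0 < \<rho> x"
    "\<And>x. \<bar>\<rho>1 x\<bar> \<le> c2 * \<rho> x" and one: "integral {a..b} \<rho> = 1" and ab: "\<delta> \<le> b - a" "b - a \<le> 1"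
    using assms unfolding good_pair_def by blast
  show lt: "a < b" using ab \<delta> by linarith
  show cr: "continuous_on S \<rho>" for S using r(1) by (rule continuous_on_UNIV_deriv)
  show pos: "0 < \<rho> x" for x by (rule r(3))
  show ll: "\<rho> x \<le> exp (c2 * \<bar>x - y\<bar>) * \<rho> y" for x y by (rule log_lipschitz[OF r(1,3,4)])
  show sup: "\<rho> x \<le> Rs" if x: "a - 2 \<le> x" "x \<le> b + 2" for x
  proof -
    have "integral {a..b} (\<lambda>_. \<rho> x * exp (- (3 * c2))) \<le> integral {a..b} \<rho>"
    proof (rule integral_le)
      fix y assume y: "y \<in> {a..b}"
      have "c2 * \<bar>x - y\<bar> \<le> c2 * 3" using x y ab c_pos by (intro mult_left_mono) auto
      then have "exp (c2 * \<bar>x - y\<bar>) * \<rho> y \<le> exp (3 * c2) * \<rho> y" using pos[of y] by (simp add: mult.commute)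
      then have "\<rho> x \<le> exp (3 * c2) * \<rho> y" using ll[of x y] by linarith
      then show "\<rho> x * exp (- (3 * c2)) \<le> \<rho> y" by (simp add: exp_minus field_simps)
    qed (auto intro: integrable_continuous_real cr)
    then have "\<rho> x * exp (- (3 * c2)) * (b - a) \<le> 1" using one lt by (simp add: mult_ac)
    moreover have "\<rho> x * exp (- (3 * c2)) * \<delta> \<le> \<rho> x * exp (- (3 * c2)) * (b - a)"
      using ab pos[of x] by (intro mult_left_mono) auto
    ultimately have "\<rho> x * exp (- (3 * c2)) * \<delta> \<le> 1" by linarith
    then show ?thesis unfolding Rs_def using \<delta> by (simp add: exp_minus field_simps)
  qed
  show av: "averaging (\<lambda>\<phi>. integral {a..b} (\<lambda>x. \<rho> x * \<phi> x))"
    unfolding averaging_def using lt pos one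
    by (intro exI[of _ a] exI[of _ b] exI[of _ \<rho>] exI[of _ "\<lambda>x. x"]) (auto intro: cr less_imp_le)
  show "var1 Vp (\<lambda>\<phi>. integral {a..b} (\<lambda>x. \<rho> x * \<phi> x))"
    unfolding var1_def
  proof (intro allI impI)
    fix \<eta> \<eta>1 :: "real \<Rightarrow> real" and S
    assume d: "\<forall>x. (\<eta> has_real_derivative \<eta>1 x) (at x)" "continuous_on UNIV \<eta>1" "\<forall>x. \<bar>\<eta> x\<bar> \<le> S"
    have S0: "0 \<le> S" using spec[OF d(3), of 0] by linarith
    have c\<eta>: "continuous_on T \<eta>" for T using d(1) by (auto intro: continuous_on_UNIV_deriv)
    \<comment> \<open>Integration by parts on the interval: two boundary terms of size
      \<open>Rs * S\<close> and an interior term, at most \<open>c2 * S\<close> because the density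
      has mass 1.\<close>
    have "((\<lambda>x. \<rho>1 x * \<eta> x + \<eta>1 x * \<rho> x) has_integral (\<rho> b * \<eta> b - \<rho> a * \<eta> a)) {a..b}"
    proof (rule fundamental_theorem_of_calculus)
      fix x
      have "((\<lambda>x. \<rho> x * \<eta> x) has_real_derivative \<rho>1 x * \<eta> x + \<eta>1 x * \<rho> x) (at x)"
        using d(1) by (intro DERIV_mult r(1)) auto
      then show "((\<lambda>x. \<rho> x * \<eta> x) has_vector_derivative \<rho>1 x * \<eta> x + \<eta>1 x * \<rho> x) (at x within {a..b})"
        by (simp add: has_real_derivative_iff_has_vector_derivative has_vector_derivative_at_within)
    qed (use lt in simp)
    moreover have i: "(\<lambda>x. \<rho>1 x * \<eta> x) integrable_on {a..b}" "(\<lambda>x. \<rho> x * \<eta>1 x) integrable_on {a..b}"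
      by (intro integrable_continuous_real continuous_intros continuous_on_subset[OF r(2)] continuous_on_subset[OF d(2)] cr c\<eta>; simp)+
    ultimately have eq: "integral {a..b} (\<lambda>x. \<rho> x * \<eta>1 x) = \<rho> b * \<eta> b - \<rho> a * \<eta> a - integral {a..b} (\<lambda>x. \<rho>1 x * \<eta> x)"
      using Henstock_Kurzweil_Integration.integral_add[OF i] by (simp add: mult.commute integral_unique)
    have "norm (integral {a..b} (\<lambda>x. \<rho>1 x * \<eta> x)) \<le> integral {a..b} (\<lambda>x. c2 * S * \<rho> x)"
    proof (rule Henstock_Kurzweil_Integration.integral_norm_bound_integral[OF i(1)])
      show "(\<lambda>x. c2 * S * \<rho> x) integrable_on {a..b}" by (intro integrable_continuous_real continuous_intros cr)
      fix x
      have "\<bar>\<rho>1 x\<bar> * \<bar>\<eta> x\<bar> \<le> c2 * \<rho> x * S" using r(4)[of x] d(3) c_pos pos[of x] by (intro mult_mono) auto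
      then show "norm (\<rho>1 x * \<eta> x) \<le> c2 * S * \<rho> x" by (simp add: abs_mult mult_ac)
    qed
    then have 3: "\<bar>integral {a..b} (\<lambda>x. \<rho>1 x * \<eta> x)\<bar> \<le> c2 * S" using one by simp
    have e: "\<bar>\<rho> x * \<eta> x\<bar> \<le> Rs * S" if "a \<le> x" "x \<le> b" for x
      unfolding abs_mult using sup[of x] pos[of x] d(3) that Rs0 by (intro mult_mono) auto
    have "\<bar>integral {a..b} (\<lambda>x. \<rho> x * \<eta>1 x)\<bar> \<le> Rs * S + Rs * S + c2 * S"
      unfolding eq
      by (rule order.trans[OF abs_triangle_ineq4 add_mono[OF order.trans[OF abs_triangle_ineq4 add_mono[OF e e]] 3]])
        (use lt in auto)
    also have "\<dots> \<le> Vp * S" using S0 P_ge(4) by (simp add: Vp_def algebra_simps)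
    finally show "\<bar>integral {a..b} (\<lambda>x. \<rho> x * \<eta>1 x)\<bar> \<le> Vp * S" .
  qed
qed

lemma averaging_\<psi>:
  assumes "averaging l" "var1 Vp l"
  shows "\<bar>l (\<psi> \<theta> k)\<bar> \<le> Cd * rate ^ k"
proof -
  have c: "continuous_on UNIV (\<lambda>x. \<alpha> ((fz \<theta> ^^ k) x, \<theta>))"
    by (rule continuous_on_compose2[OF \<alpha>_deriv(3) continuous_iter]) auto
  have "l (\<psi> \<theta> k) = l (\<lambda>x. 1 * \<alpha> ((fz \<theta> ^^ k) x, \<theta>) + (- \<alpha>bar \<theta>) * 1)"
    by (simp add: \<psi>_def[abs_def] \<alpha>h_def)
  also have "\<dots> = l (\<lambda>x. \<alpha> ((fz \<theta> ^^ k) x, \<theta>)) - mean \<theta> (\<lambda>x. \<alpha> (x, \<theta>))"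
    unfolding averaging_linear[OF assms(1) c continuous_on_const] averaging_const[OF assms(1)] by (simp add: \<alpha>bar_def)
  also have "\<bar>\<dots>\<bar> \<le> (22 * Vp + 4) / gap * B * rate ^ k"
    by (rule decay[OF assms Vp(1) \<alpha>_deriv(3) \<alpha>(3) \<alpha>(6)])
  finally show ?thesis by (simp add: Cd_def)
qed

lemma sum_rate: "(\<Sum>k<M. Cd * rate ^ k) \<le> CH"
proof -
  have "(\<Sum>k<M. Cd * rate ^ k) = Cd * ((1 - rate ^ M) / (1 - rate))"
    using rate by (simp add: sum_gp_strict flip: sum_distrib_left)
  also have "\<dots> \<le> Cd * (1 / (1 - rate))"
    using Cd0 rate by (intro mult_left_mono divide_right_mono) auto
  finally show ?thesis by (simp add: CH_def)
qed

lemma Hp_bound: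
  assumes "good_pair \<epsilon> a b G \<rho>" shows "\<bar>Hp M \<theta> a b \<rho>\<bar> \<le> CH"
proof -
  have "\<bar>Hp M \<theta> a b \<rho>\<bar> \<le> (\<Sum>k<M. Cd * rate ^ k)"
    unfolding Hp_def by (intro order.trans[OF sum_abs] sum_mono averaging_\<psi>[OF good_pairD(6,7)[OF assms]])
  then show ?thesis using sum_rate[of M] by linarith
qed

definition KF where "KF = (Vp * P + P) * B + (B + La)"

text \<open>The parameter occurs in the k iterates, in the observable and in its average. Only the
  first occurrence produces growth in k.\<close>

lemma averaging_\<psi>_lipschitz:
  assumes l: "averaging l" "var1 Vp l"
  shows "\<bar>l (\<psi> \<theta> k) - l (\<psi> \<theta>' k)\<bar> \<le> KF * (1 + real k) * \<bar>\<theta> - \<theta>'\<bar>"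
proof -
  have cA: "continuous_on UNIV (\<lambda>x. \<alpha> ((fz s ^^ k) x, s'))" for s s'
    by (rule continuous_on_compose2[OF \<alpha>_deriv(3) continuous_iter]) auto
  have sp: "l (\<psi> s k) = l (\<lambda>x. \<alpha> ((fz s ^^ k) x, s)) - \<alpha>bar s" for s
  proof -
    have "l (\<psi> s k) = l (\<lambda>x. 1 * \<alpha> ((fz s ^^ k) x, s) + (- \<alpha>bar s) * 1)"
      by (simp add: \<psi>_def[abs_def] \<alpha>h_def)
    then show ?thesis unfolding averaging_linear[OF l(1) cA continuous_on_const] averaging_const[OF l(1)] by simp
  qed
  have 1: "\<bar>l (\<lambda>x. \<alpha> ((fz \<theta> ^^ k) x, \<theta>)) - l (\<lambda>x. \<alpha> ((fz \<theta>' ^^ k) x, \<theta>))\<bar> \<le> real k * ((Vp * P + P) * B * \<bar>\<theta> - \<theta>'\<bar>)"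
    by (rule iterate_lipschitz_linear[OF l Vp(2) \<alpha>_deriv(1,2) \<alpha>(6) \<alpha>(3)])
  have "l (\<lambda>x. 1 * \<alpha> ((fz \<theta>' ^^ k) x, \<theta>) + (- 1) * \<alpha> ((fz \<theta>' ^^ k) x, \<theta>')) =
      1 * l (\<lambda>x. \<alpha> ((fz \<theta>' ^^ k) x, \<theta>)) + (- 1) * l (\<lambda>x. \<alpha> ((fz \<theta>' ^^ k) x, \<theta>'))"
    by (rule averaging_linear[OF l(1) cA cA])
  moreover have "\<bar>l (\<lambda>x. 1 * \<alpha> ((fz \<theta>' ^^ k) x, \<theta>) + (- 1) * \<alpha> ((fz \<theta>' ^^ k) x, \<theta>'))\<bar> \<le> B * \<bar>\<theta> - \<theta>'\<bar>"
  proof (rule averaging_bound[OF l(1)])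
    show "continuous_on UNIV (\<lambda>x. 1 * \<alpha> ((fz \<theta>' ^^ k) x, \<theta>) + (- 1) * \<alpha> ((fz \<theta>' ^^ k) x, \<theta>'))"
      by (intro continuous_intros cA)
    show "\<bar>1 * \<alpha> ((fz \<theta>' ^^ k) x, \<theta>) + (- 1) * \<alpha> ((fz \<theta>' ^^ k) x, \<theta>')\<bar> \<le> B * \<bar>\<theta> - \<theta>'\<bar>" for x
      using lipschitz_of_deriv_bound[OF partials_theta[OF \<alpha>(1)] \<alpha>(5), of "(fz \<theta>' ^^ k) x" \<theta> \<theta>'] by simp
  qed
  ultimately have 2: "\<bar>l (\<lambda>x. \<alpha> ((fz \<theta>' ^^ k) x, \<theta>)) - l (\<lambda>x. \<alpha> ((fz \<theta>' ^^ k) x, \<theta>'))\<bar> \<le> B * \<bar>\<theta> - \<theta>'\<bar>" by simp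
  have "\<bar>l (\<psi> \<theta> k) - l (\<psi> \<theta>' k)\<bar> \<le> real k * ((Vp * P + P) * B * \<bar>\<theta> - \<theta>'\<bar>) + B * \<bar>\<theta> - \<theta>'\<bar> + La * \<bar>\<theta> - \<theta>'\<bar>"
    unfolding sp using 1 2 \<alpha>bar_lipschitz[of \<theta> \<theta>'] by (simp add: abs_le_iff)
  also have "\<dots> \<le> KF * (1 + real k) * \<bar>\<theta> - \<theta>'\<bar>"
  proof -
    have "0 \<le> (Vp * P + P) * B" "0 \<le> (B + La) * real k" using Vp P_ge(4) B0 La by auto
    then have "real k * ((Vp * P + P) * B) + (B + La) \<le> KF * (1 + real k)"
      by (simp add: KF_def algebra_simps)
    from mult_right_mono[OF this, of "\<bar>\<theta> - \<theta>'\<bar>"] show ?thesis by (simp add: algebra_simps)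
  qed
  finally show ?thesis .
qed

lemma KF0: "0 \<le> KF" unfolding KF_def using Vp P_ge(4) B0 La by simp

end

section \<open>Constants of the one-step estimates\<close>

context slow_fast begin

definition KW where "KW = Rs * c1 * B * (c2 + B + 1)"
definition K7 where "K7 = KW * (2 * B) + Rs * (B * c1)"

lemma K7: "0 \<le> KW" "0 \<le> K7"
  using Rs0 c_pos B0 by (auto simp: KW_def K7_def)

text \<open>The fixed point for the regularity of partial sums: a sum with Lipschitz constant
  \<open>Co\<close> plus the observable along the curve, with constant \<open>2 * B + La\<close>,
  read through an inverse that contracts by 1/2, has constant \<open>Co\<close> again. In
  \<open>RR\<close>, \<open>2 * B\<close> bounds the length of the image, and each child mean is
  within \<open>Co + CH\<close> of the offset at the left end of its piece.\<close>

definition Co where "Co = 2 * B + La"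
definition RR where "RR = 2 * B * Co + 2 * Co + 2 * CH"
definition Err where "Err = (B + La) * c1 + c1 * B * (Co + 2 * B) + Cd + 2 * B * K7 + 2 * (KF * (c1 + B))"
definition KB where "KB = 2 * c1 * B * (Co + CH) + 2 * Err"

lemma KB0: "0 \<le> Co" "0 \<le> RR" "0 \<le> Err" "0 \<le> KB"
  using La B0 Cd0 c_pos K7 KF0 by (auto simp: Co_def RR_def Err_def KB_def intro!: add_nonneg_nonneg mult_nonneg_nonneg)

lemma mean_offset_close:
  assumes gp: "good_pair \<epsilon> a b G \<rho>" and u: "\<And>x x'. \<bar>u x - u x'\<bar> \<le> Co * \<bar>x - x'\<bar>" and x: "x \<in> {a..b}"
  shows "\<bar>integral {a..b} (\<lambda>x. \<rho> x * u x) - u x\<bar> \<le> Co"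
proof -
  have one: "integral {a..b} \<rho> = 1" and ab: "b - a \<le> 1" using gp by (auto simp: good_pair_def)
  have pos: "0 < \<rho> z" for z using good_pairD(3)[OF gp] .
  have c: "continuous_on {a..b} (\<lambda>z. \<rho> z * (u z - u x))" "continuous_on {a..b} (\<lambda>z. \<rho> z * u z)" "continuous_on {a..b} \<rho>"
    by (intro continuous_intros good_pairD(2)[OF gp] lipschitz_continuous_on[OF u KB0(1)])+
  have "norm (integral {a..b} (\<lambda>z. \<rho> z * (u z - u x))) \<le> integral {a..b} (\<lambda>z. Co * \<rho> z)"
  proof (rule Henstock_Kurzweil_Integration.integral_norm_bound_integral)
    show "(\<lambda>z. \<rho> z * (u z - u x)) integrable_on {a..b}" "(\<lambda>z. Co * \<rho> z) integrable_on {a..b}"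
      by (intro integrable_continuous_real c continuous_intros)+
    fix z assume z: "z \<in> {a..b}"
    have "Co * \<bar>z - x\<bar> \<le> Co * 1" using z x ab KB0 by (intro mult_left_mono) auto
    then have "\<rho> z * \<bar>u z - u x\<bar> \<le> \<rho> z * Co" using u[of z x] pos[of z] by (intro mult_left_mono) auto
    then show "norm (\<rho> z * (u z - u x)) \<le> Co * \<rho> z" using pos[of z] by (simp add: abs_mult mult.commute)
  qed
  moreover have "integral {a..b} (\<lambda>z. \<rho> z * (u z - u x)) = 1 * integral {a..b} (\<lambda>z. \<rho> z * u z) + (- u x) * integral {a..b} \<rho>"
    using integral_lincomb[OF integrable_continuous_real[OF c(2)] integrable_continuous_real[OF c(3)], of 1 "- u x"]
    by (simp add: algebra_simps)
  ultimately show ?thesis using one by simp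
qed

end

section \<open>One iteration of a standard pair\<close>

text \<open>Both smallness conditions concern the tilt term \<open>G1 x * t0 (x, G x)\<close>,
  bounded by \<open>\<epsilon> * c1 * B\<close>. Staying below \<open>lam - 2\<close> preserves
  expansion by 2 along the curve; staying below 1/2 keeps the total mass of the approximate image
  density between 1/2 and 2.\<close>

locale pair_step = slow_fast +
  fixes \<epsilon> a b :: real and G G1 \<rho> \<rho>1 :: "real \<Rightarrow> real"
  assumes eps: "0 < \<epsilon>" "\<epsilon> * c1 * B \<le> 1 / 2" "\<epsilon> * c1 * B \<le> lam - 2"
    and ab: "\<delta> \<le> b - a" "b - a \<le> 1"
    and G: "\<And>x. (G has_real_derivative G1 x) (at x)" "continuous_on UNIV G1" "\<And>x. \<bar>G1 x\<bar> \<le> \<epsilon> * c1"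
    and \<rho>: "\<And>x. (\<rho> has_real_derivative \<rho>1 x) (at x)" "continuous_on UNIV \<rho>1" "\<And>x. 0 < \<rho> x"
      "\<And>x. \<bar>\<rho>1 x\<bar> \<le> c2 * \<rho> x" "integral {a..b} \<rho> = 1"
begin

lemma good_pair: "good_pair \<epsilon> a b G \<rho>"
  unfolding good_pair_def using ab G \<rho> by blast

lemma lt: "a < b" using ab \<delta> by linarith

definition \<kappa> where "\<kappa> = \<epsilon> * c1 * B"

lemma \<kappa>: "0 \<le> \<kappa>" "\<kappa> \<le> 1 / 2" "\<epsilon> * c1 \<le> 1" "\<epsilon> * c1 \<le> \<kappa>" "0 \<le> \<epsilon> * c1"
proof -
  have 0: "0 \<le> \<epsilon> * c1" using eps c_pos by simp
  then have "\<epsilon> * c1 * 1 \<le> \<epsilon> * c1 * B" using B1 by (intro mult_left_mono)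
  then show "\<epsilon> * c1 \<le> \<kappa>" by (simp add: \<kappa>_def)
  then show "\<epsilon> * c1 \<le> 1" "0 \<le> \<kappa>" "\<kappa> \<le> 1 / 2" "0 \<le> \<epsilon> * c1" using eps(2) 0 by (auto simp: \<kappa>_def)
qed

definition h where "h x = f (x, G x)"
definition h1 where "h1 x = f1 (x, G x) + G1 x * t0 (x, G x)"

lemma cG: "continuous_on S G" using G(1) by (rule continuous_on_UNIV_deriv)

lemma along: "continuous_on UNIV g \<Longrightarrow> continuous_on UNIV (\<lambda>x. g (x, G x))"
  by (rule continuous_partial) (auto intro!: continuous_intros cG)

lemma G1t0: "\<bar>G1 x * t0 (x, G x)\<bar> \<le> \<kappa>"
  unfolding abs_mult \<kappa>_def using G(3)[of x] bounds(4)[of "(x, G x)"] \<kappa>(5) by (intro mult_mono) auto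

sublocale H: expanding_diffeo h h1
proof
  show "(h has_real_derivative h1 x) (at x)" for x
    using partials_chain[OF f DERIV_ident G(1), of x] by (simp add: h_def[abs_def] h1_def)
  show "continuous_on UNIV h1"
    unfolding h1_def[abs_def]
    by (intro continuous_intros G(2) along partials_continuous[OF f1] partials_continuous[OF t0])
  show "2 \<le> h1 x" for x
    using G1t0[of x] lam(2)[of "(x, G x)"] eps(3) unfolding h1_def \<kappa>_def by linarith
qed

lemma h1_le: "h1 x \<le> 2 * B"
  using G1t0[of x] bounds(1)[of "(x, G x)"] \<kappa>(2) B1 unfolding h1_def by linarith

lemma f1_pos: "0 < f1 z" "2 \<le> f1 z" using f1_ge[of z] by auto

lemma ratio: "\<bar>h1 x / f1 (x, G x) - 1\<bar> \<le> \<kappa> / 2"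
proof -
  have "h1 x / f1 (x, G x) - 1 = G1 x * t0 (x, G x) / f1 (x, G x)"
    using f1_nz[of "(x, G x)"] by (simp add: h1_def field_simps)
  also have "\<bar>\<dots>\<bar> \<le> \<kappa> / 2"
    unfolding abs_divide using G1t0[of x] f1_pos[of "(x, G x)"] \<kappa>(1) by (intro frac_le) auto
  finally show ?thesis .
qed

text \<open>The image density should be divided by \<open>h1\<close>. Dividing by the partial derivative \<open>f1\<close> instead
  costs a factor \<open>1 + O(\<epsilon>)\<close>, but only first derivatives of \<open>G\<close> enter its logarithmic derivative.\<close>

definition s where "s x = \<rho> x / f1 (x, G x)"
definition s1 where "s1 x = (\<rho>1 x * f1 (x, G x) - \<rho> x * (f2 (x, G x) + G1 x * e1 (x, G x))) / (f1 (x, G x))\<^sup>2"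
definition w where "w y = s (H.hinv y)"
definition w1 where "w1 y = s1 (H.hinv y) / h1 (H.hinv y)"
definition G' where "G' y = G (H.hinv y) + \<epsilon> * \<omega> (H.hinv y, G (H.hinv y))"
definition G'1 where "G'1 y = (G1 (H.hinv y) + \<epsilon> * (\<omega>1 (H.hinv y, G (H.hinv y)) + G1 (H.hinv y) * \<omega>2 (H.hinv y, G (H.hinv y)))) / h1 (H.hinv y)"

lemma s_pos: "0 < s x" using \<rho>(3)[of x] f1_pos[of "(x, G x)"] by (simp add: s_def)

lemma s_deriv: "(s has_real_derivative s1 x) (at x)"
proof -
  have "((\<lambda>x. f1 (x, G x)) has_real_derivative 1 * f2 (x, G x) + G1 x * e1 (x, G x)) (at x)"
    by (rule partials_chain[OF f1 DERIV_ident G(1)])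
  from DERIV_divide[OF \<rho>(1) this f1_nz] show ?thesis
    unfolding s_def[abs_def] s1_def by (simp add: power2_eq_square)
qed

lemma s1_bound: "\<bar>s1 x\<bar> \<le> s x * (c2 + B)"
proof -
  define u where "u = f1 (x, G x)"
  define v where "v = f2 (x, G x) + G1 x * e1 (x, G x)"
  have u: "2 \<le> u" using f1_pos unfolding u_def by blast
  have "\<bar>G1 x * e1 (x, G x)\<bar> \<le> 1 * B"
    unfolding abs_mult using G(3)[of x] \<kappa>(3) bounds(7)[of "(x, G x)"] by (intro mult_mono) auto
  then have v: "\<bar>v\<bar> \<le> 2 * B" using bounds(2)[of "(x, G x)"] unfolding v_def by linarith
  have "\<bar>\<rho>1 x * u - \<rho> x * v\<bar> \<le> c2 * \<rho> x * u + \<rho> x * (2 * B)"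
  proof (rule order.trans[OF abs_triangle_ineq4 add_mono])
    show "\<bar>\<rho>1 x * u\<bar> \<le> c2 * \<rho> x * u" unfolding abs_mult using \<rho>(4)[of x] u by (intro mult_mono) auto
    show "\<bar>\<rho> x * v\<bar> \<le> \<rho> x * (2 * B)" unfolding abs_mult using \<rho>(3)[of x] v by (intro mult_mono) auto
  qed
  also have "\<dots> \<le> c2 * \<rho> x * u + \<rho> x * (u * B)"
    using u \<rho>(3)[of x] B0 by (intro add_left_mono mult_left_mono mult_right_mono) auto
  finally have "\<bar>\<rho>1 x * u - \<rho> x * v\<bar> \<le> \<rho> x * u * (c2 + B)" by (simp add: algebra_simps)
  then have "\<bar>\<rho>1 x * u - \<rho> x * v\<bar> / u\<^sup>2 \<le> \<rho> x * u * (c2 + B) / u\<^sup>2" by (rule divide_right_mono) simp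
  also have "\<rho> x * u * (c2 + B) / u\<^sup>2 = \<rho> x / u * (c2 + B)" using u by (simp add: power2_eq_square)
  finally show ?thesis unfolding s1_def s_def u_def v_def by (simp add: abs_divide)
qed

lemma w_deriv: "(w has_real_derivative w1 y) (at y)"
  using DERIV_chain2[OF s_deriv H.deriv_hinv, of y] unfolding w_def[abs_def] w1_def by simp

lemma w_pos: "0 < w y" unfolding w_def by (rule s_pos)

lemma cw: "continuous_on S w" using w_deriv by (rule continuous_on_UNIV_deriv)

lemma inv_along: "continuous_on UNIV g \<Longrightarrow> continuous_on UNIV (\<lambda>y. g (H.hinv y))"
  by (rule continuous_on_compose2[OF _ H.continuous_hinv]) auto

lemma h1_nz: "h1 x \<noteq> 0" using H.ge2[of x] by auto

lemma w1_cont: "continuous_on UNIV w1"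
proof -
  have "continuous_on UNIV s1"
    unfolding s1_def[abs_def]
    by (intro continuous_intros along partials_continuous[OF f1] partials_continuous[OF f2] \<rho>(2) G(2) cont_e1
        continuous_on_UNIV_deriv[OF \<rho>(1)]) (simp add: f1_nz)
  then show ?thesis unfolding w1_def[abs_def]
    by (intro continuous_intros inv_along H.cont1) (simp_all add: h1_nz)
qed

lemma w1_bound: "\<bar>w1 y\<bar> \<le> c2 * w y"
proof -
  define x where "x = H.hinv y"
  have "\<bar>w1 y\<bar> \<le> (s x * (c2 + B)) / 2"
    unfolding w1_def abs_divide x_def[symmetric] using s1_bound[of x] H.ge2[of x] s_pos[of x] c_pos B0
    by (intro frac_le) (auto simp: mult_nonneg_nonneg less_imp_le)
  also have "\<dots> \<le> (s x * (2 * c2)) / 2"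
    using s_pos[of x] c B0 by (intro divide_right_mono mult_left_mono) (auto simp: less_imp_le)
  finally show ?thesis by (simp add: w_def x_def mult.commute)
qed

lemma G'_deriv: "(G' has_real_derivative G'1 y) (at y)"
proof -
  have "((\<lambda>x. G x + \<epsilon> * \<omega> (x, G x)) has_real_derivative G1 x + \<epsilon> * (1 * \<omega>1 (x, G x) + G1 x * \<omega>2 (x, G x))) (at x)" for x
    by (intro DERIV_add DERIV_cmult partials_chain[OF \<omega>(1) DERIV_ident] G(1))
  from DERIV_chain2[OF this H.deriv_hinv, of y] show ?thesis
    unfolding G'_def[abs_def] G'1_def by simp
qed

lemma G'1_cont: "continuous_on UNIV G'1"
proof -
  have "continuous_on UNIV (\<lambda>x. (G1 x + \<epsilon> * (\<omega>1 (x, G x) + G1 x * \<omega>2 (x, G x))) / h1 x)"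
    by (intro continuous_intros along G(2) \<omega>(2,3) H.cont1) (simp add: h1_nz)
  from inv_along[OF this] show ?thesis unfolding G'1_def[abs_def] .
qed

lemma G'1_bound: "\<bar>G'1 y\<bar> \<le> \<epsilon> * c1"
proof -
  define x where "x = H.hinv y"
  have 1: "\<bar>G1 x * \<omega>2 (x, G x)\<bar> \<le> 1 * B"
    unfolding abs_mult using G(3)[of x] \<kappa>(3) \<omega>(6)[of "(x, G x)"] by (intro mult_mono) auto
  have "\<bar>\<omega>1 (x, G x) + G1 x * \<omega>2 (x, G x)\<bar> \<le> 2 * B"
    using 1 \<omega>(5)[of "(x, G x)"] by linarith
  then have "\<bar>\<epsilon> * (\<omega>1 (x, G x) + G1 x * \<omega>2 (x, G x))\<bar> \<le> \<epsilon> * c1"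
    unfolding abs_mult using eps(1) c(1) by (intro mult_mono) auto
  then have "\<bar>G1 x + \<epsilon> * (\<omega>1 (x, G x) + G1 x * \<omega>2 (x, G x))\<bar> \<le> 2 * (\<epsilon> * c1)"
    using G(3)[of x] by linarith
  then have "\<bar>G'1 y\<bar> \<le> 2 * (\<epsilon> * c1) / 2"
    unfolding G'1_def abs_divide x_def[symmetric] using H.ge2[of x] \<kappa>(5) by (intro frac_le) auto
  then show ?thesis by simp
qed

section \<open>Cutting the image into pieces of admissible length\<close>

definition L where "L = h b - h a"
definition n where "n = nat \<lceil>L\<rceil>"
definition sp where "sp = L / real n"
definition y where "y i = h a + real i * sp"
definition W where "W i = integral {y i..y (Suc i)} w"
definition r where "r i z = w z / W i"
definition Wt where "Wt = (\<Sum>i<n. W i)"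

lemma L: "2 * \<delta> \<le> L" "L \<le> 2 * B" "0 < L"
proof -
  have "2 * \<delta> \<le> 2 * (b - a)" using ab(1) by simp
  then show "2 * \<delta> \<le> L" using H.growth[OF less_imp_le[OF lt]] unfolding L_def by (rule order.trans)
  then show "0 < L" using \<delta> by linarith
  obtain z where "h b - h a = (b - a) * h1 z" using MVT2[OF lt, of h h1] H.deriv by auto
  also have "\<dots> \<le> 1 * (2 * B)" using ab lt h1_le[of z] H.ge2[of z] by (intro mult_mono) auto
  finally show "L \<le> 2 * B" by (simp add: L_def)
qed

lemma n: "0 < n" "L \<le> real n" "real n < L + 1"
  unfolding n_def using L(3) by linarith+

text \<open>The pieces are equal and as few as the bound 1 permits. A short image stays in one
  piece, of length at least \<open>2 * \<delta>\<close>; otherwise the number of pieces is below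
  twice the length, so each is longer than 1/2.\<close>

lemma sp: "\<delta> \<le> sp" "sp \<le> 1" "0 < sp"
proof -
  show "sp \<le> 1" unfolding sp_def using n by (simp add: divide_le_eq)
  show "\<delta> \<le> sp"
  proof (cases "L \<le> 1")
    case True
    then have "n = 1" using n by linarith
    then show ?thesis using L \<delta> by (simp add: sp_def)
  next
    case False
    then have "real n * (1 / 2) \<le> L" using n by linarith
    then have "1 / 2 \<le> sp" unfolding sp_def using n by (simp add: field_simps)
    then show ?thesis using \<delta> by linarith
  qed
  then show "0 < sp" using \<delta> by linarith
qed

lemma y_n: "y n = h b" "y 0 = h a"
  using n(1) by (simp_all add: y_def sp_def L_def)

lemma y_Suc: "y (Suc i) = y i + sp" by (simp add: y_def algebra_simps)

lemma y_mono: "i \<le> j \<Longrightarrow> y i \<le> y j"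
  unfolding y_def using sp(3) by (simp add: mult_right_mono)

lemma y_range: "i < n \<Longrightarrow> z \<in> {y i..y (Suc i)} \<Longrightarrow> z \<in> {h a..h b}"
  using y_mono[of 0 i] y_mono[of "Suc i" n] y_n by auto

lemma W_pos: "0 < W i"
  unfolding W_def using sp(3) w_pos by (intro integral_pos_cont cw) (auto simp: y_Suc)

lemma r_integral: "W i * integral {y i..y (Suc i)} (\<lambda>z. r i z * \<phi> z) = integral {y i..y (Suc i)} (\<lambda>z. w z * \<phi> z)"
proof -
  have "(\<lambda>z. w z * \<phi> z) = (\<lambda>z. W i * (r i z * \<phi> z))"
    using W_pos[of i] by (simp add: r_def fun_eq_iff)
  then show ?thesis by simp
qed

lemma child_good_pair: "good_pair \<epsilon> (y i) (y (Suc i)) G' (r i)"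
  unfolding good_pair_def
proof (intro conjI exI allI)
  show "\<delta> \<le> y (Suc i) - y i" "y (Suc i) - y i \<le> 1" using sp by (auto simp: y_Suc)
  show "(G' has_real_derivative G'1 x) (at x)" for x by (rule G'_deriv)
  show "continuous_on UNIV G'1" by (rule G'1_cont)
  show "\<bar>G'1 x\<bar> \<le> \<epsilon> * c1" for x by (rule G'1_bound)
  show "(r i has_real_derivative w1 x / W i) (at x)" for x
    unfolding r_def[abs_def] by (rule DERIV_cdivide[OF w_deriv])
  show "continuous_on UNIV (\<lambda>x. w1 x / W i)"
    using W_pos[of i] by (intro continuous_intros w1_cont) auto
  show "0 < r i x" for x using w_pos W_pos by (simp add: r_def)
  show "\<bar>w1 x / W i\<bar> \<le> c2 * r i x" for x
    using w1_bound[of x] W_pos[of i] by (simp add: r_def abs_divide divide_right_mono)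
  have "integral {y i..y (Suc i)} (r i) = integral {y i..y (Suc i)} w / W i"
    unfolding r_def[abs_def] by simp
  then show "integral {y i..y (Suc i)} (r i) = 1" using W_pos[of i] by (simp add: W_def)
qed

lemma pieces:
  assumes "\<phi> \<in> borel_measurable borel" "\<And>z. \<bar>\<phi> z\<bar> \<le> S"
  shows "integral {h a..h b} (\<lambda>z. w z * \<phi> z) = (\<Sum>i<n. W i * integral {y i..y (Suc i)} (\<lambda>z. r i z * \<phi> z))"
proof -
  have hb: "h b = h a + real n * sp" using y_n by (simp add: y_def)
  have "integral {h a..h a + real n * sp} (\<lambda>z. w z * \<phi> z) =
      (\<Sum>i<n. integral {h a + real i * sp..h a + real (Suc i) * sp} (\<lambda>z. w z * \<phi> z))"
    by (rule integral_pieces[OF integrable_cont_mult[OF cw assms]]) (use sp in auto)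
  then show ?thesis unfolding r_integral hb by (simp add: y_def)
qed

lemma change:
  assumes "\<phi> \<in> borel_measurable borel" "\<And>z. \<bar>\<phi> z\<bar> \<le> S"
  shows "integral {h a..h b} (\<lambda>z. w z * \<phi> z) = integral {a..b} (\<lambda>x. \<rho> x * (h1 x / f1 (x, G x)) * \<phi> (h x))"
proof -
  have cs: "continuous_on {a..b} (\<lambda>x. s x * h1 x)"
    by (intro continuous_intros continuous_on_UNIV_deriv[OF s_deriv] continuous_on_subset[OF H.cont1]) auto
  have "integral {a..b} (\<lambda>x. s x * h1 x * \<phi> (h x)) = integral {h a..h b} (\<lambda>z. s (H.hinv z) * h1 (H.hinv z) / h1 (H.hinv z) * \<phi> z)"
    by (rule H.integral_push[OF _ cs assms]) (use lt in simp)
  then show ?thesis by (simp add: w_def s_def h1_nz)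
qed

lemma cont_ratio: "continuous_on T (\<lambda>x. \<rho> x * (h1 x / f1 (x, G x)))"
  by (rule continuous_on_subset[OF _ subset_UNIV])
    (intro continuous_intros continuous_on_UNIV_deriv[OF \<rho>(1)] H.cont1 along partials_continuous[OF f1]; simp add: f1_nz)

lemma c\<rho>: "continuous_on T \<rho>" using \<rho>(1) by (rule continuous_on_UNIV_deriv)

text \<open>Two bounds are kept apart: \<open>S'\<close> holds globally and serves integrability,
  whereas only the bound \<open>S\<close> on the pair enters the estimate.\<close>

lemma ratio_integral:
  assumes "\<phi> \<in> borel_measurable borel" "\<And>z. \<bar>\<phi> z\<bar> \<le> S'" "\<And>z. z \<in> {a..b} \<Longrightarrow> \<bar>\<phi> z\<bar> \<le> S"
  shows "\<bar>integral {a..b} (\<lambda>x. \<rho> x * (h1 x / f1 (x, G x)) * \<phi> x) - integral {a..b} (\<lambda>x. \<rho> x * \<phi> x)\<bar> \<le> \<kappa> * S"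
proof -
  have i: "(\<lambda>x. \<rho> x * (h1 x / f1 (x, G x)) * \<phi> x) integrable_on {a..b}" "(\<lambda>x. \<rho> x * \<phi> x) integrable_on {a..b}"
    using integrable_cont_mult[OF cont_ratio assms(1,2)] integrable_cont_mult[OF c\<rho> assms(1,2)] by auto
  have "norm (integral {a..b} (\<lambda>x. \<rho> x * (h1 x / f1 (x, G x)) * \<phi> x - \<rho> x * \<phi> x)) \<le> integral {a..b} (\<lambda>x. \<kappa> * S * \<rho> x)"
  proof (rule Henstock_Kurzweil_Integration.integral_norm_bound_integral)
    show "(\<lambda>x. \<rho> x * (h1 x / f1 (x, G x)) * \<phi> x - \<rho> x * \<phi> x) integrable_on {a..b}"
      by (rule Henstock_Kurzweil_Integration.integrable_diff[OF i])
    show "(\<lambda>x. \<kappa> * S * \<rho> x) integrable_on {a..b}" by (intro integrable_continuous_real continuous_intros c\<rho>)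
    fix x assume x: "x \<in> {a..b}"
    have "\<bar>h1 x / f1 (x, G x) - 1\<bar> * \<bar>\<phi> x\<bar> \<le> \<kappa> * S"
      using ratio[of x] assms(3)[OF x] \<kappa>(1) by (intro mult_mono) auto
    then have "\<rho> x * (\<bar>h1 x / f1 (x, G x) - 1\<bar> * \<bar>\<phi> x\<bar>) \<le> \<rho> x * (\<kappa> * S)"
      using \<rho>(3)[of x] by (intro mult_left_mono) auto
    moreover have "\<rho> x * (h1 x / f1 (x, G x)) * \<phi> x - \<rho> x * \<phi> x = \<rho> x * ((h1 x / f1 (x, G x) - 1) * \<phi> x)"
      by (simp add: algebra_simps)
    ultimately show "norm (\<rho> x * (h1 x / f1 (x, G x)) * \<phi> x - \<rho> x * \<phi> x) \<le> \<kappa> * S * \<rho> x"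
      using \<rho>(3)[of x] by (simp add: abs_mult mult_ac)
  qed
  then show ?thesis using Henstock_Kurzweil_Integration.integral_diff[OF i] \<rho>(5) by simp
qed

lemma Wt_eq: "Wt = integral {a..b} (\<lambda>x. \<rho> x * (h1 x / f1 (x, G x)))"
proof -
  have "integral {h a..h b} (\<lambda>z. w z * 1) = (\<Sum>i<n. integral {y i..y (Suc i)} (\<lambda>z. w z * 1))"
    using pieces[of "\<lambda>_. 1" 1] unfolding r_integral by simp
  then show ?thesis using change[of "\<lambda>_. 1" 1] by (simp add: Wt_def W_def)
qed

lemma Wt: "\<bar>Wt - 1\<bar> \<le> \<kappa>" "1 / 2 \<le> Wt" "Wt \<le> 2"
proof -
  show "\<bar>Wt - 1\<bar> \<le> \<kappa>" using ratio_integral[of "\<lambda>_. 1" 1 1] \<rho>(5) by (simp add: Wt_eq)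
  then show "1 / 2 \<le> Wt" "Wt \<le> 2" using \<kappa>(2) by linarith+
qed

text \<open>For a nonnegative function the density error is paid by a factor: \<open>h1 / f1\<close>
  is at least \<open>1 - \<kappa> / 2\<close>, and
  \<open>(1 + \<kappa>) * (1 - \<kappa> / 2) \<ge> 1\<close> because
  \<open>\<kappa> \<le> 1\<close>.\<close>

lemma push_upper:
  assumes "\<phi> \<in> borel_measurable borel" "\<And>z. \<bar>\<phi> z\<bar> \<le> S" "\<And>z. 0 \<le> \<phi> z"
  shows "integral {a..b} (\<lambda>x. \<rho> x * \<phi> (h x)) \<le> (1 + \<kappa>) * (\<Sum>i<n. W i * integral {y i..y (Suc i)} (\<lambda>z. r i z * \<phi> z))"
proof -
  have m: "(\<lambda>x. \<phi> (h x)) \<in> borel_measurable borel" using measurable_compose[OF H.borel_measurable_h assms(1)] .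
  have i: "(\<lambda>x. \<rho> x * (h1 x / f1 (x, G x)) * \<phi> (h x)) integrable_on {a..b}"
    by (rule integrable_cont_mult[OF cont_ratio m assms(2)])
  have "integral {a..b} (\<lambda>x. \<rho> x * \<phi> (h x)) \<le> integral {a..b} (\<lambda>x. (1 + \<kappa>) * (\<rho> x * (h1 x / f1 (x, G x)) * \<phi> (h x)))"
  proof (rule integral_le[OF integrable_cont_mult[OF c\<rho> m assms(2)] integrable_on_mult_right[OF i]])
    fix x
    have "1 - \<kappa> / 2 \<le> h1 x / f1 (x, G x)" using ratio[of x] by linarith
    then have "(1 + \<kappa>) * (1 - \<kappa> / 2) \<le> (1 + \<kappa>) * (h1 x / f1 (x, G x))" using \<kappa>(1) by (intro mult_left_mono) auto
    moreover have "1 \<le> (1 + \<kappa>) * (1 - \<kappa> / 2)"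
      using mult_left_mono[of \<kappa> 1 \<kappa>] \<kappa> by (simp add: algebra_simps)
    ultimately have "1 \<le> (1 + \<kappa>) * (h1 x / f1 (x, G x))" by linarith
    then have "\<rho> x * \<phi> (h x) * 1 \<le> \<rho> x * \<phi> (h x) * ((1 + \<kappa>) * (h1 x / f1 (x, G x)))"
      using \<rho>(3)[of x] assms(3)[of "h x"] by (intro mult_left_mono) auto
    then show "\<rho> x * \<phi> (h x) \<le> (1 + \<kappa>) * (\<rho> x * (h1 x / f1 (x, G x)) * \<phi> (h x))"
      by (simp only: mult_ac mult_1_right)
  qed
  then show ?thesis
    unfolding pieces[OF assms(1,2), symmetric] change[OF assms(1,2)] by (simp only: integral_mult_right)
qed

section \<open>Comparison with the map frozen at the left end of the pair\<close>

lemma G_near: "x \<in> {a..b} \<Longrightarrow> \<bar>G x - G a\<bar> \<le> \<epsilon> * c1"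
proof -
  assume x: "x \<in> {a..b}"
  have "\<bar>G x - G a\<bar> \<le> \<epsilon> * c1 * \<bar>x - a\<bar>" by (rule lipschitz_of_deriv_bound[OF G(1,3)])
  also have "\<dots> \<le> \<epsilon> * c1 * 1" using x ab \<kappa>(5) by (intro mult_left_mono) auto
  finally show ?thesis by simp
qed

lemma f1_lipschitz: "\<bar>f1 (x, t) - f1 (x', t')\<bar> \<le> B * \<bar>x - x'\<bar> + B * \<bar>t - t'\<bar>"
proof -
  have "\<bar>f1 (x, t) - f1 (x', t)\<bar> \<le> B * \<bar>x - x'\<bar>"
    by (rule lipschitz_of_deriv_bound[OF partials_x[OF f1] bounds(2)])
  moreover have "\<bar>f1 (x', t) - f1 (x', t')\<bar> \<le> B * \<bar>t - t'\<bar>"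
    by (rule lipschitz_of_deriv_bound[OF partials_theta[OF f1] bounds(7)])
  ultimately show ?thesis by linarith
qed

lemma f_lipschitz_theta: "\<bar>f (x, t) - f (x, t')\<bar> \<le> B * \<bar>t - t'\<bar>"
  by (rule lipschitz_of_deriv_bound[OF partials_theta[OF f] bounds(4)])

lemma \<rho>_lipschitz:
  assumes "x \<in> {a..b}" "x' \<in> {a..b}" shows "\<bar>\<rho> x - \<rho> x'\<bar> \<le> c2 * Rs * \<bar>x - x'\<bar>"
proof -
  have "norm (\<rho> x - \<rho> x') \<le> c2 * Rs * norm (x - x')"
  proof (rule field_differentiable_bound[of "{a..b}"])
    fix z assume z: "z \<in> {a..b}"
    show "(\<rho> has_field_derivative \<rho>1 z) (at z within {a..b})" by (rule has_field_derivative_at_within[OF \<rho>(1)])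
    have "\<rho> z \<le> Rs" using good_pairD(5)[OF good_pair, of z] z by simp
    then have "c2 * \<rho> z \<le> c2 * Rs" using c_pos by (intro mult_left_mono) auto
    then show "norm (\<rho>1 z) \<le> c2 * Rs" using \<rho>(4)[of z] by simp
  qed (use assms in auto)
  then show ?thesis by simp
qed

text \<open>Compares the image of the pair with that under the map frozen at \<open>G a\<close>: this shifts
  the correlation potential by one index.\<close>

lemma frozen_density:
  assumes x: "x \<in> {a..b}" "x' \<in> {a..b}" and eq: "f (x, G x) = f (x', G a)"
  shows "\<bar>\<rho> x / f1 (x, G x) - \<rho> x' / f1 (x', G a)\<bar> \<le> \<epsilon> * KW"
proof -
  interpret F: expanding_map "fz (G a)" "\<lambda>x. f1 (x, G a)" B by (rule expanding_map)
  define d where "d = \<epsilon> * c1"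
  have d: "0 \<le> d" "\<bar>G x - G a\<bar> \<le> d" using \<kappa>(5) G_near[OF x(1)] by (auto simp: d_def)
  have "2 * \<bar>x - x'\<bar> \<le> \<bar>f (x, G a) - f (x', G a)\<bar>" using F.abs_growth[of x x'] by simp
  also have "\<dots> = \<bar>f (x, G a) - f (x, G x)\<bar>" using eq by simp
  also have "\<dots> \<le> B * \<bar>G a - G x\<bar>" by (rule f_lipschitz_theta)
  also have "\<dots> \<le> B * d" using d B0 by (intro mult_left_mono) (auto simp: abs_minus_commute)
  finally have dx: "\<bar>x - x'\<bar> \<le> B * d / 2" by simp
  have u: "2 \<le> f1 (x, G x)" "2 \<le> f1 (x', G a)" using f1_pos by blast+
  have rx': "0 < \<rho> x'" "\<rho> x' \<le> Rs" using \<rho>(3) good_pairD(5)[OF good_pair, of x'] x by auto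
  have 1: "\<bar>(\<rho> x - \<rho> x') / f1 (x, G x)\<bar> \<le> (c2 * Rs * (B * d / 2)) / 2"
    unfolding abs_divide
  proof (rule frac_le)
    show "\<bar>\<rho> x - \<rho> x'\<bar> \<le> c2 * Rs * (B * d / 2)"
      by (rule order.trans[OF \<rho>_lipschitz[OF x] mult_left_mono[OF dx]]) (use c_pos Rs0 in auto)
  qed (use u d c_pos Rs0 B0 in auto)
  have 2: "\<bar>\<rho> x' * ((f1 (x', G a) - f1 (x, G x)) / (f1 (x, G x) * f1 (x', G a)))\<bar> \<le> Rs * ((B * (B * d / 2) + B * d) / 4)"
    unfolding abs_mult abs_divide
  proof (intro mult_mono frac_le)
    show "\<bar>\<rho> x'\<bar> \<le> Rs" using rx' by simp
    have "\<bar>f1 (x', G a) - f1 (x, G x)\<bar> \<le> B * \<bar>x' - x\<bar> + B * \<bar>G a - G x\<bar>" by (rule f1_lipschitz)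
    also have "\<dots> \<le> B * (B * d / 2) + B * d"
      using dx d(2) B0 by (intro add_mono mult_left_mono) (auto simp: abs_minus_commute)
    finally show "\<bar>f1 (x', G a) - f1 (x, G x)\<bar> \<le> B * (B * d / 2) + B * d" .
    show "4 \<le> \<bar>f1 (x, G x)\<bar> * \<bar>f1 (x', G a)\<bar>" using mult_mono[OF u] u by simp
  qed (use Rs0 B0 d in auto)
  have "\<rho> x / f1 (x, G x) - \<rho> x' / f1 (x', G a) =
     (\<rho> x - \<rho> x') / f1 (x, G x) + \<rho> x' * ((f1 (x', G a) - f1 (x, G x)) / (f1 (x, G x) * f1 (x', G a)))"
    using f1_nz by (simp add: field_simps)
  then have "\<bar>\<rho> x / f1 (x, G x) - \<rho> x' / f1 (x', G a)\<bar> \<le> (c2 * Rs * (B * d / 2)) / 2 + Rs * ((B * (B * d / 2) + B * d) / 4)"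
    using order.trans[OF abs_triangle_ineq add_mono[OF 1 2]] by simp
  also have "\<dots> = Rs * B * d * (c2 / 4 + B / 8 + 1 / 4)" by (simp add: field_simps)
  also have "\<dots> \<le> Rs * B * d * (c2 + B + 1)"
    using Rs0 B0 d(1) c_pos by (intro mult_left_mono) auto
  finally show ?thesis by (simp add: KW_def d_def mult_ac)
qed

text \<open>Freezing at the left end makes the two images start at the same point. Their right ends
  differ by O(\<epsilon>), and on the overlap \<open>frozen_density\<close> compares the
  densities.\<close>

lemma frozen_compare:
  assumes phi: "\<phi> \<in> borel_measurable borel" "\<And>z. \<bar>\<phi> z\<bar> \<le> S"
  shows "\<bar>integral {h a..h b} (\<lambda>z. w z * \<phi> z) - integral {a..b} (\<lambda>x. \<rho> x * \<phi> (f (x, G a)))\<bar> \<le> \<epsilon> * K7 * S"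
proof -
  interpret F: expanding_map "fz (G a)" "\<lambda>x. f1 (x, G a)" B by (rule expanding_map)
  define v where "v z = \<rho> (F.hinv z) / f1 (F.hinv z, G a)" for z
  have fa: "f (a, G a) = h a" by (simp add: h_def)
  have S0: "0 \<le> S" using phi(2)[of 0] by linarith
  have "integral {a..b} (\<lambda>x. \<rho> x * \<phi> (f (x, G a))) = integral {h a..f (b, G a)} (\<lambda>z. v z * \<phi> z)"
    using F.integral_push[OF _ c\<rho> phi, of a b] lt fa by (simp add: v_def)
  moreover have "\<bar>integral {h a..h b} (\<lambda>z. w z * \<phi> z) - integral {h a..f (b, G a)} (\<lambda>z. v z * \<phi> z)\<bar>
     \<le> (\<epsilon> * KW * (2 * B) + Rs * \<bar>h b - f (b, G a)\<bar>) * S"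
  proof (rule integral_diff_le)
    show "continuous_on {h a..h b} w" by (rule cw)
    show "continuous_on {h a..f (b, G a)} v"
      unfolding v_def[abs_def] fa[symmetric] by (rule F.continuous_push[OF c\<rho>])
    show "h a \<le> h b" using L unfolding L_def by linarith
    show "h a \<le> f (b, G a)" using F.h_le_iff[of a b] lt fa by simp
    show "min (h b) (f (b, G a)) - h a \<le> 2 * B" using L(2) unfolding L_def by linarith
    show "0 \<le> \<epsilon> * KW" using eps K7 by simp
    show "\<bar>w z - v z\<bar> \<le> \<epsilon> * KW" if z: "h a \<le> z" "z \<le> h b" "z \<le> f (b, G a)" for z
    proof -
      have 1: "H.hinv z \<in> {a..b}" using H.hinv_image[of z a b] z by simp
      have 2: "F.hinv z \<in> {a..b}" using F.hinv_image[of z a b] z fa by simp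
      have "f (H.hinv z, G (H.hinv z)) = f (F.hinv z, G a)"
        using H.h_hinv[of z] F.h_hinv[of z] by (simp add: h_def)
      from frozen_density[OF 1 2 this] show ?thesis by (simp add: w_def s_def v_def)
    qed
    have le: "\<bar>\<rho> x / f1 (x, t)\<bar> \<le> Rs" if "x \<in> {a..b}" for x t
    proof -
      have "\<bar>\<rho> x / f1 (x, t)\<bar> \<le> Rs / 1"
        unfolding abs_divide using \<rho>(3)[of x] good_pairD(5)[OF good_pair, of x] that f1_pos[of "(x, t)"] Rs0
        by (intro frac_le) auto
      then show ?thesis by simp
    qed
    show "\<bar>w z\<bar> \<le> Rs" if "z \<in> {h a..h b}" for z
      unfolding w_def s_def by (rule le[OF H.hinv_image[OF that]])
    show "\<bar>v z\<bar> \<le> Rs" if "z \<in> {h a..f (b, G a)}" for z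
      unfolding v_def by (rule le[OF F.hinv_image]) (use that fa in simp)
  qed (rule phi)+
  moreover have "(\<epsilon> * KW * (2 * B) + Rs * \<bar>h b - f (b, G a)\<bar>) * S \<le> \<epsilon> * K7 * S"
  proof (rule mult_right_mono[OF _ S0])
    have "\<bar>h b - f (b, G a)\<bar> \<le> B * \<bar>G b - G a\<bar>" unfolding h_def by (rule f_lipschitz_theta)
    also have "\<dots> \<le> B * (\<epsilon> * c1)" using G_near[of b] lt B0 by (intro mult_left_mono) auto
    finally have "Rs * \<bar>h b - f (b, G a)\<bar> \<le> Rs * (B * (\<epsilon> * c1))" using Rs0 by (intro mult_left_mono) auto
    then show "\<epsilon> * KW * (2 * B) + Rs * \<bar>h b - f (b, G a)\<bar> \<le> \<epsilon> * K7"
      unfolding K7_def by (simp add: algebra_simps)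
  qed
  ultimately show ?thesis by simp
qed

lemma G'_near: "i \<le> n \<Longrightarrow> \<bar>G' (y i) - G a\<bar> \<le> \<epsilon> * (c1 + B)"
proof -
  assume i: "i \<le> n"
  have "y i \<in> {h a..h b}" using y_mono[of 0 i] y_mono[OF i] y_n by auto
  then have "H.hinv (y i) \<in> {a..b}" by (rule H.hinv_image)
  then have 1: "\<bar>G (H.hinv (y i)) - G a\<bar> \<le> \<epsilon> * c1" by (rule G_near)
  have 2: "\<bar>\<epsilon> * \<omega> z\<bar> \<le> \<epsilon> * B" for z
    unfolding abs_mult using eps(1) \<omega>(4)[of z] by (intro mult_mono) auto
  have eq: "G' (y i) - G a = (G (H.hinv (y i)) - G a) + \<epsilon> * \<omega> (H.hinv (y i), G (H.hinv (y i)))" by (simp add: G'_def)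
  have "\<bar>G' (y i) - G a\<bar> \<le> \<epsilon> * c1 + \<epsilon> * B"
    unfolding eq by (rule order.trans[OF abs_triangle_ineq add_mono[OF 1 2]])
  then show ?thesis by (simp add: algebra_simps)
qed

text \<open>The potential of a child is frozen at the height of the child. Returning to the height
  of the parent, at distance O(\<epsilon>), changes each of the M correlations by O(\<epsilon> M),
  which is the origin of the \<epsilon> M^2 in all later errors.\<close>

lemma child_potential:
  assumes i: "i < n"
  shows "Hp M (G' (y i)) (y i) (y (Suc i)) (r i) \<le>
    (\<Sum>k<M. integral {y i..y (Suc i)} (\<lambda>z. r i z * \<psi> (G a) k z)) + KF * (c1 + B) * (\<epsilon> * (real M)\<^sup>2)"
proof -
  define l where "l \<phi> = integral {y i..y (Suc i)} (\<lambda>z. r i z * \<phi> z)" for \<phi>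
  have l: "averaging l" "var1 Vp l" unfolding l_def[abs_def] by (rule good_pairD(6,7)[OF child_good_pair])+
  have "Hp M (G' (y i)) (y i) (y (Suc i)) (r i) - (\<Sum>k<M. l (\<psi> (G a) k)) = (\<Sum>k<M. l (\<psi> (G' (y i)) k) - l (\<psi> (G a) k))"
    by (simp add: Hp_def l_def sum_subtractf)
  also have "\<dots> \<le> (\<Sum>k<M. KF * real M * (\<epsilon> * (c1 + B)))"
  proof (rule sum_mono)
    fix k assume k: "k \<in> {..<M}"
    have "l (\<psi> (G' (y i)) k) - l (\<psi> (G a) k) \<le> KF * (1 + real k) * \<bar>G' (y i) - G a\<bar>"
      using averaging_\<psi>_lipschitz[OF l, of "G' (y i)" k "G a"] by linarith
    also have "\<dots> \<le> KF * real M * (\<epsilon> * (c1 + B))"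
      using k KF0 G'_near[of i] i by (intro mult_mono) auto
    finally show "l (\<psi> (G' (y i)) k) - l (\<psi> (G a) k) \<le> KF * real M * (\<epsilon> * (c1 + B))" .
  qed
  also have "\<dots> = KF * (c1 + B) * (\<epsilon> * (real M)\<^sup>2)" by (simp add: power2_eq_square mult_ac)
  finally show ?thesis by (simp add: l_def)
qed

lemma potential_sum:
  "(\<Sum>i<n. W i * Hp M (G' (y i)) (y i) (y (Suc i)) (r i)) \<le>
    Hp M (G a) a b \<rho> - integral {a..b} (\<lambda>x. \<rho> x * \<alpha>h (x, G a)) + Cd * rate ^ M +
    2 * B * K7 * (\<epsilon> * real M) + 2 * (KF * (c1 + B)) * (\<epsilon> * (real M)\<^sup>2)"
proof -
  define T where "T k = integral {a..b} (\<lambda>x. \<rho> x * \<psi> (G a) k x)" for k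
  define D where "D = KF * (c1 + B) * (\<epsilon> * (real M)\<^sup>2)"
  have D0: "0 \<le> D" using KF0 c_pos B0 eps by (simp add: D_def)
  have "(\<Sum>i<n. W i * Hp M (G' (y i)) (y i) (y (Suc i)) (r i)) \<le>
     (\<Sum>i<n. W i * ((\<Sum>k<M. integral {y i..y (Suc i)} (\<lambda>z. r i z * \<psi> (G a) k z)) + D))"
    using child_potential W_pos by (intro sum_mono mult_left_mono) (auto simp: D_def less_imp_le)
  also have "\<dots> = (\<Sum>k<M. \<Sum>i<n. W i * integral {y i..y (Suc i)} (\<lambda>z. r i z * \<psi> (G a) k z)) + Wt * D"
    by (subst sum.swap) (simp add: distrib_left sum.distrib sum_distrib_left sum_distrib_right Wt_def)
  also have "\<dots> \<le> (\<Sum>k<M. T (Suc k) + \<epsilon> * K7 * (2 * B)) + 2 * D"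
  proof (intro add_mono sum_mono mult_right_mono Wt(3) D0)
    fix k
    have "(\<Sum>i<n. W i * integral {y i..y (Suc i)} (\<lambda>z. r i z * \<psi> (G a) k z)) = integral {h a..h b} (\<lambda>z. w z * \<psi> (G a) k z)"
      by (rule pieces[OF \<psi>_meas \<psi>_bound, symmetric])
    also have "\<dots> \<le> T (Suc k) + \<epsilon> * K7 * (2 * B)"
      using frozen_compare[OF \<psi>_meas[of "G a" k] \<psi>_bound] unfolding T_def \<psi>_Suc by linarith
    finally show "(\<Sum>i<n. W i * integral {y i..y (Suc i)} (\<lambda>z. r i z * \<psi> (G a) k z)) \<le> T (Suc k) + \<epsilon> * K7 * (2 * B)" .
  qed
  also have "(\<Sum>k<M. T (Suc k) + \<epsilon> * K7 * (2 * B)) = (\<Sum>k<M. T (Suc k)) + 2 * B * K7 * (\<epsilon> * real M)"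
    by (simp add: sum.distrib)
  also have "(\<Sum>k<M. T (Suc k)) = (\<Sum>k<M. T k) - T 0 + T M"
    by (induction M) auto
  also have "T M \<le> Cd * rate ^ M"
    using averaging_\<psi>[OF good_pairD(6,7)[OF good_pair], of "G a" M] by (simp add: T_def)
  finally show ?thesis by (simp add: T_def Hp_def D_def \<psi>_def)
qed

text \<open>The partial sum after one more step, as a function of the image point.\<close>

definition child_offset where "child_offset u z = u (H.hinv z) + \<alpha>h (H.hinv z, G (H.hinv z))"

lemma along_\<alpha>h_lipschitz: "\<bar>\<alpha>h (x, G x) - \<alpha>h (x', G x')\<bar> \<le> (2 * B + La) * \<bar>x - x'\<bar>"
proof -
  have 1: "\<bar>\<alpha>h (x, G x) - \<alpha>h (x', G x)\<bar> \<le> B * \<bar>x - x'\<bar>" by (rule \<alpha>h_lipschitz_x)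
  have "\<bar>G x - G x'\<bar> \<le> \<epsilon> * c1 * \<bar>x - x'\<bar>" by (rule lipschitz_of_deriv_bound[OF G(1,3)])
  also have "\<dots> \<le> 1 * \<bar>x - x'\<bar>" using \<kappa>(3) by (intro mult_right_mono) auto
  finally have "(B + La) * \<bar>G x - G x'\<bar> \<le> (B + La) * \<bar>x - x'\<bar>" using B0 La by (intro mult_left_mono) auto
  then have 2: "\<bar>\<alpha>h (x', G x) - \<alpha>h (x', G x')\<bar> \<le> (B + La) * \<bar>x - x'\<bar>"
    using \<alpha>h_lipschitz_theta[of x' "G x" "G x'"] by linarith
  have "\<bar>\<alpha>h (x, G x) - \<alpha>h (x', G x')\<bar> \<le> B * \<bar>x - x'\<bar> + (B + La) * \<bar>x - x'\<bar>" using 1 2 by linarith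
  then show ?thesis by (simp add: algebra_simps)
qed

section \<open>Mean and range of the partial sum plus potential after one step\<close>

context
  fixes u :: "real \<Rightarrow> real" and S :: real
  assumes u: "\<And>x x'. \<bar>u x - u x'\<bar> \<le> Co * \<bar>x - x'\<bar>" "\<And>x. \<bar>u x\<bar> \<le> S"
begin

lemma child_offset_lipschitz: "\<bar>child_offset u z - child_offset u z'\<bar> \<le> Co * \<bar>z - z'\<bar>"
proof -
  define x x' where "x = H.hinv z" and "x' = H.hinv z'"
  have "\<bar>child_offset u z - child_offset u z'\<bar> \<le> Co * \<bar>x - x'\<bar> + (2 * B + La) * \<bar>x - x'\<bar>"
    using u(1)[of x x'] along_\<alpha>h_lipschitz[of x x'] unfolding child_offset_def x_def[symmetric] x'_def[symmetric] by linarith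
  also have "\<dots> = Co * (2 * \<bar>x - x'\<bar>)" by (simp add: Co_def)
  also have "\<dots> \<le> Co * \<bar>z - z'\<bar>"
    unfolding x_def x'_def using KB0(1) by (intro mult_left_mono H.hinv_lipschitz)
  finally show ?thesis .
qed

lemma child_offset_bound: "\<bar>child_offset u z\<bar> \<le> S + 2 * B"
  unfolding child_offset_def using u(2)[of "H.hinv z"] \<alpha>h_bound[of "(H.hinv z, G (H.hinv z))"] by linarith

lemma continuous_offset: "continuous_on T u"
  by (rule lipschitz_continuous_on[OF u(1) KB0(1)])

text \<open>The partial sum may be large, so it must not be multiplied by the density error. Its
  value \<open>u a\<close> is split off with the exact total mass \<open>Wt\<close> as coefficient;
  what remains oscillates by at most \<open>Co + 2 * B\<close> on the pair, and only this is subject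
  to the error \<open>\<kappa>\<close>. The bound \<open>S\<close> is used for integrability
  alone.\<close>

lemma offset_sum:
  "(\<Sum>i<n. W i * integral {y i..y (Suc i)} (\<lambda>z. r i z * child_offset u z)) \<le>
    u a * Wt + (integral {a..b} (\<lambda>x. \<rho> x * u x) - u a + integral {a..b} (\<lambda>x. \<rho> x * \<alpha>h (x, G a))
      + (B + La) * (\<epsilon> * c1) + \<kappa> * (Co + 2 * B))"
proof -
  define d where "d x = u x + \<alpha>h (x, G x) - u a" for x
  have cont_al: "continuous_on UNIV (\<lambda>x. \<alpha>h (x, G x))" by (rule along[OF continuous_\<alpha>h])
  have cd: "continuous_on UNIV d" unfolding d_def[abs_def] by (intro continuous_intros continuous_offset cont_al)
  have dm: "d \<in> borel_measurable borel" "\<bar>d x\<bar> \<le> 2 * S + 2 * B" for x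
    using cd borel_measurable_continuous_onI u(2)[of x] u(2)[of a] \<alpha>h_bound[of "(x, G x)"] unfolding d_def
    by auto
  have dl: "\<bar>d x\<bar> \<le> Co + 2 * B" if "x \<in> {a..b}" for x
  proof -
    have "Co * \<bar>x - a\<bar> \<le> Co * 1" using that ab KB0 by (intro mult_left_mono) auto
    then show ?thesis using u(1)[of x a] \<alpha>h_bound[of "(x, G x)"] unfolding d_def by linarith
  qed
  have om: "child_offset u \<in> borel_measurable borel"
    unfolding child_offset_def[abs_def]
    by (intro borel_measurable_continuous_onI continuous_intros inv_along[of u] inv_along[OF cont_al] continuous_offset)
  have rearrange: "R * (A + C) = c * R + 1 * (R * (A + C - c))" for R A C c :: real by (simp add: algebra_simps)
  have "(\<Sum>i<n. W i * integral {y i..y (Suc i)} (\<lambda>z. r i z * child_offset u z)) = integral {h a..h b} (\<lambda>z. w z * child_offset u z)"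
    by (rule pieces[OF om child_offset_bound, symmetric])
  also have "\<dots> = integral {a..b} (\<lambda>x. \<rho> x * (h1 x / f1 (x, G x)) * child_offset u (h x))"
    by (rule change[OF om child_offset_bound])
  also have "(\<lambda>x. \<rho> x * (h1 x / f1 (x, G x)) * child_offset u (h x)) =
      (\<lambda>x. u a * (\<rho> x * (h1 x / f1 (x, G x))) + 1 * (\<rho> x * (h1 x / f1 (x, G x)) * d x))"
    by (rule ext) (unfold child_offset_def H.hinv_h d_def, rule rearrange)
  also have "integral {a..b} \<dots> = u a * Wt + 1 * integral {a..b} (\<lambda>x. \<rho> x * (h1 x / f1 (x, G x)) * d x)"
    unfolding Wt_eq by (rule integral_lincomb[OF integrable_continuous_real[OF cont_ratio] integrable_cont_mult[OF cont_ratio dm]])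
  also have "1 * integral {a..b} (\<lambda>x. \<rho> x * (h1 x / f1 (x, G x)) * d x) \<le> integral {a..b} (\<lambda>x. \<rho> x * d x) + \<kappa> * (Co + 2 * B)"
    using ratio_integral[OF dm dl] by linarith
  also have "integral {a..b} (\<lambda>x. \<rho> x * d x) \<le> integral {a..b} (\<lambda>x. \<rho> x * u x) - u a + integral {a..b} (\<lambda>x. \<rho> x * \<alpha>h (x, G a))
      + (B + La) * (\<epsilon> * c1)"
  proof -
    have ca: "continuous_on UNIV (\<lambda>x. \<alpha>h (x, G a))"
      by (intro continuous_partial[OF continuous_\<alpha>h] continuous_intros)
    have i1: "(\<lambda>x. \<rho> x * u x) integrable_on {a..b}" and i2: "(\<lambda>x. \<rho> x * \<alpha>h (x, G a)) integrable_on {a..b}"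
      and i3: "\<rho> integrable_on {a..b}"
      by (intro integrable_continuous_real continuous_intros c\<rho> continuous_offset continuous_on_subset[OF ca]; simp)+
    have "integral {a..b} (\<lambda>x. \<rho> x * d x) \<le>
      integral {a..b} (\<lambda>x. 1 * (1 * (\<rho> x * u x) + 1 * (\<rho> x * \<alpha>h (x, G a))) + ((B + La) * (\<epsilon> * c1) - u a) * \<rho> x)"
    proof (rule integral_le)
      show "(\<lambda>x. \<rho> x * d x) integrable_on {a..b}" by (rule integrable_cont_mult[OF c\<rho> dm])
      show "(\<lambda>x. 1 * (1 * (\<rho> x * u x) + 1 * (\<rho> x * \<alpha>h (x, G a))) + ((B + La) * (\<epsilon> * c1) - u a) * \<rho> x) integrable_on {a..b}"
        by (intro integrable_continuous_real continuous_intros c\<rho> continuous_offset continuous_on_subset[OF ca]) simp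
      fix x assume x: "x \<in> {a..b}"
      have "\<bar>\<alpha>h (x, G x) - \<alpha>h (x, G a)\<bar> \<le> (B + La) * (\<epsilon> * c1)"
        using \<alpha>h_lipschitz_theta[of x "G x" "G a"] mult_left_mono[OF G_near[OF x], of "B + La"] B0 La by linarith
      then have "d x \<le> u x + \<alpha>h (x, G a) + ((B + La) * (\<epsilon> * c1) - u a)" unfolding d_def by linarith
      then have "\<rho> x * d x \<le> \<rho> x * (u x + \<alpha>h (x, G a) + ((B + La) * (\<epsilon> * c1) - u a))"
        using \<rho>(3)[of x] by (intro mult_left_mono) auto
      then show "\<rho> x * d x \<le> 1 * (1 * (\<rho> x * u x) + 1 * (\<rho> x * \<alpha>h (x, G a))) + ((B + La) * (\<epsilon> * c1) - u a) * \<rho> x"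
        by (simp add: algebra_simps)
    qed
    also have "\<dots> = 1 * integral {a..b} (\<lambda>x. 1 * (\<rho> x * u x) + 1 * (\<rho> x * \<alpha>h (x, G a))) + ((B + La) * (\<epsilon> * c1) - u a) * integral {a..b} \<rho>"
      by (rule integral_lincomb[OF _ i3]) (use Henstock_Kurzweil_Integration.integrable_add[OF i1 i2] in simp)
    also have "integral {a..b} (\<lambda>x. 1 * (\<rho> x * u x) + 1 * (\<rho> x * \<alpha>h (x, G a))) = 1 * integral {a..b} (\<lambda>x. \<rho> x * u x) + 1 * integral {a..b} (\<lambda>x. \<rho> x * \<alpha>h (x, G a))"
      by (rule integral_lincomb[OF i1 i2])
    finally show ?thesis using \<rho>(5) by simp
  qed
  finally show ?thesis by simp
qed

definition child_mean where
  "child_mean M i = integral {y i..y (Suc i)} (\<lambda>z. r i z * child_offset u z) + Hp M (G' (y i)) (y i) (y (Suc i)) (r i)"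

lemma step_range:
  assumes "i < n" "j < n"
  shows "\<bar>child_mean M i - child_mean M j\<bar> \<le> RR"
proof -
  define o1 where "o1 = child_offset u"
  have o1: "\<bar>o1 z - o1 z'\<bar> \<le> Co * \<bar>z - z'\<bar>" for z z' unfolding o1_def by (rule child_offset_lipschitz)
  have mi: "\<bar>child_mean M i - o1 (y i)\<bar> \<le> Co + CH" for i
  proof -
    have "\<bar>integral {y i..y (Suc i)} (\<lambda>z. r i z * o1 z) - o1 (y i)\<bar> \<le> Co"
      by (rule mean_offset_close[OF child_good_pair o1]) (simp add: y_mono)
    then show ?thesis using Hp_bound[OF child_good_pair, of M "G' (y i)" i] unfolding child_mean_def o1_def by linarith
  qed
  have "\<bar>y i - y j\<bar> \<le> 2 * B"
    using y_range[OF assms(1), of "y i"] y_range[OF assms(2), of "y j"] y_mono[of i "Suc i"] y_mono[of j "Suc j"] L(2)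
    unfolding L_def by auto
  then have "Co * \<bar>y i - y j\<bar> \<le> Co * (2 * B)" using KB0(1) by (rule mult_left_mono)
  then have "\<bar>o1 (y i) - o1 (y j)\<bar> \<le> Co * (2 * B)" using o1[of "y i" "y j"] by linarith
  then have "\<bar>child_mean M i - child_mean M j\<bar> \<le> Co * (2 * B) + 2 * (Co + CH)"
    using mi[of i] mi[of j] unfolding abs_le_iff by auto
  then show ?thesis by (simp add: RR_def algebra_simps)
qed

text \<open>The weights sum to \<open>Wt\<close> rather than to 1. Since the large term occurs
  exactly as \<open>u a * Wt\<close>, it passes through the normalisation unchanged. Only the
  bounded remainder \<open>Y\<close> is exposed to \<open>Wt - 1\<close>, and \<open>KB\<close> does
  not depend on the size of the partial sum.\<close>

lemma step_mean:
  assumes M: "1 \<le> M"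
  shows "(\<Sum>i<n. W i / Wt * child_mean M i) \<le>
    integral {a..b} (\<lambda>x. \<rho> x * u x) + Hp M (G a) a b \<rho> + KB * (\<epsilon> * (real M)\<^sup>2 + rate ^ M)"
proof -
  define I where "I = integral {a..b} (\<lambda>x. \<rho> x * u x)"
  define Y where "Y = I - u a + Hp M (G a) a b \<rho>"
  define e where "e = \<epsilon> * (real M)\<^sup>2 + rate ^ M"
  have M1: "real M \<le> (real M)\<^sup>2" "1 \<le> (real M)\<^sup>2" using M by (auto simp: power2_eq_square mult_ge1_I)
  have e: "\<epsilon> \<le> e" "\<epsilon> * real M \<le> e" "\<epsilon> * (real M)\<^sup>2 \<le> e" "rate ^ M \<le> e" "0 \<le> e"
  proof -
    have r0: "0 \<le> rate ^ M" using rate by simp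
    have "\<epsilon> * 1 \<le> \<epsilon> * (real M)\<^sup>2" "\<epsilon> * real M \<le> \<epsilon> * (real M)\<^sup>2" "0 \<le> \<epsilon> * (real M)\<^sup>2" using M1 eps by (auto intro!: mult_left_mono)
    then show "\<epsilon> \<le> e" "\<epsilon> * real M \<le> e" "\<epsilon> * (real M)\<^sup>2 \<le> e" "rate ^ M \<le> e" "0 \<le> e"
      using r0 unfolding e_def by linarith+
  qed
  have "(\<Sum>i<n. W i * child_mean M i) \<le> u a * Wt + Y + ((B + La) * (\<epsilon> * c1) + \<kappa> * (Co + 2 * B) + Cd * rate ^ M +
    2 * B * K7 * (\<epsilon> * real M) + 2 * (KF * (c1 + B)) * (\<epsilon> * (real M)\<^sup>2))"
    using potential_sum[of M] offset_sum unfolding child_mean_def distrib_left sum.distrib Y_def I_def by linarith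
  also have "\<dots> \<le> u a * Wt + Y + Err * e"
  proof -
    have "(B + La) * (\<epsilon> * c1) \<le> (B + La) * c1 * e" using e(1) c_pos B0 La
      by (simp add: mult.assoc mult_left_mono mult.commute[of \<epsilon>])
    moreover have "\<kappa> * (Co + 2 * B) \<le> c1 * B * (Co + 2 * B) * e"
    proof -
      have "\<epsilon> * (c1 * B * (Co + 2 * B)) \<le> e * (c1 * B * (Co + 2 * B))"
        using e(1) c_pos B0 KB0 by (intro mult_right_mono) auto
      then show ?thesis by (simp add: \<kappa>_def mult_ac)
    qed
    moreover have "Cd * rate ^ M \<le> Cd * e" using e(4) Cd0 by (intro mult_left_mono)
    moreover have "2 * B * K7 * (\<epsilon> * real M) \<le> 2 * B * K7 * e" using e(2) B0 K7 by (intro mult_left_mono) auto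
    moreover have "2 * (KF * (c1 + B)) * (\<epsilon> * (real M)\<^sup>2) \<le> 2 * (KF * (c1 + B)) * e"
      using e(3) KF0 c_pos B0 by (intro mult_left_mono) auto
    ultimately show ?thesis unfolding Err_def distrib_right by linarith
  qed
  finally have s: "(\<Sum>i<n. W i * child_mean M i) \<le> u a * Wt + Y + Err * e" .
  have Wp: "0 < Wt" using Wt(2) by linarith
  have "(\<Sum>i<n. W i / Wt * child_mean M i) = (\<Sum>i<n. W i * child_mean M i) / Wt"
    by (simp add: sum_divide_distrib)
  also have "\<dots> \<le> (u a * Wt + Y + Err * e) / Wt" using s Wp by (intro divide_right_mono) auto
  also have "\<dots> = u a + Y + Y * (1 - Wt) / Wt + Err * e / Wt" using Wp by (simp add: field_simps)
  also have "\<dots> \<le> u a + Y + 2 * ((Co + CH) * \<kappa>) + 2 * (Err * e)"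
  proof -
    have "\<bar>Y\<bar> \<le> Co + CH"
      using mean_offset_close[OF good_pair u(1), of a] Hp_bound[OF good_pair, of M "G a"] lt unfolding Y_def I_def
      by (auto simp: abs_le_iff)
    then have y: "\<bar>Y * (1 - Wt)\<bar> \<le> (Co + CH) * \<kappa>"
      unfolding abs_mult using Wt(1) KB0 Cd0 by (intro mult_mono) (auto simp: abs_minus_commute)
    have half: "z / Wt \<le> 2 * z'" if "z \<le> z'" "0 \<le> z'" for z z'
    proof -
      have "z \<le> 2 * z' * Wt" using that Wt(2) mult_left_mono[OF Wt(2), of "2 * z'"] by simp
      then show ?thesis using Wp by (simp add: divide_le_eq)
    qed
    have "Y * (1 - Wt) / Wt \<le> 2 * ((Co + CH) * \<kappa>)" using y KB0 Cd0 \<kappa>(1) by (intro half) auto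
    moreover have "Err * e / Wt \<le> 2 * (Err * e)" using KB0 e(5) by (intro half) auto
    ultimately show ?thesis by linarith
  qed
  also have "2 * ((Co + CH) * \<kappa>) \<le> 2 * c1 * B * (Co + CH) * e"
  proof -
    have "\<epsilon> * (2 * c1 * B * (Co + CH)) \<le> e * (2 * c1 * B * (Co + CH))"
      using e(1) c_pos B0 KB0 Cd0 by (intro mult_right_mono) auto
    then show ?thesis by (simp add: \<kappa>_def mult_ac)
  qed
  finally show ?thesis by (simp add: Y_def I_def KB_def e_def algebra_simps)
qed

end

end

section \<open>The exponential tail bound\<close>

context slow_fast begin

text \<open>The level is part of the offset: for \<open>u\<close> constantly \<open>- R\<close> this
  is the event that one of the partial sums up to time \<open>N\<close> reaches
  \<open>R\<close>.\<close>

definition hit :: "real \<Rightarrow> nat \<Rightarrow> (real \<Rightarrow> real) \<Rightarrow> (real \<Rightarrow> real) \<Rightarrow> real set" where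
  "hit \<epsilon> N u G = {x. \<exists>k\<le>N. 0 \<le> u x + (\<Sum>j<k. \<alpha>h ((fast_slow f \<omega> \<epsilon> ^^ j) (x, G x)))}"

lemma continuous_fast_slow: "continuous_on S (fast_slow f \<omega> \<epsilon>)"
  unfolding fast_slow_def case_prod_beta prod.collapse
  by (intro continuous_intros partials_continuous[OF f] partials_continuous[OF \<omega>(1)])

lemma continuous_fast_slow_iter: "continuous_on UNIV (fast_slow f \<omega> \<epsilon> ^^ j)"
proof (induction j)
  case (Suc j)
  then show ?case using continuous_on_compose[OF Suc continuous_fast_slow] by simp
qed (simp add: id_def)

lemma hit_borel:
  assumes "continuous_on UNIV u" "continuous_on UNIV G"
  shows "hit \<epsilon> N u G \<in> sets borel"
proof -
  have c: "continuous_on UNIV (\<lambda>x. u x + (\<Sum>j<k. \<alpha>h ((fast_slow f \<omega> \<epsilon> ^^ j) (x, G x))))" for k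
    by (intro continuous_intros assms(1) continuous_on_sum continuous_on_compose2[OF continuous_\<alpha>h[of UNIV]]
        continuous_on_compose2[OF continuous_fast_slow_iter] assms(2)) auto
  have "{x. 0 \<le> u x + (\<Sum>j<k. \<alpha>h ((fast_slow f \<omega> \<epsilon> ^^ j) (x, G x)))} \<in> sets borel" for k
    by (intro borel_closed closed_Collect_le continuous_on_const c)
  moreover have "hit \<epsilon> N u G = (\<Union>k\<in>{..N}. {x. 0 \<le> u x + (\<Sum>j<k. \<alpha>h ((fast_slow f \<omega> \<epsilon> ^^ j) (x, G x)))})"
    by (auto simp: hit_def)
  ultimately show ?thesis by auto
qed

text \<open>Logarithm of the growth of the exponential moment in one step: two mass defects, the
  error of the mean, and the quadratic term from the range.\<close>

definition rem where "rem \<epsilon> M \<sigma> = 2 * (\<epsilon> * c1 * B) + \<sigma> * (KB * (\<epsilon> * (real M)\<^sup>2 + rate ^ M)) + \<sigma>\<^sup>2 * RR\<^sup>2"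

lemma rem0: "0 < \<epsilon> \<Longrightarrow> 0 \<le> \<sigma> \<Longrightarrow> 0 \<le> rem \<epsilon> M \<sigma>"
  unfolding rem_def using KB0 c_pos B0 rate by (auto intro!: add_nonneg_nonneg mult_nonneg_nonneg)

text \<open>The case of a stopped pair. If the offset is nonnegative at one point, its mean is at
  least \<open>- Co\<close> and the potential at least \<open>- CH\<close>; the summand
  \<open>Co + CH\<close> in the exponent makes the right-hand side at least 1, which bounds any
  probability.\<close>

lemma exponential_bound_trivial:
  assumes gp: "good_pair \<epsilon> a b G \<rho>" and E: "E \<in> sets borel"
    and u: "\<And>x x'. \<bar>u x - u x'\<bar> \<le> Co * \<bar>x - x'\<bar>"
    and x: "x \<in> {a..b}" "0 \<le> u x" and \<sigma>: "0 \<le> \<sigma>" "0 \<le> z"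
  shows "integral {a..b} (\<lambda>x. \<rho> x * indicator E x) \<le>
    exp (\<sigma> * (integral {a..b} (\<lambda>x. \<rho> x * u x) + Hp M (G a) a b \<rho> + (Co + CH)) + z)"
proof -
  have "\<bar>integral {a..b} (\<lambda>x. \<rho> x * indicator E x)\<bar> \<le> 1 * integral {a..b} \<rho>"
    using good_pairD(2,3)[OF gp] E by (intro abs_integral_weighted_le) (auto simp: less_imp_le indicator_def)
  then have "integral {a..b} (\<lambda>x. \<rho> x * indicator E x) \<le> 1" using gp by (auto simp: good_pair_def)
  also have "0 \<le> integral {a..b} (\<lambda>x. \<rho> x * u x) + Hp M (G a) a b \<rho> + (Co + CH)"
    using mean_offset_close[OF gp u x(1)] Hp_bound[OF gp, of M "G a"] x(2) by (simp add: abs_le_iff)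
  then have "1 \<le> exp (\<sigma> * (integral {a..b} (\<lambda>x. \<rho> x * u x) + Hp M (G a) a b \<rho> + (Co + CH)) + z)"
    using \<sigma> by simp
  finally show ?thesis .
qed

text \<open>The offset \<open>u\<close> carries the partial sum accumulated so far, which makes the induction on \<open>N\<close>
  first-step. A pair with \<open>0 \<le> u x\<close> somewhere is stopped.\<close>

lemma exponential_bound:
  assumes eps: "0 < \<epsilon>" "\<epsilon> * c1 * B \<le> 1 / 2" "\<epsilon> * c1 * B \<le> lam - 2" and M: "1 \<le> M" and \<sigma>: "0 \<le> \<sigma>"
    and gp: "good_pair \<epsilon> a b G \<rho>"
    and u: "\<And>x x'. \<bar>u x - u x'\<bar> \<le> Co * \<bar>x - x'\<bar>" "\<And>x. \<bar>u x\<bar> \<le> S"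
  shows "integral {a..b} (\<lambda>x. \<rho> x * indicator (hit \<epsilon> N u G) x) \<le>
    exp (\<sigma> * (integral {a..b} (\<lambda>x. \<rho> x * u x) + Hp M (G a) a b \<rho> + (Co + CH)) + real N * rem \<epsilon> M \<sigma>)"
  using gp u
proof (induction N arbitrary: a b G \<rho> u S)
  case (0 a b G \<rho> u S)
  have cG: "continuous_on UNIV G" using 0(1) by (auto simp: good_pair_def intro: continuous_on_UNIV_deriv)
  show ?case
  proof (cases "\<exists>x\<in>{a..b}. 0 \<le> u x")
    case True
    then obtain x where "x \<in> {a..b}" "0 \<le> u x" by blast
    then show ?thesis
      by (intro exponential_bound_trivial[OF 0(1) hit_borel[OF lipschitz_continuous_on[OF 0(2) KB0(1)] cG] 0(2)] \<sigma>) auto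
  next
    case False
    then have "integral {a..b} (\<lambda>x. \<rho> x * indicator (hit \<epsilon> 0 u G) x) = integral {a..b} (\<lambda>_. 0)"
      by (intro integral_cong) (auto simp: hit_def indicator_def)
    then show ?thesis by simp
  qed
next
  case (Suc N a b G \<rho> u S)
  obtain G1 where G1: "\<And>x. (G has_real_derivative G1 x) (at x)" "continuous_on UNIV G1" "\<And>x. \<bar>G1 x\<bar> \<le> \<epsilon> * c1"
    using Suc.prems(1) unfolding good_pair_def by blast
  obtain \<rho>1 where r1: "\<And>x. (\<rho> has_real_derivative \<rho>1 x) (at x)" "continuous_on UNIV \<rho>1" "\<And>x. 0 < \<rho> x"
    "\<And>x. \<bar>\<rho>1 x\<bar> \<le> c2 * \<rho> x" using Suc.prems(1) unfolding good_pair_def by blast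
  have ab: "\<delta> \<le> b - a" "b - a \<le> 1" "integral {a..b} \<rho> = 1" using Suc.prems(1) unfolding good_pair_def by auto
  interpret P: pair_step f f1 f2 f3 t0 t1 t2 e1 e2 t01 t11 B \<alpha> \<alpha>1 \<alpha>2 \<omega> \<omega>1 \<omega>2 c1 c2 \<delta> lam \<epsilon> a b G G1 \<rho> \<rho>1
    by unfold_locales (fact eps ab G1 r1)+
  note u = Suc.prems(2,3)
  have cu: "continuous_on UNIV u" by (rule lipschitz_continuous_on[OF u(1) KB0(1)])
  show ?case
  proof (cases "\<exists>x\<in>{a..b}. 0 \<le> u x")
    case True
    then obtain x where "x \<in> {a..b}" "0 \<le> u x" by blast
    then show ?thesis
      using rem0[OF eps(1) \<sigma>, of M]
      by (intro exponential_bound_trivial[OF Suc.prems(1) hit_borel[OF cu P.cG] u(1)] \<sigma>) auto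
  next
    case False
    define o1 where "o1 = P.child_offset u"
    define E where "E = hit \<epsilon> N o1 P.G'"
    have o1: "\<bar>o1 z - o1 z'\<bar> \<le> Co * \<bar>z - z'\<bar>" "\<bar>o1 z\<bar> \<le> S + 2 * B" for z z'
      unfolding o1_def by (rule P.child_offset_lipschitz[OF u] P.child_offset_bound[OF u])+
    have E: "E \<in> sets borel"
      unfolding E_def by (rule hit_borel[OF lipschitz_continuous_on[OF o1(1) KB0(1)] continuous_on_UNIV_deriv[OF P.G'_deriv]])
    have shift: "fast_slow f \<omega> \<epsilon> (x, G x) = (P.h x, P.G' (P.h x))" for x
      by (simp add: fast_slow_def P.h_def P.G'_def flip: P.h_def)
    \<comment> \<open>On a pair that is not stopped, time 0 does not contribute. Reaching the level
      within N+1 steps then means that the image reaches it within N steps with the updated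
      offset.\<close>
    have step: "x \<in> hit \<epsilon> (Suc N) u G \<longleftrightarrow> P.h x \<in> E" if "x \<in> {a..b}" for x
    proof -
      have neg: "u x < 0" using False that not_le by blast
      have sum: "u x + (\<Sum>j<Suc k. \<alpha>h ((fast_slow f \<omega> \<epsilon> ^^ j) (x, G x))) =
         o1 (P.h x) + (\<Sum>j<k. \<alpha>h ((fast_slow f \<omega> \<epsilon> ^^ j) (P.h x, P.G' (P.h x))))" for k
        unfolding sum.lessThan_Suc_shift funpow_Suc_right o_apply shift
        by (simp add: o1_def P.child_offset_def)
      have "x \<in> hit \<epsilon> (Suc N) u G \<longleftrightarrow> (\<exists>k\<le>N. 0 \<le> u x + (\<Sum>j<Suc k. \<alpha>h ((fast_slow f \<omega> \<epsilon> ^^ j) (x, G x))))"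
      proof
        assume "x \<in> hit \<epsilon> (Suc N) u G"
        then obtain k where k: "k \<le> Suc N" "0 \<le> u x + (\<Sum>j<k. \<alpha>h ((fast_slow f \<omega> \<epsilon> ^^ j) (x, G x)))"
          unfolding hit_def by blast
        then obtain k' where "k = Suc k'" using neg by (cases k) auto
        then show "\<exists>k\<le>N. 0 \<le> u x + (\<Sum>j<Suc k. \<alpha>h ((fast_slow f \<omega> \<epsilon> ^^ j) (x, G x)))" using k by blast
      next
        assume "\<exists>k\<le>N. 0 \<le> u x + (\<Sum>j<Suc k. \<alpha>h ((fast_slow f \<omega> \<epsilon> ^^ j) (x, G x)))"
        then obtain k where k: "k \<le> N" "0 \<le> u x + (\<Sum>j<Suc k. \<alpha>h ((fast_slow f \<omega> \<epsilon> ^^ j) (x, G x)))" by blast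
        show "x \<in> hit \<epsilon> (Suc N) u G" unfolding hit_def using k by (intro CollectI exI[of _ "Suc k"] conjI) simp
      qed
      then show ?thesis unfolding sum by (simp add: E_def hit_def)
    qed
    define C where "C = Co + CH"
    define m where "m = integral {a..b} (\<lambda>x. \<rho> x * u x) + Hp M (G a) a b \<rho>"
    define \<beta> where "\<beta> = KB * (\<epsilon> * (real M)\<^sup>2 + rate ^ M)"
    have "integral {a..b} (\<lambda>x. \<rho> x * indicator (hit \<epsilon> (Suc N) u G) x) = integral {a..b} (\<lambda>x. \<rho> x * indicator E (P.h x))"
      using step by (intro integral_cong) (simp add: indicator_def)
    also have "\<dots> \<le> (1 + P.\<kappa>) * (\<Sum>i<P.n. P.W i * integral {P.y i..P.y (Suc i)} (\<lambda>z. P.r i z * indicator E z))"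
      by (rule P.push_upper[where S = 1]) (use E in \<open>auto simp: indicator_def\<close>)
    also have "\<dots> \<le> (1 + P.\<kappa>) * (\<Sum>i<P.n. P.W i * exp (\<sigma> * (P.child_mean u M i + C) + real N * rem \<epsilon> M \<sigma>))"
    proof (intro mult_left_mono sum_mono)
      fix i assume "i \<in> {..<P.n}"
      show "integral {P.y i..P.y (Suc i)} (\<lambda>z. P.r i z * indicator E z) \<le> exp (\<sigma> * (P.child_mean u M i + C) + real N * rem \<epsilon> M \<sigma>)"
        using Suc.IH[OF P.child_good_pair o1] unfolding E_def C_def P.child_mean_def[OF u] o1_def .
    qed (use P.W_pos P.\<kappa>(1) in \<open>auto simp: less_imp_le\<close>)
    also have "\<dots> = (1 + P.\<kappa>) * P.Wt * exp (\<sigma> * C + real N * rem \<epsilon> M \<sigma>) * (\<Sum>i<P.n. P.W i / P.Wt * exp (\<sigma> * P.child_mean u M i))"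
      using P.Wt(2) by (simp add: sum_distrib_left distrib_left exp_add mult_ac)
    \<comment> \<open>One factor \<open>1 + P.\<kappa>\<close> stems from pushing the indicator, the
      other from the total mass of the children.\<close>
    also have "\<dots> \<le> (1 + P.\<kappa>) * (1 + P.\<kappa>) * exp (\<sigma> * C + real N * rem \<epsilon> M \<sigma>) * exp (\<sigma> * (m + \<beta>) + \<sigma>\<^sup>2 * RR\<^sup>2)"
    proof (intro mult_mono mult_left_mono)
      have "(\<Sum>i<P.n. P.W i / P.Wt * exp (\<sigma> * P.child_mean u M i)) \<le>
        exp (\<sigma> * (\<Sum>i<P.n. P.W i / P.Wt * P.child_mean u M i) + \<sigma>\<^sup>2 * RR\<^sup>2)"
      proof (rule exp_average_le)
        show "0 \<le> P.W i / P.Wt" for i using P.W_pos[of i] P.Wt(2) by simp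
        have "(\<Sum>i<P.n. P.W i / P.Wt) = P.Wt / P.Wt" unfolding P.Wt_def by (rule sum_divide_distrib[symmetric])
        then show "(\<Sum>i<P.n. P.W i / P.Wt) = 1" using P.Wt(2) by simp
        show "\<bar>P.child_mean u M i - P.child_mean u M j\<bar> \<le> RR" if "i < P.n" "j < P.n" for i j
          by (rule P.step_range[OF u that])
      qed
      also have "\<dots> \<le> exp (\<sigma> * (m + \<beta>) + \<sigma>\<^sup>2 * RR\<^sup>2)"
        using mult_left_mono[OF P.step_mean[OF u M] \<sigma>] by (simp add: m_def \<beta>_def)
      finally show "(\<Sum>i<P.n. P.W i / P.Wt * exp (\<sigma> * P.child_mean u M i)) \<le> exp (\<sigma> * (m + \<beta>) + \<sigma>\<^sup>2 * RR\<^sup>2)" .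
      show "P.Wt \<le> 1 + P.\<kappa>" using P.Wt(1) by linarith
    qed (use P.\<kappa>(1) P.Wt(2) P.W_pos in \<open>auto intro!: sum_nonneg mult_nonneg_nonneg divide_nonneg_nonneg simp: less_imp_le\<close>)
    also have "\<dots> \<le> exp P.\<kappa> * exp P.\<kappa> * exp (\<sigma> * C + real N * rem \<epsilon> M \<sigma>) * exp (\<sigma> * (m + \<beta>) + \<sigma>\<^sup>2 * RR\<^sup>2)"
      using P.\<kappa>(1) exp_ge_add_one_self[of P.\<kappa>] by (intro mult_right_mono mult_mono) auto
    also have "\<dots> = exp (\<sigma> * (m + C) + real (Suc N) * rem \<epsilon> M \<sigma>)"
      by (simp add: rem_def P.\<kappa>_def \<beta>_def algebra_simps flip: exp_add)
    finally show ?thesis by (simp add: m_def C_def)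
  qed
qed

section \<open>Choice of the number of correlations and of the exponential parameter\<close>

lemma rate_quadratic: "\<exists>Kr>0. \<forall>M::nat. (real M)\<^sup>2 * rate ^ M \<le> Kr"
proof -
  define s where "s = sqrt rate"
  have s: "0 < s" "s < 1" "s * s = rate" using rate by (auto simp: s_def)
  have "(\<lambda>n. real n * s ^ n) \<longlonglongrightarrow> 0" using s by (intro powser_times_n_limit_0) auto
  then have "Bseq (\<lambda>n. real n * s ^ n)" by (intro convergent_imp_Bseq convergentI)
  then obtain K where K: "0 < K" "\<And>n. norm (real n * s ^ n) \<le> K" by (auto elim: BseqE)
  have "(real M)\<^sup>2 * rate ^ M \<le> K\<^sup>2" for M
  proof -
    have "(real M)\<^sup>2 * rate ^ M = (real M * s ^ M)\<^sup>2"
      by (simp add: power2_eq_square power_mult_distrib mult_ac flip: s(3))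
    also have "\<dots> \<le> K\<^sup>2" using K(2)[of M] s by (intro power_mono) auto
    finally show ?thesis .
  qed
  then show ?thesis using K(1) by (intro exI[of _ "K\<^sup>2"]) auto
qed

text \<open>With \<open>M\<close> the ceiling of \<epsilon>^(-1/4), both \<epsilon> M^2 and 1/M^2
  are of order sqrt \<epsilon>. Since \<open>rate ^ M\<close> is at most a constant over M^2, the
  two parts of the drift error are balanced.\<close>

lemma block_length:
  assumes "0 < \<epsilon>" "\<epsilon> \<le> (1 :: real)"
  obtains M :: nat where "1 \<le> M" "\<epsilon> * (real M)\<^sup>2 \<le> 4 * sqrt \<epsilon>" "1 / (real M)\<^sup>2 \<le> sqrt \<epsilon>"
proof -
  define t where "t = 1 / sqrt (sqrt \<epsilon>)"
  define M where "M = nat \<lceil>t\<rceil>"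
  have pos: "0 < sqrt (sqrt \<epsilon>)" "sqrt (sqrt \<epsilon>) \<le> 1" using assms by auto
  then have t1: "1 \<le> t" unfolding t_def by (simp add: le_divide_eq)
  have t2: "t\<^sup>2 * sqrt \<epsilon> = 1" using assms by (simp add: t_def power_divide)
  have M: "t \<le> real M" "real M \<le> 2 * t" "1 \<le> M" using t1 unfolding M_def by linarith+
  have tp: "0 < t\<^sup>2" using t1 by simp
  have "(real M)\<^sup>2 \<le> (2 * t)\<^sup>2" using M by (intro power_mono) auto
  then have "\<epsilon> * (real M)\<^sup>2 \<le> \<epsilon> * (4 * t\<^sup>2)" using assms by (intro mult_left_mono) (auto simp: power_mult_distrib)
  also have "\<dots> = 4 * (sqrt \<epsilon> * (t\<^sup>2 * sqrt \<epsilon>))" using assms by (simp add: mult_ac)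
  finally have 1: "\<epsilon> * (real M)\<^sup>2 \<le> 4 * sqrt \<epsilon>" using t2 by simp
  have "t\<^sup>2 \<le> (real M)\<^sup>2" using M t1 by (intro power_mono) auto
  moreover have "0 < (real M)\<^sup>2" using M(3) by simp
  ultimately have "1 / (real M)\<^sup>2 \<le> 1 / t\<^sup>2" using tp by (intro divide_left_mono mult_pos_pos) auto
  also have "1 / t\<^sup>2 = sqrt \<epsilon>" using t2 tp by (simp add: field_simps)
  finally show ?thesis using that M(3) 1 by blast
qed

text \<open>The drift error sums to order N sqrt \<epsilon>, which is at most sqrt N because N
  \<epsilon> \<le> 1. Levels above \<open>A * sqrt (real N)\<close> exceed it, and what is left is
  the Gaussian optimisation.\<close>

lemma subgaussian_tail:
  "\<exists>A c0 \<epsilon>1. 0 < A \<and> 0 < c0 \<and> 0 < \<epsilon>1 \<and>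
     (\<forall>\<epsilon> N R a b G \<rho>. 0 < \<epsilon> \<longrightarrow> \<epsilon> \<le> \<epsilon>1 \<longrightarrow> 1 \<le> N \<longrightarrow> real N * \<epsilon> \<le> 1 \<longrightarrow> A * sqrt (real N) \<le> R \<longrightarrow>
        good_pair \<epsilon> a b G \<rho> \<longrightarrow>
        integral {a..b} (\<lambda>x. \<rho> x * indicator (hit \<epsilon> N (\<lambda>_. - R) G) x) \<le> exp (- (c0 * R\<^sup>2 / real N)))"
proof -
  obtain Kr where Kr: "0 < Kr" "\<And>M::nat. (real M)\<^sup>2 * rate ^ M \<le> Kr" using rate_quadratic by blast
  define C1 where "C1 = 2 * CH + Co"
  define K\<beta> where "K\<beta> = KB * (4 + Kr)"
  define Q where "Q = RR\<^sup>2 + 1"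
  define C2 where "C2 = 2 * (c1 * B)"
  \<comment> \<open>The first summand lets half of \<open>R\<close> dominate the potential and the
    drift. The last, together with \<open>A \<ge> 1\<close>, gives
    \<open>R^2 \<ge> 32 * Q * C2 * N\<close>, so that half of the Gaussian exponent absorbs the
    accumulated mass defect \<open>C2\<close>.\<close>
  define A where "A = 2 * (C1 + K\<beta>) + 1 + 32 * Q * C2"
  define \<epsilon>1 where "\<epsilon>1 = min 1 (min (1 / 2 / (c1 * B)) ((lam - 2) / (c1 * B)))"
  have cB: "0 < c1 * B" using c_pos B1 by simp
  have nn: "0 \<le> C1" "0 \<le> K\<beta>" "1 \<le> Q" "0 \<le> C2" using Cd0 KB0 Kr cB by (auto simp: C1_def K\<beta>_def Q_def C2_def)
  have "0 < x + 1 + z" "1 \<le> x + 1 + z" "x \<le> x + 1 + z" "z \<le> x + 1 + z" if "0 \<le> x" "0 \<le> z" for x z :: real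
    using that by auto
  from this[of "2 * (C1 + K\<beta>)" "32 * Q * C2"] nn
  have A: "0 < A" "1 \<le> A" "2 * (C1 + K\<beta>) \<le> A" "32 * Q * C2 \<le> A" by (simp_all add: A_def)
  have e1: "0 < \<epsilon>1" using cB lam by (simp add: \<epsilon>1_def)
  have main: "integral {a..b} (\<lambda>x. \<rho> x * indicator (hit \<epsilon> N (\<lambda>_. - R) G) x) \<le> exp (- (1 / (32 * Q) * R\<^sup>2 / real N))"
    if h: "0 < \<epsilon>" "\<epsilon> \<le> \<epsilon>1" "1 \<le> N" "real N * \<epsilon> \<le> 1" "A * sqrt (real N) \<le> R" "good_pair \<epsilon> a b G \<rho>" for \<epsilon> N R a b G \<rho>
  proof -
    have small: "\<epsilon> \<le> 1" "\<epsilon> * c1 * B \<le> 1 / 2" "\<epsilon> * c1 * B \<le> lam - 2"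
    proof -
      have "\<epsilon> \<le> 1 / 2 / (c1 * B)" "\<epsilon> \<le> (lam - 2) / (c1 * B)" "\<epsilon> \<le> 1" using h(2) by (auto simp: \<epsilon>1_def)
      then show "\<epsilon> \<le> 1" "\<epsilon> * c1 * B \<le> 1 / 2" "\<epsilon> * c1 * B \<le> lam - 2"
        using cB by (auto simp only: pos_le_divide_eq[OF cB] mult.assoc)
    qed
    obtain M :: nat where M: "1 \<le> M" "\<epsilon> * (real M)\<^sup>2 \<le> 4 * sqrt \<epsilon>" "1 / (real M)\<^sup>2 \<le> sqrt \<epsilon>"
      by (rule block_length[OF h(1) small(1)])
    have sN: "1 \<le> sqrt (real N)" "sqrt (real N) * sqrt (real N) = real N" using h(3) by auto
    have R1: "1 \<le> R" using A(2) sN(1) h(5) mult_mono[of 1 A 1 "sqrt (real N)"] by simp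
    \<comment> \<open>The minimiser of \<open>- \<sigma> * R / 2 + \<sigma>^2 * Q * N\<close>, where
      half of \<open>R\<close> has been set aside for the drift; the minimum is
      \<open>- R^2 / (16 * Q * N)\<close>.\<close>
    define \<sigma> where "\<sigma> = R / (4 * Q * real N)"
    have sg: "0 \<le> \<sigma>" using R1 nn h(3) by (simp add: \<sigma>_def)
    have rM: "rate ^ M \<le> Kr * sqrt \<epsilon>"
    proof -
      have "rate ^ M = ((real M)\<^sup>2 * rate ^ M) * (1 / (real M)\<^sup>2)" using M(1) by simp
      also have "\<dots> \<le> Kr * sqrt \<epsilon>" using Kr(2)[of M] M(3) Kr(1) by (intro mult_mono) auto
      finally show ?thesis .
    qed
    have \<beta>: "KB * (\<epsilon> * (real M)\<^sup>2 + rate ^ M) \<le> K\<beta> * sqrt \<epsilon>"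
    proof -
      have "KB * (\<epsilon> * (real M)\<^sup>2 + rate ^ M) \<le> KB * (4 * sqrt \<epsilon> + Kr * sqrt \<epsilon>)"
        using M(2) rM KB0 by (intro mult_left_mono) auto
      then show ?thesis by (simp add: K\<beta>_def algebra_simps)
    qed
    have Ns: "real N * sqrt \<epsilon> \<le> sqrt (real N)"
    proof -
      have "sqrt (real N * \<epsilon>) \<le> 1" using h(4) by simp
      then have "sqrt (real N) * (sqrt (real N) * sqrt \<epsilon>) \<le> sqrt (real N) * 1"
        using sN(1) by (intro mult_left_mono) (auto simp: real_sqrt_mult)
      then show ?thesis using sN(2) by (simp add: mult.assoc[symmetric])
    qed
    have "integral {a..b} (\<lambda>x. \<rho> x * indicator (hit \<epsilon> N (\<lambda>_. - R) G) x) \<le>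
      exp (\<sigma> * (integral {a..b} (\<lambda>x. \<rho> x * (- R)) + Hp M (G a) a b \<rho> + (Co + CH)) + real N * rem \<epsilon> M \<sigma>)"
      by (rule exponential_bound[OF h(1) small(2,3) M(1) sg h(6), of "\<lambda>_. - R" "\<bar>R\<bar>"]) (use KB0 in auto)
    also have "\<dots> \<le> exp (- (1 / (32 * Q) * R\<^sup>2 / real N))"
    proof -
      have "integral {a..b} (\<lambda>x. \<rho> x * (- R)) = - R" using h(6) by (simp add: good_pair_def)
      moreover have "Hp M (G a) a b \<rho> \<le> CH" using Hp_bound[OF h(6), of M "G a"] by linarith
      ultimately have 1: "\<sigma> * (integral {a..b} (\<lambda>x. \<rho> x * (- R)) + Hp M (G a) a b \<rho> + (Co + CH)) \<le> \<sigma> * (C1 - R)"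
        using sg by (intro mult_left_mono) (auto simp: C1_def)
      have 2: "real N * rem \<epsilon> M \<sigma> \<le> C2 + \<sigma> * (K\<beta> * sqrt (real N)) + \<sigma>\<^sup>2 * Q * real N"
      proof -
        have "real N * (2 * (\<epsilon> * c1 * B)) \<le> C2"
          using mult_right_mono[OF h(4), of "2 * (c1 * B)"] cB by (simp add: C2_def mult_ac)
        moreover have "real N * (\<sigma> * (KB * (\<epsilon> * (real M)\<^sup>2 + rate ^ M))) \<le> \<sigma> * (K\<beta> * sqrt (real N))"
        proof -
          have "real N * (\<sigma> * (KB * (\<epsilon> * (real M)\<^sup>2 + rate ^ M))) \<le> real N * (\<sigma> * (K\<beta> * sqrt \<epsilon>))"
            using \<beta> sg by (intro mult_left_mono) auto
          also have "\<dots> = \<sigma> * (K\<beta> * (real N * sqrt \<epsilon>))" by simp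
          also have "\<dots> \<le> \<sigma> * (K\<beta> * sqrt (real N))" using Ns sg nn by (intro mult_left_mono) auto
          finally show ?thesis .
        qed
        moreover have "real N * (\<sigma>\<^sup>2 * RR\<^sup>2) \<le> \<sigma>\<^sup>2 * Q * real N"
          by (simp add: Q_def algebra_simps)
        ultimately show ?thesis unfolding rem_def distrib_left by linarith
      qed
      have "C1 * 1 \<le> C1 * sqrt (real N)" using sN(1) nn(1) by (rule mult_left_mono)
      then have "2 * (C1 + K\<beta> * sqrt (real N)) \<le> 2 * (C1 + K\<beta>) * sqrt (real N)" by (simp add: algebra_simps)
      also have "\<dots> \<le> A * sqrt (real N)" using A(3) by (rule mult_right_mono) simp
      also note h(5)
      finally have "2 * (C1 + K\<beta> * sqrt (real N)) \<le> R" .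
      then have "\<sigma> * (C1 + K\<beta> * sqrt (real N)) \<le> \<sigma> * (R / 2)" using sg by (intro mult_left_mono) auto
      then have "\<sigma> * (C1 - R) + (C2 + \<sigma> * (K\<beta> * sqrt (real N)) + \<sigma>\<^sup>2 * Q * real N) \<le> C2 - \<sigma> * (R / 2) + \<sigma>\<^sup>2 * Q * real N"
        by (simp add: algebra_simps)
      also have "\<dots> = C2 - R\<^sup>2 / (16 * Q * real N)"
        using nn(3) h(3) by (simp add: \<sigma>_def power2_eq_square field_simps)
      also have "\<dots> \<le> - (1 / (32 * Q) * R\<^sup>2 / real N)"
      proof -
        have "32 * Q * C2 * real N \<le> R\<^sup>2"
        proof -
          have "32 * Q * C2 \<le> A\<^sup>2" using A(4) mult_mono[OF A(4) A(2)] A(1) by (simp add: power2_eq_square)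
          then have "32 * Q * C2 * real N \<le> A\<^sup>2 * real N" by (intro mult_right_mono) auto
          also have "\<dots> = (A * sqrt (real N))\<^sup>2" by (simp add: power_mult_distrib)
          also have "\<dots> \<le> R\<^sup>2" using h(5) A(1) by (intro power_mono) auto
          finally show ?thesis .
        qed
        then have "C2 \<le> R\<^sup>2 / (32 * Q * real N)" using nn(3) h(3) by (simp add: le_divide_eq mult_ac)
        moreover have "R\<^sup>2 / (16 * Q * real N) = 2 * (R\<^sup>2 / (32 * Q * real N))" "1 / (32 * Q) * R\<^sup>2 / real N = R\<^sup>2 / (32 * Q * real N)"
          using nn(3) h(3) by (auto simp: field_simps)
        ultimately show ?thesis by linarith
      qed
      finally show ?thesis using 1 2 by simp
    qed
    finally show ?thesis .
  qed
  show ?thesis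
    by (intro exI[of _ A] exI[of _ "1 / (32 * Q)"] exI[of _ \<epsilon>1] conjI allI impI main)
      (use A(1) e1 nn(3) in auto)
qed

end

section \<open>The averaged flow\<close>

lemma abs_le_of_deriv_le_right:
  fixes D E :: "real \<Rightarrow> real"
  assumes "\<And>x. (D has_real_derivative D1 x) (at x)" "\<And>x. 0 \<le> x \<Longrightarrow> (E has_real_derivative E1 x) (at x)"
    and "\<And>x. 0 \<le> x \<Longrightarrow> \<bar>D1 x\<bar> \<le> E1 x" "D 0 = 0" "E 0 = 0" "0 \<le> t"
  shows "\<bar>D t\<bar> \<le> E t"
proof -
  have "(\<lambda>x. E x - D x) 0 \<le> (\<lambda>x. E x - D x) t"
    by (rule DERIV_nonneg_imp_nondecreasing[OF assms(6)])
      (use assms(1,2,3) in \<open>force intro!: exI[of _ "E1 _ - D1 _"] DERIV_diff simp: abs_le_iff\<close>)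
  moreover have "(\<lambda>x. E x + D x) 0 \<le> (\<lambda>x. E x + D x) t"
    by (rule DERIV_nonneg_imp_nondecreasing[OF assms(6)])
      (use assms(1,2,3) in \<open>force intro!: exI[of _ "E1 _ + D1 _"] DERIV_add simp: abs_le_iff\<close>)
  ultimately show ?thesis using assms(4,5) by simp
qed

definition antideriv :: "(real \<Rightarrow> real) \<Rightarrow> real \<Rightarrow> real" where
  "antideriv F = (SOME \<Phi>. (\<forall>x. (\<Phi> has_real_derivative F x) (at x)) \<and> \<Phi> 0 = 0)"

lemma antideriv:
  assumes "continuous_on UNIV F"
  shows "(antideriv F has_real_derivative F x) (at x)" "antideriv F 0 = 0"
proof -
  have "isCont F x" for x using assms by (simp add: continuous_on_eq_continuous_at)
  then obtain \<Phi> where \<Phi>: "\<And>x. (\<Phi> has_real_derivative F x) (at x)"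
    using einterval_antiderivative[of "-\<infinity>" \<infinity> F] by (auto simp: has_real_derivative_iff_has_vector_derivative)
  have "\<exists>\<Phi>. (\<forall>x. (\<Phi> has_real_derivative F x) (at x)) \<and> \<Phi> 0 = 0"
    by (intro exI[of _ "\<lambda>x. \<Phi> x - \<Phi> 0"]) (auto intro!: derivative_eq_intros \<Phi>)
  from someI_ex[OF this] show "(antideriv F has_real_derivative F x) (at x)" "antideriv F 0 = 0"
    unfolding antideriv_def by blast+
qed

text \<open>Against the weight \<open>exp (K * \<bar>t\<bar>)\<close> integration from 0 gains a
  factor \<open>1 / K\<close>, uniformly on the whole line. Negative times follow by
  reflection.\<close>

lemma antideriv_diff_bound:
  assumes F: "continuous_on UNIV F" and G: "continuous_on UNIV G" and K: "0 < K" and C: "0 \<le> C"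
    and le: "\<And>s. \<bar>F s - G s\<bar> \<le> C * exp (K * \<bar>s\<bar>)"
  shows "\<bar>antideriv F t - antideriv G t\<bar> \<le> C / K * exp (K * \<bar>t\<bar>)"
proof -
  define D where "D x = antideriv F x - antideriv G x" for x
  define E where "E x = C / K * (exp (K * x) - 1)" for x
  have dD: "(D has_real_derivative F x - G x) (at x)" for x
    unfolding D_def[abs_def] by (intro DERIV_diff antideriv F G)
  have dE: "(E has_real_derivative C * exp (K * x)) (at x)" for x
    unfolding E_def[abs_def] using K by (auto intro!: derivative_eq_intros)
  have D0: "D 0 = 0" "E 0 = 0" using antideriv(2) F G by (auto simp: D_def E_def)
  have "\<bar>D t\<bar> \<le> E \<bar>t\<bar>"
  proof (cases "0 \<le> t")
    case True
    have "\<bar>D t\<bar> \<le> E t"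
    proof (rule abs_le_of_deriv_le_right[OF dD dE _ D0 True])
      show "\<bar>F x - G x\<bar> \<le> C * exp (K * x)" if "0 \<le> x" for x using le[of x] that by simp
    qed
    then show ?thesis using True by simp
  next
    case False
    have d: "((\<lambda>x. D (- x)) has_real_derivative - (F (- x) - G (- x))) (at x)" for x
      using DERIV_chain2[OF dD[of "- x"] DERIV_minus[OF DERIV_ident]] by simp
    have "\<bar>D (- (- t))\<bar> \<le> E (- t)"
    proof (rule abs_le_of_deriv_le_right[OF d dE])
      show "\<bar>- (F (- x) - G (- x))\<bar> \<le> C * exp (K * x)" if "0 \<le> x" for x
        unfolding abs_minus_cancel using le[of "- x"] that by simp
    qed (use D0 False in auto)
    then show ?thesis using False by simp
  qed
  also have "\<dots> \<le> C / K * exp (K * \<bar>t\<bar>)" unfolding E_def using C K by (intro mult_left_mono) auto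
  finally show ?thesis by (simp add: D_def)
qed

text \<open>Picard iteration in a weighted sup norm: with \<open>K = 2 * L + 1\<close> it is a
  contraction by 1/2 on the whole line, and the solution is global at once.\<close>

lemma flow_exists:
  fixes w :: "real \<Rightarrow> real"
  assumes lip: "\<And>x x'. \<bar>w x - w x'\<bar> \<le> L * \<bar>x - x'\<bar>" and L: "0 \<le> L" and bd: "\<And>x. \<bar>w x\<bar> \<le> B"
  shows "\<exists>u. u 0 = \<theta> \<and> (\<forall>t. (u has_real_derivative w (u t)) (at t))"
proof -
  define K where "K = 2 * L + 1"
  have K: "0 < K" "L / K \<le> 1 / 2" using L by (auto simp: K_def field_simps)
  have B: "0 \<le> B" using bd[of 0] by linarith
  have cw: "continuous_on UNIV w" by (rule lipschitz_continuous_on[OF lip L])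
  \<comment> \<open>The unknown is the displacement divided by the weight, so that it lies in the
    complete space of bounded continuous functions.\<close>
  define F where "F v s = w (\<theta> + exp (K * \<bar>s\<bar>) * apply_bcontfun v s)" for v :: "real \<Rightarrow>\<^sub>C real" and s
  have cF: "continuous_on UNIV (F v)" for v
    unfolding F_def[abs_def] by (intro continuous_on_compose2[OF cw] continuous_intros) auto
  define T where "T v t = exp (- (K * \<bar>t\<bar>)) * antideriv (F v) t" for v t
  have cT: "continuous_on UNIV (T v)" for v
    unfolding T_def[abs_def] using antideriv(1)[OF cF]
    by (intro continuous_intros DERIV_continuous_on[of _ _ "F v"]) (auto intro: has_field_derivative_at_within)
  have bT: "\<bar>T v t\<bar> \<le> B / K" for v t
  proof -
    have "\<bar>antideriv (F v) t - antideriv (\<lambda>_. 0) t\<bar> \<le> B / K * exp (K * \<bar>t\<bar>)"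
    proof (rule antideriv_diff_bound[OF cF continuous_on_const K(1) B])
      fix s
      have "\<bar>F v s - 0\<bar> \<le> B * 1" using bd by (simp add: F_def)
      also have "\<dots> \<le> B * exp (K * \<bar>s\<bar>)" using B K by (intro mult_left_mono) auto
      finally show "\<bar>F v s - 0\<bar> \<le> B * exp (K * \<bar>s\<bar>)" .
    qed
    moreover have "antideriv (\<lambda>_. 0) t = 0"
      using DERIV_isconst_all[of "antideriv (\<lambda>_. 0)" t 0] antideriv[of "\<lambda>_. 0"] by simp
    ultimately have "\<bar>antideriv (F v) t\<bar> \<le> B / K * exp (K * \<bar>t\<bar>)" by simp
    then have "exp (- (K * \<bar>t\<bar>)) * \<bar>antideriv (F v) t\<bar> \<le> exp (- (K * \<bar>t\<bar>)) * (B / K * exp (K * \<bar>t\<bar>))"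
      by (intro mult_left_mono) auto
    also have "\<dots> = B / K" by (simp add: exp_minus field_simps)
    finally show ?thesis by (simp add: T_def abs_mult)
  qed
  have mem: "T v \<in> bcontfun" for v
    using cT bT by (intro bcontfun_normI[of _ "B / K"]) auto
  have app: "apply_bcontfun (Bcontfun (T v)) = T v" for v using mem by (rule Bcontfun_inverse)
  have contr: "dist (Bcontfun (T v)) (Bcontfun (T v')) \<le> 1 / 2 * dist v v'" for v v'
  proof (rule dist_bound)
    fix t
    have "\<bar>antideriv (F v) t - antideriv (F v') t\<bar> \<le> (L * dist v v') / K * exp (K * \<bar>t\<bar>)"
    proof (rule antideriv_diff_bound[OF cF cF K(1)])
      show "0 \<le> L * dist v v'" using L by simp
      fix s
      have "\<bar>F v s - F v' s\<bar> \<le> L * \<bar>exp (K * \<bar>s\<bar>) * (apply_bcontfun v s - apply_bcontfun v' s)\<bar>"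
        unfolding F_def using lip[of "\<theta> + exp (K * \<bar>s\<bar>) * apply_bcontfun v s" "\<theta> + exp (K * \<bar>s\<bar>) * apply_bcontfun v' s"]
        by (simp add: algebra_simps)
      also have "\<dots> = L * exp (K * \<bar>s\<bar>) * dist (apply_bcontfun v s) (apply_bcontfun v' s)"
        by (simp add: abs_mult dist_real_def)
      also have "\<dots> \<le> L * exp (K * \<bar>s\<bar>) * dist v v'" using L by (intro mult_left_mono dist_bounded) auto
      finally show "\<bar>F v s - F v' s\<bar> \<le> L * dist v v' * exp (K * \<bar>s\<bar>)" by (simp add: mult_ac)
    qed
    then have "exp (- (K * \<bar>t\<bar>)) * \<bar>antideriv (F v) t - antideriv (F v') t\<bar> \<le>
       exp (- (K * \<bar>t\<bar>)) * ((L * dist v v') / K * exp (K * \<bar>t\<bar>))" by (intro mult_left_mono) auto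
    also have "\<dots> = L / K * dist v v'" by (simp add: exp_minus field_simps)
    also have "\<dots> \<le> 1 / 2 * dist v v'" using K by (intro mult_right_mono) auto
    finally show "dist (apply_bcontfun (Bcontfun (T v)) t) (apply_bcontfun (Bcontfun (T v')) t) \<le> 1 / 2 * dist v v'"
      unfolding app T_def dist_real_def by (simp add: abs_mult flip: right_diff_distrib)
  qed
  have "\<exists>!v. Bcontfun (T v) = v"
    by (rule banach_fix_type[of "1 / 2"]) (use contr in auto)
  then obtain v where v: "Bcontfun (T v) = v" by blast
  define u where "u t = \<theta> + antideriv (F v) t" for t
  have vt: "apply_bcontfun v t = T v t" for t using app[of v] v by simp
  have "exp (K * \<bar>t\<bar>) * apply_bcontfun v t = antideriv (F v) t" for t
    unfolding vt T_def by (simp add: exp_minus)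
  then have Fu: "F v t = w (u t)" for t by (simp add: F_def u_def)
  have "(u has_real_derivative w (u t)) (at t)" for t
    unfolding Fu[symmetric] unfolding u_def[abs_def] by (auto intro!: derivative_eq_intros antideriv(1)[OF cF])
  moreover have "u 0 = \<theta>" using antideriv(2)[OF cF] by (simp add: u_def)
  ultimately show ?thesis by blast
qed

text \<open>The squared difference of two solutions changes at a rate at most \<open>2 * L\<close>
  times itself. Multiplied by \<open>exp (- 2 * L * t)\<close> for positive times, or
  \<open>exp (2 * L * t)\<close> for negative ones, it cannot grow away from 0.\<close>

lemma flow_unique:
  fixes w u u' :: "real \<Rightarrow> real"
  assumes lip: "\<And>x x'. \<bar>w x - w x'\<bar> \<le> L * \<bar>x - x'\<bar>"
    and u: "\<And>t. (u has_real_derivative w (u t)) (at t)" and u': "\<And>t. (u' has_real_derivative w (u' t)) (at t)"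
    and eq: "u 0 = u' 0"
  shows "u = u'"
proof
  fix t
  define D where "D t = u t - u' t" for t
  define E where "E c t = (D t)\<^sup>2 * exp (c * t)" for c t
  have dE: "(E c has_real_derivative (2 * (D t * (w (u t) - w (u' t))) + c * (D t)\<^sup>2) * exp (c * t)) (at t)" for c t
    unfolding E_def[abs_def] D_def[abs_def]
    by (auto intro!: derivative_eq_intros u u' simp: algebra_simps power2_eq_square)
  have le: "\<bar>2 * (D t * (w (u t) - w (u' t)))\<bar> \<le> 2 * L * (D t)\<^sup>2" for t
  proof -
    have "\<bar>D t\<bar> * \<bar>w (u t) - w (u' t)\<bar> \<le> \<bar>D t\<bar> * (L * \<bar>D t\<bar>)"
      using lip[of "u t" "u' t"] by (intro mult_left_mono) (auto simp: D_def)
    moreover have "\<bar>2 * (D t * (w (u t) - w (u' t)))\<bar> = 2 * (\<bar>D t\<bar> * \<bar>w (u t) - w (u' t)\<bar>)"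
      by (simp only: abs_mult abs_numeral)
    moreover have "\<bar>D t\<bar> * (L * \<bar>D t\<bar>) = L * (D t)\<^sup>2" by (simp add: power2_eq_square)
    ultimately show ?thesis by simp
  qed
  have D0: "E c 0 = 0" for c using eq by (simp add: E_def D_def)
  have "\<exists>c. E c t \<le> 0"
  proof (cases "0 \<le> t")
    case True
    have "E (- 2 * L) t \<le> E (- 2 * L) 0"
    proof (rule DERIV_nonpos_imp_nonincreasing[where f = "E (- 2 * L)", OF True])
      fix x
      have "(2 * (D x * (w (u x) - w (u' x))) + (- 2 * L) * (D x)\<^sup>2) * exp ((- 2 * L) * x) \<le> 0"
        using le[of x] by (intro mult_nonpos_nonneg) auto
      then show "\<exists>y. (E (- 2 * L) has_real_derivative y) (at x) \<and> y \<le> 0" using dE by blast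
    qed
    then show ?thesis using D0 by auto
  next
    case False
    have "E (2 * L) t \<le> E (2 * L) 0"
    proof (rule DERIV_nonneg_imp_nondecreasing[where f = "E (2 * L)"])
      fix x
      have "0 \<le> (2 * (D x * (w (u x) - w (u' x))) + (2 * L) * (D x)\<^sup>2) * exp ((2 * L) * x)"
        using le[of x] by (intro mult_nonneg_nonneg) auto
      then show "\<exists>y. (E (2 * L) has_real_derivative y) (at x) \<and> 0 \<le> y" using dE by blast
    qed (use False in simp)
    then show ?thesis using D0 by auto
  qed
  then have "(D t)\<^sup>2 \<le> 0" by (auto simp: E_def mult_le_0_iff)
  then show "u t = u' t" by (simp add: D_def)
qed

lemma avg_flow:
  fixes w :: "real \<Rightarrow> real"
  assumes lip: "\<And>x x'. \<bar>w x - w x'\<bar> \<le> L * \<bar>x - x'\<bar>" and L: "0 \<le> L" and bd: "\<And>x. \<bar>w x\<bar> \<le> B"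
  shows "avg_flow w \<theta> 0 = \<theta>" "(avg_flow w \<theta> has_real_derivative w (avg_flow w \<theta> t)) (at t)"
proof -
  obtain u where u: "u 0 = \<theta>" "\<And>t. (u has_real_derivative w (u t)) (at t)" using flow_exists[OF assms] by blast
  have "avg_flow w \<theta> = u"
    unfolding avg_flow_def
  proof (rule the_equality)
    show "u 0 = \<theta> \<and> (\<forall>t. (u has_real_derivative w (u t)) (at t))" using u by blast
    fix u' assume "u' 0 = \<theta> \<and> (\<forall>t. (u' has_real_derivative w (u' t)) (at t))"
    then show "u' = u" using u by (intro flow_unique[OF lip]) auto
  qed
  then show "avg_flow w \<theta> 0 = \<theta>" "(avg_flow w \<theta> has_real_derivative w (avg_flow w \<theta> t)) (at t)" using u by auto
qed

lemma discrete_gronwall: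
  fixes e :: "nat \<Rightarrow> real"
  assumes "\<And>k. k \<le> N \<Longrightarrow> e k \<le> a + b * (\<Sum>j<k. e j)" "0 \<le> a" "0 \<le> b" "k \<le> N"
  shows "e k \<le> a * (1 + b) ^ k"
  using assms(4)
proof (induction k rule: less_induct)
  case (less k)
  have "(\<Sum>j<k. e j) \<le> (\<Sum>j<k. a * (1 + b) ^ j)" using less by (intro sum_mono) auto
  then have "e k \<le> a + b * (\<Sum>j<k. a * (1 + b) ^ j)"
    using assms(1)[OF less.prems] mult_left_mono[OF _ assms(3)] by (meson add_left_mono order.trans)
  also have "\<dots> = a * (1 + b) ^ k"
  proof (induction k)
    case (Suc k)
    then show ?case by (simp add: algebra_simps)
  qed simp
  finally show ?case .
qed

section \<open>Comparison of discrete slow orbits with the averaged flow\<close>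

context
  fixes u w :: "real \<Rightarrow> real" and L B \<epsilon> \<theta>0 :: real
  assumes u: "u 0 = \<theta>0" "\<And>t. (u has_real_derivative w (u t)) (at t)"
    and w: "\<And>x x'. \<bar>w x - w x'\<bar> \<le> L * \<bar>x - x'\<bar>" "0 \<le> L" "\<And>x. \<bar>w x\<bar> \<le> B"
    and eps: "0 < \<epsilon>"
begin

lemma flow_lipschitz: "\<bar>u t - u s\<bar> \<le> B * \<bar>t - s\<bar>"
  using field_differentiable_bound[of UNIV u "\<lambda>t. w (u t)" B t s] u(2) w(3) by simp

lemma continuous_flow: "continuous_on S u"
  by (rule DERIV_continuous_on) (rule has_field_derivative_at_within[OF u(2)])

text \<open>Each cell of length \<epsilon> contributes at most \<open>\<epsilon>^2 * L * B\<close>,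
  and there are at most 1/\<epsilon> cells.\<close>

lemma riemann_error:
  assumes g: "\<And>x x'. \<bar>g x - g x'\<bar> \<le> L * \<bar>x - x'\<bar>" and k: "real k * \<epsilon> \<le> 1"
  shows "\<bar>integral {0..real k * \<epsilon>} (\<lambda>s. g (u s)) - \<epsilon> * (\<Sum>j<k. g (u (real j * \<epsilon>)))\<bar> \<le> \<epsilon> * (L * B)"
proof -
  have B: "0 \<le> B" using w(3)[of 0] by linarith
  have cg: "continuous_on UNIV g" by (rule lipschitz_continuous_on[OF g w(2)])
  have cgu: "continuous_on S (\<lambda>s. g (u s))" for S by (rule continuous_on_compose2[OF cg continuous_flow]) auto
  have i: "(\<lambda>s. g (u s)) integrable_on {a..b}" for a b by (intro integrable_continuous_real cgu)
  have "integral {0..0 + real k * \<epsilon>} (\<lambda>s. g (u s)) = (\<Sum>j<k. integral {0 + real j * \<epsilon>..0 + real (Suc j) * \<epsilon>} (\<lambda>s. g (u s)))"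
    by (rule integral_pieces[OF i]) (use eps in simp)
  then have eq: "integral {0..real k * \<epsilon>} (\<lambda>s. g (u s)) - \<epsilon> * (\<Sum>j<k. g (u (real j * \<epsilon>))) =
     (\<Sum>j<k. integral {real j * \<epsilon>..real (Suc j) * \<epsilon>} (\<lambda>s. g (u s)) - \<epsilon> * g (u (real j * \<epsilon>)))"
    by (simp add: sum_subtractf sum_distrib_left)
  have "\<bar>integral {real j * \<epsilon>..real (Suc j) * \<epsilon>} (\<lambda>s. g (u s)) - \<epsilon> * g (u (real j * \<epsilon>))\<bar> \<le> \<epsilon> * (\<epsilon> * (L * B))" for j
  proof -
    define a where "a = real j * \<epsilon>"
    have len: "real (Suc j) * \<epsilon> = a + \<epsilon>" by (simp add: a_def algebra_simps)
    have "norm (integral {a..a + \<epsilon>} (\<lambda>s. g (u s) - g (u a))) \<le> integral {a..a + \<epsilon>} (\<lambda>_. L * (B * \<epsilon>))"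
    proof (rule Henstock_Kurzweil_Integration.integral_norm_bound_integral)
      show "(\<lambda>s. g (u s) - g (u a)) integrable_on {a..a + \<epsilon>}" by (intro integrable_continuous_real continuous_intros cgu)
      fix s assume s: "s \<in> {a..a + \<epsilon>}"
      have "\<bar>g (u s) - g (u a)\<bar> \<le> L * \<bar>u s - u a\<bar>" by (rule g)
      also have "\<dots> \<le> L * (B * \<bar>s - a\<bar>)" using flow_lipschitz w(2) by (intro mult_left_mono)
      also have "\<dots> \<le> L * (B * \<epsilon>)" using s B w(2) by (intro mult_left_mono) auto
      finally show "norm (g (u s) - g (u a)) \<le> L * (B * \<epsilon>)" by simp
    qed (rule integrable_const_ivl)
    moreover have "integral {a..a + \<epsilon>} (\<lambda>s. g (u s) - g (u a)) = integral {a..a + \<epsilon>} (\<lambda>s. g (u s)) - \<epsilon> * g (u a)"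
      using Henstock_Kurzweil_Integration.integral_diff[OF i integrable_const_ivl[of "g (u a)"], of a "a + \<epsilon>"] eps by simp
    ultimately show ?thesis unfolding len a_def[symmetric] using eps by (simp add: mult_ac)
  qed
  then have "\<bar>\<Sum>j<k. integral {real j * \<epsilon>..real (Suc j) * \<epsilon>} (\<lambda>s. g (u s)) - \<epsilon> * g (u (real j * \<epsilon>))\<bar> \<le> (\<Sum>j<k. \<epsilon> * (\<epsilon> * (L * B)))"
    by (intro order.trans[OF sum_abs sum_mono])
  also have "\<dots> = (real k * \<epsilon>) * (\<epsilon> * (L * B))" by simp
  also have "\<dots> \<le> 1 * (\<epsilon> * (L * B))" using k eps w(2) B by (intro mult_right_mono) auto
  finally show ?thesis unfolding eq by simp
qed

lemma path_compare:
  fixes om al th :: "nat \<Rightarrow> real"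
  assumes th: "\<And>k. th (Suc k) = th k + \<epsilon> * om k" "\<bar>th 0 - \<theta>0\<bar> \<le> C * \<epsilon>"
    and g: "\<And>x x'. \<bar>g x - g x'\<bar> \<le> L * \<bar>x - x'\<bar>" and N: "real N * \<epsilon> \<le> 1"
    and dev: "\<And>k. k \<le> N \<Longrightarrow> \<bar>\<Sum>j<k. om j - w (th j)\<bar> \<le> r" "\<And>k. k \<le> N \<Longrightarrow> \<bar>\<Sum>j<k. al j - g (th j)\<bar> \<le> r"
    and k: "k \<le> N" and C: "0 \<le> C"
  shows "\<bar>\<epsilon> * (\<Sum>j<k. al j) - integral {0..real k * \<epsilon>} (\<lambda>s. g (u s))\<bar> \<le>
    \<epsilon> * ((1 + L * exp L) * r + (L * exp L * (C + L * B) + L * B))"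
proof -
  have B: "0 \<le> B" using w(3)[of 0] by linarith
  have r0: "0 \<le> r" using dev(1)[of 0] by simp
  define e where "e k = \<bar>th k - u (real k * \<epsilon>)\<bar>" for k
  define E where "E = \<epsilon> * (C + r + L * B)"
  have E0: "0 \<le> E" using eps C r0 w(2) B by (simp add: E_def)
  have kN: "real k * \<epsilon> \<le> 1" if "k \<le> N" for k
  proof -
    have "real k * \<epsilon> \<le> real N * \<epsilon>" using that eps by (intro mult_right_mono) auto
    then show ?thesis using N by linarith
  qed
  have lipsum: "\<bar>\<Sum>j<k. q (th j) - q (u (real j * \<epsilon>))\<bar> \<le> L * (\<Sum>j<k. e j)"
    if "\<And>x x'. \<bar>q x - q x'\<bar> \<le> L * \<bar>x - x'\<bar>" for q k
    unfolding sum_distrib_left by (intro order.trans[OF sum_abs sum_mono]) (simp add: e_def that)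
  have tri: "\<bar>x\<bar> \<le> a + b + c" if "x = x1 + x2 + x3" "\<bar>x1\<bar> \<le> a" "\<bar>x2\<bar> \<le> b" "\<bar>x3\<bar> \<le> c" for x x1 x2 x3 a b c :: real
    using that unfolding abs_le_iff by auto
  have thk: "th k = th 0 + \<epsilon> * (\<Sum>j<k. om j)" for k by (induction k) (auto simp: th(1) algebra_simps)
  have uk: "u (real k * \<epsilon>) = \<theta>0 + integral {0..real k * \<epsilon>} (\<lambda>s. w (u s))" for k
  proof -
    have "((\<lambda>s. w (u s)) has_integral (u (real k * \<epsilon>) - u 0)) {0..real k * \<epsilon>}"
      using u(2) eps by (intro fundamental_theorem_of_calculus)
        (auto simp: has_real_derivative_iff_has_vector_derivative[symmetric] intro: has_field_derivative_at_within)
    then show ?thesis using u(1) by (simp add: integral_unique)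
  qed
  \<comment> \<open>Fluctuation, displacement of the slow variable, and quadrature. With
    \<open>om\<close> and \<open>w\<close> this closes the Gronwall inequality for the slow
    variable; with \<open>al\<close> and \<open>g\<close> it then bounds the coordinate in
    question.\<close>
  have split: "\<bar>\<epsilon> * (\<Sum>j<k. b j) - integral {0..real k * \<epsilon>} (\<lambda>s. q (u s))\<bar> \<le> \<epsilon> * r + \<epsilon> * (L * (\<Sum>j<k. e j)) + \<epsilon> * (L * B)"
    if "k \<le> N" "\<And>x x'. \<bar>q x - q x'\<bar> \<le> L * \<bar>x - x'\<bar>" "\<bar>\<Sum>j<k. b j - q (th j)\<bar> \<le> r" for k b q
  proof (rule tri)
    show "\<epsilon> * (\<Sum>j<k. b j) - integral {0..real k * \<epsilon>} (\<lambda>s. q (u s)) = \<epsilon> * (\<Sum>j<k. b j - q (th j)) +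
      \<epsilon> * (\<Sum>j<k. q (th j) - q (u (real j * \<epsilon>))) + (\<epsilon> * (\<Sum>j<k. q (u (real j * \<epsilon>))) - integral {0..real k * \<epsilon>} (\<lambda>s. q (u s)))"
      by (simp add: sum_subtractf algebra_simps)
    show "\<bar>\<epsilon> * (\<Sum>j<k. b j - q (th j))\<bar> \<le> \<epsilon> * r" using that(3) eps by (simp add: abs_mult)
    show "\<bar>\<epsilon> * (\<Sum>j<k. q (th j) - q (u (real j * \<epsilon>)))\<bar> \<le> \<epsilon> * (L * (\<Sum>j<k. e j))"
      using lipsum[OF that(2), of k] eps by (simp add: abs_mult)
    show "\<bar>\<epsilon> * (\<Sum>j<k. q (u (real j * \<epsilon>))) - integral {0..real k * \<epsilon>} (\<lambda>s. q (u s))\<bar> \<le> \<epsilon> * (L * B)"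
      using riemann_error[OF that(2) kN[OF that(1)]] by (simp add: abs_minus_commute)
  qed
  have ek: "e k \<le> E * exp L" if "k \<le> N" for k
  proof -
    have "e k \<le> E + (\<epsilon> * L) * (\<Sum>j<k. e j)" if "k \<le> N" for k
    proof -
      have "th k - u (real k * \<epsilon>) = (th 0 - \<theta>0) + (\<epsilon> * (\<Sum>j<k. om j) - integral {0..real k * \<epsilon>} (\<lambda>s. w (u s)))"
        unfolding thk[of k] uk[of k] by simp
      then have "e k \<le> C * \<epsilon> + (\<epsilon> * r + \<epsilon> * (L * (\<Sum>j<k. e j)) + \<epsilon> * (L * B))"
        unfolding e_def using order.trans[OF abs_triangle_ineq add_mono[OF th(2) split[OF that w(1) dev(1)[OF that]]]]
        by (simp add: e_def)
      then show ?thesis by (simp add: E_def algebra_simps)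
    qed
    from discrete_gronwall[OF this E0 _ that] have "e k \<le> E * (1 + \<epsilon> * L) ^ k" using eps w(2) by simp
    also have "\<dots> \<le> E * exp L"
    proof (rule mult_left_mono[OF _ E0])
      have "(1 + \<epsilon> * L) ^ k \<le> exp (\<epsilon> * L) ^ k" using eps w(2) by (intro power_mono exp_ge_add_one_self) auto
      also have "\<dots> = exp ((real k * \<epsilon>) * L)" by (simp add: exp_of_nat_mult mult.assoc)
      also have "\<dots> \<le> exp (1 * L)" using mult_right_mono[OF kN[OF that] w(2)] by simp
      finally show "(1 + \<epsilon> * L) ^ k \<le> exp L" by simp
    qed
    finally show ?thesis .
  qed
  have "\<epsilon> * (L * (\<Sum>j<k. e j)) \<le> L * (E * exp L)"
  proof -
    have "(\<Sum>j<k. e j) \<le> (\<Sum>j<k. E * exp L)" using ek k by (intro sum_mono) auto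
    then have "\<epsilon> * (L * (\<Sum>j<k. e j)) \<le> \<epsilon> * (L * (real k * (E * exp L)))"
      using eps w(2) by (intro mult_left_mono) auto
    also have "\<dots> = (real k * \<epsilon>) * (L * (E * exp L))" by simp
    also have "\<dots> \<le> 1 * (L * (E * exp L))" using kN[OF k] w(2) E0 by (intro mult_right_mono) auto
    finally show ?thesis by simp
  qed
  then have "\<bar>\<epsilon> * (\<Sum>j<k. al j) - integral {0..real k * \<epsilon>} (\<lambda>s. g (u s))\<bar> \<le> \<epsilon> * r + L * (E * exp L) + \<epsilon> * (L * B)"
    using split[OF k g dev(2)[OF k]] by linarith
  also have "\<dots> = \<epsilon> * ((1 + L * exp L) * r + (L * exp L * (C + L * B) + L * B))"
    by (simp add: E_def algebra_simps)
  finally show ?thesis .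
qed

end

text \<open>The derivative is extended by its end values, which keeps continuity and the bound. An
  antiderivative agrees with the given function on the interval up to a constant.\<close>

lemma C1_extension:
  fixes G :: "real \<Rightarrow> real"
  assumes ab: "a < b" and G: "\<And>x. x \<in> {a..b} \<Longrightarrow> (G has_real_derivative G1 x) (at x within {a..b})"
    and c: "continuous_on {a..b} G1" and le: "\<And>x. x \<in> {a..b} \<Longrightarrow> \<bar>G1 x\<bar> \<le> C"
  obtains H H1 where "\<And>x. (H has_real_derivative H1 x) (at x)" "continuous_on UNIV H1" "\<And>x. \<bar>H1 x\<bar> \<le> C"
    "\<And>x. x \<in> {a..b} \<Longrightarrow> H x = G x"
proof -
  define H1 where "H1 x = G1 (max a (min b x))" for x
  have cl: "max a (min b x) \<in> {a..b}" for x using ab by auto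
  have cH1: "continuous_on UNIV H1"
    unfolding H1_def[abs_def] by (rule continuous_on_compose2[OF c]) (use ab in \<open>auto intro!: continuous_intros\<close>)
  define D where "D x = G x - antideriv H1 x" for x
  have "\<exists>k. \<forall>x\<in>{a..b}. D x = k"
  proof (rule has_field_derivative_zero_constant)
    fix x assume x: "x \<in> {a..b}"
    have "(D has_real_derivative G1 x - H1 x) (at x within {a..b})"
      unfolding D_def[abs_def]
      by (intro DERIV_diff G x has_field_derivative_at_within[OF antideriv(1)[OF cH1]])
    moreover have "H1 x = G1 x" using x by (simp add: H1_def)
    ultimately show "(D has_field_derivative 0) (at x within {a..b})" by simp
  qed simp
  then obtain k where k: "\<And>x. x \<in> {a..b} \<Longrightarrow> D x = k" by blast
  show ?thesis
  proof (rule that[of "\<lambda>x. antideriv H1 x + k" H1])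
    show "((\<lambda>x. antideriv H1 x + k) has_real_derivative H1 x) (at x)" for x
      using DERIV_add[OF antideriv(1)[OF cH1] DERIV_const] by simp
    show "\<bar>H1 x\<bar> \<le> C" for x unfolding H1_def by (rule le[OF cl])
    show "antideriv H1 x + k = G x" if "x \<in> {a..b}" for x using k[OF that] by (simp add: D_def)
  qed (rule cH1)
qed

text \<open>The value of \<open>distr\<close> on a set is either the measure of the preimage or the
  default 0. An upper bound for the law of the path thus follows from one for the preimage, whatever
  the measurability of the path map.\<close>

lemma emeasure_distr_le:
  "emeasure (distr M N f) X \<le> emeasure M (f -` X \<inter> space M)"
  unfolding distr_def emeasure_measure_of_conv by simp

section \<open>Deviation of the paths\<close>

lemma slow_sum_eq:
  "slow_sum f A \<omega> i1 \<epsilon> p k = axis i1 (snd p) + \<epsilon> *\<^sub>R (\<Sum>j<k. A ((fast_slow f \<omega> \<epsilon> ^^ j) p))"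
  by (induction k) (auto simp: algebra_simps)

lemma slow_path_eq:
  "slow_path f A \<omega> i1 \<epsilon> p t = \<epsilon> *\<^sub>R (\<Sum>j<nat \<lfloor>t / \<epsilon>\<rfloor>. A ((fast_slow f \<omega> \<epsilon> ^^ j) p)) +
     (t / \<epsilon> - real (nat \<lfloor>t / \<epsilon>\<rfloor>)) *\<^sub>R (\<epsilon> *\<^sub>R A ((fast_slow f \<omega> \<epsilon> ^^ nat \<lfloor>t / \<epsilon>\<rfloor>) p))"
  unfolding slow_path_def slow_interp_def Let_def slow_sum_eq by (simp add: scaleR_add_right algebra_simps)

text \<open>Congruence modulo integers in both variables is preserved by the lifted map and
  invisible to \<open>A\<close>. Path increments can therefore be computed along the lifted curve
  instead of its projection.\<close>

lemma slow_path_torus_proj: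
  fixes A :: "real \<times> real \<Rightarrow> real ^ 'd"
  assumes f: "circle_lift2 f" and A: "periodic2 A" and \<omega>: "periodic2 \<omega>"
  shows "slow_path f A \<omega> i1 \<epsilon> (torus_proj p) t = slow_path f A \<omega> i1 \<epsilon> p t"
proof -
  define eqv where "eqv q q' \<longleftrightarrow> fst q - fst q' \<in> \<int> \<and> snd q - snd q' \<in> \<int>" for q q' :: "real \<times> real"
  have p1: "periodic (\<lambda>x. g (x, \<theta>))" "periodic (\<lambda>\<theta>. g (x, \<theta>))" if "periodic2 g" for g :: "real \<times> real \<Rightarrow> 'a" and x \<theta>
    using that by (auto simp: periodic_def periodic2_def)
  have inv: "g q = g q'" if "periodic2 g" "eqv q q'" for g :: "real \<times> real \<Rightarrow> 'a" and q q'
    using periodic_Ints[OF p1(1)[OF that(1)], of "fst q" "fst q'" "snd q"] periodic_Ints[OF p1(2)[OF that(1)], of "snd q" "snd q'" "fst q'"] that(2)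
    by (cases q, cases q') (auto simp: eqv_def)
  have fint: "f q - f q' \<in> \<int>" if "eqv q q'" for q q'
  proof -
    have fr: "frac a = frac b \<longleftrightarrow> a - b \<in> \<int>" for a b :: real
    proof
      assume "frac a = frac b"
      then have "a - b = real_of_int (\<lfloor>a\<rfloor> - \<lfloor>b\<rfloor>)" by (simp add: frac_def)
      then show "a - b \<in> \<int>" by (metis Ints_of_int)
    next
      assume "a - b \<in> \<int>"
      then show "frac a = frac b" using periodic_Ints[of frac a b] by (simp add: periodic_def frac_1_eq)
    qed
    \<comment> \<open>Composition with \<open>frac\<close> reduces the statement about integer
      differences of \<open>f\<close> to the one about periodic functions.\<close>
    have "periodic2 (\<lambda>q. frac (f q))" using f unfolding periodic2_def circle_lift2_def fr by blast
    from inv[OF this that] show ?thesis by (simp add: fr)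
  qed
  have step: "eqv (fast_slow f \<omega> \<epsilon> q) (fast_slow f \<omega> \<epsilon> q')" if "eqv q q'" for q q'
  proof -
    have "\<omega> q = \<omega> q'" by (rule inv[OF \<omega> that])
    then show ?thesis using fint[OF that] that by (cases q, cases q') (simp add: eqv_def fast_slow_def)
  qed
  have "eqv ((fast_slow f \<omega> \<epsilon> ^^ j) (torus_proj p)) ((fast_slow f \<omega> \<epsilon> ^^ j) p)" for j
  proof (induction j)
    case 0 show ?case by (simp add: eqv_def torus_proj_def frac_def)
  next
    case (Suc j) then show ?case using step by simp
  qed
  then have "A ((fast_slow f \<omega> \<epsilon> ^^ j) (torus_proj p)) = A ((fast_slow f \<omega> \<epsilon> ^^ j) p)" for j
    by (rule inv[OF A])
  then show ?thesis unfolding slow_path_eq by simp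
qed

text \<open>The estimates weaken monotonically in their constants, so for finitely many coordinates
  and signs the maximum and the minima serve all of them.\<close>

lemma uniform_constants:
  fixes Q :: "'i::finite \<Rightarrow> real \<Rightarrow> real \<Rightarrow> real \<Rightarrow> bool"
  assumes ex: "\<And>i. \<exists>a c e. 0 < a \<and> 0 < c \<and> 0 < e \<and> Q i a c e"
    and mono: "\<And>i a c e a' c' e'. Q i a c e \<Longrightarrow> a \<le> a' \<Longrightarrow> c' \<le> c \<Longrightarrow> e' \<le> e \<Longrightarrow> Q i a' c' e'"
  obtains a c e where "0 < a" "0 < c" "0 < e" "\<And>i. Q i a c e"
proof -
  have "\<forall>i. \<exists>t. 0 < fst t \<and> 0 < fst (snd t) \<and> 0 < snd (snd t) \<and> Q i (fst t) (fst (snd t)) (snd (snd t))"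
  proof
    fix i
    obtain a c e where "0 < a \<and> 0 < c \<and> 0 < e \<and> Q i a c e" using ex[of i] by (elim exE)
    then show "\<exists>t. 0 < fst t \<and> 0 < fst (snd t) \<and> 0 < snd (snd t) \<and> Q i (fst t) (fst (snd t)) (snd (snd t))"
      by (intro exI[of _ "(a, c, e)"]) simp
  qed
  from choice[OF this] obtain t where t: "\<And>i. 0 < fst (t i) \<and> 0 < fst (snd (t i)) \<and> 0 < snd (snd (t i)) \<and> Q i (fst (t i)) (fst (snd (t i))) (snd (snd (t i)))"
    by blast
  define a c e where "a i = fst (t i)" and "c i = fst (snd (t i))" and "e i = snd (snd (t i))" for i
  have Q: "0 < a i" "0 < c i" "0 < e i" "Q i (a i) (c i) (e i)" for i using t[of i] by (auto simp: a_def c_def e_def)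
  show ?thesis
  proof (rule that[of "Max (range a)" "Min (range c)" "Min (range e)"])
    show "0 < Max (range a)" "0 < Min (range c)" "0 < Min (range e)"
      using Q(1,2,3) by (simp_all add: Max_gr_iff)
    show "Q i (Max (range a)) (Min (range c)) (Min (range e))" for i
      by (rule mono[OF Q(4)[of i]]) simp_all
  qed
qed

section \<open>All coordinates and both signs simultaneously\<close>

locale vector_system = expanding_family +
  fixes \<omega> \<omega>1 \<omega>2 :: "real \<times> real \<Rightarrow> real" and A :: "real \<times> real \<Rightarrow> real ^ 'd" and A1 A2 :: "'d \<Rightarrow> real \<times> real \<Rightarrow> real"
    and i1 :: 'd and c1 c2 \<delta> lam :: real
  assumes A: "\<And>i. partials (\<lambda>z. A z $ i) (A1 i) (A2 i)" "\<And>i. continuous_on UNIV (A1 i)" "\<And>i z. \<bar>A z $ i\<bar> \<le> B"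
      "\<And>i z. \<bar>A1 i z\<bar> \<le> B" "\<And>i z. \<bar>A2 i z\<bar> \<le> B" "\<And>\<theta>. periodic (\<lambda>x. A (x, \<theta>))"
    and A_i1: "\<And>z. A z $ i1 = \<omega> z"
    and \<omega>: "partials \<omega> \<omega>1 \<omega>2" "continuous_on UNIV \<omega>1" "continuous_on UNIV \<omega>2"
      "\<And>z. \<bar>\<omega> z\<bar> \<le> B" "\<And>z. \<bar>\<omega>1 z\<bar> \<le> B" "\<And>z. \<bar>\<omega>2 z\<bar> \<le> B"
    and c: "2 * B \<le> c1" "2 * B \<le> c2" and \<delta>: "0 < \<delta>" "\<delta> \<le> 1 / 2"
    and lam: "2 < lam" "\<And>z. lam \<le> f1 z" and cont_e1: "continuous_on UNIV e1"
begin

lemma scaled: "\<bar>s\<bar> = 1 \<Longrightarrow> slow_fast f f1 f2 f3 t0 t1 t2 e1 e2 t01 t11 B (\<lambda>z. s * A z $ i) (\<lambda>z. s * A1 i z) (\<lambda>z. s * A2 i z) \<omega> \<omega>1 \<omega>2 c1 c2 \<delta> lam"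
proof unfold_locales
  assume s: "\<bar>s\<bar> = 1"
  show "partials (\<lambda>z. s * A z $ i) (\<lambda>z. s * A1 i z) (\<lambda>z. s * A2 i z)"
    unfolding partials_def
  proof
    fix z
    have "((\<lambda>z. A z $ i) has_derivative (\<lambda>(u, v). u * A1 i z + v * A2 i z)) (at z)"
      using A(1)[of i] by (simp only: partials_def)
    from has_derivative_mult_right[OF this, of s]
    show "((\<lambda>z. s * A z $ i) has_derivative (\<lambda>(u, v). u * (s * A1 i z) + v * (s * A2 i z))) (at z)"
      by (simp add: case_prod_unfold algebra_simps)
  qed
  show "continuous_on UNIV (\<lambda>z. s * A1 i z)" by (intro continuous_intros A(2))
  show "\<bar>s * A z $ i\<bar> \<le> B" "\<bar>s * A1 i z\<bar> \<le> B" "\<bar>s * A2 i z\<bar> \<le> B" for z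
    unfolding abs_mult s using A(3,4,5) by simp_all
  show "periodic (\<lambda>x. s * A (x, \<theta>) $ i)" for \<theta> using A(6)[of \<theta>] by (simp add: periodic_def)
qed (rule \<omega> c \<delta> lam cont_e1)+

definition Abar where "Abar i \<theta> = mean \<theta> (\<lambda>x. A (x, \<theta>) $ i)"

text \<open>This Lipschitz constant depends on \<open>B\<close> alone and hence serves every
  coordinate.\<close>

abbreviation LA where "LA \<equiv> slow_fast.La B"

lemma A_cont: "continuous_on UNIV (\<lambda>x. A (x, \<theta>) $ i)"
  by (rule continuous_on_UNIV_deriv[OF partials_x[OF A(1)]])

lemma A_slice: "(\<lambda>x. A (x, \<theta>) $ i) \<in> borel_measurable borel" "\<bar>A (x, \<theta>) $ i\<bar> \<le> B" "periodic (\<lambda>x. A (x, \<theta>) $ i)"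
  using borel_measurable_continuous_onI[OF A_cont] A(3) A(6)[of \<theta>] by (auto simp: periodic_def)

lemma \<alpha>bar_scaled: "\<bar>s\<bar> = 1 \<Longrightarrow> slow_fast.\<alpha>bar f (\<lambda>z. s * A z $ i) \<theta> = s * Abar i \<theta>"
  unfolding slow_fast.\<alpha>bar_def[OF scaled] Abar_def
  using expanding_map.mean_add[OF expanding_map A_slice A_slice, where a = s and b = 0] by simp

lemma Abar_lipschitz: "\<bar>Abar i \<theta> - Abar i \<theta>'\<bar> \<le> LA * \<bar>\<theta> - \<theta>'\<bar>"
  using slow_fast.\<alpha>bar_lipschitz[OF scaled[of 1], of i \<theta> \<theta>'] \<alpha>bar_scaled[of 1 i] by simp

lemma Abar_bound: "\<bar>Abar i \<theta>\<bar> \<le> B"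
  using slow_fast.\<alpha>bar_bound[OF scaled[of 1], of i \<theta>] \<alpha>bar_scaled[of 1 i] by simp

lemma LA0: "0 \<le> LA" using slow_fast.La(1)[OF scaled[of 1]] by simp

lemma avg_nth: "avg f A \<theta> $ i = Abar i \<theta>"
proof -
  interpret E: expanding_map "fz \<theta>" "\<lambda>x. f1 (x, \<theta>)" B by (rule expanding_map)
  have cA: "continuous_on UNIV (\<lambda>x. A (x, \<theta>))"
  proof -
    have "continuous_on UNIV (\<lambda>x. \<chi> i. A (x, \<theta>) $ i)" by (intro continuous_on_vec_lambda A_cont)
    then show ?thesis by simp
  qed
  have "norm (A (x, \<theta>)) \<le> real CARD('d) * B" for x
    by (rule order.trans[OF norm_le_l1_cart]) (rule sum_bounded_above, rule A(3))
  then have "integrable (acim (fz \<theta>)) (\<lambda>x. A (x, \<theta>))"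
    by (intro E.integrable_acim borel_measurable_continuous_onI cA)
  from integral_bounded_linear[OF bounded_linear_vec_nth this]
  have "avg f A \<theta> $ i = integral\<^sup>L (acim (fz \<theta>)) (\<lambda>x. A (x, \<theta>) $ i)" by (simp add: avg_def)
  then show ?thesis unfolding Abar_def using E.integral_acim_eq_mean[OF A_slice] by simp
qed

lemma Abar_flow:
  "avg_flow (Abar i1) \<theta> 0 = \<theta>" "(avg_flow (Abar i1) \<theta> has_real_derivative Abar i1 (avg_flow (Abar i1) \<theta> t)) (at t)"
  using avg_flow[of "Abar i1" LA B, OF Abar_lipschitz LA0 Abar_bound] by auto

lemma avg_path_nth:
  "avg_path f A i1 \<theta> t $ i = integral {0..t} (\<lambda>s. Abar i (avg_flow (Abar i1) \<theta> s))"
proof -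
  have eq: "avg f A = (\<lambda>\<theta>. \<chi> i. Abar i \<theta>)" by (simp add: fun_eq_iff vec_eq_iff avg_nth)
  have c: "continuous_on S (\<lambda>s. Abar i (avg_flow (Abar i1) \<theta> s))" for i S
  proof (rule continuous_on_compose2[of UNIV "Abar i"])
    show "continuous_on UNIV (Abar i)" by (rule lipschitz_continuous_on[OF Abar_lipschitz LA0])
    show "continuous_on S (avg_flow (Abar i1) \<theta>)" by (rule continuous_on_UNIV_deriv[OF Abar_flow(2)])
  qed auto
  have "(\<lambda>s. \<chi> i. Abar i (avg_flow (Abar i1) \<theta> s)) integrable_on {0..t}"
    by (intro integrable_continuous_real continuous_on_vec_lambda c)
  from integral_component_eq_cart[OF this, of i] show ?thesis
    unfolding avg_path_def eq by simp
qed

definition sgn_of :: "bool \<Rightarrow> real" where "sgn_of b = (if b then 1 else - 1)"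

text \<open>The Boolean selects the sign, so that both tails are covered.\<close>

definition ev :: "real \<Rightarrow> nat \<Rightarrow> real \<Rightarrow> (real \<Rightarrow> real) \<Rightarrow> 'd \<times> bool \<Rightarrow> real set" where
  "ev \<epsilon> N r G k = slow_fast.hit f (\<lambda>z. sgn_of (snd k) * A z $ fst k) \<omega> \<epsilon> N (\<lambda>_. - r) G"

text \<open>The class of pairs does not involve the observable, so one predicate serves all
  coordinates and signs.\<close>

definition fair :: "real \<Rightarrow> real \<Rightarrow> real \<Rightarrow> (real \<Rightarrow> real) \<Rightarrow> (real \<Rightarrow> real) \<Rightarrow> bool" where
  "fair = slow_fast.good_pair c1 c2 \<delta>"

lemma sgn_of: "\<bar>sgn_of b\<bar> = 1" by (simp add: sgn_of_def)

lemma fair_iff: "fair \<epsilon> a b G \<rho> \<longleftrightarrow> \<delta> \<le> b - a \<and> b - a \<le> 1 \<and>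
     (\<exists>G1. (\<forall>x. (G has_real_derivative G1 x) (at x)) \<and> continuous_on UNIV G1 \<and> (\<forall>x. \<bar>G1 x\<bar> \<le> \<epsilon> * c1)) \<and>
     (\<exists>\<rho>1. (\<forall>x. (\<rho> has_real_derivative \<rho>1 x) (at x)) \<and> continuous_on UNIV \<rho>1 \<and> (\<forall>x. 0 < \<rho> x) \<and>
        (\<forall>x. \<bar>\<rho>1 x\<bar> \<le> c2 * \<rho> x)) \<and> integral {a..b} \<rho> = 1"
  unfolding fair_def slow_fast.good_pair_def[OF scaled[of 1, simplified]] ..

lemma ev_borel:
  assumes "continuous_on UNIV G" shows "ev \<epsilon> N r G k \<in> sets borel"
  unfolding ev_def by (rule slow_fast.hit_borel[OF scaled[OF sgn_of] continuous_on_const assms])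

lemma abs_sum_le_outside_ev:
  assumes "\<And>b. x \<notin> ev \<epsilon> N r G (i, b)" "k \<le> N"
  shows "\<bar>\<Sum>j<k. A ((fast_slow f \<omega> \<epsilon> ^^ j) (x, G x)) $ i - Abar i (snd ((fast_slow f \<omega> \<epsilon> ^^ j) (x, G x)))\<bar> \<le> r"
proof -
  define S where "S = (\<Sum>j<k. A ((fast_slow f \<omega> \<epsilon> ^^ j) (x, G x)) $ i - Abar i (snd ((fast_slow f \<omega> \<epsilon> ^^ j) (x, G x))))"
  have "sgn_of b * S \<le> r" for b
  proof -
    have "\<not> 0 \<le> - r + (\<Sum>j<k. slow_fast.\<alpha>h f (\<lambda>z. sgn_of b * A z $ i) ((fast_slow f \<omega> \<epsilon> ^^ j) (x, G x)))"
      using assms unfolding ev_def slow_fast.hit_def[OF scaled[OF sgn_of]] by auto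
    then show ?thesis
      unfolding S_def slow_fast.\<alpha>h_def[OF scaled[OF sgn_of]] \<alpha>bar_scaled[OF sgn_of]
      by (simp add: sum_distrib_left right_diff_distrib)
  qed
  from this[of True] this[of False] show ?thesis unfolding S_def[symmetric] by (simp add: sgn_of_def)
qed

definition K8 where "K8 = 1 + LA * exp LA"
definition K9 where "K9 C = LA * exp LA * (C + LA * B) + LA * B"

text \<open>At grid times this is \<open>path_compare\<close>, with the sums controlled outside the
  exceptional sets. Between grid times the interpolated and the averaged path each move by at most
  \<open>\<epsilon> * B\<close>.\<close>

lemma coordinate_deviation:
  assumes eps: "0 < \<epsilon>" and N: "real N * \<epsilon> \<le> 1" and x: "\<And>k. x \<notin> ev \<epsilon> N r G k" and G: "\<bar>G x - \<theta>0\<bar> \<le> C * \<epsilon>" and C: "0 \<le> C"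
    and t: "0 \<le> t" "nat \<lfloor>t / \<epsilon>\<rfloor> \<le> N"
  shows "\<bar>(slow_path f A \<omega> i1 \<epsilon> (x, G x) t - avg_path f A i1 \<theta>0 t) $ i\<bar> \<le> \<epsilon> * (K8 * r + K9 C + 2 * B)"
proof -
  define F where "F j = (fast_slow f \<omega> \<epsilon> ^^ j) (x, G x)" for j
  define k where "k = nat \<lfloor>t / \<epsilon>\<rfloor>"
  define u where "u = avg_flow (Abar i1) \<theta>0"
  have kt: "real k \<le> t / \<epsilon>" "t / \<epsilon> \<le> real k + 1" using t eps by (auto simp: k_def)
  then have kt': "real k * \<epsilon> \<le> t" "t - real k * \<epsilon> \<le> \<epsilon>" using eps by (auto simp: field_simps)
  have snd_F: "snd (F (Suc j)) = snd (F j) + \<epsilon> * (A (F j) $ i1)" for j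
    by (simp add: F_def fast_slow_def case_prod_beta A_i1)
  have grid: "\<bar>\<epsilon> * (\<Sum>j<k. A (F j) $ i) - integral {0..real k * \<epsilon>} (\<lambda>s. Abar i (u s))\<bar> \<le>
    \<epsilon> * ((1 + LA * exp LA) * r + (LA * exp LA * (C + LA * B) + LA * B))"
    unfolding u_def
  proof (rule path_compare[where w = "Abar i1" and th = "\<lambda>j. snd (F j)" and om = "\<lambda>j. A (F j) $ i1",
        OF Abar_flow Abar_lipschitz LA0 Abar_bound eps snd_F _ Abar_lipschitz N])
    show "\<bar>snd (F 0) - \<theta>0\<bar> \<le> C * \<epsilon>" using G by (simp add: F_def)
    show "\<bar>\<Sum>j<k. A (F j) $ i1 - Abar i1 (snd (F j))\<bar> \<le> r" if "k \<le> N" for k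
      unfolding F_def by (rule abs_sum_le_outside_ev[OF x that])
    show "\<bar>\<Sum>j<k. A (F j) $ i - Abar i (snd (F j))\<bar> \<le> r" if "k \<le> N" for k
      unfolding F_def by (rule abs_sum_le_outside_ev[OF x that])
    show "k \<le> N" using t(2) by (simp add: k_def)
  qed (rule C)
  have c: "continuous_on S (\<lambda>s. Abar i (u s))" for S
  proof (rule continuous_on_compose2[of UNIV "Abar i"])
    show "continuous_on UNIV (Abar i)" by (rule lipschitz_continuous_on[OF Abar_lipschitz LA0])
    show "continuous_on S u" unfolding u_def by (rule continuous_on_UNIV_deriv[OF Abar_flow(2)])
  qed auto
  have rest: "\<bar>integral {0..t} (\<lambda>s. Abar i (u s)) - integral {0..real k * \<epsilon>} (\<lambda>s. Abar i (u s))\<bar> \<le> \<epsilon> * B"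
  proof -
    have "integral {0..t} (\<lambda>s. Abar i (u s)) = integral {0..real k * \<epsilon>} (\<lambda>s. Abar i (u s)) + integral {real k * \<epsilon>..t} (\<lambda>s. Abar i (u s))"
      using Henstock_Kurzweil_Integration.integral_combine[of 0 "real k * \<epsilon>" t "\<lambda>s. Abar i (u s)"] eps kt' integrable_continuous_real[OF c] by simp
    moreover have "norm (integral {real k * \<epsilon>..t} (\<lambda>s. Abar i (u s))) \<le> integral {real k * \<epsilon>..t} (\<lambda>_. B)"
      by (rule Henstock_Kurzweil_Integration.integral_norm_bound_integral) (use Abar_bound in \<open>auto intro: integrable_continuous_real c\<close>)
    moreover have "integral {real k * \<epsilon>..t} (\<lambda>_. B) \<le> \<epsilon> * B"
      using kt' B1 by (simp add: mult_right_mono)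
    ultimately show ?thesis by simp
  qed
  have inter: "\<bar>(t / \<epsilon> - real k) * (\<epsilon> * A (F k) $ i)\<bar> \<le> \<epsilon> * B"
  proof -
    have "\<bar>t / \<epsilon> - real k\<bar> * \<bar>\<epsilon> * A (F k) $ i\<bar> \<le> 1 * (\<epsilon> * B)"
      using kt eps A(3)[of "F k" i] by (intro mult_mono) (auto simp: abs_mult)
    then show ?thesis by (simp add: abs_mult)
  qed
  have split: "(slow_path f A \<omega> i1 \<epsilon> (x, G x) t - avg_path f A i1 \<theta>0 t) $ i =
     (\<epsilon> * (\<Sum>j<k. A (F j) $ i) - integral {0..real k * \<epsilon>} (\<lambda>s. Abar i (u s))) +
     (t / \<epsilon> - real k) * (\<epsilon> * A (F k) $ i) +
     (integral {0..real k * \<epsilon>} (\<lambda>s. Abar i (u s)) - integral {0..t} (\<lambda>s. Abar i (u s)))"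
    unfolding slow_path_eq by (simp add: avg_path_nth k_def F_def u_def)
  have tri: "\<bar>a + b + c\<bar> \<le> x + y + z" if "\<bar>a\<bar> \<le> x" "\<bar>b\<bar> \<le> y" "\<bar>c\<bar> \<le> z" for a b c x y z :: real
    using that unfolding abs_le_iff by auto
  have rest': "\<bar>integral {0..real k * \<epsilon>} (\<lambda>s. Abar i (u s)) - integral {0..t} (\<lambda>s. Abar i (u s))\<bar> \<le> \<epsilon> * B"
    using rest by (simp add: abs_minus_commute)
  have "\<bar>(slow_path f A \<omega> i1 \<epsilon> (x, G x) t - avg_path f A i1 \<theta>0 t) $ i\<bar> \<le>
     \<epsilon> * ((1 + LA * exp LA) * r + (LA * exp LA * (C + LA * B) + LA * B)) + \<epsilon> * B + \<epsilon> * B"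
    unfolding split by (rule tri[OF grid inter rest'])
  also have "\<dots> = \<epsilon> * (K8 * r + K9 C + 2 * B)" unfolding K8_def K9_def by (simp add: algebra_simps)
  finally show ?thesis .
qed

text \<open>The paths stay within \<open>R / 2\<close>, not merely \<open>R\<close>, so that outside
  the exceptional set the closed condition of deviating by at least \<open>R\<close> fails
  strictly.\<close>

lemma deviation_bound:
  assumes C: "0 \<le> C"
  obtains Cbar cst \<epsilon>1 where "0 < Cbar" "0 < cst" "0 < \<epsilon>1"
    "\<And>\<epsilon> T R \<theta>0 a b G \<rho>. 0 < \<epsilon> \<Longrightarrow> \<epsilon> \<le> \<epsilon>1 \<Longrightarrow> \<epsilon> \<le> T \<Longrightarrow> T \<le> 1 \<Longrightarrow> Cbar * sqrt (\<epsilon> * T) \<le> R \<Longrightarrow> fair \<epsilon> a b G \<rho> \<Longrightarrow>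
       (\<And>x. x \<in> {a..b} \<Longrightarrow> \<bar>G x - \<theta>0\<bar> \<le> C * \<epsilon>) \<Longrightarrow>
       \<exists>E\<in>sets borel. (\<forall>x\<in>{a..b} - E. \<forall>t\<in>{0..T}. dist (slow_path f A \<omega> i1 \<epsilon> (x, G x) t) (avg_path f A i1 \<theta>0 t) \<le> R / 2) \<and>
         integral {a..b} (\<lambda>x. \<rho> x * indicator E x) \<le> exp (- (cst * R\<^sup>2 / (\<epsilon> * T)))"
proof -
  define Q where "Q k A0 c0 \<epsilon>1 \<longleftrightarrow> (\<forall>\<epsilon> N R a b G \<rho>. 0 < \<epsilon> \<longrightarrow> \<epsilon> \<le> \<epsilon>1 \<longrightarrow> 1 \<le> N \<longrightarrow> real N * \<epsilon> \<le> 1 \<longrightarrow> A0 * sqrt (real N) \<le> R \<longrightarrow>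
        fair \<epsilon> a b G \<rho> \<longrightarrow>
        integral {a..b} (\<lambda>x. \<rho> x * indicator (ev \<epsilon> N R G k) x) \<le> exp (- (c0 * R\<^sup>2 / real N)))" for k A0 c0 \<epsilon>1
  have ex: "\<exists>A0 c0 \<epsilon>1. 0 < A0 \<and> 0 < c0 \<and> 0 < \<epsilon>1 \<and> Q k A0 c0 \<epsilon>1" for k
    unfolding Q_def ev_def fair_def by (rule slow_fast.subgaussian_tail[OF scaled[OF sgn_of]])
  have mono: "Q k a' c' e'" if "Q k a c e" "a \<le> a'" "c' \<le> c" "e' \<le> e" for k a c e a' c' e'
    unfolding Q_def
  proof (intro allI impI)
    fix \<epsilon> R aa b :: real and N :: nat and G \<rho>
    assume h: "0 < \<epsilon>" "\<epsilon> \<le> e'" "1 \<le> N" "real N * \<epsilon> \<le> 1" "a' * sqrt (real N) \<le> R" "fair \<epsilon> aa b G \<rho>"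
    have "a * sqrt (real N) \<le> a' * sqrt (real N)" using that(2) by (intro mult_right_mono) auto
    then have R: "a * sqrt (real N) \<le> R" using h(5) by linarith
    have "\<epsilon> \<le> e" using h(2) that(4) by linarith
    from that(1)[unfolded Q_def, rule_format, OF h(1) this h(3,4) R h(6)]
    have "integral {aa..b} (\<lambda>x. \<rho> x * indicator (ev \<epsilon> N R G k) x) \<le> exp (- (c * R\<^sup>2 / real N))" .
    also have "\<dots> \<le> exp (- (c' * R\<^sup>2 / real N))"
      using that(3) by (simp add: divide_right_mono mult_right_mono)
    finally show "integral {aa..b} (\<lambda>x. \<rho> x * indicator (ev \<epsilon> N R G k) x) \<le> exp (- (c' * R\<^sup>2 / real N))" .
  qed
  obtain A0 c0 \<epsilon>1 where Q: "0 < A0" "0 < c0" "0 < \<epsilon>1" "\<And>k. Q k A0 c0 \<epsilon>1"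
  proof (rule uniform_constants[of Q, OF ex])
    show "Q i a' c' e'" if "Q i a c e" "a \<le> a'" "c' \<le> c" "e' \<le> e" for i a c e a' c' e'
      by (rule mono[OF that])
  qed (rule that)
  define d where "d = real CARD('d)"
  have d: "1 \<le> d" unfolding d_def by (simp add: Suc_leI)
  have K8: "1 \<le> K8" using LA0 by (simp add: K8_def)
  have K9: "0 \<le> K9 C" using LA0 C B1 by (simp add: K9_def)
  \<comment> \<open>With \<open>r = R / (4 * d * \<epsilon> * K8)\<close> and
    \<open>N \<le> T / \<epsilon>\<close> the exponent of each tail is at least twice the final one.
    The spare half pays for the number of tails.\<close>
  define cst where "cst = c0 / (32 * d\<^sup>2 * K8\<^sup>2)"
  \<comment> \<open>One summand for each demand on \<open>R\<close>: that \<open>r\<close> reach the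
    range of the tail bound, that the deterministic errors of order \<epsilon> stay below
    \<open>R / 4\<close>, and that the factor \<open>2 * d\<close> be absorbed.\<close>
  define Cbar where "Cbar = 4 * d * K8 * A0 + 4 * d * (K9 C + 2 * B) + 2 * d / cst + 1"
  have cst: "0 < cst" using Q d K8 by (simp add: cst_def)
  have parts: "0 \<le> 4 * d * K8 * A0" "0 \<le> 4 * d * (K9 C + 2 * B)" "0 \<le> 2 * d / cst" using Q d K8 K9 B1 cst by auto
  have Cbar: "1 \<le> Cbar" "4 * d * K8 * A0 \<le> Cbar" "4 * d * (K9 C + 2 * B) \<le> Cbar" "2 * d / cst \<le> Cbar"
    using parts unfolding Cbar_def by (simp_all add: add_nonneg_nonneg)
  show ?thesis
  proof (rule that[of Cbar cst \<epsilon>1])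
    show "0 < Cbar" "0 < cst" "0 < \<epsilon>1" using Cbar cst Q by auto
    fix \<epsilon> T R \<theta>0 a b :: real and G \<rho> :: "real \<Rightarrow> real"
    assume h: "0 < \<epsilon>" "\<epsilon> \<le> \<epsilon>1" "\<epsilon> \<le> T" "T \<le> 1" "Cbar * sqrt (\<epsilon> * T) \<le> R" "fair \<epsilon> a b G \<rho>"
      and near: "\<And>x. x \<in> {a..b} \<Longrightarrow> \<bar>G x - \<theta>0\<bar> \<le> C * \<epsilon>"
    define N where "N = nat \<lfloor>T / \<epsilon>\<rfloor>"
    define r where "r = R / (4 * d * \<epsilon> * K8)"
    define w where "w = sqrt (\<epsilon> * T)"
    have TE: "1 \<le> T / \<epsilon>" using h by (simp add: le_divide_eq)
    have N: "1 \<le> N" "real N \<le> T / \<epsilon>" using TE by (auto simp: N_def le_nat_floor)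
    have "real N * \<epsilon> \<le> T" using N(2) h(1) by (simp add: field_simps)
    then have Ne: "real N * \<epsilon> \<le> 1" using h(4) by linarith
    have T0: "0 < T" using h by linarith
    have w: "0 < w" "w\<^sup>2 = \<epsilon> * T" using h T0 by (auto simp: w_def)
    \<comment> \<open>Errors of order \<epsilon> are comparable with sqrt(\<epsilon> T) because
      \<epsilon> \<le> T.\<close>
    have ew: "\<epsilon> \<le> w"
    proof -
      have "\<epsilon>\<^sup>2 \<le> \<epsilon> * T" using h by (simp add: power2_eq_square)
      then show ?thesis unfolding w_def using h(1) by (intro real_le_rsqrt)
    qed
    have CR: "Cbar * w \<le> R" using h(5) by (simp add: w_def)
    have R0: "0 < R" using CR w(1) Cbar(1) mult_pos_pos[of Cbar w] by linarith
    have sN: "sqrt (real N) \<le> w / \<epsilon>"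
    proof -
      have "sqrt (real N) \<le> sqrt (T / \<epsilon>)" using N(2) by simp
      also have "T / \<epsilon> = (w / \<epsilon>)\<^sup>2" using h(1) by (simp add: power_divide w(2)) (simp add: power2_eq_square)
      finally show ?thesis using w(1) h(1) by simp
    qed
    have r: "A0 * sqrt (real N) \<le> r"
    proof -
      have "4 * d * K8 * A0 * w \<le> Cbar * w" using Cbar(2) w(1) by (intro mult_right_mono) auto
      then have "4 * d * K8 * A0 * w \<le> R" using CR by linarith
      then have "A0 * (w / \<epsilon>) \<le> r" unfolding r_def using h(1) d K8 by (simp add: field_simps)
      moreover have "A0 * sqrt (real N) \<le> A0 * (w / \<epsilon>)" using sN Q(1) by (intro mult_left_mono) auto
      ultimately show ?thesis by linarith
    qed
    define E where "E = (\<Union>k. ev \<epsilon> N r G k)"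
    have cG: "continuous_on UNIV G" using h(6) unfolding fair_iff by (auto intro: continuous_on_UNIV_deriv)
    have E: "E \<in> sets borel" unfolding E_def using ev_borel[OF cG] by (intro sets.finite_UN) auto
    have dev: "dist (slow_path f A \<omega> i1 \<epsilon> (x, G x) t) (avg_path f A i1 \<theta>0 t) \<le> R / 2" if x: "x \<in> {a..b} - E" and t: "t \<in> {0..T}" for x t
    proof -
      have tN: "nat \<lfloor>t / \<epsilon>\<rfloor> \<le> N" unfolding N_def using t h(1) by (intro nat_mono floor_mono divide_right_mono) auto
      have xE: "x \<notin> ev \<epsilon> N r G k" for k using x unfolding E_def by blast
      have "dist (slow_path f A \<omega> i1 \<epsilon> (x, G x) t) (avg_path f A i1 \<theta>0 t) \<le>
         (\<Sum>i\<in>UNIV. \<bar>(slow_path f A \<omega> i1 \<epsilon> (x, G x) t - avg_path f A i1 \<theta>0 t) $ i\<bar>)"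
        unfolding dist_norm by (rule norm_le_l1_cart)
      also have "\<dots> \<le> (\<Sum>i\<in>(UNIV :: 'd set). \<epsilon> * (K8 * r + K9 C + 2 * B))"
        by (rule sum_mono) (rule coordinate_deviation[OF h(1) Ne xE near C _ tN]; use x t in auto)
      also have "\<dots> = d * (\<epsilon> * K8 * r) + d * ((K9 C + 2 * B) * \<epsilon>)" by (simp add: d_def algebra_simps)
      also have "d * (\<epsilon> * K8 * r) = R / 4" using h(1) d K8 by (simp add: r_def field_simps)
      also have "d * ((K9 C + 2 * B) * \<epsilon>) \<le> R / 4"
      proof -
        have "4 * d * (K9 C + 2 * B) * \<epsilon> \<le> Cbar * w"
          using Cbar(3) ew h(1) parts(2) by (intro mult_mono) (use Cbar(1) in auto)
        then show ?thesis using CR by simp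
      qed
      finally show ?thesis by simp
    qed
    have pos: "0 < \<rho> x" for x using h(6) unfolding fair_iff by blast
    have cr: "continuous_on S \<rho>" for S using h(6) unfolding fair_iff by (auto intro: continuous_on_UNIV_deriv)
    have im: "(\<lambda>x. \<rho> x * indicator X x) integrable_on {a..b}" if "X \<in> sets borel" for X
      using that by (intro integrable_cont_mult[OF cr, where S = 1]) (auto simp: indicator_def)
    have "integral {a..b} (\<lambda>x. \<rho> x * indicator E x) \<le> integral {a..b} (\<lambda>x. \<Sum>k\<in>UNIV. \<rho> x * indicator (ev \<epsilon> N r G k) x)"
    proof (rule integral_le[OF im[OF E]])
      show "(\<lambda>x. \<Sum>k\<in>UNIV. \<rho> x * indicator (ev \<epsilon> N r G k) x) integrable_on {a..b}"
        by (intro integrable_sum im ev_borel[OF cG]) simp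
      fix x
      show "\<rho> x * indicator E x \<le> (\<Sum>k\<in>UNIV. \<rho> x * indicator (ev \<epsilon> N r G k) x)"
      proof (cases "x \<in> E")
        case True
        then obtain k where k: "x \<in> ev \<epsilon> N r G k" by (auto simp: E_def)
        have "\<rho> x * indicator (ev \<epsilon> N r G k) x \<le> (\<Sum>k\<in>UNIV. \<rho> x * indicator (ev \<epsilon> N r G k) x)"
          using pos[of x] by (intro member_le_sum) (auto simp: less_imp_le)
        then show ?thesis using k True by simp
      qed (use pos[of x] in \<open>auto intro!: sum_nonneg simp: less_imp_le\<close>)
    qed
    also have "\<dots> = (\<Sum>k\<in>UNIV. integral {a..b} (\<lambda>x. \<rho> x * indicator (ev \<epsilon> N r G k) x))"
      by (rule Henstock_Kurzweil_Integration.integral_sum) (auto intro: im ev_borel[OF cG])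
    also have "\<dots> \<le> (\<Sum>k\<in>(UNIV :: ('d \<times> bool) set). exp (- (c0 * r\<^sup>2 / real N)))"
      by (intro sum_mono Q(4)[unfolded Q_def, rule_format]) (use h N Ne r in auto)
    also have "\<dots> = 2 * d * exp (- (c0 * r\<^sup>2 / real N))"
      by (simp add: d_def card_prod flip: UNIV_Times_UNIV)
    also have "\<dots> \<le> 2 * d * exp (- (2 * (cst * R\<^sup>2 / (\<epsilon> * T))))"
    proof -
      have "2 * (cst * R\<^sup>2 / (\<epsilon> * T)) = c0 * r\<^sup>2 / (T / \<epsilon>)"
        using h(1) T0 d K8 by (simp add: cst_def r_def power_divide power_mult_distrib field_simps) (simp add: power2_eq_square)
      also have "\<dots> \<le> c0 * r\<^sup>2 / real N" using N TE Q(2) by (intro divide_left_mono mult_nonneg_nonneg mult_pos_pos) auto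
      finally show ?thesis using d by simp
    qed
    \<comment> \<open>The lower bound on \<open>R\<close> makes
      \<open>cst * R^2 / (\<epsilon> * T)\<close> at least \<open>2 * d\<close>, so the number of
      events is below its exponential.\<close>
    also have "\<dots> \<le> exp (cst * R\<^sup>2 / (\<epsilon> * T)) * exp (- (2 * (cst * R\<^sup>2 / (\<epsilon> * T))))"
    proof (rule mult_right_mono)
      have "2 * d \<le> cst * Cbar" using Cbar(4) cst by (simp add: field_simps)
      also have "\<dots> \<le> cst * Cbar\<^sup>2" using Cbar(1) cst by (simp add: power2_eq_square)
      also have "\<dots> = cst * (Cbar * w)\<^sup>2 / (\<epsilon> * T)" using w h(1) T0 by (simp add: power_mult_distrib)
      also have "\<dots> \<le> cst * R\<^sup>2 / (\<epsilon> * T)"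
        using CR Cbar(1) w(1) cst h(1) T0 by (intro divide_right_mono mult_left_mono power_mono) auto
      also have "\<dots> \<le> exp (cst * R\<^sup>2 / (\<epsilon> * T))" using exp_ge_add_one_self[of "cst * R\<^sup>2 / (\<epsilon> * T)"] by linarith
      finally show "2 * d \<le> exp (cst * R\<^sup>2 / (\<epsilon> * T))" .
    qed simp
    also have "\<dots> = exp (- (cst * R\<^sup>2 / (\<epsilon> * T)))" by (simp flip: exp_add)
    finally have "integral {a..b} (\<lambda>x. \<rho> x * indicator E x) \<le> exp (- (cst * R\<^sup>2 / (\<epsilon> * T)))" .
    then show "\<exists>E\<in>sets borel. (\<forall>x\<in>{a..b} - E. \<forall>t\<in>{0..T}. dist (slow_path f A \<omega> i1 \<epsilon> (x, G x) t) (avg_path f A i1 \<theta>0 t) \<le> R / 2) \<and>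
         integral {a..b} (\<lambda>x. \<rho> x * indicator E x) \<le> exp (- (cst * R\<^sup>2 / (\<epsilon> * T)))"
      using E dev by blast
  qed
qed

end

section \<open>From the torus to bounded lifts\<close>

lemma Cr_continuous: "Cr r g \<Longrightarrow> continuous_on UNIV g"
proof (cases r)
  case (Suc k)
  moreover assume "Cr r g"
  ultimately obtain g1 g2 where "\<And>z. (g has_derivative (\<lambda>(u, v). u *\<^sub>R g1 z + v *\<^sub>R g2 z)) (at z)" by auto
  from has_derivative_continuous[OF this] show ?thesis by (simp add: continuous_on_eq_continuous_at)
qed simp

lemma Cr_partials:
  fixes g :: "real \<times> real \<Rightarrow> real"
  assumes "Cr (Suc r) g" obtains g1 g2 where "partials g g1 g2" "Cr r g1" "Cr r g2"
  using assms by (auto simp: partials_def)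

lemma Cr_component: "Cr r A \<Longrightarrow> Cr r (\<lambda>z. A z $ i)"
proof (induction r arbitrary: A)
  case 0
  then show ?case by (auto intro: continuous_intros)
next
  case (Suc r)
  then obtain g1 g2 where g: "\<And>z. (A has_derivative (\<lambda>(u, v). u *\<^sub>R g1 z + v *\<^sub>R g2 z)) (at z)" and Cr: "Cr r g1" "Cr r g2"
    by auto
  have "((\<lambda>z. A z $ i) has_derivative (\<lambda>(u, v). u *\<^sub>R (g1 z $ i) + v *\<^sub>R (g2 z $ i))) (at z)" for z
    using bounded_linear.has_derivative[OF bounded_linear_vec_nth g[of z], of i] by (simp add: case_prod_unfold)
  then show ?case using Suc.IH[OF Cr(1)] Suc.IH[OF Cr(2)] unfolding Cr.simps by (intro exI conjI allI)
qed

lemma periodic2_torus_proj: "periodic2 g \<Longrightarrow> g (torus_proj z) = g z"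
  using periodic_frac[of "\<lambda>x. g (x, frac (snd z))" "fst z"] periodic_frac[of "\<lambda>\<theta>. g (fst z, \<theta>)" "snd z"]
  by (simp add: torus_proj_def periodic2_def periodic_def)

lemma periodic2_bounded:
  fixes g :: "real \<times> real \<Rightarrow> real"
  assumes "continuous_on UNIV g" "periodic2 g"
  shows "\<exists>b. \<forall>z. \<bar>g z\<bar> \<le> b"
proof -
  have "compact (g ` (cbox (0, 0) (1, 1)))"
    by (intro compact_continuous_image continuous_on_subset[OF assms(1)]) auto
  from compact_imp_bounded[OF this] obtain b where b: "\<And>z. z \<in> cbox (0, 0) (1, 1) \<Longrightarrow> \<bar>g z\<bar> \<le> b"
    unfolding bounded_iff by (auto simp only: real_norm_def ball_simps)
  have "torus_proj z \<in> cbox (0, 0) (1, 1)" for z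
    by (simp add: torus_proj_def cbox_Pair_eq frac_lt_1 less_imp_le)
  from b[OF this] show ?thesis unfolding periodic2_torus_proj[OF assms(2)] by blast
qed

text \<open>Translation by a period adds a constant. A lift of a circle map has this property, and
  it is enough for the derivatives to be periodic.\<close>

definition quasi_periodic2 :: "(real \<times> real \<Rightarrow> real) \<Rightarrow> bool" where
  "quasi_periodic2 g \<longleftrightarrow> (\<exists>c d. \<forall>z. g (z + (1, 0)) = g z + c \<and> g (z + (0, 1)) = g z + d)"

lemma periodic2_iff: "periodic2 g \<longleftrightarrow> (\<forall>z. g (z + (1, 0)) = g z \<and> g (z + (0, 1)) = g z)"
  by (simp add: periodic2_def)

lemma periodic2_imp_quasi: "periodic2 g \<Longrightarrow> quasi_periodic2 g"
  unfolding periodic2_iff quasi_periodic2_def by (intro exI[of _ 0]) simp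

lemma integer_valued_constant:
  fixes g :: "'a::real_normed_vector \<Rightarrow> real"
  assumes "continuous_on UNIV g" "\<And>z. g z \<in> \<int>"
  shows "\<exists>c. \<forall>z. g z = c"
proof -
  have "g constant_on UNIV"
  proof (rule continuous_discrete_range_constant[OF _ assms(1)])
    show "\<exists>e>0. \<forall>y. y \<in> UNIV \<and> g y \<noteq> g x \<longrightarrow> e \<le> norm (g y - g x)" for x
      using Ints_nonzero_abs_ge1[OF Ints_diff[OF assms(2) assms(2)]] by (intro exI[of _ 1]) simp
  qed (rule connected_UNIV)
  then show ?thesis by (auto simp: constant_on_def)
qed

text \<open>The increments over a period are continuous and integer-valued on a connected space,
  hence constant.\<close>

lemma circle_lift2_quasi:
  assumes "circle_lift2 f" and c: "continuous_on UNIV f"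
  shows "quasi_periodic2 f"
proof -
  have "continuous_on UNIV (\<lambda>z. f (z + w) - f z)" for w
    by (intro continuous_intros c continuous_on_compose2[OF c]) auto
  moreover have "f (z + (1, 0)) - f z \<in> \<int>" "f (z + (0, 1)) - f z \<in> \<int>" for z
    using assms(1) by (cases z; simp add: circle_lift2_def)+
  ultimately obtain c d where "\<And>z. f (z + (1, 0)) - f z = c" "\<And>z. f (z + (0, 1)) - f z = d"
    using integer_valued_constant[of "\<lambda>z. f (z + (1, 0)) - f z"] integer_valued_constant[of "\<lambda>z. f (z + (0, 1)) - f z"] by metis
  then show ?thesis unfolding quasi_periodic2_def by (intro exI[of _ c] exI[of _ d]) (simp add: algebra_simps)
qed

lemma partials_shift:
  assumes g: "partials g g1 g2" and c: "\<And>z. g (z + w) = g z + c"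
  shows "g1 (z + w) = g1 z" "g2 (z + w) = g2 z"
proof -
  have D: "(g has_derivative (\<lambda>(u, v). u * g1 z + v * g2 z)) (at z)" for z
    using g unfolding partials_def by blast
  have "((\<lambda>z. z + w) has_derivative (\<lambda>x. x)) (at z)" by (auto intro!: derivative_eq_intros)
  from has_derivative_compose[OF this D]
  have "((\<lambda>z. g z + c) has_derivative (\<lambda>(u, v). u * g1 (z + w) + v * g2 (z + w))) (at z)" by (simp add: c)
  moreover have "((\<lambda>z. g z + c) has_derivative (\<lambda>(u, v). u * g1 z + v * g2 z)) (at z)"
    using has_derivative_add[OF D has_derivative_const[of c]] by simp
  ultimately have "(\<lambda>(u, v). u * g1 (z + w) + v * g2 (z + w)) = (\<lambda>(u, v). u * g1 z + v * g2 z)"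
    by (rule has_derivative_unique)
  from fun_cong[OF this, of "(1, 0)"] fun_cong[OF this, of "(0, 1)"]
  show "g1 (z + w) = g1 z" "g2 (z + w) = g2 z" by auto
qed

lemma partials_periodic2:
  assumes g: "partials g g1 g2" and q: "quasi_periodic2 g"
  shows "periodic2 g1" "periodic2 g2"
proof -
  obtain c d where cd: "\<And>z. g (z + (1, 0)) = g z + c" "\<And>z. g (z + (0, 1)) = g z + d"
    using q unfolding quasi_periodic2_def by blast
  show "periodic2 g1" "periodic2 g2"
    unfolding periodic2_iff using partials_shift[OF g cd(1)] partials_shift[OF g cd(2)] by blast+
qed

lemma common_bound:
  fixes F :: "('a \<Rightarrow> real) set"
  assumes "finite F" "\<And>g. g \<in> F \<Longrightarrow> \<exists>b. \<forall>z. \<bar>g z\<bar> \<le> b"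
  shows "\<exists>B\<ge>1. \<forall>g\<in>F. \<forall>z. \<bar>g z\<bar> \<le> B"
  using assms
proof (induction F)
  case empty then show ?case by (intro exI[of _ 1]) simp
next
  case (insert g F)
  obtain B where B: "1 \<le> B" "\<And>g z. g \<in> F \<Longrightarrow> \<bar>g z\<bar> \<le> B" using insert.IH insert.prems by (metis insertI2)
  obtain b where b: "\<And>z. \<bar>g z\<bar> \<le> b" using insert.prems by blast
  show ?case
  proof (intro exI[of _ "max B b"] conjI ballI allI)
    show "1 \<le> max B b" using B(1) by simp
    fix k z assume "k \<in> insert g F"
    then show "\<bar>k z\<bar> \<le> max B b"
    proof
      assume "k = g" then show ?thesis using b[of z] by simp
    next
      assume "k \<in> F" then show ?thesis using B(2)[of k z] by simp
    qed
  qed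
qed

text \<open>All derivatives concerned are continuous and periodic, hence bounded by a common
  \<open>B\<close>. The constants \<open>k1\<close>, \<open>k2\<close> of the given standard pairs
  may be smaller than the iteration wants, so they are raised to at least \<open>2 * B\<close>; the
  given pairs belong to the larger class.\<close>

lemma torus_system:
  fixes A :: "real \<times> real \<Rightarrow> real ^ 'd"
  assumes f_torus: "circle_lift2 f" and f_C4: "Cr 4 f" and om_C4: "Cr 4 \<omega>"
    and lam: "lam > 2" and expanding: "\<forall>z. pd_x f z \<ge> lam"
    and A_torus: "periodic2 A" and A_C3: "Cr 3 A" and A_1: "\<forall>z. A z $ i1 = \<omega> z"
    and \<delta>: "0 < \<delta>" "\<delta> \<le> 1 / 2"
  obtains f1 f2 f3 t0 t1 t2 e1 e2 t01 t11 B \<omega>1 \<omega>2 A1 A2 c1 c2 where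
    "vector_system f f1 f2 f3 t0 t1 t2 e1 e2 t01 t11 B \<omega> \<omega>1 \<omega>2 A A1 A2 i1 c1 c2 \<delta> lam" "k1 \<le> c1" "k2 \<le> c2"
proof -
  have four: "(4::nat) = Suc (Suc (Suc (Suc 0)))" and three: "(3::nat) = Suc (Suc (Suc 0))" by simp_all
  obtain f1 t0 where f: "partials f f1 t0" "Cr 3 f1" "Cr 3 t0" using Cr_partials f_C4 unfolding four three by metis
  obtain f2 e1 where f1: "partials f1 f2 e1" "Cr 2 f2" "Cr 2 e1" using Cr_partials f(2) unfolding three numeral_2_eq_2 by metis
  obtain t1 t01 where t0: "partials t0 t1 t01" "Cr 2 t1" "Cr 2 t01" using Cr_partials f(3) unfolding three numeral_2_eq_2 by metis
  obtain f3 e2 where f2: "partials f2 f3 e2" "Cr 1 f3" "Cr 1 e2" using Cr_partials f1(2) unfolding One_nat_def numeral_2_eq_2 by metis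
  obtain t2 t11 where t1: "partials t1 t2 t11" "Cr 1 t2" "Cr 1 t11" using Cr_partials t0(2) unfolding One_nat_def numeral_2_eq_2 by metis
  obtain \<omega>1 \<omega>2 where \<omega>: "partials \<omega> \<omega>1 \<omega>2" "Cr 3 \<omega>1" "Cr 3 \<omega>2" using Cr_partials om_C4 unfolding four three by metis
  have "\<exists>u v. partials (\<lambda>z. A z $ i) u v \<and> Cr 2 u \<and> Cr 2 v" for i
    using Cr_partials Cr_component[OF A_C3, of i] unfolding three numeral_2_eq_2 by metis
  then obtain A1 A2 where A: "\<And>i. partials (\<lambda>z. A z $ i) (A1 i) (A2 i)" "\<And>i. Cr 2 (A1 i)" "\<And>i. Cr 2 (A2 i)" by metis
  have qf: "quasi_periodic2 f" by (rule circle_lift2_quasi[OF f_torus Cr_continuous[OF f_C4]])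
  have pA: "periodic2 (\<lambda>z. A z $ i)" for i using A_torus by (simp add: periodic2_def)
  have p\<omega>: "periodic2 \<omega>" using pA[of i1] A_1 by simp
  note pf = partials_periodic2[OF f(1) qf]
  note pf1 = partials_periodic2[OF f1(1) periodic2_imp_quasi[OF pf(1)]]
  note pt0 = partials_periodic2[OF t0(1) periodic2_imp_quasi[OF pf(2)]]
  note pf2 = partials_periodic2[OF f2(1) periodic2_imp_quasi[OF pf1(1)]]
  note pt1 = partials_periodic2[OF t1(1) periodic2_imp_quasi[OF pt0(1)]]
  note p\<omega>1 = partials_periodic2[OF \<omega>(1) periodic2_imp_quasi[OF p\<omega>]]
  note pA1 = partials_periodic2[OF A(1) periodic2_imp_quasi[OF pA]]
  note cs = f(2,3)[THEN Cr_continuous] f1(2,3)[THEN Cr_continuous] t0(2)[THEN Cr_continuous] f2(2)[THEN Cr_continuous]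
    t1(2)[THEN Cr_continuous] \<omega>(2,3)[THEN Cr_continuous] om_C4[THEN Cr_continuous]
  note cA = A(2,3)[THEN Cr_continuous] Cr_component[OF A_C3, THEN Cr_continuous]
  define F where "F = {f1, f2, f3, t0, t1, t2, e1, \<omega>, \<omega>1, \<omega>2} \<union> range (\<lambda>i z. A z $ i) \<union> range A1 \<union> range A2"
  have "\<exists>b. \<forall>z. \<bar>g z\<bar> \<le> b" if "g \<in> F" for g
  proof (rule periodic2_bounded)
    show "continuous_on UNIV g"
      using that cs cA unfolding F_def by auto
    show "periodic2 g"
      using that pf pf1 pt0 pf2 pt1 p\<omega> p\<omega>1 pA pA1 unfolding F_def by auto
  qed
  moreover have "finite F" unfolding F_def by simp
  ultimately obtain B where B: "1 \<le> B" "\<And>g z. g \<in> F \<Longrightarrow> \<bar>g z\<bar> \<le> B"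
    using common_bound[of F] by blast
  have f1_ge: "lam \<le> f1 z" for z
    using expanding[rule_format, of z] DERIV_imp_deriv[OF partials_x[OF f(1)], of "snd z" "fst z"] by (simp add: pd_x_def case_prod_unfold)
  have per: "periodic (\<lambda>x. g (x, \<theta>))" if "periodic2 g" for g :: "real \<times> real \<Rightarrow> 'a" and \<theta>
    using that by (simp add: periodic_def periodic2_def)
  have "vector_system f f1 f2 f3 t0 t1 t2 e1 e2 t01 t11 B \<omega> \<omega>1 \<omega>2 A A1 A2 i1 (max k1 (2 * B)) (max k2 (2 * B)) \<delta> lam"
  proof
    show "\<bar>f1 z\<bar> \<le> B" "\<bar>f2 z\<bar> \<le> B" "\<bar>f3 z\<bar> \<le> B" "\<bar>t0 z\<bar> \<le> B" "\<bar>t1 z\<bar> \<le> B" "\<bar>t2 z\<bar> \<le> B" "\<bar>e1 z\<bar> \<le> B"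
      "\<bar>\<omega> z\<bar> \<le> B" "\<bar>\<omega>1 z\<bar> \<le> B" "\<bar>\<omega>2 z\<bar> \<le> B" "\<bar>A z $ i\<bar> \<le> B" "\<bar>A1 i z\<bar> \<le> B" "\<bar>A2 i z\<bar> \<le> B" for z i
      by (rule B(2), force simp: F_def)+
    show "2 \<le> f1 z" for z using f1_ge[of z] lam by simp
    show "f (x + 1, \<theta>) - f (x, \<theta>) \<in> \<int>" for x \<theta> using f_torus by (simp add: circle_lift2_def)
    show "periodic (\<lambda>x. f1 (x, \<theta>))" "periodic (\<lambda>x. f2 (x, \<theta>))" "periodic (\<lambda>x. t0 (x, \<theta>))" "periodic (\<lambda>x. t1 (x, \<theta>))" "periodic (\<lambda>x. A (x, \<theta>))" for \<theta>
      by (rule per pf pf1 pt0 A_torus)+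
  qed (use f(1) f1(1) t0(1) f2(1) t1(1) \<omega>(1) A(1) cs cA B(1) f1_ge lam \<delta> A_1 in auto)
  then show ?thesis by (rule that) simp_all
qed


section \<open>Standard pairs and standard families\<close>

lemma (in vector_system) std_pair_fair:
  assumes l: "is_std_pair K \<epsilon> l" and \<epsilon>: "0 \<le> \<epsilon>" and K: "sp_c1 K \<le> c1" "sp_c2 K \<le> c2" "sp_delta K / 2 = \<delta>"
  obtains G \<rho> where "fair \<epsilon> (sp_lo l) (sp_hi l) G \<rho>" "\<And>x. x \<in> {sp_lo l..sp_hi l} \<Longrightarrow> G x = sp_curve l x"
    "\<And>x. x \<in> {sp_lo l..sp_hi l} \<Longrightarrow> \<rho> x = sp_dens l x"
proof -
  define a b where "a = sp_lo l" and "b = sp_hi l"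
  note l' = l[unfolded is_std_pair_def Let_def, folded a_def b_def]
  have ab: "a < b" and len: "\<delta> \<le> b - a" "b - a \<le> 1" using l' K(3) \<delta>(2) by auto
  obtain G1 G2 where G1: "\<And>x. x \<in> {a..b} \<Longrightarrow> (sp_curve l has_real_derivative G1 x) (at x within {a..b})"
      "\<And>x. x \<in> {a..b} \<Longrightarrow> (G1 has_real_derivative G2 x) (at x within {a..b})" "\<And>x. x \<in> {a..b} \<Longrightarrow> \<bar>G1 x\<bar> \<le> \<epsilon> * sp_c1 K"
    using l' by blast
  have cG1: "continuous_on {a..b} G1" by (rule DERIV_continuous_on[OF G1(2)])
  obtain G H1 where
    G: "\<And>x. (G has_real_derivative H1 x) (at x)" "continuous_on UNIV H1" "\<And>x. \<bar>H1 x\<bar> \<le> \<epsilon> * sp_c1 K" "\<And>x. x \<in> {a..b} \<Longrightarrow> G x = sp_curve l x"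
    by (rule C1_extension[OF ab G1(1) cG1 G1(3)]) (assumption+, rule that)
  have G3: "\<bar>H1 x\<bar> \<le> \<epsilon> * c1" for x
    using G(3)[of x] mult_left_mono[OF K(1) \<epsilon>] by linarith
  have pos: "\<And>x. x \<in> {a..b} \<Longrightarrow> 0 < sp_dens l x" and one: "integral {a..b} (sp_dens l) = 1" using l' by blast+
  obtain \<rho>1 \<rho>2 where \<rho>1: "\<And>x. x \<in> {a..b} \<Longrightarrow> (sp_dens l has_real_derivative \<rho>1 x) (at x within {a..b})"
      "\<And>x. x \<in> {a..b} \<Longrightarrow> (\<rho>1 has_real_derivative \<rho>2 x) (at x within {a..b})" "\<And>x. x \<in> {a..b} \<Longrightarrow> \<bar>\<rho>1 x / sp_dens l x\<bar> \<le> sp_c2 K"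
    using l' by blast
  have dl: "((\<lambda>x. ln (sp_dens l x)) has_real_derivative \<rho>1 x / sp_dens l x) (at x within {a..b})" if "x \<in> {a..b}" for x
    using \<rho>1(1)[OF that] pos[OF that] by (auto intro!: derivative_eq_intros simp: divide_inverse)
  have nz: "sp_dens l x \<noteq> 0" if "x \<in> {a..b}" for x using pos[OF that] by simp
  have cl: "continuous_on {a..b} (\<lambda>x. \<rho>1 x / sp_dens l x)"
    by (intro continuous_on_divide DERIV_continuous_on[OF \<rho>1(1)] DERIV_continuous_on[OF \<rho>1(2)] ballI nz)
  obtain L L1 where L: "\<And>x. (L has_real_derivative L1 x) (at x)" "continuous_on UNIV L1" "\<And>x. \<bar>L1 x\<bar> \<le> sp_c2 K"
      "\<And>x. x \<in> {a..b} \<Longrightarrow> L x = ln (sp_dens l x)"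
    by (rule C1_extension[OF ab dl cl \<rho>1(3)]) (assumption+, rule that)
  \<comment> \<open>It is the logarithm of the density that is extended: this keeps the extension
    positive and bounds its logarithmic derivative by the same constant on the whole line.\<close>
  define \<rho> where "\<rho> x = exp (L x)" for x
  have \<rho>: "\<rho> x = sp_dens l x" if "x \<in> {a..b}" for x using L(4)[OF that] pos[OF that] by (simp add: \<rho>_def)
  have D: "(\<rho> has_real_derivative L1 x * \<rho> x) (at x)" for x
    unfolding \<rho>_def[abs_def] by (auto intro!: derivative_eq_intros L(1))
  show ?thesis
  proof (rule that[of G \<rho>, folded a_def b_def])
    show "fair \<epsilon> a b G \<rho>" unfolding fair_iff
    proof (intro conjI len)
      show "\<exists>G1. (\<forall>x. (G has_real_derivative G1 x) (at x)) \<and> continuous_on UNIV G1 \<and> (\<forall>x. \<bar>G1 x\<bar> \<le> \<epsilon> * c1)"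
        using G(1,2) G3 by (intro exI[of _ H1]) simp
      have "\<bar>L1 x * \<rho> x\<bar> \<le> c2 * \<rho> x" for x
        using L(3)[of x] K(2) by (simp add: abs_mult \<rho>_def)
      moreover have "continuous_on UNIV (\<lambda>x. L1 x * \<rho> x)"
        by (intro continuous_on_mult L(2) continuous_on_UNIV_deriv[OF D])
      ultimately show "\<exists>\<rho>1. (\<forall>x. (\<rho> has_real_derivative \<rho>1 x) (at x)) \<and> continuous_on UNIV \<rho>1 \<and> (\<forall>x. 0 < \<rho> x) \<and> (\<forall>x. \<bar>\<rho>1 x\<bar> \<le> c2 * \<rho> x)"
        using D by (intro exI[of _ "\<lambda>x. L1 x * \<rho> x"]) (simp add: \<rho>_def)
      show "integral {a..b} \<rho> = 1"
        using Henstock_Kurzweil_Integration.integral_cong[of "{a..b}" \<rho> "sp_dens l", OF \<rho>] one by simp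
    qed
  qed (fact G(4), fact \<rho>)
qed

text \<open>Here \<open>S\<close> is an arbitrary set. The Borel set \<open>E\<close> covers its
  preimage in the pair, and the continuous extension of the density makes the bound a gauge
  integral.\<close>

lemma emeasure_pair_measure_le:
  assumes \<rho>: "continuous_on UNIV \<rho>" "\<And>x. 0 \<le> \<rho> x" "\<And>x. x \<in> {sp_lo l..sp_hi l} \<Longrightarrow> \<rho> x = sp_dens l x"
    and E: "E \<in> sets borel" and S: "\<And>x. x \<in> {sp_lo l..sp_hi l} - E \<Longrightarrow> torus_proj (x, sp_curve l x) \<notin> S"
  shows "emeasure (pair_measure l) S \<le> ennreal (integral {sp_lo l..sp_hi l} (\<lambda>x. \<rho> x * indicator E x))"
proof -
  define I where "I = {sp_lo l..sp_hi l}"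
  define D where "D = density (restrict_space lborel I) (\<lambda>x. ennreal (sp_dens l x))"
  have meas: "\<rho> \<in> borel_measurable (restrict_space lborel I)"
    by (intro measurable_restrict_space1) (simp add: borel_measurable_continuous_onI[OF \<rho>(1)])
  have S': "(\<lambda>x. torus_proj (x, sp_curve l x)) -` S \<inter> I \<subseteq> E \<inter> I" using S unfolding I_def by blast
  have "(\<lambda>x. ennreal (sp_dens l x)) \<in> borel_measurable (restrict_space lborel I) \<longleftrightarrow>
      (\<lambda>x. ennreal (\<rho> x)) \<in> borel_measurable (restrict_space lborel I)"
    by (rule measurable_cong) (simp add: space_restrict_space I_def \<rho>(3))
  then have dm: "(\<lambda>x. ennreal (sp_dens l x)) \<in> borel_measurable (restrict_space lborel I)" using meas by simp
  have EI: "E \<inter> I \<in> sets (restrict_space lborel I)" using E by (auto simp: sets_restrict_space)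
  have "emeasure (pair_measure l) S \<le> emeasure D ((\<lambda>x. torus_proj (x, sp_curve l x)) -` S \<inter> space D)"
    unfolding pair_measure_def D_def I_def by (rule emeasure_distr_le)
  also have "\<dots> \<le> emeasure D (E \<inter> I)"
    using S' EI by (intro emeasure_mono) (simp_all add: D_def space_restrict_space)
  also have "\<dots> = (\<integral>\<^sup>+x. ennreal (sp_dens l x) * indicator (E \<inter> I) x \<partial>restrict_space lborel I)"
    unfolding D_def using dm EI by (intro emeasure_density)
  also have "\<dots> = (\<integral>\<^sup>+x. ennreal (sp_dens l x) * indicator (E \<inter> I) x * indicator I x \<partial>lborel)"
    by (rule nn_integral_restrict_space) (simp add: I_def)
  also have "\<dots> = (\<integral>\<^sup>+x. ennreal (indicator I x * (\<rho> x * indicator E x)) \<partial>lborel)"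
    by (rule nn_integral_cong) (auto simp: indicator_def I_def \<rho>(3))
  also have "\<dots> = ennreal (integral I (\<lambda>x. \<rho> x * indicator E x))"
  proof (rule nn_integral_has_integral_lebesgue)
    have "(\<lambda>x. \<rho> x * indicator E x) integrable_on I"
      unfolding I_def by (rule integrable_cont_mult[OF continuous_on_subset[OF \<rho>(1)], where S = 1]) (use E in \<open>auto simp: indicator_def\<close>)
    then show "((\<lambda>x. \<rho> x * indicator E x) has_integral integral I (\<lambda>x. \<rho> x * indicator E x)) I"
      by (rule integrable_integral)
  qed (use \<rho>(2) in simp)
  finally show ?thesis unfolding I_def .
qed

lemma emeasure_family_measure_le:
  assumes "\<And>l. l \<in> set_pmf L \<Longrightarrow> emeasure (pair_measure l) S \<le> c"
  shows "emeasure (family_measure L) S \<le> c"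
proof (cases "S \<in> sets borel")
  case True
  have "emeasure (family_measure L) S \<le> (\<integral>\<^sup>+ l. c \<partial>measure_pmf L)"
    unfolding emeasure_family_measure[OF True]
    by (rule nn_integral_mono_AE) (simp add: AE_measure_pmf_iff assms)
  then show ?thesis by simp
next
  case False
  \<comment> \<open>Outside the sigma-algebra the measure has the default value 0.\<close>
  then show ?thesis by (simp add: emeasure_notin_sets)
qed

theorem proposition2p3:
  fixes f \<omega> :: "real \<times> real \<Rightarrow> real"
    and A :: "real \<times> real \<Rightarrow> real ^ 'd"
    and i1 :: 'd
    and lam Cst :: real
    and K :: sp_params
  assumes f_torus: "circle_lift2 f" and f_C4: "Cr 4 f"
    and om_C4: "Cr 4 \<omega>" and om_norm: "Cr_norm 4 \<omega> = 1"
    and lam: "lam > 2" and expanding: "\<forall>p. pd_x f p \<ge> lam"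
    and A_torus: "periodic2 A" and A_C3: "Cr 3 A"
    and A_1: "\<forall>p. A p $ i1 = \<omega> p"
    and A1': "\<forall>\<theta> \<sigma>. \<sigma> \<noteq> 0 \<longrightarrow> \<not> cohomologous_const (\<lambda>x. f (x, \<theta>)) (\<lambda>x. \<sigma> \<bullet> A (x, \<theta>))"
    and K: "good_params f \<omega> K" and Cst: "Cst > 0"
  shows "\<exists>Tmax \<epsilon>0 Cbar cst. Tmax \<in> {0<..<1} \<and> \<epsilon>0 \<in> {0<..<1} \<and> Cbar > 0 \<and> cst > 0 \<and>
     (\<forall>\<epsilon> T R \<theta>0 \<mu>.
        0 < \<epsilon> \<and> \<epsilon> \<le> \<epsilon>0 \<and> T \<in> {\<epsilon> / \<epsilon>0 ^ 4..Tmax} \<and> R \<ge> Cbar * sqrt (\<epsilon> * T) \<and>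
        \<mu> \<in> good_measures K Cst \<epsilon> \<theta>0 \<longrightarrow>
        measure (path_law f A \<omega> i1 \<epsilon> T \<mu>) (deviation_set f A i1 T R \<theta>0)
          \<le> exp (- (cst * R\<^sup>2 / (\<epsilon> * T))))"
proof -
  have Kd: "0 < sp_delta K / 2" "sp_delta K / 2 \<le> 1 / 2" using K by (auto simp: good_params_def)
  obtain f1 f2 f3 t0 t1 t2 e1 e2 t01 t11 B \<omega>1 \<omega>2 A1 A2 c1 c2 where
    sys: "vector_system f f1 f2 f3 t0 t1 t2 e1 e2 t01 t11 B \<omega> \<omega>1 \<omega>2 A A1 A2 i1 c1 c2 (sp_delta K / 2) lam"
    and cK: "sp_c1 K \<le> c1" "sp_c2 K \<le> c2"
    by (rule torus_system[OF f_torus f_C4 om_C4 lam expanding A_torus A_C3 A_1 Kd])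
  interpret vector_system f f1 f2 f3 t0 t1 t2 e1 e2 t01 t11 B \<omega> \<omega>1 \<omega>2 A A1 A2 i1 c1 c2 "sp_delta K / 2" lam
    by (rule sys)
  obtain Cbar cst \<epsilon>1 where const: "0 < Cbar" "0 < cst" "0 < \<epsilon>1" and
    main: "\<And>\<epsilon> T R \<theta>0 a b G \<rho>. 0 < \<epsilon> \<Longrightarrow> \<epsilon> \<le> \<epsilon>1 \<Longrightarrow> \<epsilon> \<le> T \<Longrightarrow> T \<le> 1 \<Longrightarrow> Cbar * sqrt (\<epsilon> * T) \<le> R \<Longrightarrow> fair \<epsilon> a b G \<rho> \<Longrightarrow>
       (\<And>x. x \<in> {a..b} \<Longrightarrow> \<bar>G x - \<theta>0\<bar> \<le> Cst * \<epsilon>) \<Longrightarrow>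
       \<exists>E\<in>sets borel. (\<forall>x\<in>{a..b} - E. \<forall>t\<in>{0..T}. dist (slow_path f A \<omega> i1 \<epsilon> (x, G x) t) (avg_path f A i1 \<theta>0 t) \<le> R / 2) \<and>
         integral {a..b} (\<lambda>x. \<rho> x * indicator E x) \<le> exp (- (cst * R\<^sup>2 / (\<epsilon> * T)))"
    by (rule deviation_bound[of Cst]) (use Cst in auto)
  \<comment> \<open>As \<open>\<epsilon>0 < 1\<close>, the condition
    \<open>\<epsilon> / \<epsilon>0 ^ 4 \<le> T\<close> implies \<open>\<epsilon> \<le> T\<close>.
    With the choice 1/2 for the maximal time this is the range of times in
    \<open>deviation_bound\<close>.\<close>
  define \<epsilon>0 where "\<epsilon>0 = min \<epsilon>1 (1 / 2)"
  have \<epsilon>0: "0 < \<epsilon>0" "\<epsilon>0 < 1" "\<epsilon>0 \<le> \<epsilon>1" using const(3) by (auto simp: \<epsilon>0_def)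
  have per\<omega>: "periodic2 \<omega>" using A_torus A_1 unfolding periodic2_def by metis
  have "measure (path_law f A \<omega> i1 \<epsilon> T \<mu>) (deviation_set f A i1 T R \<theta>0) \<le> exp (- (cst * R\<^sup>2 / (\<epsilon> * T)))"
    if h: "0 < \<epsilon>" "\<epsilon> \<le> \<epsilon>0" "\<epsilon> / \<epsilon>0 ^ 4 \<le> T" "T \<le> 1 / 2" "Cbar * sqrt (\<epsilon> * T) \<le> R" and \<mu>: "\<mu> \<in> good_measures K Cst \<epsilon> \<theta>0"
    for \<epsilon> T R \<theta>0 :: real and \<mu>
  proof -
    obtain L where L: "\<mu> = family_measure L" "\<And>l. l \<in> set_pmf L \<Longrightarrow> is_std_pair K \<epsilon> l"
      "\<And>l x. l \<in> set_pmf L \<Longrightarrow> x \<in> {sp_lo l..sp_hi l} \<Longrightarrow> \<bar>sp_curve l x - \<theta>0\<bar> \<le> Cst * \<epsilon>"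
      using \<mu> unfolding good_measures_def is_std_family_def by blast
    have "\<epsilon>0 ^ 4 \<le> 1" using \<epsilon>0 by (simp add: power_le_one)
    then have "\<epsilon> \<le> \<epsilon> / \<epsilon>0 ^ 4" using h(1) \<epsilon>0(1) by (simp add: le_divide_eq)
    then have T: "\<epsilon> \<le> T" "T \<le> 1" using h(3,4) by auto
    have R: "0 < R"
    proof -
      have "0 < Cbar * sqrt (\<epsilon> * T)" using const(1) h(1) T(1) by simp
      then show ?thesis using h(5) by linarith
    qed
    \<comment> \<open>The preimage of the deviation set. It is bounded pair by pair; averaging over
      the family preserves the uniform bound.\<close>
    define S where "S = {z. restrict (slow_path f A \<omega> i1 \<epsilon> z) {0..T} \<in> deviation_set f A i1 T R \<theta>0}"
    have le: "emeasure (pair_measure l) S \<le> ennreal (exp (- (cst * R\<^sup>2 / (\<epsilon> * T))))" if l: "l \<in> set_pmf L" for l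
    proof -
      obtain G \<rho> where G: "fair \<epsilon> (sp_lo l) (sp_hi l) G \<rho>" "\<And>x. x \<in> {sp_lo l..sp_hi l} \<Longrightarrow> G x = sp_curve l x"
          "\<And>x. x \<in> {sp_lo l..sp_hi l} \<Longrightarrow> \<rho> x = sp_dens l x"
        by (rule std_pair_fair[OF L(2)[OF l] less_imp_le[OF h(1)] cK refl]) (rule that, assumption+)
      have "\<exists>E\<in>sets borel. (\<forall>x\<in>{sp_lo l..sp_hi l} - E. \<forall>t\<in>{0..T}. dist (slow_path f A \<omega> i1 \<epsilon> (x, G x) t) (avg_path f A i1 \<theta>0 t) \<le> R / 2) \<and>
         integral {sp_lo l..sp_hi l} (\<lambda>x. \<rho> x * indicator E x) \<le> exp (- (cst * R\<^sup>2 / (\<epsilon> * T)))"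
        by (rule main[OF h(1) _ T h(5) G(1)]) (use h(2) \<epsilon>0(3) G(2) L(3)[OF l] in auto)
      then obtain E where E: "E \<in> sets borel"
          "\<And>x t. x \<in> {sp_lo l..sp_hi l} - E \<Longrightarrow> t \<in> {0..T} \<Longrightarrow> dist (slow_path f A \<omega> i1 \<epsilon> (x, G x) t) (avg_path f A i1 \<theta>0 t) \<le> R / 2"
          "integral {sp_lo l..sp_hi l} (\<lambda>x. \<rho> x * indicator E x) \<le> exp (- (cst * R\<^sup>2 / (\<epsilon> * T)))"
        by blast
      have "emeasure (pair_measure l) S \<le> ennreal (integral {sp_lo l..sp_hi l} (\<lambda>x. \<rho> x * indicator E x))"
      proof (rule emeasure_pair_measure_le[OF _ _ G(3) E(1)])
        show "continuous_on UNIV \<rho>" using G(1) unfolding fair_iff by (auto intro: continuous_on_UNIV_deriv)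
        show "0 \<le> \<rho> x" for x using G(1) unfolding fair_iff by (auto intro: less_imp_le)
        fix x assume x: "x \<in> {sp_lo l..sp_hi l} - E"
        \<comment> \<open>The pointwise bound passes to the sup metric as
          \<open>\<le> R / 2\<close>, which is below \<open>R\<close> because \<open>R\<close> is
          positive.\<close>
        have "mdist (C0_space T) (restrict (slow_path f A \<omega> i1 \<epsilon> (torus_proj (x, sp_curve l x))) {0..T})
            (restrict (avg_path f A i1 \<theta>0) {0..T}) \<le> R / 2"
        proof (rule mdist_cfunspace_le)
          show "0 \<le> R / 2" using R by simp
          fix t assume "t \<in> topspace (top_of_set {0..T})"
          then have t: "t \<in> {0..T}" by simp
          show "mdist euclidean_metric (restrict (slow_path f A \<omega> i1 \<epsilon> (torus_proj (x, sp_curve l x))) {0..T} t)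
             (restrict (avg_path f A i1 \<theta>0) {0..T} t) \<le> R / 2"
            using E(2)[OF x t] t x G(2)[of x] by (simp add: slow_path_torus_proj[OF f_torus A_torus per\<omega>])
        qed
        then show "torus_proj (x, sp_curve l x) \<notin> S"
          using R unfolding S_def deviation_set_def by auto
      qed
      also have "\<dots> \<le> ennreal (exp (- (cst * R\<^sup>2 / (\<epsilon> * T))))" using E(3) by (rule ennreal_leI)
      finally show ?thesis .
    qed
    have "emeasure (path_law f A \<omega> i1 \<epsilon> T \<mu>) (deviation_set f A i1 T R \<theta>0) \<le>
        emeasure \<mu> ((\<lambda>z. restrict (slow_path f A \<omega> i1 \<epsilon> z) {0..T}) -` deviation_set f A i1 T R \<theta>0 \<inter> space \<mu>)"
      unfolding path_law_def by (rule emeasure_distr_le)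
    also have "(\<lambda>z. restrict (slow_path f A \<omega> i1 \<epsilon> z) {0..T}) -` deviation_set f A i1 T R \<theta>0 \<inter> space \<mu> = S"
      unfolding S_def L(1) using sets_eq_imp_space_eq[OF sets_family_measure[of L]] by auto
    also have "emeasure \<mu> S \<le> ennreal (exp (- (cst * R\<^sup>2 / (\<epsilon> * T))))"
      unfolding L(1) by (rule emeasure_family_measure_le[OF le])
    finally show ?thesis unfolding measure_def by (intro enn2real_leI) auto
  qed
  then show ?thesis
    using const(1,2) \<epsilon>0(1,2) by (intro exI[of _ "1 / 2"] exI[of _ \<epsilon>0] exI[of _ Cbar] exI[of _ cst]) auto
qed

end
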